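(* Let $0 \leq m < k < n$ be integers. For every $\alpha \in X$, $$\alpha = \mathcal Q \mathcal R^* \mathcal R\alpha.$$
   Context: Let $G$ be the Grassmannian of $k$-dimensional linear subspaces of $\mathbf R^n$ with its unique $O(n)$-invariant Borel probability measure $dP$. Let $\Gamma = \{(P,x) : P \in G, \ x \in P\}$ be the tautological bundle over $G$; $L^2(\Gamma)$ is taken with respect to the measure $dx\,dP$, where $dx$ is Lebesgue measure on $P$. $\Lambda^m(V)$ is the $m$th exterior power of a Euclidean space $V$ with the induced inner product; $m$-forms on $V$ are regarded as maps $V \to \Lambda^m(V)$. For $P \in G$, the inclusion $P \to \mathbf R^n$ induces $\Lambda^m(P) \to \Lambda^m(\mathbf R^n)$ (by which $\Lambda^m(P)$ is viewed as a subspace of $\Lambda^m(\mathbf R^n)$), and its adjoint $\Lambda^m(\mathbf R^n) \to \Lambda^m(P)$ is denoted $v \mapsto v|_P$ (it is the orthogonal projection onto $\Lambda^m(P)$). $\mathscr S$ is the Schwartz space of $m$-forms on $\mathbf R^n$: smooth $m$-forms all of whose derivatives (including order zero) are $O((1+|x|^2)^{-N/2})$ for every $N \in \{0,1,2,\dots\}$. The exterior $k$-plane transform of an $m$-form $\alpha$ is the map $\mathcal R\alpha : \Gamma \to \Lambda^m(\mathbf R^n)$, $$\mathcal R \alpha(P, x) = \int_{P^\perp} \alpha(x + y)|_P \, dy,$$ a $\Lambda^m(P)$-valued Lebesgue integral over the orthogonal complement $P^\perp$. Its formal adjoint, applied to $\beta : \Gamma \to \Lambda^m(\mathbf R^n)$,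 is $$\mathcal R^* \beta(x) = \int_{G} \beta(P, x_P)|_P \, dP,$$ where $x_P$ is the orthogonal projection of $x \in \mathbf R^n$ onto $P$. $X$ is the completion of $\mathscr S$ under the norm $\|\alpha\|_X^2 = \|\alpha\|_{L^2}^2 + \|\mathcal R\alpha\|_{L^2(\Gamma)}^2$; it is regarded as a space of $L^2$ $m$-forms on $\mathbf R^n$, and $\mathcal R$ is extended by continuity to a bounded map $X \to L^2(\Gamma)$. The Fourier transform is $\mathcal Ff(\xi) = \int_{\mathbf R^n} e^{-2\pi i x\cdot\xi} f(x)\,dx$, applied componentwise and extended to tempered distributions. For $\xi \in \mathbf R^n \setminus \{0\}$ let $H_\xi$ be the hyperplane orthogonal to $\xi$, let $\Pi(\xi)$ be the orthogonal projection of $\Lambda^m(\mathbf R^n)$ onto $\Lambda^m(H_\xi)$, and let $\Psi(\xi) = I - \Pi(\xi)$ be the orthogonal projection onto the orthocomplement of $\Lambda^m(H_\xi)$. Define $$h(\xi) = \frac{k \,\mathrm{vol}(\mathbf S^{n - 1}) \binom{n - 1}{m}}{\mathrm{vol}(\mathbf S^{k - 1}) \binom{k}{m}} \left[\frac{\Pi(\xi)}{k - m} + \frac{\Psi(\xi)}{n - m}\right] \in GL(\Lambda^m(\mathbf R^n)),$$ where $\mathrm{vol}(\mathbf S^{d-1})$ is the surface measure of the unit sphere of $\mathbf R^d$ (so $\mathrm{vol}(\mathbf S^0)=2$), and the Fourier multiplier $$\mathcal Q \gamma(x) = \int_{\mathbf R^n} e^{2\pi i x \cdot \xi} |\xi|^{n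 - k} h(\xi) \mathcal F\gamma(\xi) \, d\xi,$$ i.e. $\mathcal Q\gamma = \mathcal F^{-1}\big(|\xi|^{n-k} h\, \mathcal F\gamma\big)$, with the integral understood as an inverse Fourier transform in the $L^2$ sense when $|\xi|^{n-k}\mathcal F\gamma \in L^2$. The equality in the claim is an equality of $L^2$ $m$-forms (almost everywhere). *)

theory Defs
  imports "HOL-Probability.Probability"
begin

section \<open>Exterior powers\<close>

text \<open>
  The exterior algebra of \<open>real ^ 'n\<close> is realised as \<open>real ^ ('n set)\<close>: the axis vector
  of \<open>S = {s\<^sub>1 < \<dots> < s\<^sub>m}\<close> stands for \<open>e\<^bsub>s\<^sub>1\<^esub> \<and> \<dots> \<and> e\<^bsub>s\<^sub>m\<^esub>\<close>. These vectors are orthonormal for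
  the induced inner product (characterised by
  \<open>(v\<^sub>1 \<and> \<dots> \<and> v\<^sub>m) \<bullet> (w\<^sub>1 \<and> \<dots> \<and> w\<^sub>m) = det (v\<^sub>i \<bullet> w\<^sub>j)\<close>), which is therefore the standard
  inner product of \<open>real ^ ('n set)\<close>.
  The linear order on the index type only fixes the signs of the basis vectors.
\<close>

text \<open>The \<open>S\<close>-coordinate of \<open>v\<^sub>0 \<and> \<dots> \<and> v\<^bsub>m-1\<^esub>\<close> is the \<open>m \<times> m\<close> minor with the columns in \<open>S\<close>.\<close>

definition wedge :: "nat \<Rightarrow> (nat \<Rightarrow> real ^ 'n::{finite,linorder}) \<Rightarrow> real ^ ('n set)" where
  "wedge m v = (\<chi> S. if card S = m
     then \<Sum>p | p permutes {..<m}.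
            of_int (sign p) * (\<Prod>i<m. v i $ (sorted_list_of_set S ! p i))
     else 0)"

text \<open>\<open>\<Lambda>\<^sup>m(V)\<close>, as a subspace of \<open>\<Lambda>\<^sup>m(R\<^sup>n)\<close>.\<close>

definition ext_power :: "nat \<Rightarrow> (real ^ 'n::{finite,linorder}) set \<Rightarrow> (real ^ ('n set)) set" where
  "ext_power m V = span (wedge m ` {v. \<forall>i<m. v i \<in> V})"

definition orth_proj :: "'a::euclidean_space set \<Rightarrow> 'a \<Rightarrow> 'a" where
  "orth_proj V x = (THE y. y \<in> V \<and> (\<forall>z\<in>V. orthogonal (x - y) z))"

text \<open>\<open>v|\<^sub>P\<close>: the adjoint of the inclusion of \<open>\<Lambda>\<^sup>m(P)\<close>, i.e. the orthogonal projection.\<close>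

definition form_restrict ::
    "nat \<Rightarrow> (real ^ 'n::{finite,linorder}) set \<Rightarrow> real ^ ('n set) \<Rightarrow> real ^ ('n set)" where
  "form_restrict m P v = orth_proj (ext_power m P) v"

section \<open>Measures\<close>

text \<open>
  Lebesgue measure on a linear subspace, as a measure on the ambient space concentrated on
  the subspace: the image of the product Lebesgue measure under orthonormal coordinates
  (compare \<open>lborel\<close>). It does not depend on the orthonormal basis.
\<close>

definition subspace_lborel :: "'a::euclidean_space set \<Rightarrow> 'a measure" where
  "subspace_lborel V =
     (let B = (SOME B. B \<subseteq> V \<and> pairwise orthogonal B \<and> (\<forall>b\<in>B. norm b = 1) \<and> span B = V)
      in distr (\<Pi>\<^sub>M b\<in>B. lborel) borel (\<lambda>c. \<Sum>b\<in>B. c b *\<^sub>R b))"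

definition grassmannian :: "nat \<Rightarrow> 'a::euclidean_space set set" where
  "grassmannian k = {P. subspace P \<and> dim P = k}"

text \<open>
  The topology of the Grassmannian is the one making \<open>P \<mapsto> (orthogonal projection matrix of P)\<close>
  a topological embedding, so its Borel sets are the preimages of the Borel sets of matrices.
\<close>

definition grassmann_borel :: "nat \<Rightarrow> (real ^ 'n) set measure" where
  "grassmann_borel k = vimage_algebra (grassmannian k) (\<lambda>P. matrix (orth_proj P)) borel"

definition invariant_grassmann_measure :: "nat \<Rightarrow> (real ^ 'n) set measure \<Rightarrow> bool" where
  "invariant_grassmann_measure k M \<longleftrightarrow>
     prob_space M \<and> sets M = sets (grassmann_borel k) \<and>
     (\<forall>f. orthogonal_transformation f \<longrightarrow>
        (\<forall>E\<in>sets M. emeasure M ((\<lambda>P. f ` P) ` E) = emeasure M E))"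

definition taut_bundle :: "nat \<Rightarrow> ('a::euclidean_space set \<times> 'a) set" where
  "taut_bundle k = {(P, x). P \<in> grassmannian k \<and> x \<in> P}"

text \<open>The measure \<open>dx dP\<close> on the tautological bundle.\<close>

definition taut_measure ::
    "nat \<Rightarrow> 'a::euclidean_space set measure \<Rightarrow> ('a set \<times> 'a) measure" where
  "taut_measure k M = measure_of (taut_bundle k)
     (sets (restrict_space (M \<Otimes>\<^sub>M borel) (taut_bundle k)))
     (\<lambda>E. \<integral>\<^sup>+P. emeasure (subspace_lborel P) {x. (P, x) \<in> E} \<partial>M)"

definition L2_normsq :: "'a measure \<Rightarrow> ('a \<Rightarrow> 'b::euclidean_space) \<Rightarrow> ennreal" where
  "L2_normsq M f = (\<integral>\<^sup>+x. ennreal ((norm (f x))\<^sup>2) \<partial>M)"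

definition L2 :: "'a measure \<Rightarrow> ('a \<Rightarrow> 'b::euclidean_space) set" where
  "L2 M = {f \<in> borel_measurable M. L2_normsq M f < \<infinity>}"

definition L2_tendsto ::
    "'a measure \<Rightarrow> (nat \<Rightarrow> 'a \<Rightarrow> 'b::euclidean_space) \<Rightarrow> ('a \<Rightarrow> 'b) \<Rightarrow> bool" where
  "L2_tendsto M f g \<longleftrightarrow> (\<lambda>j. L2_normsq M (\<lambda>x. f j x - g x)) \<longlonglongrightarrow> 0"

section \<open>Schwartz forms\<close>

primrec iter_deriv :: "'a::euclidean_space list \<Rightarrow> ('a \<Rightarrow> 'b::real_normed_vector) \<Rightarrow> 'a \<Rightarrow> 'b" where
  "iter_deriv [] f = f"
| "iter_deriv (v # vs) f = (\<lambda>x. frechet_derivative (iter_deriv vs f) (at x) v)"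

definition schwartz :: "('a::euclidean_space \<Rightarrow> 'b::real_normed_vector) \<Rightarrow> bool" where
  "schwartz f \<longleftrightarrow> (\<forall>vs\<in>lists Basis.
     (\<forall>x. iter_deriv vs f differentiable (at x)) \<and>
     (\<forall>N::nat. \<exists>C. \<forall>x. norm (iter_deriv vs f x) \<le> C * (1 + (norm x)\<^sup>2) powr (- real N / 2)))"

definition forms :: "nat \<Rightarrow> (real ^ 'n::{finite,linorder} \<Rightarrow> real ^ ('n set)) set" where
  "forms m = {\<alpha>. \<forall>x. \<alpha> x \<in> ext_power m UNIV}"

definition schwartz_forms :: "nat \<Rightarrow> (real ^ 'n::{finite,linorder} \<Rightarrow> real ^ ('n set)) set" where
  "schwartz_forms m = {\<alpha> \<in> forms m. schwartz \<alpha>}"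

section \<open>The exterior k-plane transform and its formal adjoint\<close>

definition plane_transform ::
    "nat \<Rightarrow> (real ^ 'n::{finite,linorder} \<Rightarrow> real ^ ('n set))
       \<Rightarrow> (real ^ 'n::{finite,linorder}) set \<times> (real ^ 'n::{finite,linorder}) \<Rightarrow> real ^ ('n set)" where
  "plane_transform m \<alpha> =
     (\<lambda>(P, x). \<integral>y. form_restrict m P (\<alpha> (x + y)) \<partial>subspace_lborel (orthogonal_comp P))"

definition plane_adjoint ::
    "(real ^ 'n::{finite,linorder}) set measure \<Rightarrow> nat
       \<Rightarrow> ((real ^ 'n::{finite,linorder}) set \<times> (real ^ 'n::{finite,linorder}) \<Rightarrow> real ^ ('n set))
       \<Rightarrow> real ^ 'n::{finite,linorder} \<Rightarrow> real ^ ('n set)" where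
  "plane_adjoint M m \<beta> = (\<lambda>x. \<integral>P. form_restrict m P (\<beta> (P, orth_proj P x)) \<partial>M)"

definition X_normsq ::
    "nat \<Rightarrow> (real ^ 'n::{finite,linorder}) set measure \<Rightarrow> nat
       \<Rightarrow> (real ^ 'n::{finite,linorder} \<Rightarrow> real ^ ('n set)) \<Rightarrow> ennreal" where
  "X_normsq k M m \<alpha> = L2_normsq lborel \<alpha> + L2_normsq (taut_measure k M) (plane_transform m \<alpha>)"

text \<open>
  \<open>a\<close> is a Cauchy sequence of Schwartz forms for the X-norm; the element of the completion
  that it represents is identified with its \<open>L\<^sup>2\<close> limit \<open>\<alpha>\<close>.
\<close>

definition X_represents ::
    "nat \<Rightarrow> (real ^ 'n::{finite,linorder}) set measure \<Rightarrow> nat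
       \<Rightarrow> (nat \<Rightarrow> real ^ 'n::{finite,linorder} \<Rightarrow> real ^ ('n set))
       \<Rightarrow> (real ^ 'n::{finite,linorder} \<Rightarrow> real ^ ('n set)) \<Rightarrow> bool" where
  "X_represents k M m a \<alpha> \<longleftrightarrow>
     (\<forall>j. a j \<in> schwartz_forms m) \<and>
     (\<forall>e>0. \<exists>N. \<forall>i\<ge>N. \<forall>j\<ge>N. X_normsq k M m (\<lambda>x. a i x - a j x) < e) \<and>
     L2_tendsto lborel a \<alpha>"

definition X_space ::
    "nat \<Rightarrow> (real ^ 'n::{finite,linorder}) set measure \<Rightarrow> nat
       \<Rightarrow> (real ^ 'n::{finite,linorder} \<Rightarrow> real ^ ('n set)) set" where
  "X_space k M m = {\<alpha> \<in> forms m \<inter> L2 lborel. \<exists>a. X_represents k M m a \<alpha>}"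

text \<open>Extension of the transform to \<open>X\<close> by continuity (determined up to null sets).\<close>

definition plane_transform_X ::
    "nat \<Rightarrow> (real ^ 'n::{finite,linorder}) set measure \<Rightarrow> nat
       \<Rightarrow> (real ^ 'n::{finite,linorder} \<Rightarrow> real ^ ('n set))
       \<Rightarrow> (real ^ 'n::{finite,linorder}) set \<times> (real ^ 'n::{finite,linorder}) \<Rightarrow> real ^ ('n set)" where
  "plane_transform_X k M m \<alpha> = (SOME \<beta>. \<beta> \<in> L2 (taut_measure k M) \<and>
     (\<exists>a. X_represents k M m a \<alpha> \<and>
          L2_tendsto (taut_measure k M) (\<lambda>j. plane_transform m (a j)) \<beta>))"

section \<open>Fourier transform and the multiplier\<close>

definition fourier :: "('a::euclidean_space \<Rightarrow> complex) \<Rightarrow> 'a \<Rightarrow> complex" where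
  "fourier \<phi> \<xi> = (\<integral>x. exp (- 2 * complex_of_real pi * \<i> * complex_of_real (x \<bullet> \<xi>)) * \<phi> x \<partial>lborel)"

text \<open>
  The Fourier transform of the tempered distribution given by the function \<open>f\<close> is given by the
  function \<open>g\<close>. Integrability against all Schwartz functions (the Fourier transform being onto
  the Schwartz space) says precisely that \<open>f\<close> and \<open>g\<close> define tempered distributions.
\<close>

definition has_fourier ::
    "('a::euclidean_space \<Rightarrow> complex ^ 'i) \<Rightarrow> ('a \<Rightarrow> complex ^ 'i) \<Rightarrow> bool" where
  "has_fourier f g \<longleftrightarrow> (\<forall>\<phi>. schwartz \<phi> \<longrightarrow>
     integrable lborel (\<lambda>x. fourier \<phi> x *s f x) \<and>
     integrable lborel (\<lambda>\<xi>. \<phi> \<xi> *s g \<xi>) \<and>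
     (\<integral>x. fourier \<phi> x *s f x \<partial>lborel) = (\<integral>\<xi>. \<phi> \<xi> *s g \<xi> \<partial>lborel))"

definition tempered_fourier ::
    "('a::euclidean_space \<Rightarrow> complex ^ 'i) \<Rightarrow> 'a \<Rightarrow> complex ^ 'i" where
  "tempered_fourier f = (SOME g. has_fourier f g)"

text \<open>Inverse Fourier transform in the \<open>L\<^sup>2\<close> sense (determined up to null sets).\<close>

definition L2_inverse_fourier ::
    "('a::euclidean_space \<Rightarrow> complex ^ 'i) \<Rightarrow> 'a \<Rightarrow> complex ^ 'i" where
  "L2_inverse_fourier g = (SOME f. f \<in> L2 lborel \<and> has_fourier f g)"

definition cvec :: "real ^ 'i \<Rightarrow> complex ^ 'i" where
  "cvec v = (\<chi> i. complex_of_real (v $ i))"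

definition complexify :: "(real ^ 'i \<Rightarrow> real ^ 'i) \<Rightarrow> complex ^ 'i \<Rightarrow> complex ^ 'i" where
  "complexify T w = cvec (T (\<chi> i. Re (w $ i))) + \<i> *s cvec (T (\<chi> i. Im (w $ i)))"

text \<open>The surface measure of the unit sphere of \<open>R\<^sup>d\<close> is \<open>d\<close> times the volume of the unit ball.\<close>

definition sphere_vol :: "nat \<Rightarrow> real" where
  "sphere_vol d = real d * unit_ball_vol (real d)"

definition Pi_proj ::
    "nat \<Rightarrow> real ^ 'n::{finite,linorder} \<Rightarrow> real ^ ('n set) \<Rightarrow> real ^ ('n set)" where
  "Pi_proj m \<xi> = orth_proj (ext_power m {x. orthogonal \<xi> x})"

definition Psi_proj ::
    "nat \<Rightarrow> real ^ 'n::{finite,linorder} \<Rightarrow> real ^ ('n set) \<Rightarrow> real ^ ('n set)" where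
  "Psi_proj m \<xi> v = v - Pi_proj m \<xi> v"

definition h_mult ::
    "nat \<Rightarrow> nat \<Rightarrow> real ^ 'n::{finite,linorder} \<Rightarrow> real ^ ('n set) \<Rightarrow> real ^ ('n set)" where
  "h_mult k m \<xi> v =
     (real k * sphere_vol CARD('n) * real ((CARD('n) - 1) choose m)
        / (sphere_vol k * real (k choose m)))
     *\<^sub>R ((1 / (real k - real m)) *\<^sub>R Pi_proj m \<xi> v
          + (1 / (real CARD('n) - real m)) *\<^sub>R Psi_proj m \<xi> v)"

text \<open>
  The natural domain of the multiplier: \<open>\<gamma>\<close> is a tempered distribution whose Fourier transform
  is a function that becomes square integrable after multiplication by \<open>|\<xi>|\<^bsup>n-k\<^esup>\<close>.
\<close>

definition Q_domain ::
    "nat \<Rightarrow> (real ^ 'n::{finite,linorder} \<Rightarrow> complex ^ ('n set)) set" where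
  "Q_domain k = {\<gamma>. (\<exists>g. has_fourier \<gamma> g) \<and>
     (\<lambda>\<xi>. norm \<xi> ^ (CARD('n) - k) *\<^sub>R tempered_fourier \<gamma> \<xi>) \<in> L2 lborel}"

definition Q_mult ::
    "nat \<Rightarrow> nat \<Rightarrow> (real ^ 'n::{finite,linorder} \<Rightarrow> complex ^ ('n set))
       \<Rightarrow> real ^ 'n::{finite,linorder} \<Rightarrow> complex ^ ('n set)" where
  "Q_mult k m \<gamma> = L2_inverse_fourier
     (\<lambda>\<xi>. norm \<xi> ^ (CARD('n) - k) *\<^sub>R complexify (h_mult k m \<xi>) (tempered_fourier \<gamma> \<xi>))"

end

theory Submission
  imports Defs
begin

text \<open>
  Write \<open>F\<close> for the Fourier transform, \<open>R\<close> for the exterior k-plane transform and \<open>R\<^sup>*\<close> for its adjoint.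
  The formula holds because \<open>R\<^sup>* R\<close> is a Fourier multiplier whose symbol can be computed, and whose
  inverse is the symbol of the operator \<open>Q\<close>.

  \<^item> On a single plane \<open>P\<close>, integration over the cosets of the orthogonal complement turns \<open>F\<close> into the
  Fourier transform of \<open>P\<close>: for a Schwartz form \<open>w\<close>, the transform of \<open>R w (P, \<cdot>)\<close> is the restriction
  of \<open>F w (\<xi>)\<close> to \<open>P\<close>, for \<open>\<xi> \<in> P\<close> (\<open>fourier_on_plane_transform\<close>). Dually, pairing a back-projection
  with \<open>F \<phi>\<close> is a pairing on the tautological bundle with the Fourier transform of \<open>\<phi>\<close> on the
  planes (\<open>back_projection_pairing\<close>).

  \<^item> The map \<open>(P, \<xi>) \<mapsto> \<xi>\<close> pushes the measure of the bundle to \<open>c |\<xi>|\<^bsup>k-n\<^esup> d\<xi>\<close> with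
  \<open>c = vol(S\<^bsup>k-1\<^esup>) / vol(S\<^bsup>n-1\<^esup>)\<close> (\<open>nn_integral_taut_snd\<close>). The average of the projection onto
  \<open>\<Lambda>\<^sup>m(P)\<close> over the planes \<open>P\<close> that contain \<open>\<xi>\<close> commutes with the stabiliser of \<open>\<xi>\<close>, so it acts as a
  scalar on each of the two summands \<open>\<Lambda>\<^sup>m(H\<^sub>\<xi>)\<close> and its orthocomplement. These scalars are found by
  counting coordinate planes; the result is \<open>mean_restrict\<close> (\<open>integral_restrict_eq_mean\<close>).

  Together these facts say that \<open>F R\<^sup>* R w = c |\<xi>|\<^bsup>k-n\<^esup> mean_restrict F w\<close> for Schwartz forms \<open>w\<close>, and
  \<open>|\<xi>|\<^bsup>n-k\<^esup> h\<close> is the inverse of that symbol (\<open>h_mult_mean_restrict\<close>).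

  To pass to \<open>X\<close>, the energy of \<open>R w\<close> must control \<open>F w\<close> with the singular weight \<open>|\<xi>|\<^bsup>k-n\<^esup>\<close>. This
  follows from Bessel's inequality on every plane and the positivity of \<open>mean_restrict\<close>
  (\<open>form_energy_le\<close>). A Cauchy sequence for the norm of \<open>X\<close> therefore has Fourier transforms that
  converge both in \<open>L\<^sup>2(d\<xi>)\<close> and in \<open>L\<^sup>2(|\<xi>|\<^bsup>k-n\<^esup> d\<xi>)\<close>, and the identities above survive in the limit
  (\<open>has_fourier_X_limit\<close>, \<open>back_projection_fourier\<close>). Since Fourier transforms of functions in the sense
  of distributions are unique up to null sets (\<open>has_fourier_unique\<close>, \<open>has_fourier_inject\<close>), this
  determines \<open>Q R\<^sup>* R \<alpha>\<close>.
\<close>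

text \<open>The spaces \<open>R\<^sup>n\<close> and \<open>\<Lambda>(R\<^sup>n)\<close>, with coordinates indexed by \<open>'n\<close> and by its subsets.\<close>

type_synonym 'n rvec = "(real, 'n) vec"

type_synonym 'n rform = "(real, 'n set) vec"

section \<open>Functoriality of exterior powers\<close>

text \<open>The \<open>m\<close>-th exterior power of \<open>g\<close>, extended by zero to the other degrees.\<close>

definition ext_map ::
  "nat \<Rightarrow> ('n::{finite,linorder} rvec \<Rightarrow> 'n rvec)
   \<Rightarrow> 'n rform \<Rightarrow> 'n rform" where
 "ext_map m g v = (\<Sum>S | card S = m. v $ S *\<^sub>R wedge m (\<lambda>i. g (axis (sorted_list_of_set S ! i) 1)))"

lemma wedge_cong: "(\<And>i. i < m \<Longrightarrow> v i = w i) \<Longrightarrow> wedge m v = wedge m w"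
 unfolding wedge_def by (intro vec_eq_iff[THEN iffD2] allI) (auto intro!: sum.cong prod.cong)

lemma wedge_permute:
 assumes "q permutes {..<m}"
 shows "wedge m (v \<circ> q) = of_int (sign q) *\<^sub>R wedge m v"
proof -
 have "(\<Sum>p | p permutes {..<m}. of_int (sign p) * (\<Prod>i<m. v (q i) $ s (p i)))
  = of_int (sign q) * (\<Sum>p | p permutes {..<m}. of_int (sign p) * (\<Prod>i<m. v i $ s (p i)))"
  (is "?l = ?r") for s
 proof -
  have "?l = (\<Sum>p | p permutes {..<m}. of_int (sign (p \<circ> q)) * (\<Prod>i<m. v (q i) $ s ((p \<circ> q) i)))"
   by (rule sum_permutations_compose_right[OF assms])
  also have "\<dots> = (\<Sum>p | p permutes {..<m}. of_int (sign q) * (of_int (sign p) * (\<Prod>i<m. v i $ s (p i))))"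
  proof (rule sum.cong[OF refl])
   fix p assume "p \<in> {p. p permutes {..<m}}"
   then have p: "p permutes {..<m}" by simp
   have "sign (p \<circ> q) = sign p * sign q"
    using p assms by (intro sign_compose) (auto simp: permutation_permutes)
   moreover have "(\<Prod>i<m. v (q i) $ s ((p \<circ> q) i)) = (\<Prod>i<m. v i $ s (p i))"
    using prod.permute[OF assms, of "\<lambda>i. v i $ s (p i)"] by (simp add: o_def)
   ultimately show "of_int (sign (p \<circ> q)) * (\<Prod>i<m. v (q i) $ s ((p \<circ> q) i))
     = of_int (sign q) * (of_int (sign p) * (\<Prod>i<m. v i $ s (p i)))"
    by simp
  qed
  finally show ?thesis by (simp add: sum_distrib_left)
 qed
 then show ?thesis unfolding wedge_def by (auto simp: vec_eq_iff)
qed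

lemma wedge_repeated:
 assumes "i < m" "j < m" "i \<noteq> j" "v i = v j"
 shows "wedge m v = 0"
proof -
 have "v \<circ> Transposition.transpose i j = v"
  using assms(4) by (auto simp: fun_eq_iff Transposition.transpose_def)
 moreover have "Transposition.transpose i j permutes {..<m}"
  using assms by (intro permutes_swap_id) auto
 ultimately have "wedge m v = of_int (sign (Transposition.transpose i j)) *\<^sub>R wedge m v"
  using wedge_permute by metis
 then have "wedge m v = - wedge m v" using assms by (simp add: sign_swap_id)
 then show ?thesis by (simp add: vec_eq_iff)
qed

lemma wedge_zero:
 assumes "i < m" "v i = 0"
 shows "wedge m v = 0"
proof -
 have "\<exists>i<m. v i = 0" using assms by blast
 then show ?thesis unfolding wedge_def vec_eq_iff by (auto intro!: sum.neutral bexI)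
qed

lemma linear_axis_sum:
 fixes g :: "real ^ 'n \<Rightarrow> 'b::real_vector"
 assumes "linear g"
 shows "g x = (\<Sum>j\<in>UNIV. x $ j *\<^sub>R g (axis j 1))"
proof -
 have "g x = g (\<Sum>j\<in>UNIV. x $ j *\<^sub>R axis j 1)"
  using basis_expansion[of x] by (simp add: scalar_mult_eq_scaleR)
 then show ?thesis by (simp add: linear_sum[OF assms] linear_scale[OF assms])
qed

lemma linear_axis_expansion:
 fixes g :: "real ^ 'n \<Rightarrow> real ^ 'm"
 assumes "linear g"
 shows "g x $ t = (\<Sum>j\<in>UNIV. x $ j * g (axis j 1) $ t)"
 by (subst linear_axis_sum[OF assms]) simp

lemma wedge_multilinear_expansion:
 fixes g :: "'n::{finite,linorder} rvec \<Rightarrow> 'n rvec"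
 assumes "linear g"
 shows "wedge m (\<lambda>i. g (v i)) =
  (\<Sum>f\<in>{..<m} \<rightarrow>\<^sub>E UNIV. (\<Prod>i<m. v i $ f i) *\<^sub>R wedge m (\<lambda>i. g (axis (f i) 1)))"
proof -
 have "wedge m (\<lambda>i. g (v i)) $ T =
  (\<Sum>f\<in>{..<m} \<rightarrow>\<^sub>E UNIV. (\<Prod>i<m. v i $ f i) * wedge m (\<lambda>i. g (axis (f i) 1)) $ T)" for T
 proof (cases "card T = m")
  case True
  let ?t = "\<lambda>i. sorted_list_of_set T ! i"
  have "wedge m (\<lambda>i. g (v i)) $ T = (\<Sum>p | p permutes {..<m}. of_int (sign p) *
    (\<Prod>i<m. \<Sum>j\<in>UNIV. v i $ j * g (axis j 1) $ ?t (p i)))"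
   using True by (simp add: wedge_def linear_axis_expansion[OF assms, of "v _"])
  also have "\<dots> = (\<Sum>p | p permutes {..<m}. of_int (sign p) *
    (\<Sum>f\<in>{..<m} \<rightarrow>\<^sub>E UNIV. (\<Prod>i<m. v i $ f i) * (\<Prod>i<m. g (axis (f i) 1) $ ?t (p i))))"
   by (simp add: prod_sum_PiE prod.distrib)
  also have "\<dots> = (\<Sum>f\<in>{..<m} \<rightarrow>\<^sub>E UNIV. (\<Prod>i<m. v i $ f i) *
    (\<Sum>p | p permutes {..<m}. of_int (sign p) * (\<Prod>i<m. g (axis (f i) 1) $ ?t (p i))))"
   unfolding sum_distrib_left by (subst sum.swap) (simp add: mult_ac)
  finally show ?thesis using True by (simp add: wedge_def)
 next
  case False
  then show ?thesis by (simp add: wedge_def)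
 qed
 then show ?thesis by (simp add: vec_eq_iff)
qed

lemma nth_sorted_bij:
 fixes S :: "'n::{finite,linorder} set"
 assumes "card S = m"
 shows "bij_betw (nth (sorted_list_of_set S)) {..<m} S"
 using assms by (intro bij_betw_nth) auto

lemma injections_bij:
 "bij_betw (\<lambda>(S, q). restrict (\<lambda>i. sorted_list_of_set S ! q i) {..<m})
  (SIGMA S:{S::'n::{finite,linorder} set. card S = m}. {q. q permutes {..<m}})
  {f \<in> {..<m} \<rightarrow>\<^sub>E UNIV. inj_on f {..<m}}"
 (is "bij_betw ?h ?A ?B")
 unfolding bij_betw_def
proof
 have im: "(\<lambda>i. sorted_list_of_set S ! q i) ` {..<m} = S"
  if "card S = m" "q permutes {..<m}" for S :: "'n set" and q
  using bij_betw_trans[OF permutes_imp_bij[OF that(2)] nth_sorted_bij[OF that(1)]]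
  by (simp add: bij_betw_def o_def)
 show "inj_on ?h ?A"
 proof (rule inj_onI, clarsimp)
  fix S S' :: "'n set" and q q' :: "nat \<Rightarrow> nat"
  assume c: "card S' = card S" "m = card S" and q: "q permutes {..<card S}" "q' permutes {..<card S}"
   and eq: "restrict (\<lambda>i. sorted_list_of_set S ! q i) {..<card S} =
    restrict (\<lambda>i. sorted_list_of_set S' ! q' i) {..<card S}"
  have e: "sorted_list_of_set S ! q i = sorted_list_of_set S' ! q' i" if "i < card S" for i
   using fun_cong[OF eq, of i] that by simp
  have SS: "S = S'"
   using im[of S q] im[of S' q'] e c q by (metis (no_types, lifting) image_cong lessThan_iff)
  have "q i = q' i" for i
  proof (cases "i < card S")
   case True
   then have "q i < card S" "q' i < card S"
    using permutes_in_image[OF q(1)] permutes_in_image[OF q(2)] by auto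
   then show ?thesis using e[OF True] nth_sorted_bij[of S "card S"] SS
    by (auto simp: bij_betw_def inj_on_def)
  next
   case False
   then show ?thesis using q by (simp add: permutes_not_in)
  qed
  with SS show "S = S' \<and> q = q'" by auto
 qed
 show "?h ` ?A = ?B"
 proof (intro equalityI subsetI)
  fix f assume "f \<in> ?h ` ?A"
  then obtain S q where S: "card S = m" "q permutes {..<m}"
   "f = restrict (\<lambda>i. sorted_list_of_set S ! q i) {..<m}" by auto
  then have "inj_on f {..<m}"
   using bij_betw_trans[OF permutes_imp_bij[OF S(2)] nth_sorted_bij[OF S(1)]]
   by (auto simp: bij_betw_def o_def inj_on_def)
  with S show "f \<in> ?B" by auto
 next
  fix f :: "nat \<Rightarrow> 'n" assume f: "f \<in> ?B"
  define S where "S = f ` {..<m}"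
  have S: "card S = m" using f by (simp add: S_def card_image)
  define q where "q = (\<lambda>i. if i < m then inv_into {..<m} (nth (sorted_list_of_set S)) (f i) else i)"
  have b: "bij_betw f {..<m} S" using f by (simp add: S_def bij_betw_def)
  have "bij_betw (inv_into {..<m} (nth (sorted_list_of_set S)) \<circ> f) {..<m} {..<m}"
   by (rule bij_betw_trans[OF b bij_betw_inv_into[OF nth_sorted_bij[OF S]]])
  then have "bij_betw q {..<m} {..<m}"
   by (rule bij_betw_cong[THEN iffD1, rotated]) (simp add: q_def)
  then have q: "q permutes {..<m}"
   by (rule bij_imp_permutes) (simp add: q_def)
  have "sorted_list_of_set S ! q i = f i" if "i < m" for i
  proof -
   have "f i \<in> nth (sorted_list_of_set S) ` {..<m}"
    using nth_sorted_bij[OF S] that by (auto simp: bij_betw_def S_def)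
   then show ?thesis using that by (simp add: q_def f_inv_into_f)
  qed
  then have "f = restrict (\<lambda>i. sorted_list_of_set S ! q i) {..<m}"
   using f by (auto simp: fun_eq_iff restrict_def PiE_def extensional_def)
  with S q show "f \<in> ?h ` ?A" by force
 qed
qed

text \<open>
 Cauchy--Binet: in the multilinear expansion only injective index maps survive, and such a map is
 a set of size \<open>m\<close> together with a permutation.
\<close>

lemma wedge_linear_image:
 fixes g :: "'n::{finite,linorder} rvec \<Rightarrow> 'n rvec"
 assumes "linear g"
 shows "ext_map m g (wedge m v) = wedge m (\<lambda>i. g (v i))"
proof -
 let ?E = "\<lambda>f. wedge m (\<lambda>i. g (axis (f i) 1))"
 let ?F = "{..<m} \<rightarrow>\<^sub>E (UNIV::'n set)"
 have "wedge m (\<lambda>i. g (v i)) = (\<Sum>f\<in>?F. (\<Prod>i<m. v i $ f i) *\<^sub>R ?E f)"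
  by (rule wedge_multilinear_expansion[OF assms])
 also have "\<dots> = (\<Sum>f\<in>{f \<in> ?F. inj_on f {..<m}}. (\<Prod>i<m. v i $ f i) *\<^sub>R ?E f)"
 proof (rule sum.mono_neutral_right)
  show "\<forall>f\<in>?F - {f \<in> ?F. inj_on f {..<m}}. (\<Prod>i<m. v i $ f i) *\<^sub>R ?E f = 0"
  proof
   fix f assume "f \<in> ?F - {f \<in> ?F. inj_on f {..<m}}"
   then obtain i j where "i < m" "j < m" "i \<noteq> j" "f i = f j" by (auto simp: inj_on_def)
   then have "?E f = 0" by (intro wedge_repeated[of i m j]) auto
   then show "(\<Prod>i<m. v i $ f i) *\<^sub>R ?E f = 0" by simp
  qed
 qed (auto intro: finite_PiE)
 also have "\<dots> = (\<Sum>(S,q)\<in>(SIGMA S:{S. card S = m}. {q. q permutes {..<m}}).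
   (\<Prod>i<m. v i $ (sorted_list_of_set S ! q i)) *\<^sub>R ?E (\<lambda>i. sorted_list_of_set S ! q i))"
  by (subst sum.reindex_bij_betw[OF injections_bij, symmetric])
   (auto intro!: sum.cong arg_cong2[where f="(*\<^sub>R)"] wedge_cong)
 also have "\<dots> = (\<Sum>S | card S = m. \<Sum>q | q permutes {..<m}.
   (\<Prod>i<m. v i $ (sorted_list_of_set S ! q i)) *\<^sub>R ?E (\<lambda>i. sorted_list_of_set S ! q i))"
  by (rule sum.Sigma[symmetric]) (auto simp: finite_permutations)
 also have "\<dots> = (\<Sum>S | card S = m. wedge m v $ S *\<^sub>R ?E (\<lambda>i. sorted_list_of_set S ! i))"
 proof (intro sum.cong refl)
  fix S :: "'n set" assume "S \<in> {S. card S = m}"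
  then have S: "card S = m" by simp
  have "?E (\<lambda>i. sorted_list_of_set S ! q i) = of_int (sign q) *\<^sub>R ?E (\<lambda>i. sorted_list_of_set S ! i)"
   if "q permutes {..<m}" for q
   using wedge_permute[OF that, of "\<lambda>i. g (axis (sorted_list_of_set S ! i) 1)"] by (simp add: o_def)
  then show "(\<Sum>q | q permutes {..<m}. (\<Prod>i<m. v i $ (sorted_list_of_set S ! q i)) *\<^sub>R
    ?E (\<lambda>i. sorted_list_of_set S ! q i)) = wedge m v $ S *\<^sub>R ?E (\<lambda>i. sorted_list_of_set S ! i)"
   using S by (simp add: wedge_def scaleR_sum_left mult_ac)
 qed
 finally show ?thesis by (simp add: ext_map_def)
qed

lemma ext_map_linear: "linear (ext_map m g)"
 by (rule linearI) (simp_all add: ext_map_def scaleR_left_distrib sum.distrib scaleR_sum_right)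

lemma ext_map_axis:
 assumes "card S = m"
 shows "ext_map m g (axis S 1) = wedge m (\<lambda>i. g (axis (sorted_list_of_set S ! i) 1))"
proof -
 have "ext_map m g (axis S 1) =
  (\<Sum>T\<in>{T. card T = m}. if T = S then wedge m (\<lambda>i. g (axis (sorted_list_of_set S ! i) 1)) else 0)"
  unfolding ext_map_def by (rule sum.cong) (auto simp: axis_def)
 then show ?thesis using assms by simp
qed

lemma ext_map_axis_0:
 assumes "card S \<noteq> m"
 shows "ext_map m g (axis S 1) = 0"
 unfolding ext_map_def by (rule sum.neutral) (use assms in \<open>auto simp: axis_def\<close>)

lemma wedge_degree: "card S \<noteq> m \<Longrightarrow> wedge m v $ S = 0"
 by (simp add: wedge_def)

lemma ext_map_degree: "card S \<noteq> m \<Longrightarrow> ext_map m g v $ S = 0"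
 by (simp add: ext_map_def wedge_degree)

lemma permuted_nth_eq_imp:
 fixes S T :: "'n::{finite,linorder} set"
 assumes "card S = m" "card T = m" "p permutes {..<m}"
  "\<And>i. i < m \<Longrightarrow> sorted_list_of_set S ! i = sorted_list_of_set T ! p i"
 shows "S = T \<and> p = id"
proof -
 have "bij_betw (\<lambda>i. sorted_list_of_set T ! p i) {..<m} T"
  using bij_betw_trans[OF permutes_imp_bij[OF assms(3)] nth_sorted_bij[OF assms(2)]]
  by (simp add: o_def)
 with nth_sorted_bij[OF assms(1)] assms(4) have ST: "S = T"
  by (metis bij_betw_imp_surj_on image_cong lessThan_iff)
 have "p i = i" for i
 proof (cases "i < m")
  case True
  then have "p i < m" using permutes_in_image[OF assms(3)] by auto
  then show ?thesis using assms(4)[OF True] nth_sorted_bij[OF assms(1)] True ST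
   by (auto simp: bij_betw_def inj_on_def)
 next
  case False
  then show ?thesis using assms(3) by (simp add: permutes_not_in)
 qed
 with ST show ?thesis by auto
qed

lemma wedge_axis:
 fixes S :: "'n::{finite,linorder} set"
 assumes "card S = m"
 shows "wedge m (\<lambda>i. axis (sorted_list_of_set S ! i) 1) = axis S 1"
proof -
 have "wedge m (\<lambda>i. axis (sorted_list_of_set S ! i) 1) $ T = axis S 1 $ T" for T
 proof (cases "card T = m")
  case True
  have *: "(\<Prod>i<m. axis (sorted_list_of_set S ! i) (1::real) $ (sorted_list_of_set T ! p i)) =
    (if S = T \<and> p = id then 1 else 0)" if p: "p permutes {..<m}" for p
  proof (cases "\<forall>i<m. sorted_list_of_set S ! i = sorted_list_of_set T ! p i")
   case t: True
   then show ?thesis using permuted_nth_eq_imp[OF assms True p] by (simp add: axis_def)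
  next
   case False
   then obtain i where "i < m" "sorted_list_of_set S ! i \<noteq> sorted_list_of_set T ! p i" by auto
   then have "(\<Prod>i<m. axis (sorted_list_of_set S ! i) (1::real) $ (sorted_list_of_set T ! p i)) = 0"
    by (intro prod_zero bexI[of _ i]) (auto simp: axis_def)
   then show ?thesis using False by auto
  qed
  have "wedge m (\<lambda>i. axis (sorted_list_of_set S ! i) 1) $ T =
   (\<Sum>p | p permutes {..<m}. of_int (sign p) * (if S = T \<and> p = id then 1 else 0))"
   using True by (auto simp: wedge_def * intro!: sum.cong)
  also have "\<dots> = (\<Sum>p | p permutes {..<m}. if p = id then (if S = T then 1 else 0) else 0)"
   by (rule sum.cong) auto
  also have "\<dots> = (if S = T then 1 else 0)"
   by (subst sum.delta) (auto simp: finite_permutations permutes_id)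
  finally show ?thesis by (simp add: axis_def)
 next
  case False
  then show ?thesis using assms by (auto simp: wedge_degree axis_def)
 qed
 then show ?thesis by (simp add: vec_eq_iff)
qed

lemma linear_eq_on_axes:
 fixes f g :: "real ^ 'm \<Rightarrow> 'b::real_vector"
 assumes "linear f" "linear g" "\<And>j. f (axis j 1) = g (axis j 1)"
 shows "f = g"
proof
 fix x show "f x = g x"
  unfolding linear_axis_sum[OF assms(1), of x] linear_axis_sum[OF assms(2), of x] by (simp add: assms(3))
qed

lemma ext_map_compose:
 assumes "linear g" "linear h"
 shows "ext_map m (g \<circ> h) v = ext_map m g (ext_map m h v)"
proof -
 have "ext_map m (g \<circ> h) = ext_map m g \<circ> ext_map m h"
 proof (rule linear_eq_on_axes)
  fix S :: "'a set"
  show "ext_map m (g \<circ> h) (axis S 1) = (ext_map m g \<circ> ext_map m h) (axis S 1)"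
  proof (cases "card S = m")
   case True
   then show ?thesis by (simp add: ext_map_axis wedge_linear_image[OF assms(1)])
  next
   case False
   then show ?thesis by (simp add: ext_map_axis_0 linear_0[OF ext_map_linear])
  qed
 qed (auto intro: ext_map_linear linear_compose)
 then show ?thesis by simp
qed

lemma ext_map_id:
 assumes "\<And>S. card S \<noteq> m \<Longrightarrow> v $ S = 0"
 shows "ext_map m (\<lambda>x. x) v = v"
proof -
 have "ext_map m (\<lambda>x. x) v = (\<Sum>S | card S = m. v $ S *\<^sub>R axis S 1)"
  unfolding ext_map_def by (intro sum.cong refl) (simp add: wedge_axis)
 also have "\<dots> = (\<Sum>S\<in>UNIV. v $ S *\<^sub>R axis S 1)"
  by (rule sum.mono_neutral_left) (use assms in auto)
 also have "\<dots> = v"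
  using basis_expansion[of v] by (simp add: scalar_mult_eq_scaleR)
 finally show ?thesis .
qed

lemma wedge_axis_adjoint:
 fixes g g' :: "'n::{finite,linorder} rvec \<Rightarrow> 'n rvec"
 assumes adj: "\<And>x y. g x \<bullet> y = x \<bullet> g' y" and "card S = m" "card T = m"
 shows "wedge m (\<lambda>i. g (axis (sorted_list_of_set S ! i) 1)) $ T
   = wedge m (\<lambda>i. g' (axis (sorted_list_of_set T ! i) 1)) $ S"
proof -
 let ?s = "\<lambda>i. sorted_list_of_set S ! i" and ?t = "\<lambda>i. sorted_list_of_set T ! i"
 have gg: "g (axis i 1) $ j = g' (axis j 1) $ i" for i j
  using adj[of "axis i 1" "axis j 1"] by (simp add: inner_axis inner_axis')
 have "(\<Sum>p | p permutes {..<m}. of_int (sign p) * (\<Prod>i<m. g (axis (?s i) 1) $ ?t (p i))) =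
  (\<Sum>p | p permutes {..<m}. of_int (sign (inv p)) * (\<Prod>i<m. g (axis (?s i) 1) $ ?t (inv p i)))"
  by (rule sum_permutations_inverse)
 also have "\<dots> = (\<Sum>p | p permutes {..<m}. of_int (sign p) * (\<Prod>i<m. g' (axis (?t i) 1) $ ?s (p i)))"
 proof (rule sum.cong[OF refl])
  fix p assume "p \<in> {p. p permutes {..<m}}"
  then have p: "p permutes {..<m}" by simp
  have "(\<Prod>i<m. g (axis (?s i) 1) $ ?t (inv p i)) = (\<Prod>i<m. g (axis (?s (p i)) 1) $ ?t (inv p (p i)))"
   using prod.permute[OF p, of "\<lambda>i. g (axis (?s i) 1) $ ?t (inv p i)"] by (simp add: o_def)
  also have "\<dots> = (\<Prod>i<m. g' (axis (?t i) 1) $ ?s (p i))"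
   using permutes_inverses[OF p] by (simp add: gg)
  finally show "of_int (sign (inv p)) * (\<Prod>i<m. g (axis (?s i) 1) $ ?t (inv p i)) =
   of_int (sign p) * (\<Prod>i<m. g' (axis (?t i) 1) $ ?s (p i))"
   using p by (simp add: sign_inverse permutes_imp_permutation[of "{..<m}"])
 qed
 finally show ?thesis using assms by (simp add: wedge_def)
qed

lemma ext_map_nth_axis_adjoint:
 fixes g g' :: "'n::{finite,linorder} rvec \<Rightarrow> 'n rvec"
 assumes adj: "\<And>x y. g x \<bullet> y = x \<bullet> g' y"
 shows "ext_map m g (axis S 1) $ T = ext_map m g' (axis T 1) $ S"
proof (cases "card S = m \<and> card T = m")
 case True
 then show ?thesis using wedge_axis_adjoint[OF adj] by (simp add: ext_map_axis)
next
 case False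
 then show ?thesis by (auto simp: ext_map_axis_0 ext_map_degree)
qed

lemma ext_map_adjoint:
 fixes g g' :: "'n::{finite,linorder} rvec \<Rightarrow> 'n rvec"
 assumes adj: "\<And>x y. g x \<bullet> y = x \<bullet> g' y"
 shows "ext_map m g v \<bullet> w = v \<bullet> ext_map m g' w"
proof -
 have "ext_map m g v \<bullet> w = (\<Sum>T\<in>UNIV. (\<Sum>S\<in>UNIV. v $ S * ext_map m g (axis S 1) $ T) * w $ T)"
  by (simp add: inner_vec_def linear_axis_expansion[OF ext_map_linear, of m g v])
 also have "\<dots> = (\<Sum>S\<in>UNIV. v $ S * (\<Sum>T\<in>UNIV. w $ T * ext_map m g' (axis T 1) $ S))"
  unfolding ext_map_nth_axis_adjoint[OF adj] sum_distrib_left sum_distrib_right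
  by (subst sum.swap) (simp add: mult_ac)
 also have "\<dots> = v \<bullet> ext_map m g' w"
  by (simp add: inner_vec_def linear_axis_expansion[OF ext_map_linear, of m g' w])
 finally show ?thesis .
qed

section \<open>Orthogonal projections\<close>

lemma orth_proj_eqI:
 fixes x :: "'a::euclidean_space"
 assumes "subspace V" "y \<in> V" "\<And>z. z \<in> V \<Longrightarrow> orthogonal (x - y) z"
 shows "orth_proj V x = y"
 unfolding orth_proj_def
proof (rule the_equality)
 fix y' assume y': "y' \<in> V \<and> (\<forall>z\<in>V. orthogonal (x - y') z)"
 have d: "y - y' \<in> V" using assms y' by (simp add: subspace_diff)
 have "(x - y') \<bullet> (y - y') = 0" "(x - y) \<bullet> (y - y') = 0"
  using y' assms(3) d by (auto simp: orthogonal_def)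
 then have "(y - y') \<bullet> (y - y') = 0" by (simp add: inner_diff_left)
 then show "y' = y" by simp
qed (use assms in auto)

lemma orth_proj_props:
 fixes x :: "'a::euclidean_space"
 assumes "subspace V"
 shows orth_proj_in: "orth_proj V x \<in> V"
  and orth_proj_residual: "z \<in> V \<Longrightarrow> (x - orth_proj V x) \<bullet> z = 0"
proof -
 obtain y z where yz: "y \<in> span V" "\<And>w. w \<in> span V \<Longrightarrow> orthogonal z w" "x = y + z"
  using orthogonal_subspace_decomp_exists by blast
 have sp: "span V = V" using assms by (simp add: span_eq_iff)
 have "orth_proj V x = y"
  using yz assms by (intro orth_proj_eqI) (auto simp: sp)
 then show "orth_proj V x \<in> V" "z \<in> V \<Longrightarrow> (x - orth_proj V x) \<bullet> z = 0" for z
  using yz by (auto simp: sp orthogonal_def)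
qed

lemma orth_proj_id:
 assumes "subspace V" "x \<in> V"
 shows "orth_proj V x = (x::'a::euclidean_space)"
 using assms by (intro orth_proj_eqI) (auto simp: orthogonal_def)

lemma orth_proj_linear:
 assumes "subspace (V::'a::euclidean_space set)"
 shows "linear (orth_proj V)"
proof (rule linearI)
 fix x y :: 'a and r :: real
 note p = orth_proj_props[OF assms]
 show "orth_proj V (x + y) = orth_proj V x + orth_proj V y"
  using assms p(2)[of _ x] p(2)[of _ y]
  by (intro orth_proj_eqI) (auto simp: p(1) subspace_add orthogonal_def algebra_simps inner_diff_left inner_add_left)
 show "orth_proj V (r *\<^sub>R x) = r *\<^sub>R orth_proj V x"
  using assms p(2)[of _ x]
  by (intro orth_proj_eqI) (auto simp: p(1) subspace_scale orthogonal_def scaleR_diff_right[symmetric])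
qed

lemma orth_proj_adjoint:
 assumes "subspace (V::'a::euclidean_space set)"
 shows "orth_proj V x \<bullet> y = x \<bullet> orth_proj V y"
proof -
 note p = orth_proj_props[OF assms]
 have "(x - orth_proj V x) \<bullet> orth_proj V y = 0" "(y - orth_proj V y) \<bullet> orth_proj V x = 0"
  using p by auto
 then show ?thesis by (simp add: inner_diff_left inner_commute[of y] inner_commute[of "orth_proj V y"])
qed

lemma orth_proj_pythagoras:
 assumes "subspace (V::'a::euclidean_space set)"
 shows "(norm x)\<^sup>2 = (norm (orth_proj V x))\<^sup>2 + (norm (x - orth_proj V x))\<^sup>2"
proof -
 have "orthogonal (orth_proj V x) (x - orth_proj V x)"
  using orth_proj_residual[OF assms orth_proj_in[OF assms, of x], of x]
  by (simp add: orthogonal_def inner_commute)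
 from norm_add_Pythagorean[OF this] show ?thesis by simp
qed

lemma orth_proj_image:
 fixes g :: "'a::euclidean_space \<Rightarrow> 'a"
 assumes "orthogonal_transformation g" "subspace V"
 shows "orth_proj (g ` V) (g x) = g (orth_proj V x)"
proof (rule orth_proj_eqI)
 have lin: "linear g" using assms orthogonal_transformation_linear by blast
 show "subspace (g ` V)" using linear_subspace_image[OF lin assms(2)] .
 show "g (orth_proj V x) \<in> g ` V" using orth_proj_in[OF assms(2)] by blast
 fix z assume "z \<in> g ` V"
 then obtain w where "w \<in> V" "z = g w" by auto
 then show "orthogonal (g x - g (orth_proj V x)) z"
  using orth_proj_residual[OF assms(2), of w x] assms(1)
  by (simp add: linear_diff[OF lin, symmetric] orthogonal_def orthogonal_transformation_def)
qed

lemma ext_power_degree: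
 assumes "v \<in> ext_power m V" "card S \<noteq> m"
 shows "v $ S = 0"
proof -
 have "subspace {v::real^'a set. v $ S = 0}"
  by (auto simp: subspace_def)
 then have "ext_power m V \<subseteq> {v. v $ S = 0}"
  unfolding ext_power_def using assms by (intro span_minimal) (auto simp: wedge_degree)
 then show ?thesis using assms by auto
qed

text \<open>
 Exterior powers are functorial, so the idempotent self-adjoint map induced by the orthogonal
 projection onto \<open>V\<close> is the orthogonal projection onto the exterior power of \<open>V\<close>. Restriction
 of forms thereby becomes polynomial in the entries of the projection matrix.
\<close>

lemma orth_proj_ext_power:
 fixes V :: "('n::{finite,linorder} rvec) set"
 assumes "subspace V"
 shows "orth_proj (ext_power m V) v = ext_map m (orth_proj V) v"
proof (rule orth_proj_eqI)
 show "subspace (ext_power m V)" by (simp add: ext_power_def)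
 show "ext_map m (orth_proj V) v \<in> ext_power m V"
  unfolding ext_map_def ext_power_def
  by (intro span_sum span_scale span_base) (auto simp: orth_proj_in[OF assms])
 fix z assume z: "z \<in> ext_power m V"
 have "ext_map m (orth_proj V) z = z"
  using z unfolding ext_power_def
 proof (rule linear_eq_on_span[OF ext_map_linear linear_id[unfolded id_def], rotated])
  fix x assume "x \<in> wedge m ` {v. \<forall>i<m. v i \<in> V}"
  then obtain v where v: "x = wedge m v" "\<forall>i<m. v i \<in> V" by auto
  then have "wedge m (\<lambda>i. orth_proj V (v i)) = wedge m v"
   by (intro wedge_cong) (simp add: orth_proj_id[OF assms])
  then show "ext_map m (orth_proj V) x = x"
   by (simp add: v wedge_linear_image[OF orth_proj_linear[OF assms]])
 qed
 moreover have "ext_map m (orth_proj V) v \<bullet> z = v \<bullet> ext_map m (orth_proj V) z"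
  by (rule ext_map_adjoint) (rule orth_proj_adjoint[OF assms])
 ultimately show "orthogonal (v - ext_map m (orth_proj V) v) z"
  by (simp add: orthogonal_def inner_diff_left)
qed

lemma form_restrict_eq:
 "subspace P \<Longrightarrow> form_restrict m P v = ext_map m (orth_proj P) v"
 by (simp add: form_restrict_def orth_proj_ext_power)

lemma Pi_proj_eq: "Pi_proj m \<xi> v = ext_map m (orth_proj {x. orthogonal \<xi> x}) v"
 by (simp add: Pi_proj_def orth_proj_ext_power subspace_orthogonal_to_vector)

section \<open>Lebesgue measure on linear subspaces\<close>

lemma sigma_finite_measure_cballI:
 fixes N :: "'a::euclidean_space measure"
 assumes "sets N = sets borel" "\<And>r. r > 0 \<Longrightarrow> emeasure N (cball 0 r) < \<infinity>"
 shows "sigma_finite_measure N"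
proof
 have "(\<Union>i. cball (0::'a) (real (Suc i))) = UNIV"
  using real_arch_simple by (auto simp: set_eq_iff intro: order_trans)
   (metis linear not_less_eq_eq of_nat_Suc of_nat_le_iff order_trans real_arch_simple)
 then show "\<exists>A. countable A \<and> A \<subseteq> sets N \<and> \<Union> A = space N \<and> (\<forall>a\<in>A. emeasure N a \<noteq> \<infinity>)"
  using assms sets_eq_imp_space_eq[OF assms(1)]
  by (intro exI[of _ "range (\<lambda>i. cball 0 (real (Suc i)))"]) (auto simp: less_top[symmetric])
qed

text \<open>
 A translation-invariant measure is proportional to Lebesgue measure, by computing
 \<open>\<integral>\<integral> 1\<^sub>A(x) 1\<^sub>B(y - x)\<close> in two ways; here \<open>B\<close> is the unit ball, on which the image of Lebesgue
 measure under an orthogonal map agrees with Lebesgue measure.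
\<close>

lemma lborel_distr_orthogonal:
 fixes T :: "'a::euclidean_space \<Rightarrow> 'a"
 assumes T: "orthogonal_transformation T"
 shows "distr lborel borel T = lborel"
proof (rule measure_eqI)
 define N where "N = distr lborel borel T"
 have lin: "linear T" using T by (rule orthogonal_transformation_linear)
 have [measurable]: "T \<in> borel_measurable borel"
  using lin by (intro borel_measurable_continuous_onI linear_continuous_on linear_conv_bounded_linear[THEN iffD1])
 have setsN [measurable_cong]: "sets N = sets borel" by (simp add: N_def)
 have cb: "emeasure N (cball 0 r) = emeasure lborel (cball (0::'a) r)" for r
  using orthogonal_transformation_norm[OF T]
  by (auto simp: N_def emeasure_distr vimage_def cball_def intro!: arg_cong2[where f=emeasure])
 have sN: "sigma_finite_measure N"
  by (rule sigma_finite_measure_cballI[OF setsN]) (simp add: cb emeasure_cball)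
 interpret P: pair_sigma_finite N "lborel :: 'a measure"
  using sN by (simp add: pair_sigma_finite_def sigma_finite_lborel)
 have Ntr: "distr N borel ((+) c) = N" for c
 proof -
  obtain d where d: "T d = c" using orthogonal_transformation_surj[OF T] by (metis surjD)
  have "distr N borel ((+) c) = distr lborel borel (\<lambda>x. T (d + x))"
   by (simp add: N_def distr_distr o_def linear_add[OF lin] d)
  also have "\<dots> = distr (distr lborel borel ((+) d)) borel T"
   by (simp add: distr_distr o_def)
  finally show ?thesis by (simp add: lborel_distr_plus N_def)
 qed
 have trN: "(\<integral>\<^sup>+x. f (c + x) \<partial>N) = (\<integral>\<^sup>+x. f x \<partial>N)" if [measurable]: "f \<in> borel_measurable borel" for f :: "'a \<Rightarrow> ennreal" and c
  by (subst (2) Ntr[of c, symmetric], subst nn_integral_distr) (auto simp: that)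
 have trL: "(\<integral>\<^sup>+x. f (c + x) \<partial>lborel) = (\<integral>\<^sup>+x. f x \<partial>lborel)" if [measurable]: "f \<in> borel_measurable borel" for f :: "'a \<Rightarrow> ennreal" and c
  by (subst (2) lborel_distr_plus[of c, symmetric], subst nn_integral_distr) (auto simp: that)
 fix A assume "A \<in> sets (distr lborel borel T)"
 then have A[measurable]: "A \<in> sets borel" by simp
 define B where "B = cball (0::'a) 1"
 have [measurable]: "B \<in> sets borel" by (simp add: B_def)
 have "emeasure N A * emeasure lborel B = (\<integral>\<^sup>+x. indicator A x * (\<integral>\<^sup>+y. indicator B y \<partial>lborel) \<partial>N)"
  by (simp add: nn_integral_multc)
 also have "\<dots> = (\<integral>\<^sup>+x. indicator A x * (\<integral>\<^sup>+y. indicator B (- x + y) \<partial>lborel) \<partial>N)"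
  by (subst trL) auto
 also have "\<dots> = (\<integral>\<^sup>+x. \<integral>\<^sup>+y. indicator A x * indicator B (- x + y) \<partial>lborel \<partial>N)"
  by (intro nn_integral_cong nn_integral_cmult[symmetric]) auto
 also have "\<dots> = (\<integral>\<^sup>+y. \<integral>\<^sup>+x. indicator A x * indicator B (- x + y) \<partial>N \<partial>lborel)"
  by (rule P.Fubini'[symmetric]) measurable
 also have "\<dots> = (\<integral>\<^sup>+y. \<integral>\<^sup>+x. indicator A (y + x) * indicator B (- (y + x) + y) \<partial>N \<partial>lborel)"
  by (intro nn_integral_cong trN[symmetric]) measurable
 also have "\<dots> = (\<integral>\<^sup>+y. \<integral>\<^sup>+x. indicator A (x + y) * indicator B x \<partial>N \<partial>lborel)"
  by (intro nn_integral_cong) (auto simp: B_def indicator_def add_ac)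
 also have "\<dots> = (\<integral>\<^sup>+x. \<integral>\<^sup>+y. indicator A (x + y) * indicator B x \<partial>lborel \<partial>N)"
  by (rule P.Fubini') measurable
 also have "\<dots> = (\<integral>\<^sup>+x. (\<integral>\<^sup>+y. indicator A (x + y) \<partial>lborel) * indicator B x \<partial>N)"
  by (intro nn_integral_cong nn_integral_multc) auto
 also have "\<dots> = emeasure lborel A * emeasure lborel B"
  using trL[of "indicator A"]
  by (simp add: add.commute[of _ "_::'a"] nn_integral_cmult) (simp add: B_def cb)
 finally have "emeasure N A * emeasure lborel B = emeasure lborel A * emeasure lborel B" .
 moreover have "emeasure lborel B \<noteq> \<infinity>" "emeasure lborel B \<noteq> 0"
  using unit_ball_vol_pos[of "real DIM('a)"] by (auto simp: B_def emeasure_cball simp del: unit_ball_vol_pos)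
 ultimately show "emeasure (distr lborel borel T) A = emeasure lborel A"
  by (metis N_def mult_divide_eq_ennreal infinity_ennreal_def)
qed simp

lemma nn_integral_lborel_orthogonal:
 fixes T :: "'a::euclidean_space \<Rightarrow> 'a"
 assumes T: "orthogonal_transformation T" and [measurable]: "f \<in> borel_measurable borel"
 shows "(\<integral>\<^sup>+x. f (T x) \<partial>lborel) = (\<integral>\<^sup>+x. f x \<partial>lborel)"
proof -
 have "T \<in> borel_measurable borel"
  using orthogonal_transformation_linear[OF T]
  by (intro borel_measurable_continuous_onI linear_continuous_on linear_conv_bounded_linear[THEN iffD1])
 then show ?thesis
  by (subst (2) lborel_distr_orthogonal[OF T, symmetric]) (auto simp: nn_integral_distr)
qed

definition orthonormal_basis_of :: "'a::euclidean_space set \<Rightarrow> 'a set \<Rightarrow> bool" where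
 "orthonormal_basis_of V B \<longleftrightarrow> B \<subseteq> V \<and> pairwise orthogonal B \<and> (\<forall>b\<in>B. norm b = 1) \<and> span B = V"

lemma orthonormal_basis_of_facts:
 assumes "orthonormal_basis_of (V::'a::euclidean_space set) B"
 shows "finite B" "card B = dim V" "B \<subseteq> V" "span B = V" "subspace V"
  "\<And>b. b \<in> B \<Longrightarrow> norm b = 1" "\<And>b c. b \<in> B \<Longrightarrow> c \<in> B \<Longrightarrow> b \<bullet> c = (if b = c then 1 else 0)"
proof -
 have o: "pairwise orthogonal B" "\<And>b. b \<in> B \<Longrightarrow> norm b = 1" "B \<subseteq> V" "span B = V"
  using assms by (auto simp: orthonormal_basis_of_def)
 have "0 \<notin> B" using o(2) by force
 then have i: "independent B" using o by (intro pairwise_orthogonal_independent) auto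
 show "finite B" "card B = dim V" "B \<subseteq> V" "span B = V" "\<And>b. b \<in> B \<Longrightarrow> norm b = 1" "subspace V"
  using i o independent_bound basis_card_eq_dim[of B V] by (auto simp: independent_imp_finite)
 show "b \<bullet> c = (if b = c then 1 else 0)" if "b \<in> B" "c \<in> B" for b c
  using that o by (auto simp: pairwise_def orthogonal_def norm_eq_1)
qed

lemma orthonormal_basis_of_exists:
 assumes "subspace (V::'a::euclidean_space set)"
 shows "\<exists>B. orthonormal_basis_of V B"
 using orthonormal_basis_subspace[OF assms] unfolding orthonormal_basis_of_def by metis

lemma orthonormal_sum_norm:
 assumes "orthonormal_basis_of (V::'a::euclidean_space set) B"
 shows "(norm (\<Sum>b\<in>B. c b *\<^sub>R b))\<^sup>2 = (\<Sum>b\<in>B. (c b)\<^sup>2)"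
proof -
 note B = orthonormal_basis_of_facts[OF assms]
 have "(\<Sum>b\<in>B. c b *\<^sub>R b) \<bullet> (\<Sum>b\<in>B. c b *\<^sub>R b) = (\<Sum>b\<in>B. \<Sum>d\<in>B. c b * (c d * (if b = d then 1 else 0)))"
  unfolding inner_sum_left inner_sum_right by (intro sum.cong refl) (simp add: B(7))
 also have "\<dots> = (\<Sum>b\<in>B. \<Sum>d\<in>B. if b = d then (c b)\<^sup>2 else 0)"
  by (intro sum.cong refl) (auto simp: power2_eq_square)
 also have "\<dots> = (\<Sum>b\<in>B. (c b)\<^sup>2)" using B(1) by (intro sum.cong refl) (simp add: sum.delta)
 finally show ?thesis by (simp add: power2_norm_eq_inner)
qed

lemma lborel_orthonormal:
 fixes D :: "'a::euclidean_space set"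
 assumes D: "orthonormal_basis_of UNIV D"
 shows "distr (\<Pi>\<^sub>M b\<in>D. lborel) borel (\<lambda>c. \<Sum>b\<in>D. c b *\<^sub>R b) = lborel"
proof -
 note D' = orthonormal_basis_of_facts[OF D]
 have "card D = card (Basis :: 'a set)" using D' by simp
 then obtain h where h: "bij_betw h D (Basis :: 'a set)"
  using finite_same_card_bij[OF D'(1) finite_Basis] by auto
 define T where "T x = (\<Sum>d\<in>D. (x \<bullet> h d) *\<^sub>R d)" for x :: 'a
 have lin: "linear T"
  by (rule linearI) (simp_all add: T_def inner_add_left scaleR_left_distrib sum.distrib scaleR_sum_right)
 have "orthogonal_transformation T"
 proof (rule orthogonal_transformation[THEN iffD2], intro conjI allI)
  fix v
  have "(norm (T v))\<^sup>2 = (\<Sum>d\<in>D. (v \<bullet> h d)\<^sup>2)"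
   unfolding T_def by (rule orthonormal_sum_norm[OF D])
  also have "\<dots> = (\<Sum>b\<in>Basis. (v \<bullet> b)\<^sup>2)"
   by (rule sum.reindex_bij_betw[OF h, of "\<lambda>b. (v \<bullet> b)\<^sup>2"])
  also have "\<dots> = (norm v)\<^sup>2"
   unfolding power2_norm_eq_inner by (subst (2) euclidean_inner) (simp add: power2_eq_square)
  finally show "norm (T v) = norm v" by simp
 qed (rule lin)
 then have T: "distr lborel borel T = lborel" by (rule lborel_distr_orthogonal)
 have L: "(lborel :: 'a measure) = distr (\<Pi>\<^sub>M d\<in>D. lborel) borel (\<lambda>c. \<Sum>d\<in>D. c d *\<^sub>R h d)"
 proof (rule lborel_eqI)
  interpret product_sigma_finite "\<lambda>_::'a. lborel :: real measure"
   by (simp add: product_sigma_finite_def sigma_finite_lborel)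
  fix l u :: 'a assume lu: "\<And>b. b \<in> Basis \<Longrightarrow> l \<bullet> b \<le> u \<bullet> b"
  have hD: "\<And>d. d \<in> D \<Longrightarrow> h d \<in> Basis" using bij_betwE[OF h] by auto
  have coord: "(\<Sum>e\<in>D. c e *\<^sub>R h e) \<bullet> h d = c d" if "d \<in> D" for c :: "'a \<Rightarrow> real" and d
  proof -
   have "(\<Sum>e\<in>D. c e *\<^sub>R h e) \<bullet> h d = (\<Sum>e\<in>D. if e = d then c e else 0)"
    unfolding inner_sum_left using hD that h
    by (intro sum.cong refl) (auto simp: inner_Basis bij_betw_def inj_on_def)
   then show ?thesis using that D'(1) by simp
  qed
  have box: "x \<in> box l u \<longleftrightarrow> (\<forall>d\<in>D. l \<bullet> h d < x \<bullet> h d \<and> x \<bullet> h d < u \<bullet> h d)" for x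
  proof -
   have B: "Basis = h ` D" using h by (simp add: bij_betw_def)
   show ?thesis unfolding mem_box B by auto
  qed
  have vim: "(\<lambda>c. \<Sum>d\<in>D. c d *\<^sub>R h d) -` box l u \<inter> space (\<Pi>\<^sub>M d\<in>D. lborel) =
    (\<Pi>\<^sub>E d\<in>D. {l \<bullet> h d <..< u \<bullet> h d})"
   by (auto simp: box coord space_PiM PiE_iff)
  have "emeasure (distr (\<Pi>\<^sub>M d\<in>D. lborel) borel (\<lambda>c. \<Sum>d\<in>D. c d *\<^sub>R h d)) (box l u) =
    (\<Prod>d\<in>D. emeasure lborel {l \<bullet> h d <..< u \<bullet> h d})"
   using D'(1) by (subst emeasure_distr) (auto simp: vim emeasure_PiM intro!: borel_measurable_sum borel_measurable_scaleR)
  also have "\<dots> = (\<Prod>d\<in>D. ennreal ((u - l) \<bullet> h d))"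
   using hD lu by (intro prod.cong refl) (simp add: inner_diff_left)
  also have "\<dots> = (\<Prod>b\<in>Basis. ennreal ((u - l) \<bullet> b))"
   by (rule prod.reindex_bij_betw[OF h])
  also have "\<dots> = ennreal (\<Prod>b\<in>Basis. (u - l) \<bullet> b)"
   using lu by (intro prod_ennreal) (simp add: inner_diff_left)
  finally show "emeasure (distr (\<Pi>\<^sub>M d\<in>D. lborel) borel (\<lambda>c. \<Sum>d\<in>D. c d *\<^sub>R h d)) (box l u) =
    ennreal (\<Prod>b\<in>Basis. (u - l) \<bullet> b)" .
 qed simp
 have "distr lborel borel T = distr (\<Pi>\<^sub>M d\<in>D. lborel) borel (T \<circ> (\<lambda>c. \<Sum>d\<in>D. c d *\<^sub>R h d))"
  using lin by (subst L, intro distr_distr)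
   (auto intro!: borel_measurable_continuous_onI linear_continuous_on linear_conv_bounded_linear[THEN iffD1]
    borel_measurable_sum borel_measurable_scaleR)
 also have "T \<circ> (\<lambda>c. \<Sum>d\<in>D. c d *\<^sub>R h d) = (\<lambda>c. \<Sum>d\<in>D. c d *\<^sub>R d)"
 proof
  fix c :: "'a \<Rightarrow> real"
  have "T (h d) = d" if "d \<in> D" for d
  proof -
   have "T (h d) = (\<Sum>e\<in>D. if e = d then e else 0)"
    unfolding T_def using bij_betwE[OF h] that h
    by (intro sum.cong refl) (auto simp: inner_Basis bij_betw_def inj_on_def)
   then show ?thesis using that D'(1) by simp
  qed
  then show "(T \<circ> (\<lambda>c. \<Sum>d\<in>D. c d *\<^sub>R h d)) c = (\<Sum>d\<in>D. c d *\<^sub>R d)"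
   by (simp add: linear_sum[OF lin] linear_scale[OF lin])
 qed
 finally show ?thesis unfolding T by simp
qed

lemma subspace_lborel_onb:
 assumes "subspace (V::'a::euclidean_space set)"
 obtains B where "orthonormal_basis_of V B"
  "subspace_lborel V = distr (\<Pi>\<^sub>M b\<in>B. lborel) borel (\<lambda>c. \<Sum>b\<in>B. c b *\<^sub>R b)"
proof
 show "orthonormal_basis_of V (SOME B. orthonormal_basis_of V B)"
  using orthonormal_basis_of_exists[OF assms] by (rule someI_ex)
 show "subspace_lborel V = distr (\<Pi>\<^sub>M b\<in>(SOME B. orthonormal_basis_of V B). lborel) borel
   (\<lambda>c. \<Sum>b\<in>(SOME B. orthonormal_basis_of V B). c b *\<^sub>R b)"
  by (simp add: subspace_lborel_def orthonormal_basis_of_def Let_def)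
qed

lemma sets_subspace_lborel [simp, measurable_cong]: "sets (subspace_lborel V) = sets borel"
 by (simp add: subspace_lborel_def Let_def)

lemma space_subspace_lborel [simp]: "space (subspace_lborel V) = UNIV"
 by (simp add: subspace_lborel_def Let_def)

lemma measurable_onb_sum [measurable]:
 "(\<lambda>c. \<Sum>b\<in>B. c b *\<^sub>R b) \<in> measurable (\<Pi>\<^sub>M b\<in>B. (lborel::real measure)) (borel :: 'a::euclidean_space measure)"
 by (intro borel_measurable_sum borel_measurable_scaleR) auto

lemma emeasure_subspace_lborel_cball:
 assumes "subspace (V::'a::euclidean_space set)" "r > 0"
 shows "emeasure (subspace_lborel V) (cball 0 r) = ennreal (unit_ball_vol (real (dim V)) * r ^ dim V)"
proof -
 obtain B where B: "orthonormal_basis_of V B"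
  "subspace_lborel V = distr (\<Pi>\<^sub>M b\<in>B. lborel) borel (\<lambda>c. \<Sum>b\<in>B. c b *\<^sub>R b)"
  using subspace_lborel_onb[OF assms(1)] by blast
 note B' = orthonormal_basis_of_facts[OF B(1)]
 have n: "norm (\<Sum>b\<in>B. c b *\<^sub>R b) = sqrt (\<Sum>b\<in>B. (c b)\<^sup>2)" for c
  using orthonormal_sum_norm[OF B(1), of c] by (metis norm_ge_zero real_sqrt_unique)
 have "emeasure (subspace_lborel V) (cball 0 r) =
  emeasure (\<Pi>\<^sub>M b\<in>B. lborel) ({f. sqrt (\<Sum>i\<in>B. (f i)\<^sup>2) \<le> r} \<inter> space (\<Pi>\<^sub>M b\<in>B. lborel))"
  unfolding B(2) by (subst emeasure_distr) (auto simp: n intro!: arg_cong2[where f=emeasure])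
 also have "\<dots> = ennreal (unit_ball_vol (real (card B)) * r ^ card B)"
  using B'(1) assms(2) by (rule emeasure_cball_aux)
 finally show ?thesis by (simp add: B')
qed

lemma sigma_finite_subspace_lborel:
 assumes "subspace (V::'a::euclidean_space set)"
 shows "sigma_finite_measure (subspace_lborel V)"
 by (rule sigma_finite_measure_cballI) (auto simp: emeasure_subspace_lborel_cball[OF assms])

lemma AE_subspace_lborel:
 assumes "subspace (V::'a::euclidean_space set)"
 shows "AE x in subspace_lborel V. x \<in> V"
proof -
 obtain B where B: "orthonormal_basis_of V B"
  "subspace_lborel V = distr (\<Pi>\<^sub>M b\<in>B. lborel) borel (\<lambda>c. \<Sum>b\<in>B. c b *\<^sub>R b)"
  using subspace_lborel_onb[OF assms(1)] by blast
 note B' = orthonormal_basis_of_facts[OF B(1)]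
 have cl: "{x. x \<in> V} \<in> sets borel" using closed_subspace[of V] assms by (simp add: borel_closed)
 have "(\<Sum>b\<in>B. c b *\<^sub>R b) \<in> V" for c
  using B' assms by (intro subspace_sum subspace_scale) auto
 then show ?thesis unfolding B(2)
  by (subst AE_distr_iff) (auto simp: cl[simplified])
qed

lemma orthonormal_basis_of_union:
 assumes "orthonormal_basis_of V B" "orthonormal_basis_of (orthogonal_comp V) C"
 shows "orthonormal_basis_of UNIV (B \<union> C)" "B \<inter> C = {}"
proof -
 note B = orthonormal_basis_of_facts[OF assms(1)] and C = orthonormal_basis_of_facts[OF assms(2)]
 have bc: "orthogonal b c" if "b \<in> B" "c \<in> C" for b c
  using that B(3) C(3) by (auto simp: orthogonal_comp_def)
 show "B \<inter> C = {}"
  using bc C(6) by (metis disjoint_iff norm_zero orthogonal_self zero_neq_one)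
 have "x \<in> span (B \<union> C)" for x
 proof -
  have p: "orth_proj V x \<in> V" "x - orth_proj V x \<in> orthogonal_comp V"
   using orth_proj_in[OF B(5)] orth_proj_residual[OF B(5), of _ x]
   by (auto simp: orthogonal_comp_def orthogonal_def inner_commute)
  then have "orth_proj V x + (x - orth_proj V x) \<in> span (B \<union> C)"
   using B(4) C(4) by (intro span_add) (metis Un_upper1 Un_upper2 span_mono subsetD)+
  then show ?thesis by simp
 qed
 then show "orthonormal_basis_of UNIV (B \<union> C)"
  using assms bc bc[THEN orthogonal_commute[THEN iffD1]] B(6) C(6)
  unfolding orthonormal_basis_of_def pairwise_def by auto
qed

text \<open>Concatenating orthonormal bases of \<open>V\<close> and of its orthogonal complement gives Fubini.\<close>

lemma lborel_eq_subspace_product: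
 fixes V :: "'a::euclidean_space set"
 assumes V: "subspace V"
 shows "lborel = distr (subspace_lborel V \<Otimes>\<^sub>M subspace_lborel (orthogonal_comp V)) borel (\<lambda>(x, y). x + y)"
proof -
 let ?W = "orthogonal_comp V"
 have W: "subspace ?W" by (rule subspace_orthogonal_comp)
 obtain B where B: "orthonormal_basis_of V B"
  "subspace_lborel V = distr (\<Pi>\<^sub>M b\<in>B. lborel) borel (\<lambda>c. \<Sum>b\<in>B. c b *\<^sub>R b)"
  using subspace_lborel_onb[OF V] by blast
 obtain C where C: "orthonormal_basis_of ?W C"
  "subspace_lborel ?W = distr (\<Pi>\<^sub>M b\<in>C. lborel) borel (\<lambda>c. \<Sum>b\<in>C. c b *\<^sub>R b)"
  using subspace_lborel_onb[OF W] by blast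
 note B' = orthonormal_basis_of_facts[OF B(1)] and C' = orthonormal_basis_of_facts[OF C(1)]
 note U = orthonormal_basis_of_union[OF B(1) C(1)]
 interpret product_sigma_finite "\<lambda>_::'a. lborel :: real measure"
  by (simp add: product_sigma_finite_def sigma_finite_lborel)
 let ?PB = "\<Pi>\<^sub>M b\<in>B. (lborel::real measure)" and ?PC = "\<Pi>\<^sub>M b\<in>C. (lborel::real measure)"
 let ?sB = "\<lambda>c. \<Sum>b\<in>B. c b *\<^sub>R b" and ?sC = "\<lambda>c. \<Sum>b\<in>C. c b *\<^sub>R b"
 have "lborel = distr (\<Pi>\<^sub>M b\<in>B \<union> C. lborel) borel (\<lambda>c. \<Sum>b\<in>B \<union> C. c b *\<^sub>R b)"
  by (rule lborel_orthonormal[OF U(1), symmetric])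
 also have "(\<Pi>\<^sub>M b\<in>B \<union> C. lborel) = distr (?PB \<Otimes>\<^sub>M ?PC) (\<Pi>\<^sub>M b\<in>B \<union> C. lborel) (merge B C)"
  using U(2) B'(1) C'(1) by (simp add: distr_merge)
 also have "distr \<dots> borel (\<lambda>c. \<Sum>b\<in>B \<union> C. c b *\<^sub>R b) =
   distr (?PB \<Otimes>\<^sub>M ?PC) borel ((\<lambda>c. \<Sum>b\<in>B \<union> C. c b *\<^sub>R b) \<circ> merge B C)"
  by (rule distr_distr) (auto intro!: measurable_onb_sum measurable_merge)
 also have "(\<lambda>c. \<Sum>b\<in>B \<union> C. c b *\<^sub>R b) \<circ> merge B C = (\<lambda>(x, y). x + y) \<circ> (\<lambda>(c, d). (?sB c, ?sC d))"
 proof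
  fix p :: "('a \<Rightarrow> real) \<times> ('a \<Rightarrow> real)"
  obtain c d where p: "p = (c, d)" by force
  have "(\<Sum>b\<in>C. merge B C (c, d) b *\<^sub>R b) = (\<Sum>b\<in>C. d b *\<^sub>R b)"
   using U(2) by (intro sum.cong refl) (auto simp: merge_def)
  then show "((\<lambda>c. \<Sum>b\<in>B \<union> C. c b *\<^sub>R b) \<circ> merge B C) p =
   ((\<lambda>(x, y). x + y) \<circ> (\<lambda>(c, d). (?sB c, ?sC d))) p"
   unfolding p using B'(1) C'(1) U(2) by (simp add: sum.union_disjoint merge_def)
 qed
 also have "distr (?PB \<Otimes>\<^sub>M ?PC) borel \<dots> =
   distr (distr (?PB \<Otimes>\<^sub>M ?PC) (borel \<Otimes>\<^sub>M borel) (\<lambda>(c, d). (?sB c, ?sC d))) borel (\<lambda>(x, y). x + y)"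
  by (rule distr_distr[symmetric]) measurable
 also have "distr (?PB \<Otimes>\<^sub>M ?PC) (borel \<Otimes>\<^sub>M borel) (\<lambda>(c, d). (?sB c, ?sC d)) =
   subspace_lborel V \<Otimes>\<^sub>M subspace_lborel ?W"
  unfolding B(2) C(2)
  by (rule pair_measure_distr[symmetric]) (auto simp: C(2)[symmetric] sigma_finite_subspace_lborel[OF W])
 finally show ?thesis .
qed

lemma pair_sigma_finite_subspace_lborel:
 assumes "subspace (V::'a::euclidean_space set)" "subspace (W::'a set)"
 shows "pair_sigma_finite (subspace_lborel V) (subspace_lborel W)"
 using assms by (simp add: pair_sigma_finite_def sigma_finite_subspace_lborel)

lemma nn_integral_subspace_product:
 fixes V :: "'a::euclidean_space set"
 assumes V: "subspace V" and [measurable]: "f \<in> borel_measurable borel"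
 shows "(\<integral>\<^sup>+x. f x \<partial>lborel) = (\<integral>\<^sup>+x. \<integral>\<^sup>+y. f (x + y) \<partial>subspace_lborel (orthogonal_comp V) \<partial>subspace_lborel V)"
proof -
 interpret pair_sigma_finite "subspace_lborel V" "subspace_lborel (orthogonal_comp V)"
  by (rule pair_sigma_finite_subspace_lborel[OF V subspace_orthogonal_comp])
 show ?thesis
  by (subst lborel_eq_subspace_product[OF V], subst nn_integral_distr)
   (auto simp: M2.nn_integral_fst[symmetric])
qed

lemma nn_integral_gaussian_real:
 assumes s: "s > (0::real)"
 shows "(\<integral>\<^sup>+t. ennreal (exp (- (pi * s * t\<^sup>2))) \<partial>lborel) = ennreal (1 / sqrt s)"
proof -
 let ?\<sigma> = "1 / sqrt (2 * pi * s)"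
 have sg: "?\<sigma> > 0" using s by simp
 have sq: "?\<sigma>\<^sup>2 = 1 / (2 * pi * s)" using s by (simp add: power_divide)
 have d: "normal_density 0 ?\<sigma> t = sqrt s * exp (- (pi * s * t\<^sup>2))" for t
  unfolding normal_density_def sq using s by (simp add: real_sqrt_divide)
 have "1 = emeasure (density lborel (normal_density 0 ?\<sigma>)) UNIV"
  using prob_space.emeasure_space_1[OF prob_space_normal_density[OF sg, of 0]] by simp
 also have "\<dots> = (\<integral>\<^sup>+t. ennreal (sqrt s * exp (- (pi * s * t\<^sup>2))) \<partial>lborel)"
  by (subst emeasure_density) (auto simp: d)
 also have "\<dots> = ennreal (sqrt s) * (\<integral>\<^sup>+t. ennreal (exp (- (pi * s * t\<^sup>2))) \<partial>lborel)"
  using s by (subst nn_integral_cmult[symmetric]) (auto simp: ennreal_mult)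
 finally have e: "ennreal (sqrt s) * (\<integral>\<^sup>+t. ennreal (exp (- (pi * s * t\<^sup>2))) \<partial>lborel) = 1" by simp
 have "(\<integral>\<^sup>+t. ennreal (exp (- (pi * s * t\<^sup>2))) \<partial>lborel) =
   ennreal (1 / sqrt s) * (ennreal (sqrt s) * (\<integral>\<^sup>+t. ennreal (exp (- (pi * s * t\<^sup>2))) \<partial>lborel))"
  using s by (simp add: mult.assoc[symmetric] ennreal_mult[symmetric])
 then show ?thesis by (simp add: e)
qed

lemma nn_integral_subspace_prod:
 fixes V :: "'a::euclidean_space set"
 assumes "subspace V" and [measurable]: "f \<in> borel_measurable borel"
  and "\<And>B c. orthonormal_basis_of V B \<Longrightarrow> g (\<Sum>b\<in>B. c b *\<^sub>R b) = (\<Prod>b\<in>B. f (c b))"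
  and [measurable]: "g \<in> borel_measurable borel"
 shows "(\<integral>\<^sup>+x. g x \<partial>subspace_lborel V) = (\<integral>\<^sup>+t. f t \<partial>(lborel::real measure)) ^ dim V"
proof -
 obtain B where B: "orthonormal_basis_of V B"
  "subspace_lborel V = distr (\<Pi>\<^sub>M b\<in>B. lborel) borel (\<lambda>c. \<Sum>b\<in>B. c b *\<^sub>R b)"
  using subspace_lborel_onb[OF assms(1)] by blast
 note B' = orthonormal_basis_of_facts[OF B(1)]
 interpret product_sigma_finite "\<lambda>_::'a. lborel :: real measure"
  by (simp add: product_sigma_finite_def sigma_finite_lborel)
 have "(\<integral>\<^sup>+x. g x \<partial>subspace_lborel V) = (\<integral>\<^sup>+c. (\<Prod>b\<in>B. f (c b)) \<partial>(\<Pi>\<^sub>M b\<in>B. lborel))"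
  unfolding B(2) by (subst nn_integral_distr) (auto simp: assms(3)[OF B(1)])
 also have "\<dots> = (\<Prod>b\<in>B. (\<integral>\<^sup>+t. f t \<partial>lborel))"
  using B'(1) by (intro product_nn_integral_prod) auto
 finally show ?thesis by (simp add: B')
qed

lemma nn_integral_gaussian_subspace:
 fixes V :: "'a::euclidean_space set"
 assumes "subspace V" "s > 0"
 shows "(\<integral>\<^sup>+x. ennreal (exp (- (pi * s * (norm x)\<^sup>2))) \<partial>subspace_lborel V) = ennreal ((1 / sqrt s) ^ dim V)"
proof -
 have "(\<integral>\<^sup>+x. ennreal (exp (- (pi * s * (norm x)\<^sup>2))) \<partial>subspace_lborel V) =
   (\<integral>\<^sup>+t. ennreal (exp (- (pi * s * t\<^sup>2))) \<partial>(lborel::real measure)) ^ dim V"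
 proof (rule nn_integral_subspace_prod[OF assms(1)])
  fix B c assume B: "orthonormal_basis_of V B"
  show "ennreal (exp (- (pi * s * (norm (\<Sum>b\<in>B. c b *\<^sub>R b))\<^sup>2))) = (\<Prod>b\<in>B. ennreal (exp (- (pi * s * (c b)\<^sup>2))))"
   using orthonormal_basis_of_facts(1)[OF B]
   by (simp add: orthonormal_sum_norm[OF B] sum_distrib_left sum_negf[symmetric] exp_sum prod_ennreal)
 qed auto
 then show ?thesis using assms(2) by (simp add: nn_integral_gaussian_real ennreal_power)
qed

text \<open>
 Averaging a function of the projection against a Gaussian in the orthogonal directions gives
 its integral over the subspace. The right-hand side no longer mentions a basis, and it is
 visibly measurable in \<open>V\<close> and equivariant.
\<close>

lemma borel_measurable_orth_proj [measurable]:
 assumes "subspace (V::'a::euclidean_space set)"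
 shows "orth_proj V \<in> borel_measurable borel"
 using orth_proj_linear[OF assms]
 by (intro borel_measurable_continuous_onI linear_continuous_on linear_conv_bounded_linear[THEN iffD1])

definition gauss_comp :: "'a::euclidean_space set \<Rightarrow> 'a \<Rightarrow> real" where
 "gauss_comp V x = exp (- (pi * (norm (x - orth_proj V x))\<^sup>2))"

lemma gauss_comp_bounds: "0 \<le> gauss_comp V x" "gauss_comp V x > 0"
 by (auto simp: gauss_comp_def)

lemma borel_measurable_gauss_comp [measurable]:
 assumes [measurable]: "subspace (V::'a::euclidean_space set)"
 shows "gauss_comp V \<in> borel_measurable borel"
 unfolding gauss_comp_def by measurable

lemma orth_proj_add:
 assumes "subspace V" "x \<in> V" "y \<in> orthogonal_comp V"
 shows "orth_proj V (x + y) = (x::'a::euclidean_space)"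
 using assms by (intro orth_proj_eqI) (auto simp: orthogonal_comp_def orthogonal_commute)

lemma nn_integral_subspace_lborel:
 fixes V :: "'a::euclidean_space set"
 assumes V[measurable]: "subspace V" and [measurable]: "f \<in> borel_measurable borel"
 shows "(\<integral>\<^sup>+x. f x \<partial>subspace_lborel V) = (\<integral>\<^sup>+x. f (orth_proj V x) * ennreal (gauss_comp V x) \<partial>lborel)"
proof -
 let ?W = "orthogonal_comp V"
 have "(\<integral>\<^sup>+x. f (orth_proj V x) * ennreal (gauss_comp V x) \<partial>lborel) =
  (\<integral>\<^sup>+x. \<integral>\<^sup>+y. f (orth_proj V (x + y)) * ennreal (gauss_comp V (x + y)) \<partial>subspace_lborel ?W \<partial>subspace_lborel V)"
  by (rule nn_integral_subspace_product[OF V]) measurable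
 also have "\<dots> = (\<integral>\<^sup>+x. \<integral>\<^sup>+y. f x * ennreal (exp (- (pi * 1 * (norm y)\<^sup>2))) \<partial>subspace_lborel ?W \<partial>subspace_lborel V)"
 proof (rule nn_integral_cong_AE, use AE_subspace_lborel[OF V] in eventually_elim)
  case (elim x)
  show ?case
   by (rule nn_integral_cong_AE, use AE_subspace_lborel[OF subspace_orthogonal_comp[of V]] in eventually_elim)
    (simp add: orth_proj_add[OF V elim] gauss_comp_def)
 qed
 also have "\<dots> = (\<integral>\<^sup>+x. f x \<partial>subspace_lborel V)"
  by (simp add: nn_integral_cmult nn_integral_gaussian_subspace[OF subspace_orthogonal_comp, of 1, simplified])
 finally show ?thesis by simp
qed

lemma subspace_lborel_eq_distr:
 assumes V[measurable]: "subspace (V::'a::euclidean_space set)"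
 shows "subspace_lborel V = distr (density lborel (\<lambda>x. ennreal (gauss_comp V x))) borel (orth_proj V)"
proof (rule measure_eqI)
 fix A assume "A \<in> sets (subspace_lborel V)"
 then have [measurable]: "A \<in> sets borel" by simp
 have "emeasure (subspace_lborel V) A = (\<integral>\<^sup>+x. indicator A x \<partial>subspace_lborel V)" by simp
 also have "\<dots> = (\<integral>\<^sup>+x. indicator A (orth_proj V x) * ennreal (gauss_comp V x) \<partial>lborel)"
  by (rule nn_integral_subspace_lborel[OF V]) measurable
 also have "\<dots> = (\<integral>\<^sup>+x. indicator A x \<partial>distr (density lborel (\<lambda>x. ennreal (gauss_comp V x))) borel (orth_proj V))"
  by (subst nn_integral_distr, measurable, subst nn_integral_density) (auto simp: mult.commute)
 finally show "emeasure (subspace_lborel V) A =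
   emeasure (distr (density lborel (\<lambda>x. ennreal (gauss_comp V x))) borel (orth_proj V)) A" by simp
qed simp

lemma subspace_lborel_UNIV: "subspace_lborel (UNIV::'a::euclidean_space set) = lborel"
proof -
 have "orth_proj UNIV = (\<lambda>x::'a. x)" by (rule ext, rule orth_proj_id) auto
 then show ?thesis
  by (subst subspace_lborel_eq_distr) (auto simp: gauss_comp_def density_1 distr_id2)
qed

lemma gauss_comp_image:
 assumes "orthogonal_transformation (g::'a \<Rightarrow> 'a)" "subspace (V::'a::euclidean_space set)"
 shows "gauss_comp (g ` V) (g x) = gauss_comp V x"
 using orthogonal_transformation_linear[OF assms(1)] orthogonal_transformation_norm[OF assms(1)]
 by (simp add: gauss_comp_def orth_proj_image[OF assms] linear_diff[symmetric])

lemma borel_measurable_orthogonal_transformation: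
 "orthogonal_transformation (g::'a::euclidean_space \<Rightarrow> 'a) \<Longrightarrow> g \<in> borel_measurable borel"
 using orthogonal_transformation_linear[of g]
 by (intro borel_measurable_continuous_onI linear_continuous_on linear_conv_bounded_linear[THEN iffD1])

lemma nn_integral_subspace_lborel_image:
 fixes V :: "'a::euclidean_space set"
 assumes g: "orthogonal_transformation (g::'a \<Rightarrow> 'a)" and V[measurable]: "subspace V"
  and [measurable]: "f \<in> borel_measurable borel"
 shows "(\<integral>\<^sup>+x. f x \<partial>subspace_lborel (g ` V)) = (\<integral>\<^sup>+x. f (g x) \<partial>subspace_lborel V)"
proof -
 have gV[measurable]: "subspace (g ` V)"
  using linear_subspace_image[OF orthogonal_transformation_linear[OF g] V] .
 note [measurable] = borel_measurable_orthogonal_transformation[OF g]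
 have "(\<integral>\<^sup>+x. f x \<partial>subspace_lborel (g ` V)) =
   (\<integral>\<^sup>+x. f (orth_proj (g ` V) x) * ennreal (gauss_comp (g ` V) x) \<partial>lborel)"
  by (rule nn_integral_subspace_lborel) measurable
 also have "\<dots> = (\<integral>\<^sup>+x. f (orth_proj (g ` V) (g x)) * ennreal (gauss_comp (g ` V) (g x)) \<partial>lborel)"
  by (rule nn_integral_lborel_orthogonal[OF g, symmetric]) measurable
 also have "\<dots> = (\<integral>\<^sup>+x. f (g x) \<partial>subspace_lborel V)"
  by (subst nn_integral_subspace_lborel[OF V]) (auto simp: orth_proj_image[OF g V] gauss_comp_image[OF g V])
 finally show ?thesis .
qed

lemma nn_integral_subspace_lborel_translate:
 fixes V :: "'a::euclidean_space set"
 assumes V[measurable]: "subspace V" and a: "a \<in> V" and [measurable]: "f \<in> borel_measurable borel"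
 shows "(\<integral>\<^sup>+x. f (a + x) \<partial>subspace_lborel V) = (\<integral>\<^sup>+x. f x \<partial>subspace_lborel V)"
proof -
 have p: "orth_proj V (a + x) = a + orth_proj V x" for x
  using orth_proj_linear[OF V] orth_proj_id[OF V a] by (simp add: linear_add)
 have g: "gauss_comp V (a + x) = gauss_comp V x" for x by (simp add: gauss_comp_def p)
 have "(\<integral>\<^sup>+x. f (a + x) \<partial>subspace_lborel V) =
  (\<integral>\<^sup>+x. f (orth_proj V (a + x)) * ennreal (gauss_comp V (a + x)) \<partial>lborel)"
  by (subst nn_integral_subspace_lborel[OF V]) (auto simp: p g)
 also have "\<dots> = (\<integral>\<^sup>+x. f (orth_proj V x) * ennreal (gauss_comp V x) \<partial>lborel)"
  by (subst (2) lborel_distr_plus[of a, symmetric], subst nn_integral_distr) auto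
 finally show ?thesis by (subst nn_integral_subspace_lborel[OF V]) auto
qed

lemma nn_integral_lborel_scale:
 fixes f :: "'a::euclidean_space \<Rightarrow> ennreal"
 assumes c: "c > 0" and [measurable]: "f \<in> borel_measurable borel"
 shows "(\<integral>\<^sup>+x. f x \<partial>lborel) = ennreal (c ^ DIM('a)) * (\<integral>\<^sup>+x. f (c *\<^sub>R x) \<partial>lborel)"
proof -
 have "(\<integral>\<^sup>+x. f x \<partial>lborel) = (\<integral>\<^sup>+x. f x \<partial>density (distr lborel borel (\<lambda>x::'a. 0 + c *\<^sub>R x)) (\<lambda>_. \<bar>c\<bar> ^ DIM('a)))"
  using c by (subst lborel_affine[of c 0]) auto
 also have "\<dots> = ennreal (c ^ DIM('a)) * (\<integral>\<^sup>+x. f (c *\<^sub>R x) \<partial>lborel)"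
  using c by (simp add: nn_integral_density nn_integral_distr nn_integral_cmult)
 finally show ?thesis .
qed

lemma dim_orthogonal_comp:
 assumes "subspace (V::'a::euclidean_space set)"
 shows "dim V + dim (orthogonal_comp V) = DIM('a)"
proof -
 obtain B C where B: "orthonormal_basis_of V B" and C: "orthonormal_basis_of (orthogonal_comp V) C"
  using orthonormal_basis_of_exists[OF assms] orthonormal_basis_of_exists[OF subspace_orthogonal_comp[of V]] by blast
 note U = orthonormal_basis_of_union[OF B C]
 have "card (B \<union> C) = DIM('a)" using orthonormal_basis_of_facts(2)[OF U(1)] by simp
 then show ?thesis
  using U(2) orthonormal_basis_of_facts(1,2)[OF B] orthonormal_basis_of_facts(1,2)[OF C]
  by (simp add: card_Un_disjoint)
qed

lemma nn_integral_subspace_lborel_scale: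
 fixes V :: "'a::euclidean_space set"
 assumes V[measurable]: "subspace V" and c: "c > 0" and [measurable]: "f \<in> borel_measurable borel"
 shows "(\<integral>\<^sup>+x. f x \<partial>subspace_lborel V) = ennreal (c ^ dim V) * (\<integral>\<^sup>+x. f (c *\<^sub>R x) \<partial>subspace_lborel V)"
proof -
 let ?W = "orthogonal_comp V"
 have W: "subspace ?W" by (rule subspace_orthogonal_comp)
 have p: "orth_proj V (c *\<^sub>R x) = c *\<^sub>R orth_proj V x" for x
  using orth_proj_linear[OF V] by (simp add: linear_scale)
 have g: "gauss_comp V (c *\<^sub>R x) = exp (- (pi * c\<^sup>2 * (norm (x - orth_proj V x))\<^sup>2))" for x
  by (simp add: gauss_comp_def p scaleR_diff_right[symmetric] power_mult_distrib mult_ac)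
 have sq: "1 / sqrt (c\<^sup>2) = 1 / c" using c by simp
 have "(\<integral>\<^sup>+x. f x \<partial>subspace_lborel V) =
   ennreal (c ^ DIM('a)) * (\<integral>\<^sup>+x. f (orth_proj V (c *\<^sub>R x)) * ennreal (gauss_comp V (c *\<^sub>R x)) \<partial>lborel)"
  by (subst nn_integral_subspace_lborel[OF V], measurable)
   (rule nn_integral_lborel_scale[OF c], measurable)
 also have "(\<integral>\<^sup>+x. f (orth_proj V (c *\<^sub>R x)) * ennreal (gauss_comp V (c *\<^sub>R x)) \<partial>lborel) =
   (\<integral>\<^sup>+x. \<integral>\<^sup>+y. f (orth_proj V (c *\<^sub>R (x + y))) * ennreal (gauss_comp V (c *\<^sub>R (x + y)))
    \<partial>subspace_lborel ?W \<partial>subspace_lborel V)"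
  by (rule nn_integral_subspace_product[OF V]) measurable
 also have "\<dots> = (\<integral>\<^sup>+x. \<integral>\<^sup>+y. f (c *\<^sub>R x) * ennreal (exp (- (pi * c\<^sup>2 * (norm y)\<^sup>2))) \<partial>subspace_lborel ?W \<partial>subspace_lborel V)"
 proof (rule nn_integral_cong_AE, use AE_subspace_lborel[OF V] in eventually_elim)
  case (elim x)
  show ?case
   by (rule nn_integral_cong_AE, use AE_subspace_lborel[OF W] in eventually_elim)
    (simp add: orth_proj_add[OF V elim] g p)
 qed
 also have "\<dots> = (\<integral>\<^sup>+x. f (c *\<^sub>R x) \<partial>subspace_lborel V) * ennreal ((1 / c) ^ dim ?W)"
  using c by (subst nn_integral_cmult) (auto simp: nn_integral_gaussian_subspace[OF W] sq nn_integral_multc)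
 also have "ennreal (c ^ DIM('a)) * ((\<integral>\<^sup>+x. f (c *\<^sub>R x) \<partial>subspace_lborel V) * ennreal ((1 / c) ^ dim ?W)) =
   ennreal (c ^ DIM('a) * (1 / c) ^ dim ?W) * (\<integral>\<^sup>+x. f (c *\<^sub>R x) \<partial>subspace_lborel V)"
  using c by (simp add: ennreal_mult mult_ac)
 also have "c ^ DIM('a) * (1 / c) ^ dim ?W = c ^ dim V"
  using c by (simp add: dim_orthogonal_comp[OF V, symmetric] power_add power_divide)
 finally show ?thesis .
qed

section \<open>Radial functions and a universal weight\<close>

lemma distr_norm_subspace_lborel:
 fixes V :: "'a::euclidean_space set"
 assumes V: "subspace V" and d: "dim V > 0"
 shows "distr (subspace_lborel V) borel norm =
  density lborel (\<lambda>r. ennreal (sphere_vol (dim V) * r ^ (dim V - 1)) * indicator {0..} r)" (is "?M = ?N")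
proof (rule measure_eqI_generator_eq[where \<Omega>=UNIV and E="range (\<lambda>a::real. {..a})" and A="\<lambda>i. {..real i}"])
 let ?d = "dim V" and ?w = "unit_ball_vol (real (dim V))"
 have M: "emeasure ?M {..r} = ennreal (?w * r ^ ?d)" if "r > 0" for r
 proof -
  have "emeasure ?M {..r} = emeasure (subspace_lborel V) (cball 0 r)"
   by (subst emeasure_distr) (auto intro!: arg_cong2[where f=emeasure])
  then show ?thesis using emeasure_subspace_lborel_cball[OF V that] by simp
 qed
 have M0: "emeasure ?M {..0} = 0"
 proof -
  have "emeasure ?M {..0} \<le> ennreal (?w * r ^ ?d)" if "r > 0" for r
   unfolding M[OF that, symmetric] using that by (intro emeasure_mono) auto
  then have "\<forall>\<^sub>F r in at_right 0. emeasure ?M {..0} \<le> ennreal (?w * r ^ ?d)"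
   by (intro eventually_mono[OF eventually_at_right_less[of "0::real"]])
  moreover have "((\<lambda>r. ennreal (?w * r ^ ?d)) \<longlongrightarrow> ennreal (?w * 0 ^ ?d)) (at_right 0)"
   by (intro tendsto_intros)
  ultimately have "emeasure ?M {..0} \<le> ennreal (?w * 0 ^ ?d)"
   by (intro tendsto_lowerbound[OF _ _ trivial_limit_at_right_real])
  then show ?thesis using d by (simp add: zero_power)
 qed
 have Mneg: "emeasure ?M {..r} = 0" if "r \<le> 0" for r
  using emeasure_mono[of "{..r}" "{..0}" ?M] M0 that by simp
 have N: "emeasure ?N {..r} = ennreal (?w * r ^ ?d)" if "r \<ge> 0" for r
 proof -
  have "emeasure ?N {..r} = (\<integral>\<^sup>+t. ennreal (sphere_vol ?d * t ^ (?d - 1)) * indicator {0..r} t \<partial>lborel)"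
   by (subst emeasure_density) (auto intro!: nn_integral_cong simp: indicator_def)
  also have "\<dots> = ennreal (?w * r ^ ?d - ?w * 0 ^ ?d)"
  proof (rule nn_integral_FTC_Icc)
   fix x :: real assume x: "x \<in> {0..r}"
   show "((\<lambda>t. ?w * t ^ ?d) has_real_derivative sphere_vol ?d * x ^ (?d - 1)) (at x)"
    by (auto intro!: derivative_eq_intros simp: sphere_vol_def)
   show "0 \<le> sphere_vol ?d * x ^ (?d - 1)"
    using x by (simp add: sphere_vol_def)
  qed (use that in auto)
  finally show ?thesis using zero_power[OF d, where 'a=real] by simp
 qed
 have Nneg: "emeasure ?N {..r} = 0" if "r \<le> 0" for r
  using emeasure_mono[of "{..r}" "{..0}" ?N] N[of 0] that d by (simp add: zero_power)
 show "Int_stable (range (\<lambda>a::real. {..a}))" by (auto simp: Int_stable_def min_def)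
 show "sets ?M = sigma_sets UNIV (range (\<lambda>a::real. {..a}))"
  "sets ?N = sigma_sets UNIV (range (\<lambda>a::real. {..a}))"
  by (simp_all add: borel_eq_atMost)
 show "range (\<lambda>i. {..real i}) \<subseteq> range (\<lambda>a::real. {..a})" "(\<Union>i. {..real i}) = UNIV"
  using real_arch_simple by (auto simp: set_eq_iff)
 show "emeasure ?M {..real i} \<noteq> \<infinity>" for i
  using M[of "real i"] M0 by (cases "i = 0") auto
 fix X assume "X \<in> range (\<lambda>a::real. {..a})"
 then show "emeasure ?M X = emeasure ?N X"
 proof -
  obtain r where "X = {..r}" using \<open>X \<in> _\<close> by auto
  then show ?thesis using M[of r] N[of r] Mneg[of r] Nneg[of r] by (cases "r > 0") auto
 qed
qed auto

lemma nn_integral_radial: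
 fixes V :: "'a::euclidean_space set"
 assumes V: "subspace V" and d: "dim V > 0" and [measurable]: "f \<in> borel_measurable borel"
 shows "(\<integral>\<^sup>+x. f (norm x) \<partial>subspace_lborel V) =
  (\<integral>\<^sup>+r. f r * (ennreal (sphere_vol (dim V) * r ^ (dim V - 1)) * indicator {0..} r) \<partial>lborel)"
proof -
 have "(\<integral>\<^sup>+x. f (norm x) \<partial>subspace_lborel V) = (\<integral>\<^sup>+r. f r \<partial>distr (subspace_lborel V) borel norm)"
  by (subst nn_integral_distr) auto
 then show ?thesis
  by (simp add: distr_norm_subspace_lborel[OF V d] nn_integral_density mult.commute)
qed

lemma sphere_vol_pos: "d > 0 \<Longrightarrow> sphere_vol d > 0"
 by (simp add: sphere_vol_def)

lemma nn_integral_radial_compare: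
 fixes V :: "'a::euclidean_space set"
 assumes V: "subspace V" and d: "dim V > 0" and [measurable]: "f \<in> borel_measurable borel"
 shows "(\<integral>\<^sup>+x. f (norm x) \<partial>subspace_lborel V) =
  (\<integral>\<^sup>+x. f (norm x) * ennreal (sphere_vol (dim V) / sphere_vol DIM('a) / norm x ^ (DIM('a) - dim V)) \<partial>(lborel::'a measure))"
proof -
 let ?n = "DIM('a)" and ?d = "dim V"
 have dn: "?d \<le> ?n" by (rule dim_subset_UNIV)
 have "(\<integral>\<^sup>+x. f (norm x) * ennreal (sphere_vol ?d / sphere_vol ?n / norm x ^ (?n - ?d)) \<partial>(lborel::'a measure)) =
  (\<integral>\<^sup>+r. f r * ennreal (sphere_vol ?d / sphere_vol ?n / r ^ (?n - ?d)) *
    (ennreal (sphere_vol ?n * r ^ (?n - 1)) * indicator {0..} r) \<partial>lborel)"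
  unfolding subspace_lborel_UNIV[where 'a='a, symmetric]
  by (subst nn_integral_radial[where f="\<lambda>r. f r * ennreal (sphere_vol ?d / sphere_vol ?n / r ^ (?n - ?d))"]) auto
 also have "\<dots> = (\<integral>\<^sup>+r. f r * (ennreal (sphere_vol ?d * r ^ (?d - 1)) * indicator {0..} r) \<partial>lborel)"
 proof (rule nn_integral_cong_AE, use AE_lborel_singleton[of "0::real"] in eventually_elim)
  case (elim r)
  show ?case
  proof (cases "r \<ge> 0")
   case True
   have "r ^ (?n - 1) = r ^ (?n - ?d) * r ^ (?d - 1)"
    using d dn by (simp add: power_add[symmetric])
   then have "sphere_vol ?d / sphere_vol ?n / r ^ (?n - ?d) * (sphere_vol ?n * r ^ (?n - 1)) = sphere_vol ?d * r ^ (?d - 1)"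
    using elim sphere_vol_pos[of ?n] by (simp add: field_simps)
   moreover have "0 \<le> sphere_vol ?d / sphere_vol ?n / r ^ (?n - ?d)" "0 \<le> sphere_vol ?n * r ^ (?n - 1)"
    using True by (simp_all add: sphere_vol_def)
   ultimately have "ennreal (sphere_vol ?d / sphere_vol ?n / r ^ (?n - ?d)) * ennreal (sphere_vol ?n * r ^ (?n - 1))
     = ennreal (sphere_vol ?d * r ^ (?d - 1))"
    by (simp add: ennreal_mult[symmetric])
   then show ?thesis using True by (simp add: mult.assoc)
  qed simp
 qed
 also have "\<dots> = (\<integral>\<^sup>+x. f (norm x) \<partial>subspace_lborel V)"
  by (rule nn_integral_radial[OF V d, symmetric]) measurable
 finally show ?thesis by simp
qed

definition weight :: "'a::real_normed_vector \<Rightarrow> real" where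
 "weight x = 1 / (1 + (norm x)\<^sup>2)"

lemma weight_bounds: "0 < weight x" "0 \<le> weight x" "weight x \<le> 1"
 by (auto simp: weight_def add_pos_nonneg)

lemma borel_measurable_weight [measurable]: "weight \<in> borel_measurable (borel :: 'a::euclidean_space measure)"
 unfolding weight_def by measurable

lemma nn_integral_weight_real: "(\<integral>\<^sup>+t. ennreal (1 / (1 + t\<^sup>2)) \<partial>(lborel::real measure)) = ennreal pi"
proof -
 have i: "integrable lborel (\<lambda>x::real. inverse (1 + x\<^sup>2))" "(\<integral>x. inverse (1 + x\<^sup>2) \<partial>(lborel::real measure)) = pi"
  using integrable_inverse_1_plus_square LBINT_inverse_1_plus_square
  by (simp_all add: set_integrable_def interval_lebesgue_integral_def set_lebesgue_integral_def)
 have "(\<integral>\<^sup>+t. ennreal (inverse (1 + t\<^sup>2)) \<partial>(lborel::real measure)) = ennreal (\<integral>x. inverse (1 + x\<^sup>2) \<partial>(lborel::real measure))"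
  by (rule nn_integral_eq_integral[OF i(1)]) simp
 then show ?thesis unfolding i(2) by (simp add: inverse_eq_divide)
qed

lemma one_plus_sum_power_le:
 assumes "finite B" "\<And>b. b \<in> B \<Longrightarrow> 0 \<le> (f b::real)"
 shows "(\<Prod>b\<in>B. 1 + f b) \<le> (1 + (\<Sum>b\<in>B. f b)) ^ card B"
proof -
 have "(\<Prod>b\<in>B. 1 + f b) \<le> (\<Prod>b\<in>B. 1 + (\<Sum>b\<in>B. f b))"
  using assms by (intro prod_mono) (auto intro: member_le_sum)
 then show ?thesis by simp
qed

text \<open>
 Because \<open>\<Prod>(1 + x\<^sub>i\<^sup>2) \<le> (1 + |x|\<^sup>2)\<^sup>d\<close> on a \<open>d\<close>-dimensional subspace, a power of the weight is integrable
 on every subspace, with a bound that is uniform over the Grassmannian.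
\<close>

lemma nn_integral_weight_subspace:
 fixes V :: "'a::euclidean_space set"
 assumes V: "subspace V" and N: "N \<ge> dim V"
 shows "(\<integral>\<^sup>+x. ennreal (weight x ^ N) \<partial>subspace_lborel V) \<le> ennreal (pi ^ dim V)"
proof -
 obtain B where B: "orthonormal_basis_of V B"
  "subspace_lborel V = distr (\<Pi>\<^sub>M b\<in>B. lborel) borel (\<lambda>c. \<Sum>b\<in>B. c b *\<^sub>R b)"
  using subspace_lborel_onb[OF V] by blast
 note B' = orthonormal_basis_of_facts[OF B(1)]
 interpret product_sigma_finite "\<lambda>_::'a. lborel :: real measure"
  by (simp add: product_sigma_finite_def sigma_finite_lborel)
 have le: "weight (\<Sum>b\<in>B. c b *\<^sub>R b) ^ N \<le> (\<Prod>b\<in>B. 1 / (1 + (c b)\<^sup>2))" for c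
 proof -
  have "weight (\<Sum>b\<in>B. c b *\<^sub>R b) ^ N \<le> weight (\<Sum>b\<in>B. c b *\<^sub>R b) ^ card B"
   using weight_bounds N B' by (intro power_decreasing) auto
  also have "\<dots> = 1 / (1 + (\<Sum>b\<in>B. (c b)\<^sup>2)) ^ card B"
   by (simp add: weight_def orthonormal_sum_norm[OF B(1)] power_divide)
  also have "\<dots> \<le> 1 / (\<Prod>b\<in>B. 1 + (c b)\<^sup>2)"
   using one_plus_sum_power_le[OF B'(1), of "\<lambda>b. (c b)\<^sup>2"] sum_nonneg[of B "\<lambda>b. (c b)\<^sup>2"]
   by (intro divide_left_mono mult_pos_pos prod_pos zero_less_power) (auto intro: add_pos_nonneg sum_nonneg)
  finally show ?thesis by (simp add: prod_dividef)
 qed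
 have "(\<integral>\<^sup>+x. ennreal (weight x ^ N) \<partial>subspace_lborel V) \<le> (\<integral>\<^sup>+c. (\<Prod>b\<in>B. ennreal (1 / (1 + (c b)\<^sup>2))) \<partial>(\<Pi>\<^sub>M b\<in>B. lborel))"
  unfolding B(2) by (subst nn_integral_distr) (auto intro!: nn_integral_mono ennreal_leI le simp: prod_ennreal)
 also have "\<dots> = (\<Prod>b\<in>B. (\<integral>\<^sup>+t. ennreal (1 / (1 + t\<^sup>2)) \<partial>lborel))"
  using B'(1) by (intro product_nn_integral_prod) auto
 finally show ?thesis by (simp add: nn_integral_weight_real B' ennreal_power)
qed

lemma weight_add_le:
 assumes "x \<bullet> y = (0::real)"
 shows "weight (x + y) ^ (2 * N) \<le> weight x ^ N * weight (y::'a::euclidean_space) ^ N"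
proof -
 have n: "(norm (x + y))\<^sup>2 = (norm x)\<^sup>2 + (norm y)\<^sup>2"
  using assms by (simp add: norm_add_Pythagorean orthogonal_def)
 have "weight (x + y) \<le> weight x" "weight (x + y) \<le> weight y"
  by (auto simp: weight_def n intro!: divide_left_mono mult_pos_pos add_pos_nonneg)
 then have "weight (x + y) ^ N * weight (x + y) ^ N \<le> weight x ^ N * weight y ^ N"
  using weight_bounds by (intro mult_mono power_mono) (auto intro: less_imp_le)
 then show ?thesis by (simp add: power_add mult_2)
qed

section \<open>The tautological bundle\<close>

declare transpose_matrix_vector [simp del]

lemma borel_measurable_vec_nth_iff:
 fixes f :: "'b \<Rightarrow> 'a::euclidean_space ^ 'i"
 shows "f \<in> borel_measurable N \<longleftrightarrow> (\<forall>i. (\<lambda>x. f x $ i) \<in> borel_measurable N)"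
proof
 assume f: "f \<in> borel_measurable N"
 have "(\<lambda>v :: 'a ^ 'i. v $ i) \<in> borel_measurable borel" for i
  by (intro borel_measurable_continuous_onI continuous_intros)
 from measurable_compose[OF f this] show "\<forall>i. (\<lambda>x. f x $ i) \<in> borel_measurable N" by blast
next
 assume [rule_format, measurable]: "\<forall>i. (\<lambda>x. f x $ i) \<in> borel_measurable N"
 show "f \<in> borel_measurable N"
 proof (rule borel_measurable_euclidean_space[THEN iffD2], rule ballI)
  fix b :: "'a ^ 'i" assume "b \<in> Basis"
  then obtain i c where b: "b = axis i c" by (auto simp: Basis_vec_def)
  show "(\<lambda>x. f x \<bullet> b) \<in> borel_measurable N"
   unfolding b inner_axis by measurable
 qed
qed

lemma borel_measurable_vec_nth [measurable (raw)]:
 fixes f :: "'b \<Rightarrow> 'a::euclidean_space ^ 'i"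
 shows "f \<in> borel_measurable N \<Longrightarrow> (\<lambda>x. f x $ i) \<in> borel_measurable N"
 using borel_measurable_vec_nth_iff by auto

lemma borel_measurable_matrix_vector [measurable (raw)]:
 fixes A :: "'b \<Rightarrow> real ^ 'n ^ 'm"
 assumes [measurable]: "A \<in> borel_measurable N" "x \<in> borel_measurable N"
 shows "(\<lambda>z. A z *v x z) \<in> borel_measurable N"
 by (subst borel_measurable_vec_nth_iff) (simp add: matrix_vector_mult_def)

lemma borel_measurable_ext_map:
 fixes g :: "'b \<Rightarrow> 'n::{finite,linorder} rvec \<Rightarrow> 'n rvec"
 assumes [measurable]: "\<And>i. (\<lambda>z. g z (axis i 1)) \<in> borel_measurable N" "v \<in> borel_measurable N"
 shows "(\<lambda>z. ext_map m (g z) (v z)) \<in> borel_measurable N"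
proof (subst borel_measurable_vec_nth_iff, rule allI)
 fix S :: "'n set"
 show "(\<lambda>z. ext_map m (g z) (v z) $ S) \<in> borel_measurable N"
  by (simp add: ext_map_def wedge_def)
qed

lemma orthogonal_matrix_inverse:
 assumes "orthogonal_matrix (A::real^'a^'a)"
 shows "A *v (transpose A *v x) = x" "transpose A *v (A *v x) = x"
 using assms by (simp_all add: matrix_vector_mul_assoc orthogonal_matrix_def)

lemma orthogonal_matrix_imp_transformation:
 "orthogonal_matrix (A::real^'a^'a) \<Longrightarrow> orthogonal_transformation ((*v) A)"
 by (simp add: orthogonal_transformation_matrix matrix_of_matrix_vector_mul)

lemma orth_proj_matrix_image:
 assumes A: "orthogonal_matrix (A::real^'a^'a)" and P: "subspace P"
 shows "orth_proj ((*v) A ` P) x = A *v orth_proj P (transpose A *v x)"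
proof -
 have "orthogonal_transformation ((*v) A)"
  by (rule orthogonal_matrix_imp_transformation[OF A])
 then have "orth_proj ((*v) A ` P) (A *v (transpose A *v x)) = A *v orth_proj P (transpose A *v x)"
  by (rule orth_proj_image) (rule P)
 moreover have "A *v (transpose A *v x) = x"
  using A by (simp add: matrix_vector_mul_assoc orthogonal_matrix_def)
 ultimately show ?thesis by simp
qed

lemma grassmannianD: "P \<in> grassmannian k \<Longrightarrow> subspace P" "P \<in> grassmannian k \<Longrightarrow> dim P = k"
 by (auto simp: grassmannian_def)

locale invariant_grassmannian =
 fixes k :: nat and M :: "('n::{finite,linorder} rvec) set measure"
 assumes invariant: "invariant_grassmann_measure k M"
begin

lemma prob_M: "prob_space M" and sets_M: "sets M = sets (grassmann_borel k)"
 using invariant by (auto simp: invariant_grassmann_measure_def)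

sublocale M: prob_space M by (rule prob_M)

lemma space_M: "space M = grassmannian k"
 using sets_eq_imp_space_eq[OF sets_M] by (simp add: grassmann_borel_def)

lemma subspace_M: "P \<in> space M \<Longrightarrow> subspace P" "P \<in> space M \<Longrightarrow> dim P = k"
 by (auto simp: space_M grassmannian_def)

lemma matrix_orth_proj:
 "P \<in> space M \<Longrightarrow> matrix (orth_proj P) *v x = orth_proj P x"
 by (simp add: subspace_M orth_proj_linear matrix_works)

lemma measurable_matrix_orth_proj [measurable]: "(\<lambda>P. matrix (orth_proj P)) \<in> borel_measurable M"
 unfolding measurable_cong_sets[OF sets_M refl] grassmann_borel_def
 by (rule measurable_vimage_algebra1) auto

lemma measurable_orth_proj [measurable (raw)]:
 assumes p[measurable]: "p \<in> measurable N M" and [measurable]: "x \<in> borel_measurable N"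
 shows "(\<lambda>z. orth_proj (p z) (x z)) \<in> borel_measurable N"
proof -
 have "(\<lambda>z. matrix (orth_proj (p z)) *v x z) \<in> borel_measurable N" by measurable
 then show ?thesis
  by (rule measurable_cong[THEN iffD1, rotated])
   (use measurable_space[OF p] in \<open>auto simp: matrix_orth_proj\<close>)
qed

lemma measurable_gauss_comp [measurable (raw)]:
 assumes [measurable]: "p \<in> measurable N M" "x \<in> borel_measurable N"
 shows "(\<lambda>z. gauss_comp (p z) (x z)) \<in> borel_measurable N"
 unfolding gauss_comp_def by measurable

lemma measurable_ext_map_orth_proj [measurable (raw)]:
 assumes [measurable]: "p \<in> measurable N M" "x \<in> borel_measurable N"
 shows "(\<lambda>z. ext_map m (orth_proj (p z)) (x z)) \<in> borel_measurable N"
 by (rule borel_measurable_ext_map) measurable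

abbreviation taut where
 "taut \<equiv> taut_measure k M"

lemma space_restrict_taut: "space (restrict_space (M \<Otimes>\<^sub>M borel) (taut_bundle k)) = taut_bundle k"
 by (auto simp: space_restrict_space space_pair_measure space_M taut_bundle_def)

lemma measurable_proj_pair:
 "(\<lambda>p. (fst p, orth_proj (fst p) (snd p))) \<in> measurable (M \<Otimes>\<^sub>M borel) (restrict_space (M \<Otimes>\<^sub>M borel) (taut_bundle k))"
proof (rule measurable_restrict_space2)
 show "(\<lambda>p. (fst p, orth_proj (fst p) (snd p))) \<in> space (M \<Otimes>\<^sub>M borel) \<rightarrow> taut_bundle k"
  by (auto simp: space_pair_measure space_M taut_bundle_def grassmannianD intro!: orth_proj_in)
qed measurable

lemma taut_measure_eq_distr:
 "taut_measure k M = distr (density (M \<Otimes>\<^sub>M lborel) (\<lambda>p. ennreal (gauss_comp (fst p) (snd p))))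
  (restrict_space (M \<Otimes>\<^sub>M borel) (taut_bundle k)) (\<lambda>p. (fst p, orth_proj (fst p) (snd p)))" (is "_ = ?D")
proof -
 let ?R = "restrict_space (M \<Otimes>\<^sub>M borel) (taut_bundle k)"
 have mp[measurable]: "(\<lambda>p. (fst p, orth_proj (fst p) (snd p))) \<in> measurable (M \<Otimes>\<^sub>M lborel) ?R"
  using measurable_proj_pair by (simp cong: measurable_cong_sets)
 then have mp': "(\<lambda>p. (fst p, orth_proj (fst p) (snd p)))
   \<in> measurable (density (M \<Otimes>\<^sub>M lborel) (\<lambda>p. ennreal (gauss_comp (fst p) (snd p)))) ?R"
  by simp
 have *: "(\<integral>\<^sup>+P. emeasure (subspace_lborel P) {x. (P, x) \<in> E} \<partial>M) = emeasure ?D E" if E: "E \<in> sets ?R" for E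
 proof -
  have [measurable]: "(\<lambda>p. indicator E (fst p, orth_proj (fst p) (snd p)) :: ennreal) \<in> borel_measurable (M \<Otimes>\<^sub>M lborel)"
   using E by (intro measurable_compose[OF mp] borel_measurable_indicator)
  have "emeasure ?D E = (\<integral>\<^sup>+p. indicator E p \<partial>?D)"
   using E by simp
  also have "\<dots> = (\<integral>\<^sup>+p. ennreal (gauss_comp (fst p) (snd p)) * indicator E (fst p, orth_proj (fst p) (snd p)) \<partial>(M \<Otimes>\<^sub>M lborel))"
   using E by (subst nn_integral_distr[OF mp'], simp, subst nn_integral_density) auto
  also have "\<dots> = (\<integral>\<^sup>+P. \<integral>\<^sup>+x. ennreal (gauss_comp P x) * indicator E (P, orth_proj P x) \<partial>lborel \<partial>M)"
   by (subst lborel.nn_integral_fst[symmetric], rule borel_measurable_times_ennreal) auto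
  also have "\<dots> = (\<integral>\<^sup>+P. emeasure (subspace_lborel P) {x. (P, x) \<in> E} \<partial>M)"
  proof (rule nn_integral_cong)
   fix P assume P: "P \<in> space M"
   obtain E' where E': "E' \<in> sets (M \<Otimes>\<^sub>M borel)" "E = E' \<inter> taut_bundle k"
    using E by (auto simp: sets_restrict_space)
   have "{x. (P, x) \<in> E} = Pair P -` E' \<inter> P"
    using P by (auto simp: E' taut_bundle_def space_M)
   moreover have "Pair P -` E' \<in> sets borel" using E' by (simp add: sets_Pair1)
   moreover have "P \<in> sets borel" using closed_subspace[OF subspace_M(1)[OF P]] by simp
   ultimately have m[measurable]: "{x. (P, x) \<in> E} \<in> sets borel" by simp
   have "emeasure (subspace_lborel P) {x. (P, x) \<in> E} = (\<integral>\<^sup>+x. indicator {x. (P, x) \<in> E} x \<partial>subspace_lborel P)"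
    by simp
   also have "\<dots> = (\<integral>\<^sup>+x. indicator {x. (P, x) \<in> E} (orth_proj P x) * ennreal (gauss_comp P x) \<partial>lborel)"
    by (rule nn_integral_subspace_lborel[OF subspace_M(1)[OF P]]) measurable
   also have "\<dots> = (\<integral>\<^sup>+x. ennreal (gauss_comp P x) * indicator E (P, orth_proj P x) \<partial>lborel)"
    by (intro nn_integral_cong) (auto simp: indicator_def)
   finally show "(\<integral>\<^sup>+x. ennreal (gauss_comp P x) * indicator E (P, orth_proj P x) \<partial>lborel) =
    emeasure (subspace_lborel P) {x. (P, x) \<in> E}" by simp
  qed
  finally show ?thesis by simp
 qed
 have "taut_measure k M = measure_of (space ?D) (sets ?D) (emeasure ?D)"
  unfolding taut_measure_def space_distr sets_distr space_restrict_taut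
 proof (rule measure_of_eq)
  show "sets ?R \<subseteq> Pow (taut_bundle k)"
   using sets.space_closed[of ?R] space_restrict_taut by simp
  fix E assume "E \<in> sigma_sets (taut_bundle k) (sets ?R)"
  then have "E \<in> sets ?R" using sets.sigma_sets_eq[of ?R] space_restrict_taut by simp
  then show "(\<integral>\<^sup>+P. emeasure (subspace_lborel P) {x. (P, x) \<in> E} \<partial>M) = emeasure ?D E"
   by (rule *)
 qed
 then show ?thesis by (simp only: measure_of_of_measure)
qed

lemma sets_taut [measurable_cong]: "sets taut = sets (restrict_space (M \<Otimes>\<^sub>M borel) (taut_bundle k))"
 by (simp add: taut_measure_eq_distr)

lemma space_taut: "space taut = taut_bundle k"
 by (simp add: taut_measure_eq_distr space_restrict_taut)

lemma measurable_tautI: "F \<in> measurable (M \<Otimes>\<^sub>M borel) N \<Longrightarrow> F \<in> measurable taut N"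
 by (simp add: measurable_cong_sets[OF sets_taut refl] measurable_restrict_space1)

lemma measurable_taut_proj:
 assumes "F \<in> measurable taut N"
 shows "(\<lambda>p. F (fst p, orth_proj (fst p) (snd p))) \<in> measurable (M \<Otimes>\<^sub>M borel) N"
proof -
 have "F \<circ> (\<lambda>p. (fst p, orth_proj (fst p) (snd p))) \<in> measurable (M \<Otimes>\<^sub>M borel) N"
  using measurable_proj_pair assms by (intro measurable_comp) (auto simp: measurable_cong_sets[OF sets_taut refl])
 then show ?thesis by (simp add: o_def)
qed

lemma nn_integral_taut_gauss:
 assumes F[measurable]: "F \<in> borel_measurable taut"
 shows "(\<integral>\<^sup>+p. F p \<partial>taut) = (\<integral>\<^sup>+P. \<integral>\<^sup>+x. F (P, orth_proj P x) * ennreal (gauss_comp P x) \<partial>lborel \<partial>M)"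
proof -
 let ?R = "restrict_space (M \<Otimes>\<^sub>M borel) (taut_bundle k)"
 have mp[measurable]: "(\<lambda>p. (fst p, orth_proj (fst p) (snd p))) \<in> measurable (M \<Otimes>\<^sub>M lborel) ?R"
  using measurable_proj_pair by (simp cong: measurable_cong_sets)
 then have mp': "(\<lambda>p. (fst p, orth_proj (fst p) (snd p)))
   \<in> measurable (density (M \<Otimes>\<^sub>M lborel) (\<lambda>p. ennreal (gauss_comp (fst p) (snd p)))) ?R"
  by simp
 have FR: "F \<in> borel_measurable ?R" using F by (simp add: measurable_cong_sets[OF sets_taut refl])
 have [measurable]: "(\<lambda>p. F (fst p, orth_proj (fst p) (snd p))) \<in> borel_measurable (M \<Otimes>\<^sub>M lborel)"
  by (rule measurable_compose[OF mp FR])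
 have "(\<integral>\<^sup>+p. F p \<partial>taut) = (\<integral>\<^sup>+p. ennreal (gauss_comp (fst p) (snd p)) * F (fst p, orth_proj (fst p) (snd p)) \<partial>(M \<Otimes>\<^sub>M lborel))"
  unfolding taut_measure_eq_distr using FR
  by (subst nn_integral_distr[OF mp'], simp, subst nn_integral_density) auto
 also have "\<dots> = (\<integral>\<^sup>+P. \<integral>\<^sup>+x. F (P, orth_proj P x) * ennreal (gauss_comp P x) \<partial>lborel \<partial>M)"
  by (subst lborel.nn_integral_fst[symmetric]) (measurable, simp add: mult.commute)
 finally show ?thesis .
qed

lemma nn_integral_taut:
 assumes [measurable]: "F \<in> borel_measurable (M \<Otimes>\<^sub>M borel)"
 shows "(\<integral>\<^sup>+p. F p \<partial>taut) = (\<integral>\<^sup>+P. \<integral>\<^sup>+x. F (P, x) \<partial>subspace_lborel P \<partial>M)"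
 unfolding nn_integral_taut_gauss[OF measurable_tautI[OF assms]]
 by (intro nn_integral_cong nn_integral_subspace_lborel[symmetric] subspace_M) measurable

lemma measurable_nn_integral_subspace:
 assumes [measurable]: "F \<in> borel_measurable (M \<Otimes>\<^sub>M borel)"
 shows "(\<lambda>P. \<integral>\<^sup>+x. F (P, x) \<partial>subspace_lborel P) \<in> borel_measurable M"
proof -
 have "(\<lambda>P. \<integral>\<^sup>+x. F (P, orth_proj P x) * ennreal (gauss_comp P x) \<partial>lborel) \<in> borel_measurable M"
  by measurable
 then show ?thesis
  by (rule measurable_cong[THEN iffD1, rotated])
   (intro nn_integral_subspace_lborel[symmetric] subspace_M; measurable)
qed

lemma integral_taut:
 fixes F :: "_ \<Rightarrow> 'b::{banach, second_countable_topology}"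
 assumes [measurable]: "F \<in> borel_measurable (M \<Otimes>\<^sub>M borel)" and i: "integrable taut F"
 shows "(\<integral>p. F p \<partial>taut) = (\<integral>P. \<integral>x. F (P, x) \<partial>subspace_lborel P \<partial>M)"
proof -
 interpret L: pair_sigma_finite M "lborel :: ('n::{finite,linorder} rvec) measure"
  by (simp add: pair_sigma_finite_def M.sigma_finite_measure_axioms sigma_finite_lborel)
 let ?R = "restrict_space (M \<Otimes>\<^sub>M borel) (taut_bundle k)"
 have mp[measurable]: "(\<lambda>p. (fst p, orth_proj (fst p) (snd p))) \<in> measurable (M \<Otimes>\<^sub>M lborel) ?R"
  using measurable_proj_pair by (simp cong: measurable_cong_sets)
 then have mp': "(\<lambda>p. (fst p, orth_proj (fst p) (snd p)))
   \<in> measurable (density (M \<Otimes>\<^sub>M lborel) (\<lambda>p. ennreal (gauss_comp (fst p) (snd p)))) ?R"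
  by simp
 have FR: "F \<in> borel_measurable ?R" by (simp add: measurable_restrict_space1)
 have [measurable]: "(\<lambda>p. F (fst p, orth_proj (fst p) (snd p))) \<in> borel_measurable (M \<Otimes>\<^sub>M lborel)"
  by (rule measurable_compose[OF mp FR])
 let ?G = "\<lambda>p. gauss_comp (fst p) (snd p) *\<^sub>R F (fst p, orth_proj (fst p) (snd p))"
 have G: "integrable (M \<Otimes>\<^sub>M lborel) ?G"
  using i unfolding taut_measure_eq_distr
  by (subst (asm) integrable_distr_eq[OF mp' FR], subst (asm) integrable_density)
   (auto simp: gauss_comp_bounds)
 have "(\<integral>p. F p \<partial>taut) = (\<integral>p. ?G p \<partial>(M \<Otimes>\<^sub>M lborel))"
  unfolding taut_measure_eq_distr
  by (subst integral_distr[OF mp' FR], subst integral_density)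
   (auto simp: gauss_comp_bounds)
 also have "\<dots> = (\<integral>P. \<integral>x. gauss_comp P x *\<^sub>R F (P, orth_proj P x) \<partial>lborel \<partial>M)"
  using L.integral_fst'[OF G] by simp
 also have "\<dots> = (\<integral>P. \<integral>x. F (P, x) \<partial>subspace_lborel P \<partial>M)"
 proof (rule Bochner_Integration.integral_cong[OF refl])
  fix P assume P: "P \<in> space M"
  note [measurable] = subspace_M(1)[OF P]
  have [measurable]: "(\<lambda>x. F (P, x)) \<in> borel_measurable borel" using P by measurable
  show "(\<integral>x. gauss_comp P x *\<^sub>R F (P, orth_proj P x) \<partial>lborel) = (\<integral>x. F (P, x) \<partial>subspace_lborel P)"
   unfolding subspace_lborel_eq_distr[OF subspace_M(1)[OF P]]
   by (subst integral_distr, measurable, subst integral_density) (measurable, auto simp: gauss_comp_bounds)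
 qed
 finally show ?thesis .
qed

lemma image_in_space:
 assumes A: "orthogonal_matrix A" and P: "P \<in> space M"
 shows "(*v) A ` P \<in> space M"
proof -
 have inj: "inj ((*v) A)" using orthogonal_matrix_inverse(2)[OF A] by (metis injI)
 show ?thesis
  using P linear_subspace_image[OF matrix_vector_mul_linear[of A], of P]
   dim_image_eq[OF matrix_vector_mul_linear[of A] inj_on_subset[OF inj subset_UNIV], of P]
  by (auto simp: space_M grassmannian_def)
qed

lemma measurable_image:
 assumes A: "orthogonal_matrix A"
 shows "(\<lambda>P. (*v) A ` P) \<in> measurable M M"
 unfolding measurable_cong_sets[OF refl sets_M] grassmann_borel_def
proof (rule measurable_vimage_algebra2)
 show "(\<lambda>P. (*v) A ` P) \<in> space M \<rightarrow> grassmannian k"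
  using image_in_space[OF A] by (auto simp: space_M)
 have "(\<lambda>P. A ** matrix (orth_proj P) ** transpose A) \<in> borel_measurable M"
  by (subst borel_measurable_vec_nth_iff, rule allI, subst borel_measurable_vec_nth_iff)
   (simp add: matrix_matrix_mult_def)
 then show "(\<lambda>P. matrix (orth_proj ((*v) A ` P))) \<in> borel_measurable M"
 proof (rule measurable_cong[THEN iffD1, rotated])
  fix P assume P: "P \<in> space M"
  have "matrix (orth_proj ((*v) A ` P)) *v x = (A ** matrix (orth_proj P) ** transpose A) *v x" for x
   using orth_proj_matrix_image[OF A subspace_M(1)[OF P]]
   by (simp add: matrix_orth_proj[OF P] matrix_orth_proj[OF image_in_space[OF A P]] matrix_vector_mul_assoc[symmetric])
  then show "A ** matrix (orth_proj P) ** transpose A = matrix (orth_proj ((*v) A ` P))"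
   by (simp add: matrix_eq)
 qed
qed

lemma distr_image:
 assumes A: "orthogonal_matrix A"
 shows "distr M M (\<lambda>P. (*v) A ` P) = M"
proof (rule measure_eqI)
 fix E assume "E \<in> sets (distr M M (\<lambda>P. (*v) A ` P))"
 then have E: "E \<in> sets M" by simp
 have At: "orthogonal_matrix (transpose A)" using A by (simp add: orthogonal_matrix_transpose)
 have "(\<lambda>P. (*v) A ` P) -` E \<inter> space M = (\<lambda>P. (*v) (transpose A) ` P) ` E"
 proof (intro equalityI subsetI)
  fix P assume "P \<in> (\<lambda>P. (*v) A ` P) -` E \<inter> space M"
  then show "P \<in> (\<lambda>P. (*v) (transpose A) ` P) ` E"
   by (intro image_eqI[of _ _ "(*v) A ` P"]) (auto simp: image_image orthogonal_matrix_inverse[OF A])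
 next
  fix P assume "P \<in> (\<lambda>P. (*v) (transpose A) ` P) ` E"
  then obtain Q where Q: "Q \<in> E" "P = (*v) (transpose A) ` Q" by auto
  then have "(*v) A ` P = Q" by (simp add: image_image orthogonal_matrix_inverse[OF A])
  then show "P \<in> (\<lambda>P. (*v) A ` P) -` E \<inter> space M"
   using Q image_in_space[OF At] sets.sets_into_space[OF E] by auto
 qed
 then have "emeasure (distr M M (\<lambda>P. (*v) A ` P)) E = emeasure M ((\<lambda>P. (*v) (transpose A) ` P) ` E)"
  using measurable_image[OF A] E by (simp add: emeasure_distr)
 also have "\<dots> = emeasure M E"
  using invariant E orthogonal_matrix_imp_transformation[OF At] by (auto simp: invariant_grassmann_measure_def)
 finally show "emeasure (distr M M (\<lambda>P. (*v) A ` P)) E = emeasure M E" .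
qed simp

lemma nn_integral_taut_image:
 assumes A: "orthogonal_matrix A" and [measurable]: "F \<in> borel_measurable (M \<Otimes>\<^sub>M borel)"
 shows "(\<integral>\<^sup>+p. F ((*v) A ` fst p, A *v snd p) \<partial>taut) = (\<integral>\<^sup>+p. F p \<partial>taut)"
proof -
 note [measurable] = measurable_image[OF A] measurable_nn_integral_subspace[OF assms(2)]
 have "(\<integral>\<^sup>+p. F ((*v) A ` fst p, A *v snd p) \<partial>taut) =
   (\<integral>\<^sup>+P. \<integral>\<^sup>+x. F ((*v) A ` P, A *v x) \<partial>subspace_lborel P \<partial>M)"
  by (subst nn_integral_taut) auto
 also have "\<dots> = (\<integral>\<^sup>+P. \<integral>\<^sup>+x. F ((*v) A ` P, x) \<partial>subspace_lborel ((*v) A ` P) \<partial>M)"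
  by (intro nn_integral_cong nn_integral_subspace_lborel_image[symmetric] orthogonal_matrix_imp_transformation A subspace_M)
   (auto intro!: measurable_compose[OF _ assms(2)] measurable_Pair measurable_const image_in_space[OF A])
 also have "\<dots> = (\<integral>\<^sup>+P. \<integral>\<^sup>+x. F (P, x) \<partial>subspace_lborel P \<partial>distr M M (\<lambda>P. (*v) A ` P))"
  by (subst nn_integral_distr) auto
 also have "\<dots> = (\<integral>\<^sup>+p. F p \<partial>taut)"
  by (simp add: distr_image[OF A] nn_integral_taut)
 finally show ?thesis .
qed

end

section \<open>An invariant probability measure on the orthogonal group\<close>

text \<open>
 Gram--Schmidt on the rows commutes with right multiplication by orthogonal matrices. Applied
 to a random matrix whose law is invariant under such multiplications (the uniform distribution
 on the invertible matrices in the unit ball), it therefore produces a random orthogonal matrix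
 with right-invariant law.
\<close>

declare sum.cong [fundef_cong]

lemma card_lessThan_less:
 assumes "j < (i::'n::{finite,linorder})"
 shows "card {..<j} < card {..<i}"
proof (rule psubset_card_mono)
 show "{..<j} \<subset> {..<i}" using assms by auto
qed simp

function gram_schmidt :: "('n::{finite,linorder} rvec, 'n) vec \<Rightarrow> 'n \<Rightarrow> 'n rvec" where
 "gram_schmidt W i =
  (W $ i - (\<Sum>j\<in>{..<i}. (W $ i \<bullet> gram_schmidt W j) *\<^sub>R gram_schmidt W j))
   /\<^sub>R norm (W $ i - (\<Sum>j\<in>{..<i}. (W $ i \<bullet> gram_schmidt W j) *\<^sub>R gram_schmidt W j))"
 by auto
termination
 by (relation "Wellfounded.measure (\<lambda>(W, i). card {..<i})") (auto simp: card_lessThan_less)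

declare gram_schmidt.simps [simp del]

lemma gram_schmidt_induct [case_names less]:
 fixes i :: "'n::{finite,linorder}"
 assumes "\<And>i. (\<And>j. j < i \<Longrightarrow> P j) \<Longrightarrow> P i"
 shows "P i"
proof (induction "card {..<i}" arbitrary: i rule: less_induct)
 case less
 show ?case
 proof (rule assms)
  fix j assume "j < i"
  then show "P j" by (intro less card_lessThan_less)
 qed
qed

lemma borel_measurable_gram_schmidt [measurable]:
 "(\<lambda>W. gram_schmidt W i) \<in> borel_measurable borel"
proof (induction i rule: gram_schmidt_induct)
 case (less i)
 note [measurable] = less
 have [measurable]: "(\<lambda>W. \<Sum>j\<in>{..<i}. (W $ i \<bullet> gram_schmidt W j) *\<^sub>R gram_schmidt W j) \<in> borel_measurable borel"
  by (intro borel_measurable_sum borel_measurable_scaleR borel_measurable_inner less) auto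
 show ?case unfolding gram_schmidt.simps[of _ i] by measurable
qed

lemma row_mult_orthogonal: "(W ** h) $ i = transpose h *v (W $ i :: 'n::{finite,linorder} rvec)"
 by (simp add: vec_eq_iff matrix_matrix_mult_def matrix_vector_mult_def transpose_def mult.commute)

lemma gram_schmidt_equivariant:
 assumes h: "orthogonal_matrix h"
 shows "gram_schmidt (W ** h) i = transpose h *v gram_schmidt W i"
proof (induction i rule: gram_schmidt_induct)
 case (less i)
 have T: "orthogonal_transformation ((*v) (transpose h))"
  using h by (intro orthogonal_matrix_imp_transformation) (simp add: orthogonal_matrix_transpose)
 have lin: "linear ((*v) (transpose h))" by simp
 have ip: "(transpose h *v x) \<bullet> (transpose h *v y) = x \<bullet> y" for x y
  using T by (simp add: orthogonal_transformation_def)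
 let ?r = "\<lambda>W. W $ i - (\<Sum>j\<in>{..<i}. (W $ i \<bullet> gram_schmidt W j) *\<^sub>R gram_schmidt W j)"
 have "?r (W ** h) = transpose h *v ?r W"
  by (simp add: row_mult_orthogonal less ip linear_diff[OF lin] linear_sum[OF lin] linear_scale[OF lin])
 then show ?case
  unfolding gram_schmidt.simps[of _ i]
  by (simp add: orthogonal_transformation_norm[OF T] linear_scale[OF lin])
qed

lemma gram_schmidt_orthonormal:
 assumes W: "det W \<noteq> 0"
 shows "norm (gram_schmidt W i) = 1 \<and> (\<forall>j<i. gram_schmidt W i \<bullet> gram_schmidt W j = 0) \<and>
  gram_schmidt W i \<in> span ((\<lambda>j. W $ j) ` {..i})"
proof (induction i rule: gram_schmidt_induct)
 case (less i)
 let ?u = "gram_schmidt W"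
 let ?s = "\<Sum>j\<in>{..<i}. (W $ i \<bullet> ?u j) *\<^sub>R ?u j"
 let ?r = "W $ i - ?s"
 have uu: "?u j \<bullet> ?u l = (if j = l then 1 else 0)" if "j < i" "l < i" for j l
  using less[OF that(1)] less[OF that(2)]
  by (cases j l rule: linorder_cases) (auto simp: norm_eq_1 inner_commute)
 have sp: "?u j \<in> span ((\<lambda>j. W $ j) ` {..<i})" if "j < i" for j
 proof -
  have "{..j} \<subseteq> {..<i}" using that by auto
  from span_mono[OF image_mono[OF this]] show ?thesis using less[OF that] by blast
 qed
 then have ssp: "?s \<in> span ((\<lambda>j. W $ j) ` {..<i})"
  by (intro span_sum span_scale) auto
 have "?r \<noteq> 0"
 proof
  assume "?r = 0"
  then have "W $ i \<in> span ((\<lambda>j. W $ j) ` {..<i})" using ssp by simp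
  moreover have "(\<lambda>j. W $ j) ` {..<i} \<subseteq> {row j W | j. j \<noteq> i}" by (auto simp: row_def)
  ultimately have "- row i W \<in> span {row j W | j. j \<noteq> i}"
   using span_mono[OF \<open>_ \<subseteq> {row j W | j. j \<noteq> i}\<close>] by (auto simp: row_def intro!: span_neg)
  then have "- row i W \<in> vec.span {row j W | j. j \<noteq> i}" by (simp add: span_vec_eq)
  from det_row_span[OF this] have "det (\<chi> k. if k = i then row i W + - row i W else row k W) = det W" .
  moreover have "(\<chi> k. if k = i then row i W + - row i W else row k W) = (\<chi> k. if k = i then 0 else row k W)"
   by (simp add: vec_eq_iff)
  ultimately have "det (\<chi> k. if k = i then 0 else row k W) = det W" by metis
  moreover have "det (\<chi> k. if k = i then 0 else row k W) = 0"
   by (rule det_zero_row(1)[of i]) (simp add: row_def vec_eq_iff)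
  ultimately show False using W by simp
 qed
 moreover have ui: "?u i = ?r /\<^sub>R norm ?r" by (rule gram_schmidt.simps)
 ultimately have n: "norm (?u i) = 1" by simp
 have "?r \<bullet> ?u j = 0" if "j < i" for j
 proof -
  have "?s \<bullet> ?u j = (\<Sum>l\<in>{..<i}. if l = j then W $ i \<bullet> ?u l else 0)"
   unfolding inner_sum_left by (rule sum.cong) (use that in \<open>auto simp: uu\<close>)
  then show ?thesis using that by (simp add: inner_diff_left)
 qed
 then have o: "\<forall>j<i. ?u i \<bullet> ?u j = 0" by (simp add: ui)
 have "?r \<in> span ((\<lambda>j. W $ j) ` {..i})"
 proof (rule span_diff)
  have "{..<i} \<subseteq> {..i}" by auto
  from span_mono[OF image_mono[OF this]] show "?s \<in> span ((\<lambda>j. W $ j) ` {..i})" using ssp by blast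
 qed (auto intro: span_base)
 then have "?u i \<in> span ((\<lambda>j. W $ j) ` {..i})" unfolding ui by (rule span_scale)
 with n o show ?case by simp
qed

definition orthogonalize :: "('n::{finite,linorder} rvec, 'n) vec \<Rightarrow> ('n rvec, 'n) vec" where
 "orthogonalize W = (\<chi> i. gram_schmidt W i)"

lemma orthogonal_matrix_orthogonalize:
 assumes "det W \<noteq> 0"
 shows "orthogonal_matrix (orthogonalize W)"
proof -
 have "gram_schmidt W i \<bullet> gram_schmidt W j = 0" if "i \<noteq> j" for i j
  using that gram_schmidt_orthonormal[OF assms, of i] gram_schmidt_orthonormal[OF assms, of j]
  by (cases i j rule: linorder_cases) (auto simp: inner_commute)
 then show ?thesis
  using gram_schmidt_orthonormal[OF assms]
  by (auto simp: orthogonal_matrix_orthonormal_rows orthogonalize_def row_def orthogonal_def)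
qed

lemma orthogonalize_equivariant:
 assumes "orthogonal_matrix h"
 shows "orthogonalize (W ** h) = orthogonalize W ** h"
proof -
 have "orthogonalize (W ** h) $ i = (orthogonalize W ** h) $ i" for i
  by (simp add: row_mult_orthogonal) (simp add: orthogonalize_def gram_schmidt_equivariant[OF assms])
 then show ?thesis by (simp add: vec_eq_iff)
qed

lemma borel_measurable_orthogonalize [measurable]: "orthogonalize \<in> borel_measurable borel"
 by (subst borel_measurable_vec_nth_iff) (simp add: orthogonalize_def)

definition matrix_ball :: "(('n::{finite,linorder} rvec, 'n) vec) set" where
 "matrix_ball = {W. norm W < 1 \<and> det W \<noteq> 0}"

lemma open_matrix_ball: "open matrix_ball"
proof -
 have "continuous_on UNIV (det :: ('n::{finite,linorder} rvec, 'n::{finite,linorder}) vec \<Rightarrow> real)"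
  unfolding det_def by (intro continuous_intros)
 then have "open {W :: ('n::{finite,linorder} rvec, 'n::{finite,linorder}) vec. det W \<noteq> 0}"
  by (intro open_Collect_neq continuous_on_const)
 moreover have "open {W :: ('n::{finite,linorder} rvec, 'n::{finite,linorder}) vec. norm W < 1}"
  by (intro open_Collect_less continuous_intros)
 ultimately show ?thesis unfolding matrix_ball_def Collect_conj_eq by (rule open_Int[rotated])
qed

lemma sets_matrix_ball [measurable]: "matrix_ball \<in> sets borel"
 by (simp add: open_matrix_ball borel_open)

lemma emeasure_matrix_ball:
 "emeasure lborel (matrix_ball :: (('n::{finite,linorder} rvec, 'n) vec) set) \<noteq> 0"
 "emeasure lborel (matrix_ball :: (('n rvec, 'n) vec) set) \<noteq> \<infinity>"
proof -
 let ?I = "mat 1 :: ('n rvec, 'n) vec"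
 define c where "c = 1 / (2 * norm ?I)"
 have "?I \<noteq> 0" by (simp add: vec_eq_iff mat_def)
 then have c: "c > 0" "norm (c *\<^sub>R ?I) < 1" by (auto simp: c_def)
 have "c *\<^sub>R ?I = (\<chi> i. c *s (?I $ i))" by (simp add: vec_eq_iff)
 then have "det (c *\<^sub>R ?I) = (\<Prod>i::'n\<in>UNIV. c) * det (\<chi> i. ?I $ i)"
  by (simp only: det_rows_mul)
 then have "det (c *\<^sub>R ?I) \<noteq> 0" using c by simp
 then have "c *\<^sub>R ?I \<in> matrix_ball" using c by (simp add: matrix_ball_def)
 then obtain e where e: "e > 0" "cball (c *\<^sub>R ?I) e \<subseteq> matrix_ball"
  using open_matrix_ball open_contains_cball by blast
 have "emeasure lborel (cball (c *\<^sub>R ?I) e) \<noteq> 0"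
  using e(1) unit_ball_vol_pos[of "real DIM(('n rvec, 'n) vec)"] by (simp add: emeasure_cball del: unit_ball_vol_pos)
 then show "emeasure lborel (matrix_ball :: (('n rvec, 'n) vec) set) \<noteq> 0"
  using emeasure_mono[OF e(2), of lborel] sets_matrix_ball by auto
 have "emeasure lborel (matrix_ball :: (('n rvec, 'n) vec) set) \<le> emeasure lborel (cball (0 :: ('n rvec, 'n) vec) 1)"
  by (intro emeasure_mono) (auto simp: matrix_ball_def)
 also have "\<dots> < \<infinity>" by (rule emeasure_lborel_cball_finite)
 finally show "emeasure lborel (matrix_ball :: (('n rvec, 'n) vec) set) \<noteq> \<infinity>" by simp
qed

lemma orthogonal_transformation_mult:
 assumes h: "orthogonal_matrix h"
 shows "orthogonal_transformation (\<lambda>W :: ('n::{finite,linorder} rvec, 'n) vec. W ** h)"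
proof -
 have T: "orthogonal_transformation ((*v) (transpose h))"
  using h by (intro orthogonal_matrix_imp_transformation) (simp add: orthogonal_matrix_transpose)
 have "linear (\<lambda>W :: ('n rvec, 'n) vec. W ** h)"
  by (rule linearI) (simp_all add: vec_eq_iff matrix_matrix_mult_def sum.distrib algebra_simps sum_distrib_left)
 moreover have "(V ** h) \<bullet> (W ** h) = V \<bullet> W" for V W :: "('n rvec, 'n) vec"
  using T by (simp add: inner_vec_def[of "_ ** _"] row_mult_orthogonal orthogonal_transformation_def)
   (simp add: inner_vec_def[of V])
 ultimately show ?thesis by (simp add: orthogonal_transformation_def)
qed

definition haar :: "(('n::{finite,linorder} rvec, 'n) vec) measure" where
 "haar = distr (uniform_measure lborel matrix_ball) borel orthogonalize"

lemma sets_haar [simp, measurable_cong]: "sets haar = sets borel"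
 by (simp add: haar_def)

lemma space_haar [simp]: "space haar = UNIV"
 by (simp add: haar_def)

lemma prob_space_haar: "prob_space haar"
 unfolding haar_def
 by (intro prob_space.prob_space_distr prob_space_uniform_measure)
  (auto simp: emeasure_matrix_ball emeasure_matrix_ball[simplified])

lemma AE_haar: "AE g in haar. orthogonal_matrix g"
proof -
 have c: "closed {g :: ('n::{finite,linorder} rvec, 'n::{finite,linorder}) vec. orthogonal_matrix g}"
  unfolding orthogonal_matrix_def
  by (intro closed_Collect_conj closed_Collect_eq)
   (auto simp: matrix_matrix_mult_def transpose_def intro!: continuous_intros)
 have "AE W in uniform_measure lborel matrix_ball. orthogonal_matrix (orthogonalize W)"
  by (rule AE_uniform_measureI) (simp, simp add: matrix_ball_def orthogonal_matrix_orthogonalize)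
 then show ?thesis
  unfolding haar_def using borel_closed[OF c] by (subst AE_distr_iff) simp_all
qed

lemma borel_measurable_mult_right [measurable]:
 "(\<lambda>g. g ** (h :: ('n::{finite,linorder} rvec, 'n) vec)) \<in> borel_measurable (borel :: (('n rvec, 'n) vec) measure)"
 by (subst borel_measurable_vec_nth_iff, rule allI, subst borel_measurable_vec_nth_iff)
  (simp add: matrix_matrix_mult_def)

lemma distr_haar_mult:
 assumes h: "orthogonal_matrix (h :: ('n::{finite,linorder} rvec, 'n) vec)"
 shows "distr haar borel (\<lambda>g. g ** h) = haar"
proof (rule measure_eqI)
 fix A :: "(('n rvec, 'n) vec) set" assume "A \<in> sets (distr haar borel (\<lambda>g. g ** h))"
 then have [measurable]: "A \<in> sets borel" by simp
 have "det (W ** h) \<noteq> 0 \<longleftrightarrow> det W \<noteq> 0" for W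
  using det_orthogonal_matrix[OF h] by (auto simp: det_mul)
 then have D: "W ** h \<in> matrix_ball \<longleftrightarrow> W \<in> matrix_ball" for W
  by (simp add: matrix_ball_def orthogonal_transformation_norm[OF orthogonal_transformation_mult[OF h]])
 have "emeasure (distr haar borel (\<lambda>g. g ** h)) A = (\<integral>\<^sup>+g. indicator A (g ** h) \<partial>haar)"
  by (subst nn_integral_indicator[symmetric]) (auto simp: nn_integral_distr simp del: nn_integral_indicator)
 also have "\<dots> = (\<integral>\<^sup>+W. indicator A (orthogonalize W ** h) * indicator matrix_ball W \<partial>lborel) / emeasure lborel (matrix_ball :: (('n rvec, 'n) vec) set)"
  unfolding haar_def by (subst nn_integral_distr, measurable, subst nn_integral_uniform_measure) auto
 also have "(\<integral>\<^sup>+W. indicator A (orthogonalize W ** h) * indicator matrix_ball W \<partial>lborel) =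
  (\<integral>\<^sup>+W. indicator A (orthogonalize (W ** h)) * indicator matrix_ball (W ** h) \<partial>lborel)"
  by (intro nn_integral_cong) (simp add: orthogonalize_equivariant[OF h] indicator_def D)
 also have "\<dots> = (\<integral>\<^sup>+W. indicator A (orthogonalize W) * indicator matrix_ball W \<partial>lborel)"
  by (rule nn_integral_lborel_orthogonal[OF orthogonal_transformation_mult[OF h]]) measurable
 also have "\<dots> / emeasure lborel (matrix_ball :: (('n rvec, 'n) vec) set) = (\<integral>\<^sup>+g. indicator A g \<partial>haar)"
  unfolding haar_def by (subst nn_integral_distr, measurable, subst nn_integral_uniform_measure) auto
 finally show "emeasure (distr haar borel (\<lambda>g. g ** h)) A = emeasure haar A" by simp
qed simp

section \<open>Adapted frames\<close>

definition coord_subspace :: "'n set \<Rightarrow> (real ^ 'n) set" where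
 "coord_subspace I = {x. \<forall>i. i \<notin> I \<longrightarrow> x $ i = 0}"

lemma subspace_coord: "subspace (coord_subspace I)"
 by (auto simp: subspace_def coord_subspace_def)

lemma orth_proj_coord: "orth_proj (coord_subspace I) x = (\<chi> i. if i \<in> I then x $ i else 0)"
 by (rule orth_proj_eqI[OF subspace_coord])
  (auto simp: coord_subspace_def orthogonal_def inner_vec_def intro!: sum.neutral)

lemma ext_map_coord_axis:
 fixes S :: "'n::{finite,linorder} set"
 assumes "card S = m"
 shows "ext_map m (orth_proj (coord_subspace I)) (axis S 1) = (if S \<subseteq> I then axis S 1 else 0)"
proof -
 have p: "orth_proj (coord_subspace I) (axis i 1) = (if i \<in> I then axis i 1 else 0)" for i :: 'n
  by (auto simp: orth_proj_coord vec_eq_iff axis_def)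
 show ?thesis
 proof (cases "S \<subseteq> I")
  case True
  have "sorted_list_of_set S ! i \<in> I" if "i < m" for i
   using nth_sorted_bij[OF assms] that True by (auto simp: bij_betw_def)
  then have "wedge m (\<lambda>i. orth_proj (coord_subspace I) (axis (sorted_list_of_set S ! i) 1)) =
    wedge m (\<lambda>i. axis (sorted_list_of_set S ! i) 1)"
   by (intro wedge_cong) (simp add: p)
  then show ?thesis using True by (simp add: ext_map_axis assms wedge_axis)
 next
  case False
  then obtain j where j: "j \<in> S" "j \<notin> I" by auto
  then have "j \<in> nth (sorted_list_of_set S) ` {..<m}"
   using nth_sorted_bij[OF assms] by (simp add: bij_betw_def)
  then obtain i where "i < m" "sorted_list_of_set S ! i = j" by auto
  then have "wedge m (\<lambda>i. orth_proj (coord_subspace I) (axis (sorted_list_of_set S ! i) 1)) = 0"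
   using j by (intro wedge_zero[of i]) (auto simp: p)
  then show ?thesis using False by (simp add: ext_map_axis assms)
 qed
qed

text \<open>An orthogonal matrix \<open>h\<close> carrying the standard pair \<open>(span(e\<^sub>i: i \<in> I), e\<^bsub>i0\<^esub>)\<close> to \<open>(P, \<xi>/|\<xi>|)\<close>.\<close>

definition adapted_frame ::
  "'n set \<Rightarrow> 'n \<Rightarrow> (real ^ 'n) set \<Rightarrow> real ^ 'n \<Rightarrow> real ^ 'n ^ 'n \<Rightarrow> bool" where
 "adapted_frame I i0 P \<xi> h \<longleftrightarrow>
  orthogonal_matrix h \<and> P = (*v) h ` coord_subspace I \<and> \<xi> = norm \<xi> *\<^sub>R (h *v axis i0 1)"

lemma adapted_frame_exists:
 fixes P :: "(real ^ 'n) set"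
 assumes P: "subspace P" and I: "card I = dim P" "i0 \<in> I" and \<xi>: "\<xi> \<in> P" "\<xi> \<noteq> 0"
 shows "\<exists>h. adapted_frame I i0 P \<xi> h"
proof -
 define u where "u = \<xi> /\<^sub>R norm \<xi>"
 have u: "u \<in> P" "norm u = 1" "\<xi> = norm \<xi> *\<^sub>R u" using \<xi> P by (auto simp: u_def subspace_scale)
 have uu: "u \<bullet> u = 1" using u(2) by (simp add: norm_eq_1)
 define Q where "Q = P \<inter> {x. orthogonal u x}"
 have Q: "subspace Q" unfolding Q_def by (intro subspace_inter P subspace_orthogonal_to_vector) 
 obtain C where C: "orthonormal_basis_of Q C" using orthonormal_basis_of_exists[OF Q] by blast
 obtain D where D: "orthonormal_basis_of (orthogonal_comp P) D"
  using orthonormal_basis_of_exists[OF subspace_orthogonal_comp] by blast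
 note C' = orthonormal_basis_of_facts[OF C] and D' = orthonormal_basis_of_facts[OF D]
 have uC: "u \<notin> C" using C'(3) uu by (auto simp: Q_def orthogonal_def)
 have "P \<subseteq> span (insert u C)"
 proof
  fix x assume x: "x \<in> P"
  have "x - (x \<bullet> u) *\<^sub>R u \<in> Q"
   using x u(1) P uu by (auto simp: Q_def subspace_diff subspace_scale orthogonal_def inner_diff_right inner_commute)
  then have "x - (x \<bullet> u) *\<^sub>R u \<in> span (insert u C)"
   using C'(4) span_mono[of C "insert u C"] by auto
  then have "x - (x \<bullet> u) *\<^sub>R u + (x \<bullet> u) *\<^sub>R u \<in> span (insert u C)"
   by (intro span_add span_scale) (auto intro: span_base)
  then show "x \<in> span (insert u C)" by simp
 qed
 moreover have "insert u C \<subseteq> P" using u C'(3) by (auto simp: Q_def)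
 ultimately have B: "orthonormal_basis_of P (insert u C)"
  using C u P C'(3) span_minimal[of "insert u C" P]
  by (auto simp: orthonormal_basis_of_def pairwise_insert Q_def orthogonal_commute)
 note B' = orthonormal_basis_of_facts[OF B] and U = orthonormal_basis_of_union[OF B D]
 note U' = orthonormal_basis_of_facts[OF U(1)]
 have "card C = card (I - {i0})" using I B'(2) uC C'(1) by simp
 then obtain f1 where f1: "bij_betw f1 (I - {i0}) C"
  using finite_same_card_bij[of "I - {i0}" C] C'(1) by auto
 have "card D = CARD('n) - card I"
  using dim_orthogonal_comp[OF P] D'(2) I by simp
 then have "card (- I) = card D" by (simp add: Compl_eq_Diff_UNIV card_Diff_subset)
 then obtain f2 where f2: "bij_betw f2 (- I) D"
  using finite_same_card_bij[of "- I" D] D'(1) by auto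
 define h0 where "h0 i = (if i = i0 then u else if i \<in> I then f1 i else f2 i)" for i
 have im: "h0 i \<in> insert u C \<union> D" for i
  using bij_betwE[OF f1] bij_betwE[OF f2] by (auto simp: h0_def)
 have hI: "h0 ` I = insert u C"
  using I(2) f1 by (auto simp: h0_def bij_betw_def image_iff)
 have "inj h0"
 proof (rule injI)
  fix i j assume e: "h0 i = h0 j"
  have 1: "h0 i \<in> insert u C \<longleftrightarrow> i \<in> I" for i
   using bij_betwE[OF f1] bij_betwE[OF f2] U(2) I(2) by (auto simp: h0_def)
  have 2: "h0 i = u \<longleftrightarrow> i = i0" for i
   using bij_betwE[OF f1] bij_betwE[OF f2] U(2) I(2) uC by (auto simp: h0_def)
  have 3: "i \<in> I \<longleftrightarrow> j \<in> I" "i = i0 \<longleftrightarrow> j = i0"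
   using 1[of i] 1[of j] 2[of i] 2[of j] e by auto
  show "i = j"
   using 3 e f1 f2 by (auto simp: h0_def bij_betw_def inj_on_def split: if_splits)
 qed
 then have hh: "h0 i \<bullet> h0 j = (if i = j then 1 else 0)" for i j
  using U'(7)[OF im[of i] im[of j]] by (simp add: inj_eq)
 define H where "H = (\<chi> a i. h0 i $ a)"
 have col: "column i H = h0 i" for i by (simp add: H_def column_def)
 have Hax: "H *v axis i 1 = h0 i" for i by (simp add: matrix_vector_mult_basis col)
 have oH: "orthogonal_matrix H"
  unfolding orthogonal_matrix_orthonormal_columns using hh by (simp add: col norm_eq_1 orthogonal_def)
 have "P = (*v) H ` coord_subspace I"
 proof
  have "subspace ((*v) H ` coord_subspace I)"
   by (intro linear_subspace_image subspace_coord) simp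
  moreover have "insert u C \<subseteq> (*v) H ` coord_subspace I"
  proof
   fix b assume "b \<in> insert u C"
   then obtain i where "i \<in> I" "b = H *v axis i 1" using hI Hax by auto
   moreover have "axis i 1 \<in> coord_subspace I" using \<open>i \<in> I\<close> by (auto simp: coord_subspace_def axis_def)
   ultimately show "b \<in> (*v) H ` coord_subspace I" by blast
  qed
  ultimately show "P \<subseteq> (*v) H ` coord_subspace I" using B'(4) span_minimal by blast
  show "(*v) H ` coord_subspace I \<subseteq> P"
  proof
   fix y assume "y \<in> (*v) H ` coord_subspace I"
   then obtain x where x: "x \<in> coord_subspace I" "y = H *v x" by auto
   have "y = (\<Sum>j\<in>UNIV. x $ j *\<^sub>R h0 j)"
    using linear_axis_sum[OF matrix_vector_mul_linear[of H], of x] by (simp add: x Hax)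
   moreover have "x $ j *\<^sub>R h0 j \<in> P" for j
    using x hI B'(3) P by (cases "j \<in> I") (auto simp: coord_subspace_def subspace_0 intro!: subspace_scale)
   ultimately show "y \<in> P" using P by (simp add: subspace_sum)
  qed
 qed
 moreover have "H *v axis i0 1 = u" by (simp add: Hax h0_def)
 ultimately show ?thesis unfolding adapted_frame_def using oH u(3) by metis
qed

lemma adapted_frame_mult:
 fixes P :: "(real ^ 'n) set"
 assumes "adapted_frame I i0 P \<xi> h" "orthogonal_matrix g"
 shows "adapted_frame I i0 ((*v) g ` P) (g *v \<xi>) (g ** h)"
proof -
 have n: "norm (g *v \<xi>) = norm \<xi>"
  using orthogonal_transformation_norm[OF orthogonal_matrix_imp_transformation[OF assms(2)]] .
 have P: "P = (*v) h ` coord_subspace I" and \<xi>: "\<xi> = norm \<xi> *\<^sub>R (h *v axis i0 1)" and h: "orthogonal_matrix h"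
  using assms(1) by (auto simp: adapted_frame_def)
 have "g *v \<xi> = norm \<xi> *\<^sub>R (g *v (h *v axis i0 1))"
  by (subst \<xi>) (simp add: matrix_vector_mult_scaleR)
 then show ?thesis
  unfolding adapted_frame_def n
  using orthogonal_matrix_mul[OF assms(2) h]
  by (simp add: P image_image matrix_vector_mul_assoc)
qed

lemma orthogonal_complement_frame:
 fixes P :: "(real ^ 'n) set"
 assumes "adapted_frame I i0 P \<xi> h" "\<xi> \<noteq> 0"
 shows "{x. orthogonal \<xi> x} = (*v) h ` coord_subspace (- {i0})"
proof -
 have h: "orthogonal_matrix h" and \<xi>: "\<xi> = norm \<xi> *\<^sub>R (h *v axis i0 1)"
  using assms(1) by (auto simp: adapted_frame_def)
 have T: "(h *v x) \<bullet> (h *v y) = x \<bullet> y" for x y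
  using orthogonal_matrix_imp_transformation[OF h] by (simp add: orthogonal_transformation_def)
 have o: "orthogonal \<xi> (h *v y) \<longleftrightarrow> y $ i0 = 0" for y
  using assms(2) by (subst \<xi>) (simp add: orthogonal_def T inner_axis')
 show ?thesis
 proof (intro equalityI subsetI)
  fix x assume "x \<in> {x. orthogonal \<xi> x}"
  moreover have "x = h *v (transpose h *v x)" by (simp add: orthogonal_matrix_inverse[OF h])
  ultimately show "x \<in> (*v) h ` coord_subspace (- {i0})"
   using o[of "transpose h *v x"] by (intro image_eqI[of _ _ "transpose h *v x"]) (simp_all add: coord_subspace_def)
 qed (auto simp: o coord_subspace_def)
qed

lemma matrix_adjoint: "(A *v x) \<bullet> y = x \<bullet> (transpose A *v (y :: real ^ 'n))"
 by (simp add: dot_lmul_matrix[symmetric] inner_commute transpose_matrix_vector)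

lemma ext_map_orth_proj_frame:
 fixes h :: "('n::{finite,linorder} rvec, 'n) vec"
 assumes h: "orthogonal_matrix h" and V: "subspace V"
 shows "ext_map m (orth_proj ((*v) h ` V)) v =
  ext_map m ((*v) h) (ext_map m (orth_proj V) (ext_map m ((*v) (transpose h)) v))"
proof -
 have "orth_proj ((*v) h ` V) = (*v) h \<circ> (orth_proj V \<circ> (*v) (transpose h))"
  by (rule ext) (simp add: orth_proj_matrix_image[OF h V])
 then show ?thesis
  by (simp add: ext_map_compose orth_proj_linear[OF V] linear_compose)
qed

lemma ext_map_frame_entry:
 fixes h :: "('n::{finite,linorder} rvec, 'n) vec"
 assumes h: "orthogonal_matrix h"
 shows "ext_map m (orth_proj ((*v) h ` coord_subspace I)) (axis T' 1) $ T =
  (\<Sum>S | card S = m. of_bool (S \<subseteq> I) * (ext_map m ((*v) h) (axis S 1) $ T * ext_map m ((*v) h) (axis S 1) $ T'))"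
proof -
 let ?L = "ext_map m ((*v) h)" and ?p = "ext_map m (orth_proj (coord_subspace I))"
 let ?w = "ext_map m ((*v) (transpose h)) (axis T' 1)"
 have w: "?w $ S = ?L (axis S 1) $ T'" for S
  by (rule ext_map_nth_axis_adjoint) (simp add: matrix_adjoint transpose_transpose)
 have lin: "linear (\<lambda>v. ?L (?p v))"
  using linear_compose[OF ext_map_linear ext_map_linear, of m _ m] by (simp add: o_def)
 have "ext_map m (orth_proj ((*v) h ` coord_subspace I)) (axis T' 1) $ T = ?L (?p ?w) $ T"
  by (simp add: ext_map_orth_proj_frame[OF h subspace_coord])
 also have "\<dots> = (\<Sum>S\<in>UNIV. ?w $ S * ?L (?p (axis S 1)) $ T)"
  by (rule linear_axis_expansion[OF lin])
 also have "\<dots> = (\<Sum>S | card S = m. ?w $ S * ?L (?p (axis S 1)) $ T)"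
  by (rule sum.mono_neutral_right) (auto simp: ext_map_axis_0 linear_0[OF ext_map_linear])
 also have "\<dots> = (\<Sum>S | card S = m. of_bool (S \<subseteq> I) * (?L (axis S 1) $ T * ?L (axis S 1) $ T'))"
  by (intro sum.cong refl) (auto simp: w ext_map_coord_axis linear_0[OF ext_map_linear])
 finally show ?thesis .
qed

section \<open>The average of the restriction operator\<close>

text \<open>
 The conditional expectation, given \<open>\<xi> \<in> P\<close>, of the projection onto \<open>\<Lambda>\<^sup>m(P)\<close>. It commutes with
 the stabiliser of \<open>\<xi>\<close>, hence acts as a scalar on each of the two summands \<open>\<Lambda>\<^sup>m(H\<^sub>\<xi>)\<close> and
 \<open>\<xi> \<and> \<Lambda>\<^bsup>m-1\<^esup>(H\<^sub>\<xi>)\<close>; the scalars are ratios of dimensions.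
\<close>

definition mean_coeff :: "nat \<Rightarrow> nat \<Rightarrow> nat \<Rightarrow> real" where
 "mean_coeff n k m = real (k choose m) / (real k * real ((n - 1) choose m))"

definition mean_restrict ::
  "nat \<Rightarrow> nat \<Rightarrow> 'n::{finite,linorder} rvec \<Rightarrow> 'n rform \<Rightarrow> 'n rform" where
 "mean_restrict k m \<xi> v = mean_coeff CARD('n) k m *\<^sub>R
  ((real k - real m) *\<^sub>R Pi_proj m \<xi> v + (real CARD('n) - real m) *\<^sub>R Psi_proj m \<xi> v)"

text \<open>
 In an adapted frame the projection onto \<open>\<Lambda>\<^sup>m(P)\<close> and \<open>mean_restrict\<close> are both diagonal; this is the
 difference of their diagonal entries.
\<close>

definition defect_coeff :: "nat \<Rightarrow> nat \<Rightarrow> 'n::finite set \<Rightarrow> 'n \<Rightarrow> 'n set \<Rightarrow> real" where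
 "defect_coeff k m I i0 S = of_bool (S \<subseteq> I) -
  mean_coeff CARD('n) k m * (if i0 \<in> S then real CARD('n) - real m else real k - real m)"

lemma restrict_defect_frame:
 fixes P :: "('n::{finite,linorder} rvec) set"
 assumes fr: "adapted_frame I i0 P \<xi> h" and \<xi>: "\<xi> \<noteq> 0" and T: "card T' = m"
 shows "ext_map m (orth_proj P) (axis T' 1) $ T - mean_restrict k m \<xi> (axis T' 1) $ T =
  (\<Sum>S | card S = m. defect_coeff k m I i0 S *
   (ext_map m ((*v) h) (axis S 1) $ T * ext_map m ((*v) h) (axis S 1) $ T'))"
proof -
 have h: "orthogonal_matrix h" and P: "P = (*v) h ` coord_subspace I"
  using fr by (auto simp: adapted_frame_def)
 let ?c = "\<lambda>S. ext_map m ((*v) h) (axis S 1) $ T * ext_map m ((*v) h) (axis S 1) $ T'"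
 let ?n = "real CARD('n)" and ?a = "mean_coeff CARD('n) k m"
 have 1: "Pi_proj m \<xi> (axis T' 1) $ T = (\<Sum>S | card S = m. of_bool (S \<subseteq> - {i0}) * ?c S)"
  unfolding Pi_proj_eq orthogonal_complement_frame[OF fr \<xi>] by (rule ext_map_frame_entry[OF h])
 have cU: "(*v) h ` coord_subspace (UNIV :: 'n set) = UNIV"
  using orthogonal_matrix_inverse(1)[OF h] by (auto simp: coord_subspace_def image_iff) metis
 have "axis T' (1::real) = ext_map m (\<lambda>x. x) (axis T' 1)"
  by (rule ext_map_id[symmetric]) (use T in \<open>auto simp: axis_def\<close>)
 also have "(\<lambda>x. x) = orth_proj ((*v) h ` coord_subspace (UNIV :: 'n set))"
  unfolding cU by (rule ext, rule orth_proj_id[symmetric]) auto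
 finally have 2: "axis T' (1::real) $ T = (\<Sum>S | card S = m. of_bool (S \<subseteq> UNIV) * ?c S)"
  using ext_map_frame_entry[OF h, of m UNIV T' T] by simp
 have "ext_map m (orth_proj P) (axis T' 1) $ T - mean_restrict k m \<xi> (axis T' 1) $ T =
  (\<Sum>S | card S = m. of_bool (S \<subseteq> I) * ?c S) - ?a * ((real k - real m) * (\<Sum>S | card S = m. of_bool (S \<subseteq> - {i0}) * ?c S)
   + (?n - real m) * ((\<Sum>S | card S = m. of_bool (S \<subseteq> UNIV) * ?c S) - (\<Sum>S | card S = m. of_bool (S \<subseteq> - {i0}) * ?c S)))"
  unfolding P ext_map_frame_entry[OF h, of m I T' T] mean_restrict_def Psi_proj_def by (simp add: 1 2)
 also have "\<dots> = (\<Sum>S | card S = m. of_bool (S \<subseteq> I) * ?c S - ?a * ((real k - real m) * (of_bool (S \<subseteq> - {i0}) * ?c S)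
   + (?n - real m) * (of_bool (S \<subseteq> UNIV) * ?c S - of_bool (S \<subseteq> - {i0}) * ?c S)))"
  by (simp only: sum_subtractf sum.distrib sum_distrib_left[symmetric])
 also have "\<dots> = (\<Sum>S | card S = m. defect_coeff k m I i0 S * ?c S)"
  by (intro sum.cong refl) (auto simp: defect_coeff_def algebra_simps)
 finally show ?thesis .
qed

text \<open>
 On each of the two summands the operators have the same trace. This fixes the scalars in
 \<open>mean_restrict\<close>.
\<close>

lemma sum_defect_coeff:
 fixes I :: "'n::finite set"
 assumes mk: "m < k" "k \<le> CARD('n)" and I: "card I = k" "i0 \<in> I"
 shows "(\<Sum>S | card S = m \<and> i0 \<notin> S. defect_coeff k m I i0 S) = 0"
  "(\<Sum>S | card S = m \<and> i0 \<in> S. defect_coeff k m I i0 S) = 0"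
proof -
 let ?n = "CARD('n)" and ?a = "mean_coeff CARD('n) k m"
 have c1: "card {S. card S = m \<and> i0 \<notin> S \<and> S \<subseteq> I} = (k - 1) choose m"
 proof -
  have "{S. card S = m \<and> i0 \<notin> S \<and> S \<subseteq> I} = {S. S \<subseteq> I - {i0} \<and> card S = m}" by auto
  then show ?thesis using n_subsets[of "I - {i0}" m] I by (simp only: card_Diff_singleton finite)
 qed
 have c2: "card {S::'n set. card S = m \<and> i0 \<notin> S} = (?n - 1) choose m"
 proof -
  have "{S::'n set. card S = m \<and> i0 \<notin> S} = {S. S \<subseteq> UNIV - {i0} \<and> card S = m}" by auto
  then show ?thesis using n_subsets[of "UNIV - {i0}" m] by (simp only: card_Diff_singleton finite UNIV_I)
 qed
 have c3: "card {S. card S = m \<and> S \<subseteq> I} = k choose m"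
  using n_subsets[of I m] I by (simp add: conj_ac)
 have c4: "card {S::'n set. card S = m} = ?n choose m"
  using n_subsets[of "UNIV::'n set" m] by simp
 have "real ((k - m) * (k choose m)) = real (k * ((k - 1) choose m))"
  by (simp only: binomial_absorb_comp)
 then have b1: "real k * real ((k - 1) choose m) = (real k - real m) * real (k choose m)"
  using mk by (simp add: of_nat_diff)
 have "real ((?n - m) * (?n choose m)) = real (?n * ((?n - 1) choose m))"
  by (simp only: binomial_absorb_comp)
 then have b2: "real ?n * real ((?n - 1) choose m) = (real ?n - real m) * real (?n choose m)"
  using mk by (simp add: of_nat_diff)
 have pos: "real k > 0" "real ((?n - 1) choose m) > 0" "real ?n > 0" using mk by auto
 have a: "?a * real ((?n - 1) choose m) = real (k choose m) / real k"
  using pos by (simp add: mean_coeff_def field_simps)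
 have i1: "(\<Sum>S | card S = m \<and> i0 \<notin> S. of_bool (S \<subseteq> I) :: real) = real ((k - 1) choose m)"
 proof -
  have "{S. card S = m \<and> i0 \<notin> S} \<inter> {S. S \<subseteq> I} = {S. card S = m \<and> i0 \<notin> S \<and> S \<subseteq> I}" by auto
  then show ?thesis by (subst sum_of_bool_eq) (simp_all only: c1 finite)
 qed
 have i3: "(\<Sum>S | card S = m. of_bool (S \<subseteq> I) :: real) = real (k choose m)"
  by (subst sum_of_bool_eq) (auto simp: Collect_conj_eq[symmetric] c3[symmetric] conj_ac Int_def)
 have split: "(\<Sum>S | card S = m. g S) = (\<Sum>S | card S = m \<and> i0 \<in> S. g S) + (\<Sum>S | card S = m \<and> i0 \<notin> S. g S)" for g :: "'n set \<Rightarrow> real"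
  by (subst sum.union_disjoint[symmetric]) (auto intro!: sum.cong)
 have i2: "(\<Sum>S | card S = m \<and> i0 \<in> S. of_bool (S \<subseteq> I) :: real) = real (k choose m) - real ((k - 1) choose m)"
  using split[of "\<lambda>S. of_bool (S \<subseteq> I)"] i1 i3 by simp
 have n2: "real (card {S::'n set. card S = m \<and> i0 \<in> S}) = real (?n choose m) - real ((?n - 1) choose m)"
  using split[of "\<lambda>S. 1"] c2 c4 by simp
 have "(\<Sum>S | card S = m \<and> i0 \<notin> S. defect_coeff k m I i0 S) =
  (\<Sum>S | card S = m \<and> i0 \<notin> S. of_bool (S \<subseteq> I) - ?a * (real k - real m))"
  by (intro sum.cong) (auto simp: defect_coeff_def)
 also have "\<dots> = real ((k - 1) choose m) - (?a * real ((?n - 1) choose m)) * (real k - real m)"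
  by (simp add: sum_subtractf i1 c2)
 also have "\<dots> = 0" unfolding a using b1 pos by (simp add: field_simps)
 finally show "(\<Sum>S | card S = m \<and> i0 \<notin> S. defect_coeff k m I i0 S) = 0" .
 have "(\<Sum>S | card S = m \<and> i0 \<in> S. defect_coeff k m I i0 S) =
  (\<Sum>S | card S = m \<and> i0 \<in> S. of_bool (S \<subseteq> I) - ?a * (real ?n - real m))"
  by (intro sum.cong) (auto simp: defect_coeff_def)
 also have "\<dots> = real (k choose m) - real ((k - 1) choose m) - ?a * ((real ?n - real m) * (real (?n choose m) - real ((?n - 1) choose m)))"
  by (simp add: sum_subtractf i2 n2)
 also have "(real ?n - real m) * (real (?n choose m) - real ((?n - 1) choose m)) = real m * real ((?n - 1) choose m)"
  using b2 by (simp add: algebra_simps)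
 also have "real (k choose m) - real ((k - 1) choose m) - ?a * (real m * real ((?n - 1) choose m)) =
  real (k choose m) - real ((k - 1) choose m) - real m * (real (k choose m) / real k)"
  using a by (simp add: mult_ac)
 also have "\<dots> = 0" using b1 pos by (simp add: field_simps)
 finally show "(\<Sum>S | card S = m \<and> i0 \<in> S. defect_coeff k m I i0 S) = 0" .
qed

text \<open>
 Signed coordinate permutations that fix \<open>i0\<close> act transitively on the sets of size \<open>m\<close> containing
 \<open>i0\<close>, and on the others. Hence a group average only sees the two sums of \<open>sum_defect_coeff\<close>.
\<close>

lemma permutation_matrix_exists:
 fixes S S' :: "'n::{finite,linorder} set"
 assumes c: "card S = m" "card S' = m" and i0: "i0 \<in> S \<longleftrightarrow> i0 \<in> S'"
 shows "\<exists>s :: ('n rvec, 'n) vec. \<exists>\<epsilon>. orthogonal_matrix s \<and> s *v axis i0 1 = axis i0 1 \<and>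
  (\<epsilon>::real)\<^sup>2 = 1 \<and> ext_map m ((*v) s) (axis S 1) = \<epsilon> *\<^sub>R axis S' 1"
proof -
 have "card (S - {i0}) = card (S' - {i0})" using c i0 by (cases "i0 \<in> S") auto
 then obtain f1 where f1: "bij_betw f1 (S - {i0}) (S' - {i0})"
  using finite_same_card_bij[of "S - {i0}" "S' - {i0}"] by auto
 have "card (insert i0 S) = card (insert i0 S')" using c i0 by (simp add: card_insert_if)
 then have "card (- insert i0 S) = card (- insert i0 S')" by (simp add: Compl_eq_Diff_UNIV card_Diff_subset)
 then obtain f2 where f2: "bij_betw f2 (- insert i0 S) (- insert i0 S')"
  using finite_same_card_bij[of "- insert i0 S" "- insert i0 S'"] by auto
 define \<sigma> where "\<sigma> i = (if i = i0 then i0 else if i \<in> S then f1 i else f2 i)" for i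
 have f1': "f1 i \<in> S'" "f1 i \<noteq> i0" if "i \<in> S" "i \<noteq> i0" for i using bij_betwE[OF f1] that by auto
 have f2': "f2 i \<notin> S'" "f2 i \<noteq> i0" if "i \<notin> S" "i \<noteq> i0" for i using bij_betwE[OF f2] that by auto
 have inj: "inj \<sigma>"
 proof (rule injI)
  fix i j assume e: "\<sigma> i = \<sigma> j"
  have "\<sigma> i = i0 \<longleftrightarrow> i = i0" "\<sigma> i \<in> S' \<longleftrightarrow> i \<in> S" for i
   using f1'[of i] f2'[of i] i0 by (auto simp: \<sigma>_def)
  then have "i = i0 \<longleftrightarrow> j = i0" "i \<in> S \<longleftrightarrow> j \<in> S" using e by metis+
  moreover have "i = j" if "i \<noteq> i0" "j \<noteq> i0" "i \<in> S" "j \<in> S"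
   using inj_onD[OF bij_betw_imp_inj_on[OF f1], of i j] e that by (simp add: \<sigma>_def)
  moreover have "i = j" if "i \<noteq> i0" "j \<noteq> i0" "i \<notin> S" "j \<notin> S"
   using inj_onD[OF bij_betw_imp_inj_on[OF f2], of i j] e that by (simp add: \<sigma>_def)
  ultimately show "i = j" by blast
 qed
 have im: "\<sigma> ` S = S'"
 proof (rule card_subset_eq)
  show "\<sigma> ` S \<subseteq> S'" using f1' i0 by (auto simp: \<sigma>_def)
  show "card (\<sigma> ` S) = card S'" using inj c by (simp add: card_image inj_on_subset)
 qed simp
 define s :: "('n rvec, 'n) vec" where "s = (\<chi> a i. axis (\<sigma> i) 1 $ a)"
 have col: "column i s = axis (\<sigma> i) 1" for i by (simp add: s_def column_def vec_eq_iff)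
 have sax: "s *v axis i 1 = axis (\<sigma> i) 1" for i by (simp add: matrix_vector_mult_basis col)
 have os: "orthogonal_matrix s"
  unfolding orthogonal_matrix_orthonormal_columns col using inj
  by (auto simp: orthogonal_def inner_axis_axis inj_eq)
 define f where "f = restrict (\<lambda>i. \<sigma> (sorted_list_of_set S ! i)) {..<m}"
 have bS: "bij_betw f {..<m} S'"
 proof -
  have "bij_betw (\<sigma> \<circ> nth (sorted_list_of_set S)) {..<m} S'"
   by (rule bij_betw_trans[OF nth_sorted_bij[OF c(1)]]) (simp add: bij_betw_def im inj_on_subset[OF inj])
  then show ?thesis by (rule bij_betw_cong[THEN iffD1, rotated]) (simp add: f_def)
 qed
 have "f \<in> {f \<in> {..<m} \<rightarrow>\<^sub>E UNIV. inj_on f {..<m}}"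
  using bS by (auto simp: f_def bij_betw_def)
 then have "f \<in> (\<lambda>(S, q). restrict (\<lambda>i. sorted_list_of_set S ! q i) {..<m}) `
   (SIGMA S:{S::'n set. card S = m}. {q. q permutes {..<m}})"
  using bij_betw_imp_surj_on[OF injections_bij[of m]] by blast
 then obtain S'' q where q: "card S'' = m" "q permutes {..<m}"
   "f = restrict (\<lambda>i. sorted_list_of_set S'' ! q i) {..<m}"
  by auto
 have "bij_betw f {..<m} S''"
  using bij_betw_trans[OF permutes_imp_bij[OF q(2)] nth_sorted_bij[OF q(1)]]
  by (rule bij_betw_cong[THEN iffD1, rotated]) (simp add: q(3))
 then have S'': "S'' = S'" using bS by (simp add: bij_betw_def)
 have "ext_map m ((*v) s) (axis S 1) = wedge m (\<lambda>i. axis (f i) 1)"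
  unfolding ext_map_axis[OF c(1)] by (rule wedge_cong) (simp add: sax f_def)
 also have "\<dots> = wedge m ((\<lambda>i. axis (sorted_list_of_set S' ! i) 1) \<circ> q)"
  by (rule wedge_cong) (simp add: q(3) S'')
 also have "\<dots> = of_int (sign q) *\<^sub>R axis S' 1"
  by (simp add: wedge_permute[OF q(2)] wedge_axis[OF c(2)])
 finally have "ext_map m ((*v) s) (axis S 1) = of_int (sign q) *\<^sub>R axis S' 1" .
 moreover have "(of_int (sign q) :: real)\<^sup>2 = 1" by (simp add: sign_def)
 moreover have "s *v axis i0 1 = axis i0 1" by (simp add: sax \<sigma>_def)
 ultimately show ?thesis using os by blast
qed

lemma norm_ext_map_orthogonal:
 fixes h :: "('n::{finite,linorder} rvec, 'n) vec"
 assumes h: "orthogonal_matrix h"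
 shows "norm (ext_map m ((*v) h) (axis S 1)) \<le> 1"
proof (cases "card S = m")
 case True
 have "ext_map m ((*v) h) (axis S 1) \<bullet> ext_map m ((*v) h) (axis S 1) =
   axis S 1 \<bullet> ext_map m ((*v) (transpose h) \<circ> (*v) h) (axis S 1)"
  by (subst ext_map_adjoint[of _ "(*v) (transpose h)"]) (simp_all add: matrix_adjoint ext_map_compose)
 also have "(*v) (transpose h) \<circ> (*v) h = (\<lambda>x. x)"
  by (rule ext) (simp add: orthogonal_matrix_inverse[OF h])
 also have "ext_map m (\<lambda>x. x) (axis S 1) = (axis S 1 :: real ^ 'n set)"
  by (rule ext_map_id) (use True in \<open>auto simp: axis_def\<close>)
 finally show ?thesis by (simp add: norm_eq_sqrt_inner inner_axis_axis)
qed (simp add: ext_map_axis_0)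

lemma nn_integral_haar_mult:
 assumes h: "orthogonal_matrix (h :: ('n::{finite,linorder} rvec, 'n) vec)" and [measurable]: "F \<in> borel_measurable borel"
 shows "(\<integral>\<^sup>+g. F (g ** h) \<partial>haar) = (\<integral>\<^sup>+g. F g \<partial>haar)"
proof -
 have "(\<integral>\<^sup>+g. F g \<partial>haar) = (\<integral>\<^sup>+g. F g \<partial>distr haar borel (\<lambda>g. g ** h))"
  by (simp only: distr_haar_mult[OF h])
 then show ?thesis by (subst (asm) nn_integral_distr) auto
qed

lemma integral_haar_mult:
 fixes F :: "_ \<Rightarrow> complex"
 assumes h: "orthogonal_matrix (h :: ('n::{finite,linorder} rvec, 'n) vec)" and [measurable]: "F \<in> borel_measurable borel"
 shows "(\<integral>g. F (g ** h) \<partial>haar) = (\<integral>g. F g \<partial>haar)"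
proof -
 have "(\<integral>g. F g \<partial>haar) = (\<integral>g. F g \<partial>distr haar borel (\<lambda>g. g ** h))"
  by (simp only: distr_haar_mult[OF h])
 then show ?thesis by (subst (asm) integral_distr) auto
qed

lemma orthogonal_matrix_to_direction:
 fixes x :: "'n::{finite,linorder} rvec"
 shows "\<exists>h. orthogonal_matrix h \<and> x = norm x *\<^sub>R (h *v axis i0 1)"
proof (cases "x = 0")
 case True
 then show ?thesis by (auto intro!: exI[of _ "mat 1"] orthogonal_matrix_id)
next
 case False
 then show ?thesis
  using adapted_frame_exists[of UNIV UNIV i0 x] by (auto simp: adapted_frame_def)
qed

lemma nn_integral_haar_radial:
 fixes x :: "'n::{finite,linorder} rvec"
 assumes [measurable]: "f \<in> borel_measurable borel"
 shows "(\<integral>\<^sup>+g. f (g *v x) \<partial>haar) = (\<integral>\<^sup>+g. f (norm x *\<^sub>R (g *v axis i0 1)) \<partial>haar)"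
proof -
 obtain h where h: "orthogonal_matrix h" "x = norm x *\<^sub>R (h *v axis i0 1)"
  using orthogonal_matrix_to_direction by blast
 have "(\<integral>\<^sup>+g. f (g *v x) \<partial>haar) = (\<integral>\<^sup>+g. f (norm x *\<^sub>R ((g ** h) *v axis i0 1)) \<partial>haar)"
  by (subst h(2)) (simp add: matrix_vector_mult_scaleR matrix_vector_mul_assoc)
 also have "\<dots> = (\<integral>\<^sup>+g. f (norm x *\<^sub>R (g *v axis i0 1)) \<partial>haar)"
  by (rule nn_integral_haar_mult[OF h(1)]) measurable
 finally show ?thesis .
qed

lemma orth_proj_hyperplane:
 "orth_proj {x. orthogonal \<xi> x} x = x - ((x \<bullet> \<xi>) / (\<xi> \<bullet> \<xi>)) *\<^sub>R (\<xi>::'a::euclidean_space)"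
 by (rule orth_proj_eqI[OF subspace_orthogonal_to_vector])
  (auto simp: orthogonal_def inner_diff_right inner_commute)

lemma borel_measurable_mean_restrict [measurable (raw)]:
 assumes [measurable]: "\<xi> \<in> borel_measurable N" "v \<in> borel_measurable N"
 shows "(\<lambda>z. mean_restrict k m (\<xi> z) (v z)) \<in> borel_measurable N"
proof -
 have [measurable]: "(\<lambda>z. Pi_proj m (\<xi> z) (v z)) \<in> borel_measurable N"
  unfolding Pi_proj_eq by (rule borel_measurable_ext_map) (auto simp: orth_proj_hyperplane)
 show ?thesis unfolding mean_restrict_def Psi_proj_def by measurable
qed

lemma norm_orth_proj_le:
 assumes "subspace (V::'a::euclidean_space set)"
 shows "norm (orth_proj V x) \<le> norm x"
 using orth_proj_pythagoras[OF assms, of x] by (metis norm_ge_zero power2_le_imp_le le_add_same_cancel1 zero_le_power2)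

lemma norm_ext_map_orth_proj_le:
 assumes "subspace (V::('n::{finite,linorder} rvec) set)"
 shows "norm (ext_map m (orth_proj V) v) \<le> norm v"
 unfolding orth_proj_ext_power[OF assms, symmetric]
 by (rule norm_orth_proj_le) (simp add: ext_power_def)

lemma norm_mean_restrict_le:
 "norm (mean_restrict k m \<xi> (v :: 'n::{finite,linorder} rform))
  \<le> \<bar>mean_coeff CARD('n) k m\<bar> * (\<bar>real k - real m\<bar> + \<bar>real CARD('n) - real m\<bar> * 2) * norm v"
proof -
 have 1: "norm (Pi_proj m \<xi> v) \<le> norm v"
  unfolding Pi_proj_eq by (rule norm_ext_map_orth_proj_le[OF subspace_orthogonal_to_vector])
 have 2: "norm (Psi_proj m \<xi> v) \<le> 2 * norm v"
  unfolding Psi_proj_def using 1 norm_triangle_ineq4[of v "Pi_proj m \<xi> v"] by simp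
 have "norm ((real k - real m) *\<^sub>R Pi_proj m \<xi> v + (real CARD('n) - real m) *\<^sub>R Psi_proj m \<xi> v)
  \<le> \<bar>real k - real m\<bar> * norm v + \<bar>real CARD('n) - real m\<bar> * (2 * norm v)"
  using 1 2 by (intro norm_triangle_le add_mono) (auto intro!: mult_left_mono)
 also have "\<dots> = (\<bar>real k - real m\<bar> + \<bar>real CARD('n) - real m\<bar> * 2) * norm v"
  by (simp add: algebra_simps)
 finally show ?thesis
  unfolding mean_restrict_def norm_scaleR mult.assoc by (rule mult_left_mono) simp
qed

context invariant_grassmannian
begin

lemma measurable_fst_taut [measurable]: "fst \<in> measurable taut M"
 by (rule measurable_tautI) measurable

lemma measurable_snd_taut [measurable]: "snd \<in> borel_measurable taut"
 by (rule measurable_tautI) measurable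

lemma taut_memD: "p \<in> space taut \<Longrightarrow> subspace (fst p) \<and> dim (fst p) = k \<and> snd p \<in> fst p \<and> fst p \<in> space M"
 by (auto simp: space_taut taut_bundle_def grassmannian_def space_M)

lemma sigma_finite_taut: "sigma_finite_measure taut"
proof
 let ?A = "\<lambda>i. {p \<in> space taut. norm (snd p) \<le> real (Suc i)}"
 have fin: "emeasure taut (?A i) < \<infinity>" for i
 proof -
  have "?A i \<in> sets taut" by measurable
  then have "emeasure taut (?A i) = (\<integral>\<^sup>+p. indicator (?A i) p \<partial>taut)" by simp
  also have "\<dots> = (\<integral>\<^sup>+p. indicator {x. norm x \<le> real (Suc i)} (snd p) \<partial>taut)"
   by (rule nn_integral_cong) (simp add: indicator_def)
  also have "\<dots> = (\<integral>\<^sup>+P. \<integral>\<^sup>+x. indicator {x. norm x \<le> real (Suc i)} x \<partial>subspace_lborel P \<partial>M)"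
   by (subst nn_integral_taut) auto
  also have "\<dots> = (\<integral>\<^sup>+P. ennreal (unit_ball_vol (real k) * real (Suc i) ^ k) \<partial>M)"
  proof (rule nn_integral_cong)
   fix P assume P: "P \<in> space M"
   have "{x. norm x \<le> real (Suc i)} = cball (0::'n::{finite,linorder} rvec) (real (Suc i))" by auto
   then show "(\<integral>\<^sup>+x. indicator {x. norm x \<le> real (Suc i)} x \<partial>subspace_lborel P) =
     ennreal (unit_ball_vol (real k) * real (Suc i) ^ k)"
    using emeasure_subspace_lborel_cball[OF subspace_M(1)[OF P], of "real (Suc i)"] subspace_M(2)[OF P] by simp
  qed
  also have "\<dots> < \<infinity>" by (simp add: M.emeasure_space_1)
  finally show ?thesis .
 qed
 have "(\<Union>i. ?A i) = space taut"
 proof -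
  have "\<exists>i. norm x \<le> real (Suc i)" for x :: "'n::{finite,linorder} rvec"
   using real_arch_simple[of "norm x"] by (metis le_SucI of_nat_le_iff order_trans order_refl)
  then show ?thesis by auto
 qed
 then show "\<exists>A. countable A \<and> A \<subseteq> sets taut \<and> \<Union> A = space taut \<and> (\<forall>a\<in>A. emeasure taut a \<noteq> \<infinity>)"
  using fin by (intro exI[of _ "range ?A"]) (auto simp: less_top[symmetric])
qed

text \<open>The density of the image of the bundle measure under \<open>(P, x) \<mapsto> x\<close>.\<close>

definition base_density :: "'n::{finite,linorder} rvec \<Rightarrow> real" where
 "base_density x = sphere_vol k / sphere_vol CARD('n) / norm x ^ (CARD('n) - k)"

lemma base_density_nonneg: "0 \<le> base_density x"
 by (simp add: base_density_def sphere_vol_def)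

lemma borel_measurable_base_density [measurable]: "base_density \<in> borel_measurable borel"
 unfolding base_density_def by measurable

text \<open>
 Both sides are invariant under rotations, so averaging over the orthogonal group reduces the
 claim to radial functions, where it is integration in polar coordinates on each plane.
\<close>

lemma nn_integral_taut_snd:
 assumes k: "0 < k" and f[measurable]: "f \<in> borel_measurable borel"
 shows "(\<integral>\<^sup>+p. f (snd p) \<partial>taut) = (\<integral>\<^sup>+x. f x * ennreal (base_density x) \<partial>lborel)"
proof -
 interpret H: prob_space "haar :: (('n::{finite,linorder} rvec, 'n::{finite,linorder}) vec) measure" by (rule prob_space_haar)
 interpret T: sigma_finite_measure taut by (rule sigma_finite_taut)
 interpret HT: pair_sigma_finite "haar :: (('n::{finite,linorder} rvec, 'n::{finite,linorder}) vec) measure" taut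
  by (simp add: pair_sigma_finite_def H.sigma_finite_measure_axioms sigma_finite_taut)
 interpret HL: pair_sigma_finite "haar :: (('n::{finite,linorder} rvec, 'n::{finite,linorder}) vec) measure" "lborel :: ('n::{finite,linorder} rvec) measure"
  by (simp add: pair_sigma_finite_def H.sigma_finite_measure_axioms sigma_finite_lborel)
 obtain i0 :: 'n where True by simp
 define \<rho> where "\<rho> r = (\<integral>\<^sup>+g. f (r *\<^sub>R (g *v axis i0 1)) \<partial>haar)" for r :: real
 have [measurable]: "\<rho> \<in> borel_measurable borel"
  unfolding \<rho>_def by measurable
 have "(\<integral>\<^sup>+p. f (snd p) \<partial>taut) = (\<integral>\<^sup>+g. \<integral>\<^sup>+p. f (snd p) \<partial>taut \<partial>(haar :: (('n::{finite,linorder} rvec, 'n::{finite,linorder}) vec) measure))"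
  by (simp add: H.emeasure_space_1[simplified])
 also have "\<dots> = (\<integral>\<^sup>+g. \<integral>\<^sup>+p. f (g *v snd p) \<partial>taut \<partial>haar)"
 proof (rule nn_integral_cong_AE, use AE_haar in eventually_elim)
  case (elim g)
  show ?case using nn_integral_taut_image[OF elim, of "\<lambda>p. f (snd p)"] by simp
 qed
 also have "\<dots> = (\<integral>\<^sup>+p. \<integral>\<^sup>+g. f (g *v snd p) \<partial>haar \<partial>taut)"
  by (rule HT.Fubini'[symmetric]) measurable
 also have "\<dots> = (\<integral>\<^sup>+p. \<rho> (norm (snd p)) \<partial>taut)"
  unfolding \<rho>_def by (intro nn_integral_cong nn_integral_haar_radial) measurable
 also have "\<dots> = (\<integral>\<^sup>+P. \<integral>\<^sup>+x. \<rho> (norm x) \<partial>subspace_lborel P \<partial>M)"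
  by (subst nn_integral_taut) auto
 also have "\<dots> = (\<integral>\<^sup>+P. \<integral>\<^sup>+x. \<rho> (norm x) * ennreal (base_density x) \<partial>lborel \<partial>M)"
  using k by (intro nn_integral_cong) (simp add: nn_integral_radial_compare subspace_M base_density_def)
 also have "\<dots> = (\<integral>\<^sup>+x. \<rho> (norm x) * ennreal (base_density x) \<partial>lborel)"
  by (simp add: M.emeasure_space_1)
 also have "\<dots> = (\<integral>\<^sup>+x. \<integral>\<^sup>+g. f (g *v x) * ennreal (base_density x) \<partial>haar \<partial>lborel)"
  unfolding \<rho>_def by (intro nn_integral_cong) (simp add: nn_integral_haar_radial[symmetric] nn_integral_multc)
 also have "\<dots> = (\<integral>\<^sup>+g. \<integral>\<^sup>+x. f (g *v x) * ennreal (base_density x) \<partial>lborel \<partial>haar)"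
  by (rule HL.Fubini') measurable
 also have "\<dots> = (\<integral>\<^sup>+g. \<integral>\<^sup>+x. f x * ennreal (base_density x) \<partial>lborel \<partial>(haar :: (('n::{finite,linorder} rvec, 'n::{finite,linorder}) vec) measure))"
 proof (rule nn_integral_cong_AE, use AE_haar in eventually_elim)
  case (elim g)
  note g = orthogonal_matrix_imp_transformation[OF elim]
  have "base_density (g *v x) = base_density x" for x
   by (simp add: base_density_def orthogonal_transformation_norm[OF g])
  then show ?case using nn_integral_lborel_orthogonal[OF g, of "\<lambda>x. f x * ennreal (base_density x)"] by simp
 qed
 also have "\<dots> = (\<integral>\<^sup>+x. f x * ennreal (base_density x) \<partial>lborel)"
  by (simp add: H.emeasure_space_1[simplified])
 finally show ?thesis .
qed

lemma distr_taut_snd: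
 assumes k: "0 < k"
 shows "distr taut borel snd = density lborel (\<lambda>x. ennreal (base_density x))"
proof (rule measure_eqI)
 fix A assume "A \<in> sets (distr taut borel snd)"
 then have [measurable]: "A \<in> sets borel" by simp
 have "emeasure (distr taut borel snd) A = (\<integral>\<^sup>+p. indicator A (snd p) \<partial>taut)"
  by (subst nn_integral_indicator[symmetric]) (auto simp: nn_integral_distr simp del: nn_integral_indicator)
 also have "\<dots> = emeasure (density lborel (\<lambda>x. ennreal (base_density x))) A"
  by (subst nn_integral_taut_snd[OF k]) (auto simp: emeasure_density mult.commute)
 finally show "emeasure (distr taut borel snd) A = emeasure (density lborel (\<lambda>x. ennreal (base_density x))) A" .
qed simp

lemma integral_taut_snd:
 fixes F :: "_ \<Rightarrow> complex"
 assumes k: "0 < k" and [measurable]: "F \<in> borel_measurable borel"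
 shows "(\<integral>p. F (snd p) \<partial>taut) = (\<integral>x. base_density x *\<^sub>R F x \<partial>lborel)"
  and "integrable taut (\<lambda>p. F (snd p)) \<longleftrightarrow> integrable lborel (\<lambda>x. base_density x *\<^sub>R F x)"
proof -
 have "(\<integral>p. F (snd p) \<partial>taut) = (\<integral>x. F x \<partial>distr taut borel snd)"
  by (subst integral_distr) auto
 then show "(\<integral>p. F (snd p) \<partial>taut) = (\<integral>x. base_density x *\<^sub>R F x \<partial>lborel)"
  unfolding distr_taut_snd[OF k] by (subst (asm) integral_density) (auto simp: base_density_nonneg)
 have "integrable taut (\<lambda>p. F (snd p)) \<longleftrightarrow> integrable (distr taut borel snd) F"
  by (subst integrable_distr_eq) auto
 then show "integrable taut (\<lambda>p. F (snd p)) \<longleftrightarrow> integrable lborel (\<lambda>x. base_density x *\<^sub>R F x)"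
  unfolding distr_taut_snd[OF k] by (subst (asm) integrable_density) (auto simp: base_density_nonneg)
qed

lemma AE_taut_nonzero:
 assumes k: "0 < k"
 shows "AE p in taut. snd p \<noteq> 0"
proof -
 have "AE x in density lborel (\<lambda>x. ennreal (base_density x)). x \<noteq> (0::'n::{finite,linorder} rvec)"
  using AE_lborel_singleton[of "0::'n::{finite,linorder} rvec"] by (subst AE_density) auto
 then have "AE x in distr taut borel snd. x \<noteq> 0" unfolding distr_taut_snd[OF k] .
 then show ?thesis by (subst (asm) AE_distr_iff) auto
qed

lemma integral_taut_image:
 fixes F :: "_ \<Rightarrow> complex"
 assumes A: "orthogonal_matrix A" and [measurable]: "F \<in> borel_measurable (M \<Otimes>\<^sub>M borel)"
 shows "(\<integral>p. F ((*v) A ` fst p, A *v snd p) \<partial>taut) = (\<integral>p. F p \<partial>taut)"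
proof -
 note [measurable] = measurable_image[OF A]
 have tM[measurable]: "(\<lambda>p. p) \<in> measurable taut (M \<Otimes>\<^sub>M borel)" by (rule measurable_tautI) measurable
 have m[measurable]: "(\<lambda>p. ((*v) A ` fst p, A *v snd p)) \<in> measurable taut (M \<Otimes>\<^sub>M borel)"
  by measurable
 have "distr taut (M \<Otimes>\<^sub>M borel) (\<lambda>p. ((*v) A ` fst p, A *v snd p)) = distr taut (M \<Otimes>\<^sub>M borel) (\<lambda>p. p)"
 proof (rule measure_eqI)
  fix E assume "E \<in> sets (distr taut (M \<Otimes>\<^sub>M borel) (\<lambda>p. ((*v) A ` fst p, A *v snd p)))"
  then have E[measurable]: "E \<in> sets (M \<Otimes>\<^sub>M borel)" by simp
  have "emeasure (distr taut (M \<Otimes>\<^sub>M borel) (\<lambda>p. ((*v) A ` fst p, A *v snd p))) E =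
   (\<integral>\<^sup>+p. indicator E ((*v) A ` fst p, A *v snd p) \<partial>taut)"
   using E by (subst nn_integral_indicator[symmetric]) (auto simp: nn_integral_distr simp del: nn_integral_indicator)
  also have "\<dots> = (\<integral>\<^sup>+p. indicator E p \<partial>taut)"
   by (rule nn_integral_taut_image[OF A]) measurable
  also have "\<dots> = emeasure (distr taut (M \<Otimes>\<^sub>M borel) (\<lambda>p. p)) E"
   using E by (subst nn_integral_indicator[symmetric]) (auto simp: nn_integral_distr simp del: nn_integral_indicator)
  finally show "emeasure (distr taut (M \<Otimes>\<^sub>M borel) (\<lambda>p. ((*v) A ` fst p, A *v snd p))) E =
    emeasure (distr taut (M \<Otimes>\<^sub>M borel) (\<lambda>p. p)) E" .
 qed simp
 then have "(\<integral>p. F p \<partial>distr taut (M \<Otimes>\<^sub>M borel) (\<lambda>p. ((*v) A ` fst p, A *v snd p))) =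
  (\<integral>p. F p \<partial>distr taut (M \<Otimes>\<^sub>M borel) (\<lambda>p. p))" by simp
 then show ?thesis by (simp add: integral_distr)
qed

end

lemma borel_measurable_transpose_vector [measurable (raw)]:
 fixes A :: "'b \<Rightarrow> real ^ 'n ^ 'm"
 assumes [measurable]: "A \<in> borel_measurable N" "x \<in> borel_measurable N"
 shows "(\<lambda>z. transpose (A z) *v x z) \<in> borel_measurable N"
 by (subst borel_measurable_vec_nth_iff) (simp add: matrix_vector_mult_def transpose_def)

lemma defect_average_zero:
 fixes f :: "'n::{finite,linorder} rvec \<Rightarrow> complex" and P :: "('n rvec) set"
 assumes mk: "m < k" "k \<le> CARD('n)" and P: "subspace P" "dim P = k" "\<xi> \<in> P" "\<xi> \<noteq> 0"
  and f[measurable]: "f \<in> borel_measurable borel" and fB: "\<And>x. norm (f x) \<le> B"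
  and T: "card T' = m"
 shows "(\<integral>g. f (g *v \<xi>) * of_real (ext_map m (\<lambda>x. g *v orth_proj P (transpose g *v x)) (axis T' 1) $ T
   - mean_restrict k m (g *v \<xi>) (axis T' 1) $ T) \<partial>haar) = 0"
proof -
 interpret H: prob_space "haar :: (('n rvec, 'n) vec) measure" by (rule prob_space_haar)
 obtain I :: "'n set" where I: "card I = k"
  using mk(2) obtain_subset_with_card_n[of k "UNIV :: 'n set"] by auto
 then obtain i0 where i0: "i0 \<in> I" using mk(1) by (metis card.empty all_not_in_conv not_less_zero)
 obtain h where fr: "adapted_frame I i0 P \<xi> h"
  using adapted_frame_exists[OF P(1) _ i0 P(3,4)] I P(2) by auto
 then have h: "orthogonal_matrix h" by (simp add: adapted_frame_def)
 let ?c = "\<lambda>S g. ext_map m ((*v) g) (axis S 1) $ T * ext_map m ((*v) g) (axis S 1) $ T'"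
 let ?d = "defect_coeff k m I i0"
 let ?F = "\<lambda>g. f (norm \<xi> *\<^sub>R (g *v axis i0 1))"
 define J where "J S = (\<integral>g. ?F g * of_real (?c S g) \<partial>haar)" for S
 have [measurable]: "(\<lambda>g. ext_map m ((*v) g) (axis S 1)) \<in> borel_measurable borel" for S
  by (rule borel_measurable_ext_map) measurable
 have c1: "\<bar>?c S g\<bar> \<le> 1" if g: "orthogonal_matrix g" for S and g :: "('n rvec, 'n) vec"
 proof -
  have "\<bar>ext_map m ((*v) g) (axis S 1) $ U\<bar> \<le> 1" for U
   using norm_ext_map_orthogonal[OF g, of m S] component_le_norm_cart order_trans by blast
  then show ?thesis unfolding abs_mult by (intro mult_le_one) auto
 qed
 have int: "integrable haar (\<lambda>g. ?F g * of_real (?c S g))" for S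
 proof (rule H.integrable_const_bound[of _ B])
  show "AE g in haar. norm (?F g * of_real (?c S g)) \<le> B"
   using AE_haar
  proof eventually_elim
   case (elim g)
   then show ?case using c1[OF elim, of S] fB mult_mono[OF fB c1[OF elim, of S]] order_trans[OF norm_ge_zero fB]
    by (simp add: norm_mult abs_mult)
  qed
 qed measurable
 have J_eq: "J S = J S'" if S: "card S = m" "card S' = m" "i0 \<in> S \<longleftrightarrow> i0 \<in> S'" for S S'
 proof -
  obtain s :: "('n rvec, 'n) vec" and \<epsilon> :: real where s: "orthogonal_matrix s" "s *v axis i0 1 = axis i0 1" "\<epsilon>\<^sup>2 = 1"
   "ext_map m ((*v) s) (axis S 1) = \<epsilon> *\<^sub>R axis S' 1"
   using permutation_matrix_exists[OF S] by blast
  have "ext_map m ((*v) (g ** s)) (axis S 1) = \<epsilon> *\<^sub>R ext_map m ((*v) g) (axis S' 1)" for g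
  proof -
   have "(*v) (g ** s) = (*v) g \<circ> (*v) s" by (rule ext) (simp add: matrix_vector_mul_assoc)
   then show ?thesis
    by (simp add: ext_map_compose s(4) linear_scale[OF ext_map_linear])
  qed
  then have c: "?c S (g ** s) = ?c S' g" for g
   using s(3) by (simp add: power2_eq_square algebra_simps)
  have "J S = (\<integral>g. ?F (g ** s) * of_real (?c S (g ** s)) \<partial>haar)"
   unfolding J_def by (rule integral_haar_mult[OF s(1), symmetric]) measurable
  also have "\<dots> = J S'"
   unfolding J_def c by (simp add: matrix_vector_mul_assoc[symmetric] s(2))
  finally show ?thesis .
 qed
 have "(\<integral>g. f (g *v \<xi>) * of_real (ext_map m (\<lambda>x. g *v orth_proj P (transpose g *v x)) (axis T' 1) $ T
   - mean_restrict k m (g *v \<xi>) (axis T' 1) $ T) \<partial>haar) =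
  (\<integral>g. ?F (g ** h) * of_real (\<Sum>S | card S = m. ?d S * ?c S (g ** h)) \<partial>haar)"
 proof (rule integral_cong_AE)
  have E: "f (g *v \<xi>) * of_real (ext_map m (\<lambda>x. g *v orth_proj P (transpose g *v x)) (axis T' 1) $ T
   - mean_restrict k m (g *v \<xi>) (axis T' 1) $ T) = ?F (g ** h) * of_real (\<Sum>S | card S = m. ?d S * ?c S (g ** h))"
   if g: "orthogonal_matrix g" for g
  proof -
   note fg = adapted_frame_mult[OF fr g]
   note g' = orthogonal_matrix_imp_transformation[OF g]
   have n: "norm (g *v \<xi>) = norm \<xi>" using orthogonal_transformation_norm[OF g'] .
   have nz: "g *v \<xi> \<noteq> 0" using n P(4) by (metis norm_eq_zero)
   have "g *v \<xi> = norm \<xi> *\<^sub>R ((g ** h) *v axis i0 1)"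
    using fg n by (simp add: adapted_frame_def)
   moreover have "(\<lambda>x. g *v orth_proj P (transpose g *v x)) = orth_proj ((*v) g ` P)"
    by (rule ext) (rule orth_proj_matrix_image[OF g P(1), symmetric])
   ultimately show ?thesis using restrict_defect_frame[OF fg nz T, where k=k and T=T] by simp
  qed
  show "AE g in haar. f (g *v \<xi>) * of_real (ext_map m (\<lambda>x. g *v orth_proj P (transpose g *v x)) (axis T' 1) $ T
   - mean_restrict k m (g *v \<xi>) (axis T' 1) $ T) = ?F (g ** h) * of_real (\<Sum>S | card S = m. ?d S * ?c S (g ** h))"
   using AE_haar by eventually_elim (rule E)
  show m2: "(\<lambda>g. ?F (g ** h) * of_real (\<Sum>S | card S = m. ?d S * ?c S (g ** h))) \<in> borel_measurable haar"
  proof -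
   have "(\<lambda>g. ?F g * of_real (\<Sum>S | card S = m. ?d S * ?c S g)) \<in> borel_measurable borel" by measurable
   from measurable_compose[OF borel_measurable_mult_right[of h] this] show ?thesis by simp
  qed
  note [measurable] = P(1)
  have [measurable]: "(\<lambda>g. ext_map m (\<lambda>x. g *v orth_proj P (transpose g *v x)) (axis T' 1)) \<in> borel_measurable haar"
   by (rule borel_measurable_ext_map) measurable
  show "(\<lambda>g. f (g *v \<xi>) * of_real (ext_map m (\<lambda>x. g *v orth_proj P (transpose g *v x)) (axis T' 1) $ T
   - mean_restrict k m (g *v \<xi>) (axis T' 1) $ T)) \<in> borel_measurable haar"
   by measurable
 qed
 also have "\<dots> = (\<integral>g. ?F g * of_real (\<Sum>S | card S = m. ?d S * ?c S g) \<partial>haar)"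
  by (rule integral_haar_mult[OF h]) measurable
 also have "\<dots> = (\<integral>g. (\<Sum>S | card S = m. of_real (?d S) * (?F g * of_real (?c S g))) \<partial>haar)"
  by (simp add: sum_distrib_left mult_ac)
 also have "\<dots> = (\<Sum>S | card S = m. of_real (?d S) * J S)"
  unfolding J_def using int by (subst Bochner_Integration.integral_sum) (auto intro: integrable_mult_right)
 also have "\<dots> = (\<Sum>S | card S = m \<and> i0 \<in> S. of_real (?d S) * J S) + (\<Sum>S | card S = m \<and> i0 \<notin> S. of_real (?d S) * J S)"
  by (subst sum.union_disjoint[symmetric]) (auto intro!: sum.cong)
 also have "(\<Sum>S | card S = m \<and> i0 \<in> S. of_real (?d S) * J S) = 0"
 proof (cases "\<exists>S0. card S0 = m \<and> i0 \<in> S0")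
  case True
  then obtain S0 where "card S0 = m" "i0 \<in> S0" by blast
  then have "(\<Sum>S | card S = m \<and> i0 \<in> S. of_real (?d S) * J S) = (\<Sum>S | card S = m \<and> i0 \<in> S. of_real (?d S) * J S0)"
   by (intro sum.cong refl arg_cong2[where f="(*)"] J_eq) auto
  also have "\<dots> = of_real (\<Sum>S | card S = m \<and> i0 \<in> S. ?d S) * J S0" by (simp add: sum_distrib_right)
  finally show ?thesis by (simp only: sum_defect_coeff[OF mk I i0]) simp
 next
  case False
  then have e: "{S. card S = m \<and> i0 \<in> S} = {}" by auto
  show ?thesis by (simp only: e sum.empty)
 qed
 also have "(\<Sum>S | card S = m \<and> i0 \<notin> S. of_real (?d S) * J S) = 0"
 proof (cases "\<exists>S0. card S0 = m \<and> i0 \<notin> S0")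
  case True
  then obtain S0 where "card S0 = m" "i0 \<notin> S0" by blast
  then have "(\<Sum>S | card S = m \<and> i0 \<notin> S. of_real (?d S) * J S) = (\<Sum>S | card S = m \<and> i0 \<notin> S. of_real (?d S) * J S0)"
   by (intro sum.cong refl arg_cong2[where f="(*)"] J_eq) auto
  also have "\<dots> = of_real (\<Sum>S | card S = m \<and> i0 \<notin> S. ?d S) * J S0" by (simp add: sum_distrib_right)
  finally show ?thesis by (simp only: sum_defect_coeff[OF mk I i0]) simp
 next
  case False
  then have e: "{S. card S = m \<and> i0 \<notin> S} = {}" by auto
  show ?thesis by (simp only: e sum.empty)
 qed
 finally show ?thesis by simp
qed

context invariant_grassmannian
begin

text \<open>
 Write the integral over the bundle as an average over the orthogonal group. By invariance of
 the group measure, the group average of the defect (the difference of the two sides) may be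
 computed in a frame adapted to \<open>(P, \<xi>)\<close>, where it vanishes.
\<close>

theorem integral_restrict_eq_mean:
 fixes f :: "'n::{finite,linorder} rvec \<Rightarrow> complex"
 assumes mk: "m < k" "k \<le> CARD('n)"
  and f[measurable]: "f \<in> borel_measurable borel" and fB: "\<And>x. norm (f x) \<le> B"
  and fin: "(\<integral>\<^sup>+p. ennreal (norm (f (snd p))) \<partial>taut) < \<infinity>"
  and T: "card T' = m"
 shows "(\<integral>p. f (snd p) * of_real (ext_map m (orth_proj (fst p)) (axis T' 1) $ T) \<partial>taut) =
   (\<integral>p. f (snd p) * of_real (mean_restrict k m (snd p) (axis T' 1) $ T) \<partial>taut)"
  and "integrable taut (\<lambda>p. f (snd p) * of_real (ext_map m (orth_proj (fst p)) (axis T' 1) $ T))"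
  and "integrable taut (\<lambda>p. f (snd p) * of_real (mean_restrict k m (snd p) (axis T' 1) $ T))"
proof -
 interpret H: prob_space "haar :: (('n rvec, 'n) vec) measure" by (rule prob_space_haar)
 interpret HT: pair_sigma_finite "haar :: (('n rvec, 'n) vec) measure" taut
  by (simp add: pair_sigma_finite_def H.sigma_finite_measure_axioms sigma_finite_taut)
 have k: "0 < k" using mk by simp
 define K where "K = \<bar>mean_coeff CARD('n) k m\<bar> * (\<bar>real k - real m\<bar> + \<bar>real CARD('n) - real m\<bar> * 2)"
 have K0: "K \<ge> 0" by (simp add: K_def)
 let ?L = "\<lambda>P. ext_map m (orth_proj P) (axis T' 1) $ T" and ?A = "\<lambda>\<xi>. mean_restrict k m \<xi> (axis T' 1) $ T"
 have Lb: "\<bar>?L P\<bar> \<le> 1" if "subspace P" for P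
  using norm_ext_map_orth_proj_le[OF that, of m "axis T' 1"] component_le_norm_cart[of "ext_map m (orth_proj P) (axis T' 1)" T]
  by simp
 have Ab: "\<bar>?A \<xi>\<bar> \<le> K" for \<xi> :: "'n rvec"
  using norm_mean_restrict_le[of k m \<xi> "axis T' 1"] component_le_norm_cart[of "mean_restrict k m \<xi> (axis T' 1)" T]
  by (simp add: K_def)
 have fi: "integrable taut (\<lambda>p. f (snd p))"
  using fin by (intro integrableI_bounded) auto
 show iL: "integrable taut (\<lambda>p. f (snd p) * of_real (?L (fst p)))"
 proof (rule Bochner_Integration.integrable_bound[OF fi])
  show "AE p in taut. norm (f (snd p) * of_real (?L (fst p))) \<le> norm (f (snd p))"
  proof (rule AE_I2)
   fix p assume "p \<in> space taut"
   then have "\<bar>?L (fst p)\<bar> \<le> 1" using taut_memD Lb by blast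
   then show "norm (f (snd p) * of_real (?L (fst p))) \<le> norm (f (snd p))"
    by (simp add: norm_mult mult_left_le)
  qed
 qed measurable
 show iA: "integrable taut (\<lambda>p. f (snd p) * of_real (?A (snd p)))"
 proof (rule Bochner_Integration.integrable_bound[OF integrable_mult_right[of "of_real K", OF fi]])
  show "AE p in taut. norm (f (snd p) * of_real (?A (snd p))) \<le> norm (of_real K * f (snd p))"
  proof (rule AE_I2)
   fix p
   show "norm (f (snd p) * of_real (?A (snd p))) \<le> norm (of_real K * f (snd p))"
    using K0 mult_left_mono[OF Ab[of "snd p"], of "norm (f (snd p))"] by (simp add: norm_mult mult.commute)
  qed
 qed measurable
 define \<Phi> where "\<Phi> g p = f (g *v snd p) * of_real (ext_map m (\<lambda>x. g *v orth_proj (fst p) (transpose g *v x)) (axis T' 1) $ T - ?A (g *v snd p))"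
  for g :: "('n rvec, 'n) vec" and p :: "('n rvec) set \<times> ('n rvec)"
 have [measurable]: "(\<lambda>z. ext_map m (\<lambda>x. fst z *v orth_proj (fst (snd z)) (transpose (fst z) *v x)) (axis T' 1))
   \<in> borel_measurable (haar \<Otimes>\<^sub>M taut)"
  by (rule borel_measurable_ext_map) measurable
 have [measurable]: "(\<lambda>z. \<Phi> (fst z) (snd z)) \<in> borel_measurable (haar \<Otimes>\<^sub>M taut)"
  unfolding \<Phi>_def by measurable
 have \<Phi>_image: "\<Phi> g p = f (g *v snd p) * of_real (?L ((*v) g ` fst p) - ?A (g *v snd p))"
  if "orthogonal_matrix g" "p \<in> space taut" for g p
 proof -
  have "(\<lambda>x. g *v orth_proj (fst p) (transpose g *v x)) = orth_proj ((*v) g ` fst p)"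
   using taut_memD[OF that(2)] by (intro ext orth_proj_matrix_image[OF that(1), symmetric]) auto
  then show ?thesis by (simp add: \<Phi>_def)
 qed
 have \<Phi>b: "norm (\<Phi> g p) \<le> (1 + K) * norm (f (g *v snd p))" if "orthogonal_matrix g" "p \<in> space taut" for g p
 proof -
  have s: "subspace ((*v) g ` fst p)" using taut_memD[OF that(2)] by (intro linear_subspace_image) auto
  have "\<bar>?L ((*v) g ` fst p) - ?A (g *v snd p)\<bar> \<le> 1 + K"
   using Lb[OF s] Ab[of "g *v snd p"] by linarith
  then show ?thesis
   unfolding \<Phi>_image[OF that] norm_mult norm_of_real by (subst mult.commute) (rule mult_right_mono, simp_all)
 qed
 have int\<Phi>: "integrable (haar \<Otimes>\<^sub>M taut) (\<lambda>z. \<Phi> (fst z) (snd z))"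
 proof (rule integrableI_bounded)
  have "(\<integral>\<^sup>+z. ennreal (norm (\<Phi> (fst z) (snd z))) \<partial>(haar \<Otimes>\<^sub>M taut)) = (\<integral>\<^sup>+g. \<integral>\<^sup>+p. ennreal (norm (\<Phi> g p)) \<partial>taut \<partial>haar)"
   by (subst HT.M2.nn_integral_fst[symmetric]) auto
  also have "\<dots> \<le> (\<integral>\<^sup>+g. ennreal (1 + K) * (\<integral>\<^sup>+p. ennreal (norm (f (snd p))) \<partial>taut) \<partial>(haar :: (('n rvec, 'n) vec) measure))"
  proof (rule nn_integral_mono_AE, use AE_haar in eventually_elim)
   case (elim g)
   have "(\<integral>\<^sup>+p. ennreal (norm (\<Phi> g p)) \<partial>taut) \<le> (\<integral>\<^sup>+p. ennreal (1 + K) * ennreal (norm (f (g *v snd p))) \<partial>taut)"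
    using \<Phi>b[OF elim] K0 by (intro nn_integral_mono) (simp add: ennreal_mult[symmetric] ennreal_leI del: ennreal_plus)
   also have "\<dots> = ennreal (1 + K) * (\<integral>\<^sup>+p. ennreal (norm (f (g *v snd p))) \<partial>taut)"
    by (rule nn_integral_cmult) measurable
   also have "(\<integral>\<^sup>+p. ennreal (norm (f (g *v snd p))) \<partial>taut) = (\<integral>\<^sup>+p. ennreal (norm (f (snd p))) \<partial>taut)"
    using nn_integral_taut_image[OF elim, of "\<lambda>p. ennreal (norm (f (snd p)))"] by simp
   finally show ?case .
  qed
  also have "\<dots> < \<infinity>" using fin by (simp add: H.emeasure_space_1[simplified] ennreal_mult_less_top)
  finally show "(\<integral>\<^sup>+z. ennreal (norm (\<Phi> (fst z) (snd z))) \<partial>(haar \<Otimes>\<^sub>M taut)) < \<infinity>" .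
 qed measurable
 let ?D = "\<lambda>p. f (snd p) * of_real (?L (fst p) - ?A (snd p))"
 have inner: "(\<integral>p. \<Phi> g p \<partial>taut) = (\<integral>p. ?D p \<partial>taut)" if g: "orthogonal_matrix g" for g
 proof -
  have "(\<integral>p. \<Phi> g p \<partial>taut) = (\<integral>p. ?D ((*v) g ` fst p, g *v snd p) \<partial>taut)"
   using \<Phi>_image[OF g] by (intro Bochner_Integration.integral_cong) auto
  also have "\<dots> = (\<integral>p. ?D p \<partial>taut)"
   by (rule integral_taut_image[OF g]) measurable
  finally show ?thesis .
 qed
 have "(\<integral>p. ?D p \<partial>taut) = (\<integral>g. \<integral>p. ?D p \<partial>taut \<partial>(haar :: (('n rvec, 'n) vec) measure))"
  by (simp add: H.prob_space[simplified])
 also have "\<dots> = (\<integral>g. \<integral>p. \<Phi> g p \<partial>taut \<partial>haar)"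
 proof (rule integral_cong_AE)
  show "AE g in haar. (\<integral>p. ?D p \<partial>taut) = (\<integral>p. \<Phi> g p \<partial>taut)"
   using AE_haar by eventually_elim (rule inner[symmetric])
 qed measurable
 also have "\<dots> = (\<integral>p. \<integral>g. \<Phi> g p \<partial>haar \<partial>taut)"
  using HT.Fubini_integral[of "\<lambda>g p. \<Phi> g p"] int\<Phi> by (simp add: case_prod_beta')
 also have "\<dots> = (\<integral>p. 0 \<partial>taut)"
 proof (rule integral_cong_AE)
  show "AE p in taut. (\<integral>g. \<Phi> g p \<partial>haar) = 0"
   using AE_taut_nonzero[OF k] AE_space
  proof eventually_elim
   case (elim p)
   then show ?case
    unfolding \<Phi>_def using taut_memD[of p] by (intro defect_average_zero[OF mk _ _ _ _ f fB T]) auto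
  qed
  have "(\<lambda>z. \<Phi> (snd z) (fst z)) \<in> borel_measurable (taut \<Otimes>\<^sub>M haar)"
   using measurable_compose[OF measurable_pair_swap' \<open>(\<lambda>z. \<Phi> (fst z) (snd z)) \<in> borel_measurable (haar \<Otimes>\<^sub>M taut)\<close>]
   by (simp add: case_prod_beta')
  then show "(\<lambda>p. \<integral>g. \<Phi> g p \<partial>haar) \<in> borel_measurable taut"
   by (intro H.borel_measurable_lebesgue_integral) (simp add: case_prod_beta')
 qed simp
 finally have "(\<integral>p. ?D p \<partial>taut) = 0" by simp
 moreover have "(\<integral>p. ?D p \<partial>taut) = (\<integral>p. f (snd p) * of_real (?L (fst p)) - f (snd p) * of_real (?A (snd p)) \<partial>taut)"
  by (simp add: algebra_simps)
 ultimately show "(\<integral>p. f (snd p) * of_real (?L (fst p)) \<partial>taut) = (\<integral>p. f (snd p) * of_real (?A (snd p)) \<partial>taut)"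
  by (simp add: Bochner_Integration.integral_diff[OF iL iA])
qed

end

section \<open>Fourier transforms on subspaces\<close>

definition echar :: "'a::euclidean_space \<Rightarrow> 'a \<Rightarrow> complex" where
 "echar x \<xi> = exp (- 2 * complex_of_real pi * \<i> * complex_of_real (x \<bullet> \<xi>))"

lemma norm_echar [simp]: "norm (echar x \<xi>) = 1"
 by (simp add: echar_def)

lemma echar_0 [simp]: "echar 0 \<xi> = 1" "echar x 0 = 1"
 by (simp_all add: echar_def)

lemma echar_commute: "echar x \<xi> = echar \<xi> x"
 by (simp add: echar_def inner_commute)

lemma echar_add_left: "echar (x + y) \<xi> = echar x \<xi> * echar y \<xi>"
 by (simp add: echar_def inner_add_left exp_add[symmetric] algebra_simps)

lemma cnj_echar: "cnj (echar x \<xi>) = echar (- x) \<xi>"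
 by (simp add: echar_def exp_cnj)

lemma borel_measurable_echar [measurable (raw)]:
 assumes [measurable]: "f \<in> borel_measurable N" "g \<in> borel_measurable N"
 shows "(\<lambda>z. echar (f z) (g z)) \<in> borel_measurable N"
proof -
 have [measurable]: "(\<lambda>z. complex_of_real (f z \<bullet> g z)) \<in> borel_measurable N" by measurable
 have "continuous_on UNIV (\<lambda>w::complex. exp (- 2 * complex_of_real pi * \<i> * w))" by (intro continuous_intros)
 from borel_measurable_continuous_on[OF this, of "\<lambda>z. complex_of_real (f z \<bullet> g z)"]
 show ?thesis by (simp add: echar_def)
qed

lemma borel_measurable_cnj [measurable (raw)]:
 assumes "f \<in> borel_measurable N"
 shows "(\<lambda>z. cnj (f z)) \<in> borel_measurable N"
 by (rule borel_measurable_continuous_on[OF _ assms]) (intro continuous_intros)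

definition fourier_on :: "'a::euclidean_space set \<Rightarrow> ('a \<Rightarrow> complex) \<Rightarrow> 'a \<Rightarrow> complex" where
 "fourier_on V \<phi> \<xi> = (\<integral>x. echar x \<xi> * \<phi> x \<partial>subspace_lborel V)"

lemma fourier_on_UNIV: "fourier_on UNIV = fourier"
 by (simp add: fun_eq_iff fourier_on_def fourier_def echar_def subspace_lborel_UNIV)

lemma fourier_echar: "fourier \<phi> \<xi> = (\<integral>x. echar x \<xi> * \<phi> x \<partial>lborel)"
 by (simp add: fourier_def echar_def)

lemma fourier_gaussian_real:
 assumes s: "s > (0::real)"
 shows "(\<integral>t. exp (- 2 * complex_of_real pi * \<i> * complex_of_real (t * u)) * complex_of_real (exp (- (pi * s * t\<^sup>2))) \<partial>lborel)
  = complex_of_real (1 / sqrt s * exp (- (pi * u\<^sup>2 / s)))" (is "?l = _")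
proof -
 define c where "c = sqrt (2 * pi * s)"
 have c: "c > 0" using s by (simp add: c_def)
 have c2: "c\<^sup>2 = 2 * pi * s" using s by (simp add: c_def)
 define \<tau> where "\<tau> = - 2 * pi * u / c"
 have "complex_of_real (exp (- (\<tau>\<^sup>2) / 2)) = char std_normal_distribution \<tau>"
  by (simp add: char_std_normal_distribution)
 also have "\<dots> = (\<integral>x. std_normal_density x *\<^sub>R iexp (\<tau> * x) \<partial>lborel)"
  unfolding char_def by (subst integral_density) auto
 also have "\<dots> = \<bar>c\<bar> *\<^sub>R (\<integral>t. std_normal_density (0 + c * t) *\<^sub>R iexp (\<tau> * (0 + c * t)) \<partial>lborel)"
  using c by (intro lborel_integral_real_affine) auto
 also have "(\<integral>t. std_normal_density (0 + c * t) *\<^sub>R iexp (\<tau> * (0 + c * t)) \<partial>lborel) =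
  (\<integral>t. complex_of_real (1 / sqrt (2 * pi)) * (exp (- 2 * complex_of_real pi * \<i> * complex_of_real (t * u)) * complex_of_real (exp (- (pi * s * t\<^sup>2)))) \<partial>lborel)"
 proof (rule Bochner_Integration.integral_cong[OF refl])
  fix t
  have "\<tau> * (0 + c * t) = - 2 * pi * (t * u)" using c by (simp add: \<tau>_def)
  then have 1: "iexp (\<tau> * (0 + c * t)) = exp (- 2 * complex_of_real pi * \<i> * complex_of_real (t * u))"
   by (simp only:) (simp add: mult_ac)
  have "(0 + c * t)\<^sup>2 / 2 = pi * s * t\<^sup>2" by (simp add: power_mult_distrib c2)
  then have 2: "std_normal_density (0 + c * t) = 1 / sqrt (2 * pi) * exp (- (pi * s * t\<^sup>2))"
   by (simp add: std_normal_density_def)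
  show "std_normal_density (0 + c * t) *\<^sub>R iexp (\<tau> * (0 + c * t)) =
    complex_of_real (1 / sqrt (2 * pi)) * (exp (- 2 * complex_of_real pi * \<i> * complex_of_real (t * u)) * complex_of_real (exp (- (pi * s * t\<^sup>2))))"
   unfolding 1 2 by (simp add: scaleR_conv_of_real mult_ac)
 qed
 also have "\<dots> = complex_of_real (1 / sqrt (2 * pi)) * ?l" by (rule integral_mult_right_zero)
 finally have e: "complex_of_real (exp (- (\<tau>\<^sup>2) / 2)) = complex_of_real (c / sqrt (2 * pi)) * ?l"
  using c by (simp add: scaleR_conv_of_real)
 have "c / sqrt (2 * pi) = sqrt s" using s by (simp add: c_def real_sqrt_mult)
 moreover have "- (\<tau>\<^sup>2) / 2 = - (pi * u\<^sup>2 / s)"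
  using s unfolding \<tau>_def power_divide c2 by (simp add: power_mult_distrib field_simps power2_eq_square)
 ultimately have "complex_of_real (sqrt s) * ?l = complex_of_real (exp (- (pi * u\<^sup>2 / s)))" using e by simp
 then have "complex_of_real (1 / sqrt s) * (complex_of_real (sqrt s) * ?l) = complex_of_real (1 / sqrt s) * complex_of_real (exp (- (pi * u\<^sup>2 / s)))" by simp
 then show ?thesis using s by (simp add: field_simps)
qed

lemma orth_proj_onb:
 assumes B: "orthonormal_basis_of (V::'a::euclidean_space set) B"
 shows "orth_proj V x = (\<Sum>b\<in>B. (b \<bullet> x) *\<^sub>R b)"
proof (rule orth_proj_eqI)
 note B' = orthonormal_basis_of_facts[OF B]
 show "subspace V" by (rule B')
 show "(\<Sum>b\<in>B. (b \<bullet> x) *\<^sub>R b) \<in> V" using B' by (intro subspace_sum subspace_scale) auto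
 let ?y = "x - (\<Sum>b\<in>B. (b \<bullet> x) *\<^sub>R b)"
 fix z assume "z \<in> V"
 have "orthogonal ?y b" if "b \<in> B" for b
 proof -
  have "(\<Sum>c\<in>B. (c \<bullet> x) *\<^sub>R c) \<bullet> b = (\<Sum>c\<in>B. if c = b then b \<bullet> x else 0)"
   unfolding inner_sum_left by (rule sum.cong) (use that B'(7) in auto)
  then show ?thesis using that B'(1) by (simp add: orthogonal_def inner_diff_left inner_commute[of x])
 qed
 moreover have "z \<in> span B" using \<open>z \<in> V\<close> B'(4) by simp
 ultimately show "orthogonal ?y z" by (rule orthogonal_to_span[rotated])
qed

lemma integrable_gaussian_subspace:
 fixes V :: "'a::euclidean_space set"
 assumes V: "subspace V" and s: "s > 0"
 shows "integrable (subspace_lborel V) (\<lambda>x. exp (- (pi * s * (norm x)\<^sup>2)))"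
 using nn_integral_gaussian_subspace[OF V s] by (intro integrableI_bounded) auto

lemma fourier_gaussian_subspace:
 fixes V :: "'a::euclidean_space set"
 assumes V: "subspace V" and s: "s > 0"
 shows "fourier_on V (\<lambda>x. complex_of_real (exp (- (pi * s * (norm x)\<^sup>2)))) \<xi> =
  complex_of_real ((1 / sqrt s) ^ dim V * exp (- (pi * (norm (orth_proj V \<xi>))\<^sup>2 / s)))"
proof -
 obtain B where B: "orthonormal_basis_of V B"
  "subspace_lborel V = distr (\<Pi>\<^sub>M b\<in>B. lborel) borel (\<lambda>c. \<Sum>b\<in>B. c b *\<^sub>R b)"
  using subspace_lborel_onb[OF V] by blast
 note B' = orthonormal_basis_of_facts[OF B(1)]
 interpret product_sigma_finite "\<lambda>_::'a. lborel :: real measure"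
  by (simp add: product_sigma_finite_def sigma_finite_lborel)
 let ?f = "\<lambda>b t. exp (- 2 * complex_of_real pi * \<i> * complex_of_real (t * (b \<bullet> \<xi>))) * complex_of_real (exp (- (pi * s * t\<^sup>2)))"
 have int: "integrable lborel (?f b)" for b
 proof (rule integrableI_bounded)
  have "(\<integral>\<^sup>+t. ennreal (norm (?f b t)) \<partial>lborel) = ennreal (1 / sqrt s)"
   using nn_integral_gaussian_real[OF s] by (simp add: norm_mult)
  then show "(\<integral>\<^sup>+t. ennreal (norm (?f b t)) \<partial>lborel) < \<infinity>" by simp
 qed measurable
 have "fourier_on V (\<lambda>x. complex_of_real (exp (- (pi * s * (norm x)\<^sup>2)))) \<xi> = (\<integral>c. (\<Prod>b\<in>B. ?f b (c b)) \<partial>(\<Pi>\<^sub>M b\<in>B. lborel))"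
 proof -
  have "echar (\<Sum>b\<in>B. c b *\<^sub>R b) \<xi> * complex_of_real (exp (- (pi * s * (norm (\<Sum>b\<in>B. c b *\<^sub>R b))\<^sup>2))) = (\<Prod>b\<in>B. ?f b (c b))" for c
   unfolding orthonormal_sum_norm[OF B(1)] prod.distrib echar_def
   using B'(1) by (simp add: inner_sum_left sum_distrib_left exp_sum sum_negf[symmetric])
  then show ?thesis unfolding fourier_on_def B(2) by (subst integral_distr) auto
 qed
 also have "\<dots> = (\<Prod>b\<in>B. \<integral>t. ?f b t \<partial>lborel)"
  using B'(1) int by (rule product_integral_prod)
 also have "\<dots> = (\<Prod>b\<in>B. complex_of_real (1 / sqrt s * exp (- (pi * (b \<bullet> \<xi>)\<^sup>2 / s))))"
  by (simp only: fourier_gaussian_real[OF s])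
 also have "\<dots> = complex_of_real ((1 / sqrt s) ^ dim V * exp (\<Sum>b\<in>B. - (pi * (b \<bullet> \<xi>)\<^sup>2 / s)))"
  using B'(1) by (simp add: prod.distrib B' exp_sum prod_dividef power_divide)
 also have "(\<Sum>b\<in>B. - (pi * (b \<bullet> \<xi>)\<^sup>2 / s)) = - (pi * (norm (orth_proj V \<xi>))\<^sup>2 / s)"
  by (simp add: orth_proj_onb[OF B(1)] orthonormal_sum_norm[OF B(1)] sum_negf sum_divide_distrib sum_distrib_left)
 finally show ?thesis .
qed

lemma echar_mult_formula:
 fixes f g :: "'a::euclidean_space \<Rightarrow> complex"
 assumes "sigma_finite_measure N1" "sigma_finite_measure N2"
  and [measurable_cong]: "sets N1 = sets borel" "sets N2 = sets borel"
  and f: "integrable N1 f" and g: "integrable N2 g"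
 shows "(\<integral>x. f x * (\<integral>\<xi>. echar x \<xi> * g \<xi> \<partial>N2) \<partial>N1) = (\<integral>\<xi>. g \<xi> * (\<integral>x. echar x \<xi> * f x \<partial>N1) \<partial>N2)"
proof -
 interpret pair_sigma_finite N1 N2 using assms by (simp add: pair_sigma_finite_def)
 have [measurable]: "f \<in> borel_measurable N1" "g \<in> borel_measurable N2" using f g by auto
 have fst_borel: "fst \<in> borel_measurable (N1 \<Otimes>\<^sub>M N2)" and snd_borel: "snd \<in> borel_measurable (N1 \<Otimes>\<^sub>M N2)"
  using measurable_fst[of N1 N2] measurable_snd[of N1 N2] by (simp_all cong: measurable_cong_sets)
 note [measurable] = fst_borel snd_borel
 have i: "integrable (N1 \<Otimes>\<^sub>M N2) (\<lambda>z. f (fst z) * (echar (fst z) (snd z) * g (snd z)))"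
 proof (rule integrableI_bounded)
  have "(\<integral>\<^sup>+z. ennreal (norm (f (fst z) * (echar (fst z) (snd z) * g (snd z)))) \<partial>(N1 \<Otimes>\<^sub>M N2)) =
   (\<integral>\<^sup>+x. \<integral>\<^sup>+\<xi>. ennreal (norm (f x)) * ennreal (norm (g \<xi>)) \<partial>N2 \<partial>N1)"
   by (subst M2.nn_integral_fst[symmetric]) (auto simp: norm_mult ennreal_mult)
  also have "\<dots> = (\<integral>\<^sup>+x. ennreal (norm (f x)) \<partial>N1) * (\<integral>\<^sup>+\<xi>. ennreal (norm (g \<xi>)) \<partial>N2)"
   by (simp add: nn_integral_cmult nn_integral_multc)
  also have "\<dots> < \<infinity>" using f g by (simp add: integrable_iff_bounded ennreal_mult_less_top)
  finally show "(\<integral>\<^sup>+z. ennreal (norm (f (fst z) * (echar (fst z) (snd z) * g (snd z)))) \<partial>(N1 \<Otimes>\<^sub>M N2)) < \<infinity>" .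
 qed measurable
 have "(\<integral>x. \<integral>\<xi>. f x * (echar x \<xi> * g \<xi>) \<partial>N2 \<partial>N1) = (\<integral>\<xi>. \<integral>x. f x * (echar x \<xi> * g \<xi>) \<partial>N1 \<partial>N2)"
  using i by (intro Fubini_integral[symmetric]) (simp add: case_prod_beta')
 moreover have "(\<integral>x. f x * (echar x \<xi> * g \<xi>) \<partial>N1) = g \<xi> * (\<integral>x. echar x \<xi> * f x \<partial>N1)" for \<xi>
  by (subst integral_mult_right_zero[symmetric]) (simp add: mult_ac)
 ultimately show ?thesis by simp
qed

lemma norm_integral_le_nn_integral:
 fixes f :: "'b \<Rightarrow> 'c::{banach, second_countable_topology}"
 shows "ennreal (norm (\<integral>x. f x \<partial>N)) \<le> (\<integral>\<^sup>+x. ennreal (norm (f x)) \<partial>N)"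
proof (cases "integrable N f")
 case True
 then show ?thesis by (rule integral_norm_bound_ennreal)
qed (simp add: not_integrable_integral_eq)

lemma norm_fourier_on_le:
 assumes "integrable (subspace_lborel V) b"
 shows "norm (fourier_on V b \<xi>) \<le> (\<integral>x. norm (b x) \<partial>subspace_lborel V)"
 unfolding fourier_on_def
 by (rule order_trans[OF integral_norm_bound]) (simp add: norm_mult)

lemma borel_measurable_fourier_on [measurable]:
 assumes V: "subspace (V::'a::euclidean_space set)" and [measurable]: "b \<in> borel_measurable borel"
 shows "fourier_on V b \<in> borel_measurable borel"
proof -
 interpret sigma_finite_measure "subspace_lborel V" by (rule sigma_finite_subspace_lborel[OF V])
 show ?thesis unfolding fourier_on_def[abs_def] by measurable
qed

text \<open>
 Bessel's inequality: damping \<open>|F b|\<^sup>2\<close> by a Gaussian turns its integral into a double integral of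
 \<open>b\<close> against a Gaussian approximate identity, which is bounded by the arithmetic-geometric mean
 inequality.
\<close>

lemma bessel_damped:
 fixes V :: "'a::euclidean_space set"
 assumes V: "subspace V" and s: "s > 0" and [measurable]: "b \<in> borel_measurable borel"
  and b: "integrable (subspace_lborel V) b"
 shows "(\<integral>\<^sup>+\<xi>. ennreal ((norm (fourier_on V b \<xi>))\<^sup>2 * exp (- (pi * s * (norm \<xi>)\<^sup>2))) \<partial>subspace_lborel V)
  \<le> (\<integral>\<^sup>+x. ennreal ((norm (b x))\<^sup>2) \<partial>subspace_lborel V)"
proof -
 let ?N = "subspace_lborel V"
 let ?G = "\<lambda>\<xi>. complex_of_real (exp (- (pi * s * (norm \<xi>)\<^sup>2)))"
 define H where "H z = (1 / sqrt s) ^ dim V * exp (- (pi * (norm (orth_proj V z))\<^sup>2 / s))" for z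
 note sf = sigma_finite_subspace_lborel[OF V]
 interpret pair_sigma_finite ?N ?N by (rule pair_sigma_finite_subspace_lborel[OF V V])
 note [measurable] = borel_measurable_fourier_on[OF V] borel_measurable_orth_proj[OF V]
 have [measurable]: "H \<in> borel_measurable borel" unfolding H_def by measurable
 have H0: "H z \<ge> 0" for z using s by (simp add: H_def)
 have lin: "linear (orth_proj V)" by (rule orth_proj_linear[OF V])
 have H1: "(\<integral>\<^sup>+y. ennreal (H (x - y)) \<partial>?N) = 1" if "x \<in> V" for x
 proof -
  have "(\<integral>\<^sup>+y. ennreal (H (x - y)) \<partial>?N) = (\<integral>\<^sup>+y. ennreal (H (- x + y)) \<partial>?N)"
   by (intro nn_integral_cong arg_cong[where f=ennreal]) (simp add: H_def linear_diff[OF lin] linear_add[OF lin] linear_neg[OF lin] norm_minus_commute)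
  also have "\<dots> = (\<integral>\<^sup>+y. ennreal (H y) \<partial>?N)"
   by (rule nn_integral_subspace_lborel_translate[OF V]) (use that V in \<open>auto simp: subspace_neg\<close>)
  also have "\<dots> = (\<integral>\<^sup>+y. ennreal ((1 / sqrt s) ^ dim V) * ennreal (exp (- (pi * (1/s) * (norm y)\<^sup>2))) \<partial>?N)"
   using AE_subspace_lborel[OF V] s
   by (intro nn_integral_cong_AE) (auto elim!: eventually_mono simp: H_def orth_proj_id[OF V] ennreal_mult)
  also have "\<dots> = ennreal ((1 / sqrt s) ^ dim V) * ennreal ((1 / sqrt (1/s)) ^ dim V)"
   using s by (subst nn_integral_cmult) (auto simp: nn_integral_gaussian_subspace[OF V, of "1/s", simplified])
  also have "\<dots> = 1" using s by (simp add: ennreal_mult[symmetric] power_mult_distrib[symmetric] real_sqrt_divide)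
  finally show ?thesis .
 qed
 let ?u = "\<lambda>\<xi>. cnj (fourier_on V b \<xi>) * ?G \<xi>"
 have iG: "integrable ?N ?G"
  using integrable_gaussian_subspace[OF V s] by simp
 have iu: "integrable ?N ?u"
 proof (rule Bochner_Integration.integrable_bound)
  show "integrable ?N (\<lambda>\<xi>. (\<integral>x. norm (b x) \<partial>?N) *\<^sub>R ?G \<xi>)" using iG by simp
  show "AE \<xi> in ?N. norm (?u \<xi>) \<le> norm ((\<integral>x. norm (b x) \<partial>?N) *\<^sub>R ?G \<xi>)"
   using norm_fourier_on_le[OF b] by (intro AE_I2) (auto simp: norm_mult intro!: mult_right_mono)
 qed measurable
 have icb: "integrable ?N (\<lambda>y. cnj (b y))" using b by simp
 have inner: "(\<integral>\<xi>. echar x \<xi> * ?u \<xi> \<partial>?N) = (\<integral>y. cnj (b y) * of_real (H (x - y)) \<partial>?N)" for x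
 proof -
  have "(\<integral>\<xi>. echar x \<xi> * ?u \<xi> \<partial>?N) = (\<integral>\<xi>. (echar x \<xi> * ?G \<xi>) * (\<integral>y. echar (- \<xi>) y * cnj (b y) \<partial>?N) \<partial>?N)"
  proof (rule Bochner_Integration.integral_cong[OF refl])
   fix \<xi>
   have "cnj (fourier_on V b \<xi>) = (\<integral>y. cnj (echar y \<xi> * b y) \<partial>?N)"
    unfolding fourier_on_def by (rule Bochner_Integration.integral_cnj[symmetric])
   also have "\<dots> = (\<integral>y. echar (- \<xi>) y * cnj (b y) \<partial>?N)"
    by (simp add: cnj_echar) (simp add: echar_def inner_commute)
   finally show "echar x \<xi> * ?u \<xi> = (echar x \<xi> * ?G \<xi>) * (\<integral>y. echar (- \<xi>) y * cnj (b y) \<partial>?N)" by simp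
  qed
  also have "\<dots> = (\<integral>\<xi>. (echar x (- \<xi>) * ?G (- \<xi>)) * (\<integral>y. echar \<xi> y * cnj (b y) \<partial>?N) \<partial>distr ?N borel uminus)"
   by (subst integral_distr) auto
  also have "distr ?N borel uminus = ?N"
  proof (rule measure_eqI)
   fix A assume "A \<in> sets (distr ?N borel uminus)"
   then have [measurable]: "A \<in> sets borel" by simp
   have T: "orthogonal_transformation (uminus :: 'a \<Rightarrow> 'a)"
    by (simp add: orthogonal_transformation_neg orthogonal_transformation_id[unfolded id_def])
   have "uminus ` V = V" using V by (auto simp: image_iff subspace_neg) (metis minus_minus subspace_neg)
   then have "(\<integral>\<^sup>+x. indicator A (- x) \<partial>?N) = (\<integral>\<^sup>+x. indicator A x \<partial>?N)"
    using nn_integral_subspace_lborel_image[OF T V, of "indicator A"] by simp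
   then show "emeasure (distr ?N borel uminus) A = emeasure ?N A"
    by (subst nn_integral_indicator[symmetric]) (auto simp: nn_integral_distr simp del: nn_integral_indicator, simp)
  qed simp
  also have "(\<integral>\<xi>. (echar x (- \<xi>) * ?G (- \<xi>)) * (\<integral>y. echar \<xi> y * cnj (b y) \<partial>?N) \<partial>?N) =
    (\<integral>y. cnj (b y) * (\<integral>\<xi>. echar \<xi> y * (echar x (- \<xi>) * ?G (- \<xi>)) \<partial>?N) \<partial>?N)"
  proof (rule echar_mult_formula[OF sf sf _ _ _ icb])
   show "integrable ?N (\<lambda>\<xi>. echar x (- \<xi>) * ?G (- \<xi>))"
    by (rule Bochner_Integration.integrable_bound[OF iG]) (measurable, simp add: norm_mult)
  qed auto
  also have "\<dots> = (\<integral>y. cnj (b y) * of_real (H (x - y)) \<partial>?N)"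
  proof (intro Bochner_Integration.integral_cong[OF refl] arg_cong2[where f="(*)"] refl)
   fix y
   have "(\<integral>\<xi>. echar \<xi> y * (echar x (- \<xi>) * ?G (- \<xi>)) \<partial>?N) = fourier_on V ?G (y - x)"
    unfolding fourier_on_def
    by (intro Bochner_Integration.integral_cong refl) (simp add: echar_def exp_add[symmetric] inner_diff_right inner_commute algebra_simps)
   then show "(\<integral>\<xi>. echar \<xi> y * (echar x (- \<xi>) * ?G (- \<xi>)) \<partial>?N) = of_real (H (x - y))"
    unfolding fourier_gaussian_subspace[OF V s] by (simp add: H_def linear_diff[OF lin] norm_minus_commute)
  qed
  finally show ?thesis .
 qed
 have "(\<integral>\<^sup>+\<xi>. ennreal ((norm (fourier_on V b \<xi>))\<^sup>2 * exp (- (pi * s * (norm \<xi>)\<^sup>2))) \<partial>?N) =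
   ennreal (norm (\<integral>\<xi>. ?u \<xi> * fourier_on V b \<xi> \<partial>?N))"
 proof -
  let ?r = "\<lambda>\<xi>. (norm (fourier_on V b \<xi>))\<^sup>2 * exp (- (pi * s * (norm \<xi>)\<^sup>2))"
  have e: "?u \<xi> * fourier_on V b \<xi> = complex_of_real (?r \<xi>)" for \<xi>
   using complex_norm_square[of "fourier_on V b \<xi>"] by (simp add: mult_ac)
  have "integrable ?N (\<lambda>\<xi>. ?u \<xi> * fourier_on V b \<xi>)"
  proof (rule Bochner_Integration.integrable_bound)
   show "integrable ?N (\<lambda>\<xi>. (\<integral>x. norm (b x) \<partial>?N) *\<^sub>R ?u \<xi>)" using iu by simp
   show "AE \<xi> in ?N. norm (?u \<xi> * fourier_on V b \<xi>) \<le> norm ((\<integral>x. norm (b x) \<partial>?N) *\<^sub>R ?u \<xi>)"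
    using norm_fourier_on_le[OF b] by (intro AE_I2) (auto simp: norm_mult mult.commute[of _ "norm (fourier_on V b _)"] intro!: mult_right_mono)
  qed measurable
  then have "integrable ?N (\<lambda>\<xi>. complex_of_real (?r \<xi>))" by (simp only: e)
  then have i: "integrable ?N ?r" by (simp only: complex_of_real_integrable_eq)
  have "(\<integral>\<^sup>+\<xi>. ennreal (?r \<xi>) \<partial>?N) = ennreal (\<integral>\<xi>. ?r \<xi> \<partial>?N)"
   by (rule nn_integral_eq_integral[OF i]) simp
  also have "(\<integral>\<xi>. ?r \<xi> \<partial>?N) = norm (\<integral>\<xi>. complex_of_real (?r \<xi>) \<partial>?N)"
   by (simp only: integral_complex_of_real norm_of_real) (simp add: abs_of_nonneg)
  finally show ?thesis by (simp only: e)
 qed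
 also have "(\<integral>\<xi>. ?u \<xi> * fourier_on V b \<xi> \<partial>?N) = (\<integral>x. b x * (\<integral>\<xi>. echar x \<xi> * ?u \<xi> \<partial>?N) \<partial>?N)"
  unfolding fourier_on_def[of V b] by (rule echar_mult_formula[OF sf sf _ _ b iu[unfolded fourier_on_def[of V b]], symmetric]) auto
 also have "\<dots> = (\<integral>x. b x * (\<integral>y. cnj (b y) * of_real (H (x - y)) \<partial>?N) \<partial>?N)"
  by (simp only: inner)
 also have "ennreal (norm \<dots>) \<le> (\<integral>\<^sup>+x. ennreal (norm (b x * (\<integral>y. cnj (b y) * of_real (H (x - y)) \<partial>?N))) \<partial>?N)"
  by (rule norm_integral_le_nn_integral)
 also have "\<dots> \<le> (\<integral>\<^sup>+x. \<integral>\<^sup>+y. ennreal (norm (b x) * norm (b y) * H (x - y)) \<partial>?N \<partial>?N)"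
 proof (rule nn_integral_mono)
  fix x
  have "ennreal (norm (b x * (\<integral>y. cnj (b y) * of_real (H (x - y)) \<partial>?N))) =
    ennreal (norm (b x)) * ennreal (norm (\<integral>y. cnj (b y) * of_real (H (x - y)) \<partial>?N))"
   by (simp add: norm_mult ennreal_mult)
  also have "\<dots> \<le> ennreal (norm (b x)) * (\<integral>\<^sup>+y. ennreal (norm (cnj (b y) * of_real (H (x - y)))) \<partial>?N)"
   by (intro mult_left_mono norm_integral_le_nn_integral) simp
  also have "\<dots> = (\<integral>\<^sup>+y. ennreal (norm (b x) * norm (b y) * H (x - y)) \<partial>?N)"
   using H0 by (subst nn_integral_cmult[symmetric]) (auto simp: norm_mult ennreal_mult[symmetric] mult.assoc)
  finally show "ennreal (norm (b x * (\<integral>y. cnj (b y) * of_real (H (x - y)) \<partial>?N))) \<le>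
    (\<integral>\<^sup>+y. ennreal (norm (b x) * norm (b y) * H (x - y)) \<partial>?N)" .
 qed
 also have "\<dots> \<le> (\<integral>\<^sup>+x. \<integral>\<^sup>+y. ennreal ((norm (b x))\<^sup>2 / 2) * ennreal (H (x - y)) + ennreal ((norm (b y))\<^sup>2 / 2) * ennreal (H (x - y)) \<partial>?N \<partial>?N)"
 proof (intro nn_integral_mono)
  fix x y
  have "norm (b x) * norm (b y) \<le> (norm (b x))\<^sup>2 / 2 + (norm (b y))\<^sup>2 / 2"
   using sum_squares_bound[of "norm (b x)" "norm (b y)"] by (simp add: field_simps)
  then have "norm (b x) * norm (b y) * H (x - y) \<le> ((norm (b x))\<^sup>2 / 2 + (norm (b y))\<^sup>2 / 2) * H (x - y)"
   using H0 by (intro mult_right_mono)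
  then show "ennreal (norm (b x) * norm (b y) * H (x - y)) \<le> ennreal ((norm (b x))\<^sup>2 / 2) * ennreal (H (x - y)) + ennreal ((norm (b y))\<^sup>2 / 2) * ennreal (H (x - y))"
   using H0 by (simp add: ennreal_mult[symmetric] ennreal_plus[symmetric] distrib_right ennreal_leI del: ennreal_plus)
 qed
 also have "\<dots> = (\<integral>\<^sup>+x. ennreal ((norm (b x))\<^sup>2 / 2) * (\<integral>\<^sup>+y. ennreal (H (x - y)) \<partial>?N) \<partial>?N) +
   (\<integral>\<^sup>+x. \<integral>\<^sup>+y. ennreal ((norm (b y))\<^sup>2 / 2) * ennreal (H (x - y)) \<partial>?N \<partial>?N)"
  by (simp add: nn_integral_add nn_integral_cmult)
 also have "(\<integral>\<^sup>+x. \<integral>\<^sup>+y. ennreal ((norm (b y))\<^sup>2 / 2) * ennreal (H (x - y)) \<partial>?N \<partial>?N) =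
   (\<integral>\<^sup>+y. \<integral>\<^sup>+x. ennreal ((norm (b y))\<^sup>2 / 2) * ennreal (H (x - y)) \<partial>?N \<partial>?N)"
  by (rule Fubini') measurable
 also have "\<dots> = (\<integral>\<^sup>+y. ennreal ((norm (b y))\<^sup>2 / 2) * (\<integral>\<^sup>+x. ennreal (H (y - x)) \<partial>?N) \<partial>?N)"
  by (simp add: nn_integral_cmult H_def linear_diff[OF lin] norm_minus_commute)
 also have "(\<integral>\<^sup>+x. ennreal ((norm (b x))\<^sup>2 / 2) * (\<integral>\<^sup>+y. ennreal (H (x - y)) \<partial>?N) \<partial>?N) = (\<integral>\<^sup>+x. ennreal ((norm (b x))\<^sup>2 / 2) \<partial>?N)"
  using AE_subspace_lborel[OF V] by (intro nn_integral_cong_AE) (auto elim!: eventually_mono simp: H1)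
 also have "(\<integral>\<^sup>+x. ennreal ((norm (b x))\<^sup>2 / 2) \<partial>?N) + (\<integral>\<^sup>+x. ennreal ((norm (b x))\<^sup>2 / 2) \<partial>?N) = (\<integral>\<^sup>+x. ennreal ((norm (b x))\<^sup>2) \<partial>?N)"
  by (subst nn_integral_add[symmetric]) (auto simp: ennreal_plus[symmetric] simp del: ennreal_plus)
 finally show ?thesis .
qed

lemma bessel_inequality:
 fixes V :: "'a::euclidean_space set"
 assumes V: "subspace V" and [measurable]: "b \<in> borel_measurable borel"
  and b: "integrable (subspace_lborel V) b"
 shows "(\<integral>\<^sup>+\<xi>. ennreal ((norm (fourier_on V b \<xi>))\<^sup>2) \<partial>subspace_lborel V)
  \<le> (\<integral>\<^sup>+x. ennreal ((norm (b x))\<^sup>2) \<partial>subspace_lborel V)" (is "_ \<le> ?C")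
proof -
 let ?N = "subspace_lborel V"
 let ?F = "\<lambda>j \<xi>. ennreal ((norm (fourier_on V b \<xi>))\<^sup>2 * exp (- (pi * inverse (real (Suc j)) * (norm \<xi>)\<^sup>2)))"
 note [measurable] = borel_measurable_fourier_on[OF V]
 have "(\<lambda>j. ?F j \<xi>) \<longlonglongrightarrow> ennreal ((norm (fourier_on V b \<xi>))\<^sup>2 * exp (- (pi * 0 * (norm \<xi>)\<^sup>2)))" for \<xi>
  by (intro tendsto_intros LIMSEQ_inverse_real_of_nat)
 then have "(\<integral>\<^sup>+\<xi>. ennreal ((norm (fourier_on V b \<xi>))\<^sup>2) \<partial>?N) = (\<integral>\<^sup>+\<xi>. liminf (\<lambda>j. ?F j \<xi>) \<partial>?N)"
  by (intro nn_integral_cong lim_imp_Liminf[symmetric]) auto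
 also have "\<dots> \<le> liminf (\<lambda>j. \<integral>\<^sup>+\<xi>. ?F j \<xi> \<partial>?N)"
  by (rule nn_integral_liminf) measurable
 also have "\<dots> \<le> liminf (\<lambda>j. ?C)"
  by (intro Liminf_mono always_eventually allI bessel_damped[OF V _ assms(2) b]) simp
 finally show ?thesis by (simp add: Liminf_const)
qed

section \<open>Schwartz functions\<close>

definition rapid_decay :: "('a::euclidean_space \<Rightarrow> 'b::real_normed_vector) \<Rightarrow> bool" where
 "rapid_decay f \<longleftrightarrow> (\<forall>N::nat. \<exists>C. \<forall>x. norm (f x) \<le> C * weight x ^ N)"

lemma rapid_decayD:
 assumes "rapid_decay f"
 shows "\<exists>C\<ge>0. \<forall>x. norm (f x) \<le> C * weight x ^ N"
proof -
 obtain C where C: "\<forall>x. norm (f x) \<le> C * weight x ^ N" using assms by (auto simp: rapid_decay_def)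
 have "0 \<le> C * weight (0::'a) ^ N" using C norm_ge_zero order_trans by blast
 then have "C \<ge> 0" by (simp add: weight_def)
 then show ?thesis using C by blast
qed

lemma rapid_decay_diff:
 fixes f g :: "'a::euclidean_space \<Rightarrow> 'b::real_normed_vector"
 assumes "rapid_decay f" "rapid_decay g"
 shows "rapid_decay (\<lambda>x. f x - g x)"
 unfolding rapid_decay_def
proof
 fix N
 obtain C D where C: "\<And>x. norm (f x) \<le> C * weight x ^ N" and D: "\<And>x. norm (g x) \<le> D * weight x ^ N"
  using assms by (meson rapid_decayD)
 have "norm (f x - g x) \<le> (C + D) * weight x ^ N" for x
  using norm_triangle_ineq4[of "f x" "g x"] C[of x] D[of x] by (simp add: distrib_right)
 then show "\<exists>C. \<forall>x. norm (f x - g x) \<le> C * weight x ^ N" by blast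
qed

lemma rapid_decay_bound:
 assumes "rapid_decay f" "\<And>x. norm (g x) \<le> norm (f x)"
 shows "rapid_decay g"
 using assms unfolding rapid_decay_def by (meson order_trans)

lemma integrable_weight_subspace:
 fixes V :: "'a::euclidean_space set"
 assumes V: "subspace V" and N: "N \<ge> dim V"
 shows "integrable (subspace_lborel V) (\<lambda>x. weight x ^ N)"
proof (rule integrableI_bounded)
 have "(\<integral>\<^sup>+x. ennreal (norm (weight x ^ N)) \<partial>subspace_lborel V) \<le> ennreal (pi ^ dim V)"
  using nn_integral_weight_subspace[OF V N] by (simp add: abs_of_nonneg weight_bounds)
 then show "(\<integral>\<^sup>+x. ennreal (norm (weight x ^ N)) \<partial>subspace_lborel V) < \<infinity>"
  by (rule order.strict_trans1) simp
qed measurable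

lemma rapid_decay_integrable_subspace:
 fixes V :: "'a::euclidean_space set" and f :: "'a \<Rightarrow> 'b::{banach, second_countable_topology}"
 assumes f: "rapid_decay f" and V: "subspace V" and [measurable]: "f \<in> borel_measurable borel"
 shows "integrable (subspace_lborel V) f"
proof -
 obtain C where C: "C \<ge> 0" "\<And>x. norm (f x) \<le> C * weight x ^ dim V" using rapid_decayD[OF f] by blast
 show ?thesis
 proof (rule Bochner_Integration.integrable_bound)
  show "integrable (subspace_lborel V) (\<lambda>x. C * weight x ^ dim V)"
   using integrable_weight_subspace[OF V order_refl] by simp
  show "AE x in subspace_lborel V. norm (f x) \<le> norm (C * weight x ^ dim V)"
   using C by (intro AE_I2) (simp add: abs_of_nonneg weight_bounds)
 qed measurable
qed

lemma rapid_decay_integrable: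
 fixes f :: "'a::euclidean_space \<Rightarrow> 'b::{banach, second_countable_topology}"
 assumes "rapid_decay f" "f \<in> borel_measurable borel"
 shows "integrable lborel f"
 using rapid_decay_integrable_subspace[OF assms(1) subspace_UNIV assms(2)] by (simp add: subspace_lborel_UNIV)

lemma schwartz_rapid_decay:
 assumes "schwartz f"
 shows "rapid_decay f"
 unfolding rapid_decay_def
proof
 fix N
 have "[] \<in> lists (Basis :: 'a set)" by simp
 from bspec[OF assms[unfolded schwartz_def] this]
 have "\<forall>N::nat. \<exists>C. \<forall>x. norm (f x) \<le> C * (1 + (norm x)\<^sup>2) powr (- real N / 2)" by simp
 then obtain C where C: "\<forall>x. norm (f x) \<le> C * (1 + (norm x)\<^sup>2) powr (- real (2 * N) / 2)"
  by blast
 have "(1 + (norm x)\<^sup>2) powr (- real (2 * N) / 2) = weight x ^ N" for x :: 'a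
 proof -
  have pos: "0 < 1 + (norm x)\<^sup>2" by (rule add_pos_nonneg) auto
  have "- real (2 * N) / 2 = - real N" by simp
  then show ?thesis
   by (simp only: powr_minus powr_realpow[OF pos] weight_def power_one_over inverse_eq_divide)
 qed
 then show "\<exists>C. \<forall>x. norm (f x) \<le> C * weight x ^ N" using C by auto
qed

lemma schwartz_differentiable:
 assumes "schwartz f"
 shows "f differentiable (at x)"
proof -
 have "[] \<in> lists (Basis :: 'a set)" by simp
 from bspec[OF assms[unfolded schwartz_def] this] show ?thesis by simp
qed

lemma schwartz_continuous: "schwartz f \<Longrightarrow> continuous_on UNIV f"
 by (intro continuous_at_imp_continuous_on ballI differentiable_imp_continuous_within schwartz_differentiable)

lemma schwartz_borel: "schwartz f \<Longrightarrow> f \<in> borel_measurable borel"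
 by (rule borel_measurable_continuous_onI) (rule schwartz_continuous)

lemma iter_deriv_append: "iter_deriv (us @ vs) f = iter_deriv us (iter_deriv vs f)"
 by (induction us) auto

lemma schwartz_deriv:
 assumes "schwartz f" "b \<in> Basis"
 shows "schwartz (\<lambda>x. frechet_derivative f (at x) b)"
proof -
 have "(\<lambda>x. frechet_derivative f (at x) b) = iter_deriv [b] f" by simp
 then show ?thesis
  unfolding schwartz_def using assms
  by (simp only: iter_deriv_append[symmetric]) (auto simp: schwartz_def)
qed

lemma weight_shift:
 assumes "norm b \<le> 1"
 shows "weight (x + b :: 'a::euclidean_space) \<le> 3 * weight x"
proof -
 have "norm x \<le> norm (x + b) + 1" using norm_triangle_ineq4[of "x + b" b] assms by simp
 then have "(norm x)\<^sup>2 \<le> (norm (x + b) + 1)\<^sup>2" by (intro power_mono) auto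
 also have "\<dots> \<le> 2 * (norm (x + b))\<^sup>2 + 2"
  using sum_squares_bound[of "norm (x + b)" 1] by (simp add: power2_sum)
 also have "\<dots> \<le> 3 * (norm (x + b))\<^sup>2 + 2" by simp
 finally have "1 + (norm x)\<^sup>2 \<le> 3 * (1 + (norm (x + b))\<^sup>2)" by simp
 then show ?thesis
  by (simp add: weight_def field_simps add_pos_nonneg)
qed

lemma difference_quotient_bound:
 fixes \<phi> :: "'a::euclidean_space \<Rightarrow> complex"
 assumes \<phi>: "schwartz \<phi>" and b: "b \<in> Basis"
  and C: "C \<ge> 0" "\<And>x. norm (frechet_derivative \<phi> (at x) b) \<le> C * weight x ^ N"
  and c: "0 < c" "c \<le> (1::real)"
 shows "norm ((\<phi> (x + c *\<^sub>R b) - \<phi> x) /\<^sub>R c) \<le> C * 3 ^ N * weight x ^ N"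
proof -
 let ?g = "\<lambda>t. \<phi> (x + t *\<^sub>R b)" and ?B = "C * 3 ^ N * weight x ^ N"
 have lin: "linear (frechet_derivative \<phi> (at y))" for y
  using linear_frechet_derivative[OF schwartz_differentiable[OF \<phi>]] .
 have "norm (?g c - ?g 0) \<le> ?B * norm (c - 0)"
 proof (rule differentiable_bound[of "{0..c}"])
  fix t assume t: "t \<in> {0..c}"
  have "(\<phi> has_derivative frechet_derivative \<phi> (at (x + t *\<^sub>R b))) (at (x + t *\<^sub>R b))"
   using frechet_derivative_works schwartz_differentiable[OF \<phi>] by blast
  moreover have "((\<lambda>t. x + t *\<^sub>R b) has_derivative (\<lambda>h. h *\<^sub>R b)) (at t within {0..c})"
   by (auto intro!: derivative_eq_intros)
  ultimately show "(?g has_derivative (\<lambda>h. frechet_derivative \<phi> (at (x + t *\<^sub>R b)) (h *\<^sub>R b))) (at t within {0..c})"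
   using has_derivative_compose by blast
  have "norm (t *\<^sub>R b) \<le> 1" using t c b by simp
  then have "weight (x + t *\<^sub>R b) ^ N \<le> (3 * weight x) ^ N"
   using weight_bounds by (intro power_mono weight_shift) auto
  then have "C * weight (x + t *\<^sub>R b) ^ N \<le> ?B"
   using mult_left_mono[OF _ C(1)] by (simp add: power_mult_distrib mult.assoc)
  then have "norm (frechet_derivative \<phi> (at (x + t *\<^sub>R b)) b) \<le> ?B" using C(2) order_trans by blast
  then show "onorm (\<lambda>h. frechet_derivative \<phi> (at (x + t *\<^sub>R b)) (h *\<^sub>R b)) \<le> ?B"
   by (intro onorm_le) (simp add: linear_scale[OF lin] mult.commute[of _ "\<bar>_\<bar>"] mult_left_mono)
 qed (use c in auto)
 then have "norm (\<phi> (x + c *\<^sub>R b) - \<phi> x) \<le> ?B * c" using c by simp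
 then have "norm (\<phi> (x + c *\<^sub>R b) - \<phi> x) / c \<le> ?B" using c by (simp only: pos_divide_le_eq)
 moreover have "norm ((\<phi> (x + c *\<^sub>R b) - \<phi> x) /\<^sub>R c) = norm (\<phi> (x + c *\<^sub>R b) - \<phi> x) / c"
  using c unfolding norm_scaleR by (simp add: divide_inverse mult.commute)
 ultimately show ?thesis by simp
qed

lemma fourier_deriv:
 fixes \<phi> :: "'a::euclidean_space \<Rightarrow> complex"
 assumes \<phi>: "schwartz \<phi>" and b: "b \<in> Basis"
 shows "fourier (\<lambda>x. frechet_derivative \<phi> (at x) b) \<xi> = (2 * complex_of_real pi * \<i> * complex_of_real (b \<bullet> \<xi>)) * fourier \<phi> \<xi>"
proof -
 let ?D = "\<lambda>x. frechet_derivative \<phi> (at x) b" and ?n = "DIM('a)"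
 define c where "c j = inverse (real (Suc j))" for j
 have c: "0 < c j" "c j \<le> 1" for j by (auto simp: c_def inverse_le_1_iff)
 have c0: "c \<longlonglongrightarrow> 0" unfolding c_def by (rule LIMSEQ_inverse_real_of_nat)
 let ?q = "\<lambda>j x. (\<phi> (x + c j *\<^sub>R b) - \<phi> x) /\<^sub>R c j"
 note [measurable] = schwartz_borel[OF \<phi>] schwartz_borel[OF schwartz_deriv[OF \<phi> b]]
 obtain C where C: "C \<ge> 0" "\<And>x. norm (?D x) \<le> C * weight x ^ ?n"
  using rapid_decayD[OF schwartz_rapid_decay[OF schwartz_deriv[OF \<phi> b]]] by blast
 have q: "(\<lambda>j. ?q j x) \<longlonglongrightarrow> ?D x" for x
 proof -
  have d: "(\<phi> has_derivative frechet_derivative \<phi> (at x)) (at x)"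
   using frechet_derivative_works schwartz_differentiable[OF \<phi>] by blast
  have "((\<lambda>h. norm (\<phi> (x + h) - \<phi> x - frechet_derivative \<phi> (at x) h) / norm h) \<longlongrightarrow> 0) (at 0)"
   using d by (simp add: has_derivative_at)
  moreover have "filterlim (\<lambda>j. c j *\<^sub>R b) (at 0) sequentially"
  proof (rule filterlim_atI)
   have "(\<lambda>j. c j *\<^sub>R b) \<longlonglongrightarrow> 0 *\<^sub>R b" by (intro tendsto_scaleR c0 tendsto_const)
   then show "(\<lambda>j. c j *\<^sub>R b) \<longlonglongrightarrow> 0" by simp
   show "\<forall>\<^sub>F j in sequentially. c j *\<^sub>R b \<noteq> 0"
    using b nonzero_Basis c(1) by (intro always_eventually) (auto simp: less_imp_neq[symmetric])
  qed
  ultimately have "(\<lambda>j. norm (\<phi> (x + c j *\<^sub>R b) - \<phi> x - frechet_derivative \<phi> (at x) (c j *\<^sub>R b)) / norm (c j *\<^sub>R b)) \<longlonglongrightarrow> 0"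
   by (rule filterlim_compose)
  moreover have "norm (\<phi> (x + c j *\<^sub>R b) - \<phi> x - frechet_derivative \<phi> (at x) (c j *\<^sub>R b)) / norm (c j *\<^sub>R b) = norm (?q j x - ?D x)" for j
  proof -
   have "?q j x - ?D x = (\<phi> (x + c j *\<^sub>R b) - \<phi> x - frechet_derivative \<phi> (at x) (c j *\<^sub>R b)) /\<^sub>R c j"
    using c(1)[of j] linear_scale[OF linear_frechet_derivative[OF schwartz_differentiable[OF \<phi>]]]
    by (simp add: scaleR_diff_right)
   then show ?thesis using c(1)[of j] b by (simp add: divide_inverse mult.commute)
  qed
  ultimately have "(\<lambda>j. norm (?q j x - ?D x)) \<longlonglongrightarrow> 0" by simp
  then show ?thesis using Lim_null tendsto_norm_zero_iff by blast
 qed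
 have lim1: "(\<lambda>j. \<integral>x. echar x \<xi> * ?q j x \<partial>lborel) \<longlonglongrightarrow> (\<integral>x. echar x \<xi> * ?D x \<partial>lborel)"
 proof (rule integral_dominated_convergence[where w="\<lambda>x. C * 3 ^ ?n * weight x ^ ?n"])
  show "integrable lborel (\<lambda>x::'a. C * 3 ^ ?n * weight x ^ ?n)"
   using integrable_weight_subspace[OF subspace_UNIV[where 'a='a], of ?n] by (simp add: subspace_lborel_UNIV)
  show "AE x in lborel. (\<lambda>j. echar x \<xi> * ?q j x) \<longlonglongrightarrow> echar x \<xi> * ?D x"
   using q by (intro AE_I2 tendsto_mult tendsto_const)
  show "AE x in lborel. norm (echar x \<xi> * ?q j x) \<le> C * 3 ^ ?n * weight x ^ ?n" for j
   using difference_quotient_bound[OF \<phi> b C c] by (intro AE_I2) (simp only: norm_mult norm_echar mult_1_left)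
 qed measurable
 have i: "integrable lborel (\<lambda>x. echar x \<xi> * \<phi> x)"
  by (rule Bochner_Integration.integrable_bound[OF rapid_decay_integrable[OF schwartz_rapid_decay[OF \<phi>]]])
   (auto simp: norm_mult)
 have sh: "(\<integral>x. echar x \<xi> * \<phi> (x + v) \<partial>lborel) = echar (- v) \<xi> * fourier \<phi> \<xi>"
  and ish: "integrable lborel (\<lambda>x. echar x \<xi> * \<phi> (x + v))" for v
 proof -
  have e: "echar x \<xi> * \<phi> (x + v) = echar (- v) \<xi> * (echar (v + x) \<xi> * \<phi> (v + x))" for x
   by (simp add: mult.assoc[symmetric] echar_add_left[symmetric] add.commute)
  have "(\<integral>x. echar (v + x) \<xi> * \<phi> (v + x) \<partial>lborel) = (\<integral>x. echar x \<xi> * \<phi> x \<partial>distr lborel borel ((+) v))"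
   by (subst integral_distr) auto
  then show "(\<integral>x. echar x \<xi> * \<phi> (x + v) \<partial>lborel) = echar (- v) \<xi> * fourier \<phi> \<xi>"
   by (simp add: e lborel_distr_plus fourier_echar)
  have "integrable (distr lborel borel ((+) v)) (\<lambda>x. echar x \<xi> * \<phi> x)" using i by (simp add: lborel_distr_plus)
  then have "integrable lborel (\<lambda>x. echar (v + x) \<xi> * \<phi> (v + x))" by (subst (asm) integrable_distr_eq) auto
  then show "integrable lborel (\<lambda>x. echar x \<xi> * \<phi> (x + v))" unfolding e by (rule integrable_mult_right)
 qed
 have q_eq: "(\<integral>x. echar x \<xi> * ?q j x \<partial>lborel) = ((echar (- (c j *\<^sub>R b)) \<xi> - 1) /\<^sub>R c j) * fourier \<phi> \<xi>" for j
 proof -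
  have "(\<integral>x. echar x \<xi> * ?q j x \<partial>lborel) = (\<integral>x. (echar x \<xi> * \<phi> (x + c j *\<^sub>R b) - echar x \<xi> * \<phi> x) /\<^sub>R c j \<partial>lborel)"
   by (intro Bochner_Integration.integral_cong refl) (simp add: algebra_simps)
  also have "\<dots> = ((\<integral>x. echar x \<xi> * \<phi> (x + c j *\<^sub>R b) \<partial>lborel) - (\<integral>x. echar x \<xi> * \<phi> x \<partial>lborel)) /\<^sub>R c j"
   by (simp add: Bochner_Integration.integral_diff[OF ish i])
  also have "\<dots> = ((echar (- (c j *\<^sub>R b)) \<xi> - 1) /\<^sub>R c j) * fourier \<phi> \<xi>"
   unfolding sh by (simp add: fourier_echar algebra_simps)
  finally show ?thesis .
 qed
 have lim2: "(\<lambda>j. ((echar (- (c j *\<^sub>R b)) \<xi> - 1) /\<^sub>R c j) * fourier \<phi> \<xi>) \<longlonglongrightarrow> (2 * complex_of_real pi * \<i> * complex_of_real (b \<bullet> \<xi>)) * fourier \<phi> \<xi>"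
 proof (intro tendsto_mult tendsto_const)
  let ?z = "2 * complex_of_real pi * \<i> * complex_of_real (b \<bullet> \<xi>)"
  have "((\<lambda>w. exp (w * ?z)) has_field_derivative ?z) (at 0)"
   by (auto intro!: derivative_eq_intros)
  then have "((\<lambda>h. (exp (h * ?z) - 1) / h) \<longlongrightarrow> ?z) (at 0)"
   by (simp add: DERIV_def)
  moreover have "filterlim (\<lambda>j. complex_of_real (c j)) (at 0) sequentially"
  proof (rule filterlim_atI)
   show "(\<lambda>j. complex_of_real (c j)) \<longlonglongrightarrow> 0" using tendsto_of_real[OF c0, where 'a=complex] by simp
   show "\<forall>\<^sub>F j in sequentially. complex_of_real (c j) \<noteq> 0"
    using c(1) by (intro always_eventually) (auto simp: less_imp_neq[symmetric])
  qed
  ultimately have "(\<lambda>j. (exp (complex_of_real (c j) * ?z) - 1) / complex_of_real (c j)) \<longlonglongrightarrow> ?z"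
   by (rule filterlim_compose)
  moreover have "(exp (complex_of_real (c j) * ?z) - 1) / complex_of_real (c j) = (echar (- (c j *\<^sub>R b)) \<xi> - 1) /\<^sub>R c j" for j
   by (simp add: echar_def scaleR_conv_of_real divide_inverse mult_ac)
  ultimately show "(\<lambda>j. (echar (- (c j *\<^sub>R b)) \<xi> - 1) /\<^sub>R c j) \<longlonglongrightarrow> ?z" by simp
 qed
 have "(\<integral>x. echar x \<xi> * ?D x \<partial>lborel) = (2 * complex_of_real pi * \<i> * complex_of_real (b \<bullet> \<xi>)) * fourier \<phi> \<xi>"
  by (rule LIMSEQ_unique[OF lim1[unfolded q_eq] lim2])
 then show ?thesis by (simp only: fourier_echar)
qed

lemma fourier_bounded:
 fixes \<phi> :: "'a::euclidean_space \<Rightarrow> complex"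
 shows "norm (fourier \<phi> \<xi>) \<le> (\<integral>x. norm (\<phi> x) \<partial>lborel)"
 unfolding fourier_echar by (rule order_trans[OF integral_norm_bound]) (simp add: norm_mult)

lemma fourier_power_bounded:
 fixes \<phi> :: "'a::euclidean_space \<Rightarrow> complex"
 assumes "schwartz \<phi>" and b: "b \<in> Basis"
 shows "\<exists>C. \<forall>\<xi>. \<bar>b \<bullet> \<xi>\<bar> ^ N * norm (fourier \<phi> \<xi>) \<le> C"
 using assms(1)
proof (induction N arbitrary: \<phi>)
 case 0
 then show ?case using fourier_bounded[of \<phi>] by auto
next
 case (Suc N)
 obtain C where C: "\<And>\<xi>. \<bar>b \<bullet> \<xi>\<bar> ^ N * norm (fourier (\<lambda>x. frechet_derivative \<phi> (at x) b) \<xi>) \<le> C"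
  using Suc.IH[OF schwartz_deriv[OF Suc.prems b]] by blast
 have "\<bar>b \<bullet> \<xi>\<bar> ^ Suc N * norm (fourier \<phi> \<xi>) \<le> C" for \<xi>
 proof -
  have "1 * (\<bar>b \<bullet> \<xi>\<bar> ^ Suc N * norm (fourier \<phi> \<xi>)) \<le> (2 * pi) * (\<bar>b \<bullet> \<xi>\<bar> ^ Suc N * norm (fourier \<phi> \<xi>))"
   using pi_ge_two by (intro mult_right_mono) auto
  also have "\<dots> = \<bar>b \<bullet> \<xi>\<bar> ^ N * norm (fourier (\<lambda>x. frechet_derivative \<phi> (at x) b) \<xi>)"
   unfolding fourier_deriv[OF Suc.prems b] by (simp add: norm_mult)
  finally show ?thesis using C[of \<xi>] by simp
 qed
 then show ?case by blast
qed

text \<open>The Fourier transform turns derivatives into powers of \<open>\<xi>\<close>.\<close>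

lemma fourier_rapid_decay:
 fixes \<phi> :: "'a::euclidean_space \<Rightarrow> complex"
 assumes \<phi>: "schwartz \<phi>"
 shows "rapid_decay (fourier \<phi>)"
 unfolding rapid_decay_def
proof
 fix N
 have "\<forall>b\<in>Basis. \<exists>C. \<forall>\<xi>. \<bar>b \<bullet> \<xi>\<bar> ^ (2 * N) * norm (fourier \<phi> \<xi>) \<le> C"
  using fourier_power_bounded[OF \<phi>] by blast
 then obtain C where C: "\<And>b \<xi>. b \<in> Basis \<Longrightarrow> \<bar>b \<bullet> \<xi>\<bar> ^ (2 * N) * norm (fourier \<phi> \<xi>) \<le> C b"
  by metis
 define K where "K = (\<integral>x. norm (\<phi> x) \<partial>lborel) + (\<Sum>b\<in>Basis. C b)"
 let ?d = "real (Suc DIM('a))"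
 have C0: "0 \<le> C b" if "b \<in> Basis" for b
  using C[OF that, of 0] by (rule order_trans[rotated]) simp
 have "norm (fourier \<phi> \<xi>) \<le> (?d ^ N * K) * weight \<xi> ^ N" for \<xi>
 proof -
  define A where "A = insert 1 ((\<lambda>b. (b \<bullet> \<xi>)\<^sup>2) ` Basis)"
  have A: "finite A" "A \<noteq> {}" by (auto simp: A_def)
  have "1 + (norm \<xi>)\<^sup>2 = 1 + (\<Sum>b\<in>Basis. (b \<bullet> \<xi>)\<^sup>2)"
   unfolding power2_norm_eq_inner by (subst euclidean_inner) (simp add: power2_eq_square inner_commute)
  also have "\<dots> \<le> Max A + (\<Sum>b\<in>(Basis::'a set). Max A)"
   using A by (intro add_mono sum_mono Max_ge) (auto simp: A_def)
  also have "\<dots> = ?d * Max A" by (simp add: algebra_simps)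
  finally have "(1 + (norm \<xi>)\<^sup>2) ^ N \<le> (?d * Max A) ^ N" by (intro power_mono) auto
  also have "\<dots> = ?d ^ N * Max A ^ N" by (rule power_mult_distrib)
  finally have 1: "(1 + (norm \<xi>)\<^sup>2) ^ N \<le> ?d ^ N * Max A ^ N" .
  have "Max A ^ N * norm (fourier \<phi> \<xi>) \<le> K"
  proof -
   have "Max A \<in> A" using A by (rule Max_in)
   then consider "Max A = 1" | b where "b \<in> Basis" "Max A = (b \<bullet> \<xi>)\<^sup>2" by (auto simp: A_def)
   then show ?thesis
   proof cases
    case 1
    then show ?thesis using fourier_bounded[of \<phi> \<xi>] C0 by (simp add: K_def add_increasing2 sum_nonneg)
   next
    case 2
    have "Max A ^ N * norm (fourier \<phi> \<xi>) = \<bar>b \<bullet> \<xi>\<bar> ^ (2 * N) * norm (fourier \<phi> \<xi>)"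
     unfolding 2 by (simp add: power_mult)
    also have "\<dots> \<le> C b" by (rule C[OF 2(1)])
    also have "\<dots> \<le> (\<Sum>b\<in>Basis. C b)" using 2(1) C0 by (intro member_le_sum) auto
    also have "\<dots> \<le> K" by (simp add: K_def)
    finally show ?thesis .
   qed
  qed
  then have "?d ^ N * Max A ^ N * norm (fourier \<phi> \<xi>) \<le> ?d ^ N * K"
   by (simp add: mult.assoc mult_left_mono)
  then have "(1 + (norm \<xi>)\<^sup>2) ^ N * norm (fourier \<phi> \<xi>) \<le> ?d ^ N * K"
   by (rule order_trans[OF mult_right_mono[OF 1 norm_ge_zero]])
  then show ?thesis
   by (simp add: weight_def power_one_over pos_le_divide_eq add_pos_nonneg mult.commute del: of_nat_Suc)
 qed
 then show "\<exists>C. \<forall>\<xi>. norm (fourier \<phi> \<xi>) \<le> C * weight \<xi> ^ N" by blast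
qed

section \<open>Restriction and integration under the Fourier transform\<close>

lemma integral_subspace_product:
 fixes V :: "'a::euclidean_space set" and f :: "'a \<Rightarrow> 'b::{banach, second_countable_topology}"
 assumes V: "subspace V" and [measurable]: "f \<in> borel_measurable borel" and f: "integrable lborel f"
 shows "(\<integral>x. f x \<partial>lborel) = (\<integral>x. \<integral>y. f (x + y) \<partial>subspace_lborel (orthogonal_comp V) \<partial>subspace_lborel V)"
proof -
 let ?W = "orthogonal_comp V"
 interpret pair_sigma_finite "subspace_lborel V" "subspace_lborel ?W"
  by (rule pair_sigma_finite_subspace_lborel[OF V subspace_orthogonal_comp])
 have "integrable (distr (subspace_lborel V \<Otimes>\<^sub>M subspace_lborel ?W) borel (\<lambda>(x, y). x + y)) f"
  using f by (subst (asm) lborel_eq_subspace_product[OF V])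
 then have "integrable (subspace_lborel V \<Otimes>\<^sub>M subspace_lborel ?W) (\<lambda>p. f (fst p + snd p))"
  by (subst (asm) integrable_distr_eq) (auto simp: case_prod_beta')
 from integral_fst'[OF this]
 have "(\<integral>p. f (fst p + snd p) \<partial>(subspace_lborel V \<Otimes>\<^sub>M subspace_lborel ?W)) =
  (\<integral>x. \<integral>y. f (x + y) \<partial>subspace_lborel ?W \<partial>subspace_lborel V)" by simp
 moreover have "(\<integral>x. f x \<partial>lborel) = (\<integral>p. f (fst p + snd p) \<partial>(subspace_lborel V \<Otimes>\<^sub>M subspace_lborel ?W))"
  by (subst lborel_eq_subspace_product[OF V], subst integral_distr) (auto simp: case_prod_beta')
 ultimately show ?thesis by simp
qed

lemma integral_norm_bound_integral_AE:
 fixes f :: "'b \<Rightarrow> 'c::{banach, second_countable_topology}"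
 assumes "integrable N g" "f \<in> borel_measurable N" "AE x in N. norm (f x) \<le> g x"
 shows "norm (\<integral>x. f x \<partial>N) \<le> (\<integral>x. g x \<partial>N)"
proof -
 have "integrable N f"
  by (rule Bochner_Integration.integrable_bound[OF assms(1,2)]) (use assms(3) in \<open>auto elim!: eventually_mono\<close>)
 then have "(\<integral>x. norm (f x) \<partial>N) \<le> (\<integral>x. g x \<partial>N)"
  using assms by (intro integral_mono_AE) auto
 then show ?thesis using integral_norm_bound order_trans by blast
qed

lemma AE_orthogonal_comp:
 fixes V :: "'a::euclidean_space set"
 assumes "x \<in> V"
 shows "AE y in subspace_lborel (orthogonal_comp V). x \<bullet> y = 0"
 using AE_subspace_lborel[OF subspace_orthogonal_comp[of V]] assms
 by (auto elim!: eventually_mono simp: orthogonal_comp_def orthogonal_def)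

text \<open>
 Fourier slice theorem, dual form: integrating a Fourier transform over the cosets of the
 complement of \<open>V\<close> is the Fourier transform on \<open>V\<close> of the restriction. A Gaussian damping in
 the complement makes Fubini applicable and acts as an approximate identity after the
 transform.
\<close>

lemma integral_fourier_complement:
 fixes V :: "'a::euclidean_space set" and \<phi> :: "'a \<Rightarrow> complex"
 assumes V: "subspace V" and \<phi>: "schwartz \<phi>" and x: "x \<in> V"
 shows "(\<integral>y. fourier \<phi> (x + y) \<partial>subspace_lborel (orthogonal_comp V)) = fourier_on V \<phi> x"
proof -
 let ?W = "orthogonal_comp V"
 let ?N = "subspace_lborel ?W"
 have W: "subspace ?W" by (rule subspace_orthogonal_comp)
 note [measurable] = schwartz_borel[OF \<phi>]
 have rd: "rapid_decay \<phi>" and rf: "rapid_decay (fourier \<phi>)"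
  using schwartz_rapid_decay[OF \<phi>] fourier_rapid_decay[OF \<phi>] by auto
 have [measurable]: "fourier \<phi> \<in> borel_measurable borel"
  unfolding fourier_on_UNIV[symmetric] by (rule borel_measurable_fourier_on) auto
 have i\<phi>: "integrable lborel \<phi>" by (rule rapid_decay_integrable[OF rd]) measurable
 define c where "c j = inverse (real (Suc j))" for j
 have c: "0 < c j" for j by (simp add: c_def)
 have c0: "c \<longlonglongrightarrow> 0" unfolding c_def by (rule LIMSEQ_inverse_real_of_nat)
 let ?G = "\<lambda>j y. complex_of_real (exp (- (pi * (c j)\<^sup>2 * (norm y)\<^sup>2)))"
 have iG: "integrable ?N (?G j)" for j
  using integrable_gaussian_subspace[OF W, of "(c j)\<^sup>2"] c[of j] by simp
 have Gl: "(\<lambda>j. ?G j y) \<longlonglongrightarrow> 1" for y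
 proof -
  have "(\<lambda>j. ?G j y) \<longlonglongrightarrow> complex_of_real (exp (- (pi * 0\<^sup>2 * (norm y)\<^sup>2)))"
   by (intro tendsto_intros c0)
  then show ?thesis by simp
 qed
 \<comment> \<open>The damped integrals converge to the left-hand side.\<close>
 obtain C where C: "C \<ge> 0" "\<And>z. norm (fourier \<phi> z) \<le> C * weight z ^ (2 * dim ?W)"
  using rapid_decayD[OF rf] by blast
 have "(\<lambda>j. \<integral>y. fourier \<phi> (x + y) * ?G j y \<partial>?N) \<longlonglongrightarrow> (\<integral>y. fourier \<phi> (x + y) * 1 \<partial>?N)"
 proof (rule integral_dominated_convergence[where w="\<lambda>y. C * weight y ^ dim ?W"])
  show "integrable ?N (\<lambda>y. C * weight y ^ dim ?W)"
   using integrable_weight_subspace[OF W order_refl] by simp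
  show "AE y in ?N. (\<lambda>j. fourier \<phi> (x + y) * ?G j y) \<longlonglongrightarrow> fourier \<phi> (x + y) * 1"
   using Gl by (intro AE_I2 tendsto_mult tendsto_const)
  show "AE y in ?N. norm (fourier \<phi> (x + y) * ?G j y) \<le> C * weight y ^ dim ?W" for j
   using AE_orthogonal_comp[OF x]
  proof eventually_elim
   case (elim y)
   have "norm (fourier \<phi> (x + y) * ?G j y) \<le> norm (fourier \<phi> (x + y))"
    by (simp add: norm_mult mult_left_le)
   also have "\<dots> \<le> C * weight (x + y) ^ (2 * dim ?W)" by (rule C)
   also have "\<dots> \<le> C * (weight x ^ dim ?W * weight y ^ dim ?W)"
    using weight_add_le[OF elim] C(1) by (intro mult_left_mono)
   also have "\<dots> \<le> C * (1 * weight y ^ dim ?W)"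
    using C(1) by (intro mult_left_mono mult_right_mono power_le_one) (simp_all add: weight_bounds)
   finally show ?case by simp
  qed
 qed measurable
 then have lim1: "(\<lambda>j. \<integral>y. fourier \<phi> (x + y) * ?G j y \<partial>?N) \<longlonglongrightarrow> (\<integral>y. fourier \<phi> (x + y) \<partial>?N)" by simp
 \<comment> \<open>The damped integrals, computed by Fubini and rescaled.\<close>
 have eq: "(\<integral>y. fourier \<phi> (x + y) * ?G j y \<partial>?N) =
  (\<integral>\<xi>. \<integral>\<eta>. echar x \<xi> * \<phi> (\<xi> + c j *\<^sub>R \<eta>) * complex_of_real (exp (- (pi * 1 * (norm \<eta>)\<^sup>2))) \<partial>?N \<partial>subspace_lborel V)" for j
 proof -
  let ?g = "\<lambda>z. complex_of_real ((1 / c j) ^ dim ?W * exp (- (pi * (norm (orth_proj ?W z))\<^sup>2 / (c j)\<^sup>2)))"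
  have [measurable]: "orth_proj ?W \<in> borel_measurable borel" by (rule borel_measurable_orth_proj[OF W])
  have "(\<integral>y. fourier \<phi> (x + y) * ?G j y \<partial>?N) = (\<integral>y. ?G j y * (\<integral>z. echar y z * (echar x z * \<phi> z) \<partial>lborel) \<partial>?N)"
   by (simp add: fourier_echar echar_commute[of _ "x + _"] echar_add_left mult_ac)
  also have "\<dots> = (\<integral>z. (echar x z * \<phi> z) * (\<integral>y. echar y z * ?G j y \<partial>?N) \<partial>lborel)"
   by (rule echar_mult_formula[OF sigma_finite_subspace_lborel[OF W] sigma_finite_lborel _ _ iG])
    (auto intro!: Bochner_Integration.integrable_bound[OF i\<phi>] simp: norm_mult)
  also have "\<dots> = (\<integral>z. (echar x z * \<phi> z) * ?g z \<partial>lborel)"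
   using fourier_gaussian_subspace[OF W, of "(c j)\<^sup>2"] c[of j] by (simp add: fourier_on_def)
  also have "\<dots> = (\<integral>\<xi>. \<integral>\<eta>. (echar x (\<xi> + \<eta>) * \<phi> (\<xi> + \<eta>)) * ?g (\<xi> + \<eta>) \<partial>?N \<partial>subspace_lborel V)"
  proof (rule integral_subspace_product[OF V])
   show "integrable lborel (\<lambda>z. (echar x z * \<phi> z) * ?g z)"
   proof (rule Bochner_Integration.integrable_bound)
    show "integrable lborel (\<lambda>z. complex_of_real ((1 / c j) ^ dim ?W) * \<phi> z)" using i\<phi> by simp
    show "AE z in lborel. norm (echar x z * \<phi> z * ?g z) \<le> norm (complex_of_real ((1 / c j) ^ dim ?W) * \<phi> z)"
    proof (rule AE_I2)
     fix z
     let ?e = "exp (- (pi * (norm (orth_proj ?W z))\<^sup>2 / (c j)\<^sup>2))" and ?r = "(1 / c j) ^ dim ?W"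
     have r: "0 \<le> ?r" using c[of j] by simp
     have "norm (echar x z * \<phi> z * ?g z) = norm (\<phi> z) * (?r * ?e)"
      unfolding norm_mult[of _ "complex_of_real _"] norm_of_real using r by (simp only: abs_mult) (simp add: norm_mult abs_of_nonneg)
     also have "\<dots> \<le> norm (\<phi> z) * (?r * 1)"
      using r by (intro mult_left_mono) auto
     also have "\<dots> = norm (complex_of_real ?r * \<phi> z)"
      unfolding norm_mult norm_of_real using r by (simp only: abs_of_nonneg mult.commute mult_1_right)
     finally show "norm (echar x z * \<phi> z * ?g z) \<le> norm (complex_of_real ?r * \<phi> z)" .
    qed
   qed measurable
  qed measurable
  also have "\<dots> = (\<integral>\<xi>. \<integral>\<eta>. echar x \<xi> * \<phi> (\<xi> + c j *\<^sub>R \<eta>) * complex_of_real (exp (- (pi * 1 * (norm \<eta>)\<^sup>2))) \<partial>?N \<partial>subspace_lborel V)"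
  proof (rule integral_cong_AE)
   show "AE \<xi> in subspace_lborel V. (\<integral>\<eta>. (echar x (\<xi> + \<eta>) * \<phi> (\<xi> + \<eta>)) * ?g (\<xi> + \<eta>) \<partial>?N) =
    (\<integral>\<eta>. echar x \<xi> * \<phi> (\<xi> + c j *\<^sub>R \<eta>) * complex_of_real (exp (- (pi * 1 * (norm \<eta>)\<^sup>2))) \<partial>?N)"
    using AE_subspace_lborel[OF V]
   proof eventually_elim
    case (elim \<xi>)
    have sc: "distr ?N borel (\<lambda>y. c j *\<^sub>R y) = density ?N (\<lambda>_. ennreal ((1 / c j) ^ dim ?W))"
    proof (rule measure_eqI)
     fix A assume "A \<in> sets (distr ?N borel (\<lambda>y. c j *\<^sub>R y))"
     then have [measurable]: "A \<in> sets borel" by simp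
     have "emeasure (density ?N (\<lambda>_. ennreal ((1 / c j) ^ dim ?W))) A = ennreal ((1 / c j) ^ dim ?W) * (\<integral>\<^sup>+y. indicator A y \<partial>?N)"
      by (simp add: emeasure_density nn_integral_cmult)
     also have "(\<integral>\<^sup>+y. indicator A y \<partial>?N) = ennreal (c j ^ dim ?W) * (\<integral>\<^sup>+y. indicator A (c j *\<^sub>R y) \<partial>?N)"
      by (rule nn_integral_subspace_lborel_scale[OF W c]) measurable
     also have "ennreal ((1 / c j) ^ dim ?W) * \<dots> = (\<integral>\<^sup>+y. indicator A (c j *\<^sub>R y) \<partial>?N)"
      using c[of j] by (simp add: mult.assoc[symmetric] ennreal_mult[symmetric] power_mult_distrib[symmetric])
     also have "\<dots> = emeasure (distr ?N borel (\<lambda>y. c j *\<^sub>R y)) A"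
      by (subst nn_integral_indicator[symmetric]) (auto simp: nn_integral_distr simp del: nn_integral_indicator)
     finally show "emeasure (distr ?N borel (\<lambda>y. c j *\<^sub>R y)) A = emeasure (density ?N (\<lambda>_. ennreal ((1 / c j) ^ dim ?W))) A" by simp
    qed simp
    have o: "x \<bullet> \<eta> = 0 \<and> orth_proj ?W (\<xi> + \<eta>) = \<eta>" if "\<eta> \<in> ?W" for \<eta>
    proof
     show "x \<bullet> \<eta> = 0" using that x by (auto simp: orthogonal_comp_def orthogonal_def)
     show "orth_proj ?W (\<xi> + \<eta>) = \<eta>"
      by (rule orth_proj_eqI[OF W that]) (use elim in \<open>auto simp: orthogonal_comp_def\<close>)
    qed
    have "(\<integral>\<eta>. (echar x (\<xi> + \<eta>) * \<phi> (\<xi> + \<eta>)) * ?g (\<xi> + \<eta>) \<partial>?N) =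
     (\<integral>\<eta>. (1 / c j) ^ dim ?W *\<^sub>R (echar x \<xi> * \<phi> (\<xi> + \<eta>) * complex_of_real (exp (- (pi * (norm \<eta>)\<^sup>2 / (c j)\<^sup>2)))) \<partial>?N)"
    proof (rule integral_cong_AE)
     show "AE \<eta> in ?N. (echar x (\<xi> + \<eta>) * \<phi> (\<xi> + \<eta>)) * ?g (\<xi> + \<eta>) =
       (1 / c j) ^ dim ?W *\<^sub>R (echar x \<xi> * \<phi> (\<xi> + \<eta>) * complex_of_real (exp (- (pi * (norm \<eta>)\<^sup>2 / (c j)\<^sup>2))))"
      using AE_subspace_lborel[OF W]
     proof eventually_elim
      case (elim \<eta>)
      have "echar x (\<xi> + \<eta>) = echar x \<xi>" using o[OF elim] by (simp add: echar_def inner_add_right)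
      then show ?case using o[OF elim] by (simp add: scaleR_conv_of_real mult_ac)
     qed
    qed measurable
    also have "\<dots> = (\<integral>\<eta>. echar x \<xi> * \<phi> (\<xi> + \<eta>) * complex_of_real (exp (- (pi * (norm \<eta>)\<^sup>2 / (c j)\<^sup>2))) \<partial>distr ?N borel (\<lambda>y. c j *\<^sub>R y))"
     unfolding sc using c[of j] by (subst integral_density) auto
    also have "\<dots> = (\<integral>\<eta>. echar x \<xi> * \<phi> (\<xi> + c j *\<^sub>R \<eta>) * complex_of_real (exp (- (pi * (norm (c j *\<^sub>R \<eta>))\<^sup>2 / (c j)\<^sup>2))) \<partial>?N)"
     by (subst integral_distr) auto
    finally show ?case using c[of j] by (simp add: power_mult_distrib)
   qed
   interpret S: sigma_finite_measure ?N by (rule sigma_finite_subspace_lborel[OF W])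
   show "(\<lambda>\<xi>. \<integral>\<eta>. (echar x (\<xi> + \<eta>) * \<phi> (\<xi> + \<eta>)) * ?g (\<xi> + \<eta>) \<partial>?N) \<in> borel_measurable (subspace_lborel V)"
    by measurable
   show "(\<lambda>\<xi>. \<integral>\<eta>. echar x \<xi> * \<phi> (\<xi> + c j *\<^sub>R \<eta>) * complex_of_real (exp (- (pi * 1 * (norm \<eta>)\<^sup>2))) \<partial>?N) \<in> borel_measurable (subspace_lborel V)"
    by measurable
  qed
  finally show ?thesis .
 qed
 \<comment> \<open>Dominated convergence, using that the decay in \<open>\<xi>\<close> is unaffected by orthogonal shifts.\<close>
 interpret WV: pair_sigma_finite "subspace_lborel V" ?N by (rule pair_sigma_finite_subspace_lborel[OF V W])
 interpret S: sigma_finite_measure ?N by (rule sigma_finite_subspace_lborel[OF W])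
 obtain D where D: "D \<ge> 0" "\<And>z. norm (\<phi> z) \<le> D * weight z ^ (2 * dim V)"
  using rapid_decayD[OF rd] by blast
 let ?E = "\<lambda>\<eta>. complex_of_real (exp (- (pi * 1 * (norm \<eta>)\<^sup>2)))"
 have nnE: "(\<integral>\<^sup>+\<eta>. ennreal (exp (- (pi * 1 * (norm \<eta>)\<^sup>2))) \<partial>?N) = 1"
  using nn_integral_gaussian_subspace[OF W, of 1] by simp
 have iE: "integrable ?N (\<lambda>\<eta>. exp (- (pi * 1 * (norm \<eta>)\<^sup>2)))" by (rule integrable_gaussian_subspace[OF W]) simp
 have intE: "(\<integral>\<eta>. exp (- (pi * 1 * (norm \<eta>)\<^sup>2)) \<partial>?N) = 1"
  using nn_integral_eq_integral[OF iE] nnE by (simp del: mult_1_right mult_1_left)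
 have bound: "norm (\<phi> (\<xi> + t *\<^sub>R \<eta>)) \<le> D * weight \<xi> ^ dim V" if "\<xi> \<in> V" "\<eta> \<in> ?W" for \<xi> \<eta> and t :: real
 proof -
  have o: "\<xi> \<bullet> (t *\<^sub>R \<eta>) = 0" using that by (simp add: orthogonal_comp_def orthogonal_def)
  have "norm (\<phi> (\<xi> + t *\<^sub>R \<eta>)) \<le> D * weight (\<xi> + t *\<^sub>R \<eta>) ^ (2 * dim V)" by (rule D)
  also have "\<dots> \<le> D * (weight \<xi> ^ dim V * weight (t *\<^sub>R \<eta>) ^ dim V)"
   using weight_add_le[OF o] D(1) by (intro mult_left_mono)
  also have "\<dots> \<le> D * (weight \<xi> ^ dim V * 1)"
   using D(1) by (intro mult_left_mono power_le_one) (simp_all add: weight_bounds)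
  finally show ?thesis by simp
 qed
 have inner_lim: "(\<lambda>j. \<integral>\<eta>. echar x \<xi> * \<phi> (\<xi> + c j *\<^sub>R \<eta>) * ?E \<eta> \<partial>?N) \<longlonglongrightarrow> echar x \<xi> * \<phi> \<xi>" if \<xi>: "\<xi> \<in> V" for \<xi>
 proof -
  have "(\<lambda>j. \<integral>\<eta>. echar x \<xi> * \<phi> (\<xi> + c j *\<^sub>R \<eta>) * ?E \<eta> \<partial>?N) \<longlonglongrightarrow> (\<integral>\<eta>. echar x \<xi> * \<phi> \<xi> * ?E \<eta> \<partial>?N)"
  proof (rule integral_dominated_convergence[where w="\<lambda>\<eta>. D * weight \<xi> ^ dim V * exp (- (pi * 1 * (norm \<eta>)\<^sup>2))"])
   show "integrable ?N (\<lambda>\<eta>. D * weight \<xi> ^ dim V * exp (- (pi * 1 * (norm \<eta>)\<^sup>2)))"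
    using iE by (rule integrable_mult_right)
   show "AE \<eta> in ?N. (\<lambda>j. echar x \<xi> * \<phi> (\<xi> + c j *\<^sub>R \<eta>) * ?E \<eta>) \<longlonglongrightarrow> echar x \<xi> * \<phi> \<xi> * ?E \<eta>"
   proof (intro AE_I2 tendsto_mult tendsto_const)
    fix \<eta>
    have "(\<lambda>j. \<xi> + c j *\<^sub>R \<eta>) \<longlonglongrightarrow> \<xi> + 0 *\<^sub>R \<eta>" by (intro tendsto_intros c0)
    then show "(\<lambda>j. \<phi> (\<xi> + c j *\<^sub>R \<eta>)) \<longlonglongrightarrow> \<phi> \<xi>"
     using schwartz_continuous[OF \<phi>] by (intro continuous_on_tendsto_compose[of UNIV \<phi>]) auto
   qed
   show "AE \<eta> in ?N. norm (echar x \<xi> * \<phi> (\<xi> + c j *\<^sub>R \<eta>) * ?E \<eta>) \<le> D * weight \<xi> ^ dim V * exp (- (pi * 1 * (norm \<eta>)\<^sup>2))" for j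
    using AE_subspace_lborel[OF W] by eventually_elim (simp add: norm_mult bound[OF \<xi>] mult_right_mono)
  qed measurable
  moreover have "(\<integral>\<eta>. echar x \<xi> * \<phi> \<xi> * ?E \<eta> \<partial>?N) = echar x \<xi> * \<phi> \<xi>"
   by (subst integral_mult_right_zero) (simp only: integral_complex_of_real intE, simp)
  ultimately show ?thesis by (simp only:)
 qed
 have lim2: "(\<lambda>j. \<integral>\<xi>. \<integral>\<eta>. echar x \<xi> * \<phi> (\<xi> + c j *\<^sub>R \<eta>) * ?E \<eta> \<partial>?N \<partial>subspace_lborel V) \<longlonglongrightarrow> (\<integral>\<xi>. echar x \<xi> * \<phi> \<xi> \<partial>subspace_lborel V)"
 proof (rule integral_dominated_convergence[where w="\<lambda>\<xi>. D * weight \<xi> ^ dim V"])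
  show "integrable (subspace_lborel V) (\<lambda>\<xi>. D * weight \<xi> ^ dim V)"
   using integrable_weight_subspace[OF V order_refl] by simp
  show "AE \<xi> in subspace_lborel V. (\<lambda>j. \<integral>\<eta>. echar x \<xi> * \<phi> (\<xi> + c j *\<^sub>R \<eta>) * ?E \<eta> \<partial>?N) \<longlonglongrightarrow> echar x \<xi> * \<phi> \<xi>"
   using AE_subspace_lborel[OF V] by eventually_elim (rule inner_lim)
  show "AE \<xi> in subspace_lborel V. norm (\<integral>\<eta>. echar x \<xi> * \<phi> (\<xi> + c j *\<^sub>R \<eta>) * ?E \<eta> \<partial>?N) \<le> D * weight \<xi> ^ dim V" for j
   using AE_subspace_lborel[OF V]
  proof eventually_elim
   case (elim \<xi>)
   have "norm (\<integral>\<eta>. echar x \<xi> * \<phi> (\<xi> + c j *\<^sub>R \<eta>) * ?E \<eta> \<partial>?N) \<le> (\<integral>\<eta>. D * weight \<xi> ^ dim V * exp (- (pi * 1 * (norm \<eta>)\<^sup>2)) \<partial>?N)"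
   proof (rule integral_norm_bound_integral_AE)
    show "integrable ?N (\<lambda>\<eta>. D * weight \<xi> ^ dim V * exp (- (pi * 1 * (norm \<eta>)\<^sup>2)))" using iE by (rule integrable_mult_right)
    show "AE \<eta> in ?N. norm (echar x \<xi> * \<phi> (\<xi> + c j *\<^sub>R \<eta>) * ?E \<eta>) \<le> D * weight \<xi> ^ dim V * exp (- (pi * 1 * (norm \<eta>)\<^sup>2))"
     using AE_subspace_lborel[OF W] by eventually_elim (simp add: norm_mult bound[OF elim] mult_right_mono)
   qed measurable
   also have "\<dots> = D * weight \<xi> ^ dim V" by (simp only: integral_mult_right_zero intE)
   finally show ?case .
  qed
 qed measurable
 have "(\<integral>y. fourier \<phi> (x + y) \<partial>?N) = (\<integral>\<xi>. echar x \<xi> * \<phi> \<xi> \<partial>subspace_lborel V)"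
  using LIMSEQ_unique[OF lim1[unfolded eq] lim2] .
 then show ?thesis by (simp add: fourier_on_def echar_commute[of x])
qed

section \<open>Gaussians determine integrable functions\<close>

text \<open>
 The Gaussians modulated by characters, closed under multiplication by coordinates and hence
 under differentiation.
\<close>

definition gauss_wave :: "real \<Rightarrow> 'a::euclidean_space \<Rightarrow> 'a \<Rightarrow> 'a \<Rightarrow> complex" where
 "gauss_wave s p q x = exp (complex_of_real (- (s * (x \<bullet> x)) + x \<bullet> p) + \<i> * complex_of_real (x \<bullet> q))"

inductive_set gauss_poly :: "real \<Rightarrow> 'a::euclidean_space \<Rightarrow> 'a \<Rightarrow> ('a \<Rightarrow> complex) set"
 for s p q where
  wave: "gauss_wave s p q \<in> gauss_poly s p q"
 | scale: "f \<in> gauss_poly s p q \<Longrightarrow> (\<lambda>x. c * f x) \<in> gauss_poly s p q"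
 | coord: "f \<in> gauss_poly s p q \<Longrightarrow> (\<lambda>x. complex_of_real (x \<bullet> b) * f x) \<in> gauss_poly s p q"
 | add: "f \<in> gauss_poly s p q \<Longrightarrow> g \<in> gauss_poly s p q \<Longrightarrow> (\<lambda>x. f x + g x) \<in> gauss_poly s p q"

lemma gauss_wave_has_derivative:
 "(gauss_wave s p q has_derivative (\<lambda>v. (complex_of_real (- 2 * s * (x \<bullet> v) + v \<bullet> p) + \<i> * complex_of_real (v \<bullet> q)) * gauss_wave s p q x)) (at x)"
proof -
 have "((\<lambda>x. complex_of_real (- (s * (x \<bullet> x)) + x \<bullet> p) + \<i> * complex_of_real (x \<bullet> q)) has_derivative
  (\<lambda>v. complex_of_real (- 2 * s * (x \<bullet> v) + v \<bullet> p) + \<i> * complex_of_real (v \<bullet> q))) (at x)"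
  by (auto intro!: derivative_eq_intros simp: inner_commute algebra_simps fun_eq_iff)
 note d = has_derivative_compose[OF this DERIV_exp[THEN has_field_derivative_imp_has_derivative]]
 show ?thesis unfolding gauss_wave_def[abs_def]
  by (rule has_derivative_eq_rhs[OF d]) (simp only: mult.commute)
qed

lemma gauss_poly_derivative:
 assumes "f \<in> gauss_poly s p q"
 shows "\<exists>f'. (\<forall>x. (f has_derivative f' x) (at x)) \<and> (\<forall>v. (\<lambda>x. f' x v) \<in> gauss_poly s p q)"
 using assms
proof induction
 case wave
 let ?f' = "\<lambda>x v. (complex_of_real (- 2 * s * (x \<bullet> v) + v \<bullet> p) + \<i> * complex_of_real (v \<bullet> q)) * gauss_wave s p q x"
 have "(\<lambda>x. ?f' x v) \<in> gauss_poly s p q" for v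
 proof -
  have "(\<lambda>x. complex_of_real (- 2 * s) * (complex_of_real (x \<bullet> v) * gauss_wave s p q x) +
    (complex_of_real (v \<bullet> p) + \<i> * complex_of_real (v \<bullet> q)) * gauss_wave s p q x) \<in> gauss_poly s p q"
   by (intro gauss_poly.intros)
  then show ?thesis by (simp add: algebra_simps)
 qed
 then show ?case using gauss_wave_has_derivative[of s p q] by (intro exI[of _ ?f']) simp
next
 case (scale f c)
 then obtain f' where f': "\<And>x. (f has_derivative f' x) (at x)" "\<And>v. (\<lambda>x. f' x v) \<in> gauss_poly s p q" by blast
 show ?case
  by (intro exI[of _ "\<lambda>x v. c * f' x v"] conjI allI has_derivative_mult_right f' gauss_poly.scale)
next
 case (coord f b)
 then obtain f' where f': "\<And>x. (f has_derivative f' x) (at x)" "\<And>v. (\<lambda>x. f' x v) \<in> gauss_poly s p q" by blast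
 show ?case
 proof (intro exI[of _ "\<lambda>x v. complex_of_real (x \<bullet> b) * f' x v + complex_of_real (v \<bullet> b) * f x"] conjI allI)
  fix x
  have "((\<lambda>x. complex_of_real (x \<bullet> b)) has_derivative (\<lambda>v. complex_of_real (v \<bullet> b))) (at x)"
   by (auto intro!: derivative_eq_intros)
  from has_derivative_mult[OF this f'(1)]
  show "((\<lambda>x. complex_of_real (x \<bullet> b) * f x) has_derivative (\<lambda>v. complex_of_real (x \<bullet> b) * f' x v + complex_of_real (v \<bullet> b) * f x)) (at x)" .
 qed (intro gauss_poly.intros coord f')
next
 case (add f g)
 then obtain f' g' where f': "\<And>x. (f has_derivative f' x) (at x)" "\<And>v. (\<lambda>x. f' x v) \<in> gauss_poly s p q"
  and g': "\<And>x. (g has_derivative g' x) (at x)" "\<And>v. (\<lambda>x. g' x v) \<in> gauss_poly s p q" by blast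
 show ?case
  by (intro exI[of _ "\<lambda>x v. f' x v + g' x v"] conjI allI has_derivative_add gauss_poly.add f' g')
qed

lemma gauss_poly_iter_deriv:
 assumes "f \<in> gauss_poly s p q"
 shows "iter_deriv vs f \<in> gauss_poly s p q"
proof (induction vs)
 case (Cons v vs)
 then obtain f' where f': "\<And>x. (iter_deriv vs f has_derivative f' x) (at x)" "\<And>v. (\<lambda>x. f' x v) \<in> gauss_poly s p q"
  using gauss_poly_derivative by blast
 have "iter_deriv (v # vs) f = (\<lambda>x. f' x v)"
  using frechet_derivative_at[OF f'(1)] by (simp add: fun_eq_iff) 
 then show ?case using f'(2) by simp
qed (simp add: assms)

lemma one_plus_power_le_exp:
 assumes "0 \<le> (u::real)" "s > 0"
 shows "(1 + u) ^ N \<le> fact N / s ^ N * exp (s * (1 + u))"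
proof -
 have "(s * (1 + u)) ^ N / fact N \<le> exp (s * (1 + u))"
 proof -
  have "(\<Sum>n\<in>{N}. inverse (fact n) * (s * (1 + u)) ^ n) \<le> (\<Sum>n. inverse (fact n) * (s * (1 + u)) ^ n)"
   using assms by (intro sum_le_suminf summable_exp) auto
  then show ?thesis by (simp add: exp_def divide_inverse mult.commute)
 qed
 then have "s ^ N * (1 + u) ^ N \<le> exp (s * (1 + u)) * fact N"
  unfolding power_mult_distrib by (subst (asm) pos_divide_le_eq) auto
 then have "(1 + u) ^ N \<le> fact N * exp (s * (1 + u)) / s ^ N"
  using assms by (subst pos_le_divide_eq) (auto simp: mult.commute)
 then show ?thesis by simp
qed

lemma gauss_poly_rapid_decay:
 assumes "f \<in> gauss_poly s p q" and s: "s > 0"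
 shows "rapid_decay f"
 using assms(1)
proof induction
 case wave
 show ?case unfolding rapid_decay_def
 proof
  fix N
  define K where "K = fact N / (s/2) ^ N * exp (s/2) * exp ((norm p)\<^sup>2 / (2 * s))"
  have "norm (gauss_wave s p q x) \<le> K * weight x ^ N" for x
  proof -
   let ?u = "(norm x)\<^sup>2"
   have "x \<bullet> p \<le> norm x * norm p" by (rule norm_cauchy_schwarz)
   also have "\<dots> \<le> s / 2 * ?u + (norm p)\<^sup>2 / (2 * s)"
   proof -
    have "0 \<le> (s * norm x - norm p)\<^sup>2" by simp
    then have "2 * s * (norm x * norm p) \<le> s\<^sup>2 * ?u + (norm p)\<^sup>2" by (simp add: power2_diff power_mult_distrib mult_ac)
    then show ?thesis using s by (simp add: field_simps power2_eq_square)
   qed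
   finally have "- (s * (x \<bullet> x)) + x \<bullet> p \<le> - (s/2 * (1 + ?u)) + s / 2 + (norm p)\<^sup>2 / (2 * s)"
    by (simp add: power2_norm_eq_inner[symmetric] algebra_simps)
   then have "norm (gauss_wave s p q x) \<le> exp (- (s/2 * (1 + ?u)) + s / 2 + (norm p)\<^sup>2 / (2 * s))"
    by (simp add: gauss_wave_def)
   also have "\<dots> = exp (- (s/2 * (1 + ?u))) * (exp (s/2) * exp ((norm p)\<^sup>2 / (2 * s)))"
    by (simp only: exp_add mult.assoc)
   finally have 1: "norm (gauss_wave s p q x) \<le> exp (- (s/2 * (1 + ?u))) * (exp (s/2) * exp ((norm p)\<^sup>2 / (2 * s)))" .
   have "(1 + ?u) ^ N \<le> fact N / (s/2) ^ N * exp (s/2 * (1 + ?u))"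
    using s by (intro one_plus_power_le_exp) auto
   then have "exp (- (s/2 * (1 + ?u))) * (1 + ?u) ^ N \<le> exp (- (s/2 * (1 + ?u))) * (fact N / (s/2) ^ N * exp (s/2 * (1 + ?u)))"
    by (intro mult_left_mono) auto
   also have "\<dots> = fact N / (s/2) ^ N" by (simp add: exp_minus)
   finally have "exp (- (s/2 * (1 + ?u))) \<le> fact N / (s/2) ^ N / (1 + ?u) ^ N"
    by (subst pos_le_divide_eq) (auto intro!: zero_less_power add_pos_nonneg)
   then have "exp (- (s/2 * (1 + ?u))) \<le> fact N / (s/2) ^ N * weight x ^ N"
    by (simp add: weight_def power_one_over)
   then have "exp (- (s/2 * (1 + ?u))) * (exp (s/2) * exp ((norm p)\<^sup>2 / (2 * s))) \<le> fact N / (s/2) ^ N * weight x ^ N * (exp (s/2) * exp ((norm p)\<^sup>2 / (2 * s)))"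
    by (intro mult_right_mono) auto
   with 1 show ?thesis by (simp add: K_def mult_ac)
  qed
  then show "\<exists>C. \<forall>x. norm (gauss_wave s p q x) \<le> C * weight x ^ N" by blast
 qed
next
 case (scale f c)
 show ?case unfolding rapid_decay_def
 proof
  fix N
  obtain C where "\<And>x. norm (f x) \<le> C * weight x ^ N" using rapid_decayD[OF scale.IH] by blast
  then have "norm (c * f x) \<le> (norm c * C) * weight x ^ N" for x
   by (simp add: norm_mult mult.assoc mult_left_mono)
  then show "\<exists>C. \<forall>x. norm (c * f x) \<le> C * weight x ^ N" by blast
 qed
next
 case (coord f b)
 show ?case unfolding rapid_decay_def
 proof
  fix N
  obtain C where C: "C \<ge> 0" "\<And>x. norm (f x) \<le> C * weight x ^ (N + 1)" using rapid_decayD[OF coord.IH] by blast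
  have "norm (complex_of_real (x \<bullet> b) * f x) \<le> (norm b * C) * weight x ^ N" for x
  proof -
   have "norm x * weight x \<le> 1"
    using sum_squares_bound[of "norm x" 1] by (simp add: weight_def pos_divide_le_eq add_pos_nonneg)
     (smt (verit) norm_ge_zero power2_eq_square zero_le_power2)
   then have w: "norm b * C * weight x ^ N * (norm x * weight x) \<le> norm b * C * weight x ^ N * 1"
    using C(1) by (intro mult_left_mono) (simp_all add: weight_bounds)
   have "norm (complex_of_real (x \<bullet> b) * f x) \<le> (norm x * norm b) * (C * weight x ^ (N + 1))"
    unfolding norm_mult norm_of_real using C(2)[of x] Cauchy_Schwarz_ineq2[of x b]
    by (intro mult_mono) auto
   then show ?thesis using w by (simp add: mult_ac)
  qed
  then show "\<exists>C. \<forall>x. norm (complex_of_real (x \<bullet> b) * f x) \<le> C * weight x ^ N" by blast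
 qed
next
 case (add f g)
 have "rapid_decay (\<lambda>x. - g x)" by (rule rapid_decay_bound[OF add.IH(2)]) simp
 from rapid_decay_diff[OF add.IH(1) this] show ?case by simp
qed

lemma gauss_poly_schwartz:
 assumes "f \<in> gauss_poly s p q" "s > 0"
 shows "schwartz f"
 unfolding schwartz_def
proof (intro ballI conjI allI)
 fix vs :: "'a list" and N :: nat
 note g = gauss_poly_iter_deriv[OF assms(1), of vs]
 show "iter_deriv vs f differentiable (at x)" for x
  using gauss_poly_derivative[OF g] by (auto simp: differentiable_def)
 obtain C where C: "C \<ge> 0" "\<And>x. norm (iter_deriv vs f x) \<le> C * weight x ^ N"
  using rapid_decayD[OF gauss_poly_rapid_decay[OF g assms(2)]] by blast
 have "weight x ^ N \<le> (1 + (norm x)\<^sup>2) powr (- real N / 2)" for x :: 'a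
 proof -
  have pos: "1 + (norm x)\<^sup>2 \<ge> 1" by simp
  have "weight x ^ N = (1 + (norm x)\<^sup>2) powr (- real N)"
   using powr_realpow[of "1 + (norm x)\<^sup>2" N] pos
   by (simp add: powr_minus weight_def power_one_over inverse_eq_divide)
  also have "\<dots> \<le> (1 + (norm x)\<^sup>2) powr (- real N / 2)" using pos by (intro powr_mono) auto
  finally show ?thesis .
 qed
 then have "norm (iter_deriv vs f x) \<le> C * (1 + (norm x)\<^sup>2) powr (- real N / 2)" for x
  using C mult_left_mono[OF _ C(1)] order_trans by metis
 then show "\<exists>C. \<forall>x. norm (iter_deriv vs f x) \<le> C * (1 + (norm x)\<^sup>2) powr (- real N / 2)" by blast
qed

definition bump :: "real \<Rightarrow> 'a::euclidean_space \<Rightarrow> 'a \<Rightarrow> complex" where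
 "bump s p x = complex_of_real (exp (- (pi * s * (norm (x - p))\<^sup>2)))"

lemma bump_schwartz:
 assumes "s > 0"
 shows "schwartz (bump s p)"
proof -
 have "bump s p = (\<lambda>x. complex_of_real (exp (- (pi * s * (norm p)\<^sup>2))) * gauss_wave (pi * s) ((2 * pi * s) *\<^sub>R p) 0 x)"
 proof
  fix x
  have "complex_of_real (- (pi * s * (norm (x - p))\<^sup>2)) = complex_of_real (- (pi * s * (norm p)\<^sup>2)) +
    (complex_of_real (- ((pi * s) * (x \<bullet> x)) + x \<bullet> ((2 * pi * s) *\<^sub>R p)) + \<i> * complex_of_real (x \<bullet> 0))"
   by (simp add: power2_norm_eq_inner inner_diff_left inner_diff_right inner_commute[of p x] ring_distribs)
  then show "bump s p x = complex_of_real (exp (- (pi * s * (norm p)\<^sup>2))) * gauss_wave (pi * s) ((2 * pi * s) *\<^sub>R p) 0 x"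
   unfolding bump_def gauss_wave_def exp_of_real[symmetric] exp_add[symmetric] by (simp only:)
 qed
 also have "\<dots> \<in> gauss_poly (pi * s) ((2 * pi * s) *\<^sub>R p) 0"
  by (intro gauss_poly.intros)
 finally show ?thesis
  using assms by (intro gauss_poly_schwartz[of _ "pi * s" "(2 * pi * s) *\<^sub>R p" 0]) auto
qed

text \<open>Every bump is itself the Fourier transform of a Schwartz function.\<close>

lemma bump_fourier:
 fixes p :: "'a::euclidean_space"
 assumes s: "s > 0"
 shows "\<exists>\<psi>. schwartz \<psi> \<and> fourier \<psi> = bump s p"
proof (intro exI conjI)
 let ?c = "complex_of_real (1 / (1 / sqrt (1/s)) ^ DIM('a))"
 let ?\<psi> = "\<lambda>x. ?c * gauss_wave (pi * (1/s)) 0 ((2 * pi) *\<^sub>R p) x"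
 show "schwartz ?\<psi>"
  using s by (intro gauss_poly_schwartz[of _ "pi * (1/s)" 0 "(2 * pi) *\<^sub>R p"] gauss_poly.intros) auto
 show "fourier ?\<psi> = bump s p"
 proof
  fix \<xi>
  have "echar x \<xi> * ?\<psi> x = ?c * (echar x (\<xi> - p) * complex_of_real (exp (- (pi * (1/s) * (norm x)\<^sup>2))))" for x
  proof -
   have "- 2 * complex_of_real pi * \<i> * complex_of_real (x \<bullet> \<xi>) +
     (complex_of_real (- (pi * (1/s) * (x \<bullet> x)) + x \<bullet> 0) + \<i> * complex_of_real (x \<bullet> ((2 * pi) *\<^sub>R p))) =
     - 2 * complex_of_real pi * \<i> * complex_of_real (x \<bullet> (\<xi> - p)) + complex_of_real (- (pi * (1/s) * (norm x)\<^sup>2))"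
    by (simp add: inner_diff_right power2_norm_eq_inner right_diff_distrib)
   then have "echar x \<xi> * gauss_wave (pi * (1/s)) 0 ((2 * pi) *\<^sub>R p) x = echar x (\<xi> - p) * complex_of_real (exp (- (pi * (1/s) * (norm x)\<^sup>2)))"
    unfolding echar_def gauss_wave_def exp_of_real[symmetric] exp_add[symmetric] by (simp only:)
   then show ?thesis by (simp only: mult.left_commute[of "echar x \<xi>"])
  qed
  then have "fourier ?\<psi> \<xi> = ?c * fourier_on UNIV (\<lambda>x. complex_of_real (exp (- (pi * (1/s) * (norm x)\<^sup>2)))) (\<xi> - p)"
   unfolding fourier_echar fourier_on_UNIV by (simp only: integral_mult_right_zero)
  also have "\<dots> = ?c * complex_of_real ((1 / sqrt (1/s)) ^ DIM('a) * exp (- (pi * (norm (orth_proj UNIV (\<xi> - p)))\<^sup>2 / (1/s))))"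
   using s by (subst fourier_gaussian_subspace) auto
  also have "\<dots> = bump s p \<xi>"
  proof -
   have r: "1 / r * (r * e) = e" if "r \<noteq> 0" for r e :: real using that by simp
   have "(1 / sqrt (1/s)) ^ DIM('a) \<noteq> 0" using s by simp
   from r[OF this] have "?c * complex_of_real ((1 / sqrt (1/s)) ^ DIM('a) * e) = complex_of_real e" for e
    unfolding of_real_mult[symmetric] by (rule arg_cong)
   moreover have "pi * (norm (orth_proj UNIV (\<xi> - p)))\<^sup>2 / (1/s) = pi * s * (norm (\<xi> - p))\<^sup>2"
    by (simp add: orth_proj_id[OF subspace_UNIV])
   ultimately show ?thesis by (simp only: bump_def)
  qed
  finally show "fourier ?\<psi> \<xi> = bump s p \<xi>" .
 qed
qed

text \<open>The probability that a Gaussian of width \<open>c\<close> around \<open>x\<close> hits \<open>A\<close>.\<close>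

definition gauss_mass :: "'a::euclidean_space set \<Rightarrow> real \<Rightarrow> 'a \<Rightarrow> ennreal" where
 "gauss_mass A c x = (\<integral>\<^sup>+y. indicator A (x + c *\<^sub>R y) * ennreal (exp (- (pi * 1 * (norm y)\<^sup>2))) \<partial>lborel)"

lemma nn_integral_gaussian_lborel:
 "s > 0 \<Longrightarrow> (\<integral>\<^sup>+y. ennreal (exp (- (pi * s * (norm y)\<^sup>2))) \<partial>(lborel :: 'a::euclidean_space measure)) = ennreal ((1 / sqrt s) ^ DIM('a))"
 using nn_integral_gaussian_subspace[OF subspace_UNIV, of s, where 'a='a] by (simp add: subspace_lborel_UNIV)

lemma borel_measurable_gauss_mass [measurable]:
 assumes [measurable]: "A \<in> sets borel"
 shows "gauss_mass A c \<in> borel_measurable borel"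
 unfolding gauss_mass_def[abs_def] by measurable

lemma gauss_mass_eq:
 fixes x :: "'a::euclidean_space"
 assumes c: "c > 0" and [measurable]: "A \<in> sets borel"
 shows "ennreal (c ^ DIM('a)) * gauss_mass A c x = (\<integral>\<^sup>+p. indicator A p * ennreal (exp (- (pi * (1 / c\<^sup>2) * (norm (x - p))\<^sup>2))) \<partial>lborel)"
proof -
 let ?F = "\<lambda>p. indicator A p * ennreal (exp (- (pi * (1 / c\<^sup>2) * (norm (x - p))\<^sup>2)))"
 have "(\<integral>\<^sup>+p. ?F p \<partial>lborel) = (\<integral>\<^sup>+p. ?F p \<partial>distr lborel borel ((+) x))" by (simp add: lborel_distr_plus)
 also have "\<dots> = (\<integral>\<^sup>+y. ?F (x + y) \<partial>lborel)" by (subst nn_integral_distr) auto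
 also have "\<dots> = ennreal (c ^ DIM('a)) * (\<integral>\<^sup>+y. ?F (x + c *\<^sub>R y) \<partial>lborel)"
  by (rule nn_integral_lborel_scale[OF c]) measurable
 also have "(\<integral>\<^sup>+y. ?F (x + c *\<^sub>R y) \<partial>lborel) = gauss_mass A c x"
  unfolding gauss_mass_def using c by (intro nn_integral_cong) (simp add: power_mult_distrib)
 finally show ?thesis by simp
qed

lemma gauss_mass_le:
 fixes x :: "'a::euclidean_space"
 assumes c: "0 < c" "c \<le> 1" and A: "A \<subseteq> cball 0 R" "A \<in> sets borel"
 shows "gauss_mass A c x \<le> ennreal ((1 / sqrt (1/2)) ^ DIM('a) * exp (pi * R\<^sup>2 / 2)) * ennreal (exp (- (pi * (1/4) * (norm (x - 0))\<^sup>2)))"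
proof -
 have "gauss_mass A c x \<le> (\<integral>\<^sup>+y. ennreal (exp (pi * R\<^sup>2 / 2) * exp (- (pi * (1/4) * (norm x)\<^sup>2))) * ennreal (exp (- (pi * (1/2) * (norm y)\<^sup>2))) \<partial>(lborel :: 'a measure))"
  unfolding gauss_mass_def
 proof (rule nn_integral_mono)
  fix y :: 'a
  show "indicator A (x + c *\<^sub>R y) * ennreal (exp (- (pi * 1 * (norm y)\<^sup>2))) \<le>
   ennreal (exp (pi * R\<^sup>2 / 2) * exp (- (pi * (1/4) * (norm x)\<^sup>2))) * ennreal (exp (- (pi * (1/2) * (norm y)\<^sup>2)))"
  proof (cases "x + c *\<^sub>R y \<in> A")
   case True
   then have "norm (x + c *\<^sub>R y) \<le> R" using A by auto
   moreover have "norm (c *\<^sub>R y) \<le> norm y" using c by (simp add: mult_left_le_one_le)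
   ultimately have "norm x \<le> R + norm y" using norm_triangle_ineq4[of "x + c *\<^sub>R y" "c *\<^sub>R y"] by simp
   then have "(norm x)\<^sup>2 \<le> (R + norm y)\<^sup>2" by (intro power_mono) auto
   also have "\<dots> \<le> 2 * R\<^sup>2 + 2 * (norm y)\<^sup>2" using sum_squares_bound[of R "norm y"] by (simp add: power2_sum)
   finally have "- (norm y)\<^sup>2 \<le> R\<^sup>2 / 2 - (1/4) * (norm x)\<^sup>2 - (1/2) * (norm y)\<^sup>2" by simp
   then have "pi * (- (norm y)\<^sup>2) \<le> pi * (R\<^sup>2 / 2 - (1/4) * (norm x)\<^sup>2 - (1/2) * (norm y)\<^sup>2)"
    by (intro mult_left_mono) auto
   then have "exp (- (pi * 1 * (norm y)\<^sup>2)) \<le> exp (pi * R\<^sup>2 / 2) * exp (- (pi * (1/4) * (norm x)\<^sup>2)) * exp (- (pi * (1/2) * (norm y)\<^sup>2))"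
    by (simp add: exp_add[symmetric] right_diff_distrib)
   then show ?thesis using True by (simp add: ennreal_mult[symmetric] ennreal_leI)
  qed simp
 qed
 also have "\<dots> = ennreal (exp (pi * R\<^sup>2 / 2) * exp (- (pi * (1/4) * (norm x)\<^sup>2))) * ennreal ((1 / sqrt (1/2)) ^ DIM('a))"
  by (subst nn_integral_cmult) (simp_all only: nn_integral_gaussian_lborel[of "1/2"], auto)
 finally show ?thesis by (simp add: ennreal_mult[symmetric] mult_ac)
qed

lemma gauss_mass_tendsto:
 fixes x :: "'a::euclidean_space"
 assumes x: "x \<in> box a b \<or> x \<notin> cbox a b" and c: "c \<longlonglongrightarrow> 0"
 shows "(\<lambda>j. gauss_mass (box a b) (c j) x) \<longlonglongrightarrow> indicator (box a b) x"
proof -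
 let ?e = "\<lambda>y::'a. ennreal (exp (- (pi * 1 * (norm y)\<^sup>2)))"
 have n: "(\<integral>\<^sup>+y. ?e y \<partial>lborel) = 1" by (subst nn_integral_gaussian_lborel) auto
 have "(\<lambda>j. gauss_mass (box a b) (c j) x) \<longlonglongrightarrow> (\<integral>\<^sup>+y. indicator (box a b) x * ?e y \<partial>lborel)"
  unfolding gauss_mass_def
 proof (rule nn_integral_dominated_convergence[where w="?e"])
  show "AE y in lborel. indicator (box a b) (x + c j *\<^sub>R y) * ?e y \<le> ?e y" for j
   by (intro AE_I2) (auto simp: indicator_def)
  show "AE y in lborel. (\<lambda>j. indicator (box a b) (x + c j *\<^sub>R y) * ?e y) \<longlonglongrightarrow> indicator (box a b) x * ?e y"
  proof (intro AE_I2)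
   fix y
   have t: "(\<lambda>j. x + c j *\<^sub>R y) \<longlonglongrightarrow> x"
    using tendsto_add[OF tendsto_const tendsto_scaleR[OF c tendsto_const], of x y] by simp
   have "\<forall>\<^sub>F j in sequentially. (indicator (box a b) (x + c j *\<^sub>R y) :: ennreal) = indicator (box a b) x"
    using x
   proof
    assume "x \<in> box a b"
    then show ?thesis using topological_tendstoD[OF t open_box, of a b] by (auto elim!: eventually_mono)
   next
    assume "x \<notin> cbox a b"
    then show ?thesis
     using topological_tendstoD[OF t open_Compl[OF closed_cbox], of a b] box_subset_cbox[of a b]
     by (auto elim!: eventually_mono simp: indicator_def)
   qed
   then show "(\<lambda>j. indicator (box a b) (x + c j *\<^sub>R y) * ?e y) \<longlonglongrightarrow> indicator (box a b) x * ?e y"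
    by (intro tendsto_eventually) (auto elim!: eventually_mono)
  qed
  show "(\<integral>\<^sup>+y. ?e y \<partial>lborel) < \<infinity>" by (simp only: n) simp
 qed measurable
 moreover have "(\<integral>\<^sup>+y. indicator (box a b) x * ?e y \<partial>lborel) = indicator (box a b) x"
  using n by (subst nn_integral_cmult) auto
 ultimately show ?thesis by (simp only:)
qed

lemma AE_not_box_boundary: "AE x::'a::euclidean_space in lborel. x \<in> box a b \<or> x \<notin> cbox a b"
proof -
 have "emeasure lborel (cbox a b - box a b) = 0"
  using box_subset_cbox[of a b]
  by (subst emeasure_Diff) (auto simp: emeasure_lborel_box_eq emeasure_lborel_cbox_eq)
 then have "cbox a b - box a b \<in> null_sets lborel" by (auto simp: null_sets_def)
 from AE_not_in[OF this] show ?thesis by eventually_elim auto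
qed

text \<open>
 A function whose integrals against all Gaussians vanish is zero: smearing the indicator of a
 box by narrow Gaussians shows that its positive and negative part give boxes the same mass.
\<close>

lemma gaussian_determines:
 fixes h :: "'a::euclidean_space \<Rightarrow> real"
 assumes [measurable]: "h \<in> borel_measurable borel"
  and int: "\<And>s p. s > 0 \<Longrightarrow> integrable lborel (\<lambda>x. exp (- (pi * s * (norm (x - p))\<^sup>2)) * h x)"
  and zero: "\<And>s p. s > 0 \<Longrightarrow> (\<integral>x. exp (- (pi * s * (norm (x - p))\<^sup>2)) * h x \<partial>lborel) = 0"
 shows "AE x in lborel. h x = 0"
proof -
 let ?e = "\<lambda>s p x. exp (- (pi * s * (norm (x - p))\<^sup>2))"
 define h1 h2 where "h1 x = ennreal (h x)" and "h2 x = ennreal (- h x)" for x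
 have hm [measurable]: "h1 \<in> borel_measurable borel" "h2 \<in> borel_measurable borel"
  unfolding h1_def[abs_def] h2_def[abs_def] by measurable
 have ht: "h1 x < top" "h2 x < top" for x by (simp_all add: h1_def h2_def)
 have e1: "ennreal (?e s p x * h x) = ennreal (?e s p x) * h1 x" for s p x
  unfolding h1_def by (cases "h x \<ge> 0") (simp_all add: ennreal_mult ennreal_neg mult_nonneg_nonpos)
 have e2: "ennreal (- (?e s p x * h x)) = ennreal (?e s p x) * h2 x" for s p x
  unfolding h2_def by (cases "h x \<le> 0") (simp_all add: ennreal_mult[symmetric] ennreal_neg mult_nonneg_nonneg)
 have fin: "(\<integral>\<^sup>+x. ennreal (?e s p x) * h1 x \<partial>lborel) < \<infinity>" "(\<integral>\<^sup>+x. ennreal (?e s p x) * h2 x \<partial>lborel) < \<infinity>"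
  if "s > 0" for s p
  using int[OF that, of p] unfolding real_integrable_def e1 e2 by (auto simp: less_top)
 have eq: "(\<integral>\<^sup>+x. ennreal (?e s p x) * h1 x \<partial>lborel) = (\<integral>\<^sup>+x. ennreal (?e s p x) * h2 x \<partial>lborel)" if "s > 0" for s p
 proof -
  let ?a = "\<integral>\<^sup>+x. ennreal (?e s p x) * h1 x \<partial>lborel" and ?b = "\<integral>\<^sup>+x. ennreal (?e s p x) * h2 x \<partial>lborel"
  have "enn2real ?a - enn2real ?b = 0"
   using zero[OF that, of p] unfolding real_lebesgue_integral_def[OF int[OF that]] e1 e2 .
  then have "ennreal (enn2real ?a) = ennreal (enn2real ?b)" by simp
  moreover have "ennreal (enn2real ?a) = ?a"
   using fin(1)[OF that, of p] by (intro ennreal_enn2real) simp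
  moreover have "ennreal (enn2real ?b) = ?b"
   using fin(2)[OF that, of p] by (intro ennreal_enn2real) simp
  ultimately show ?thesis by (simp only:)
 qed
 define c where "c j = inverse (real (Suc j))" for j
 have c: "0 < c j" "c j \<le> 1" for j by (auto simp: c_def inverse_le_1_iff)
 have c0: "c \<longlonglongrightarrow> 0" unfolding c_def by (rule LIMSEQ_inverse_real_of_nat)
 have smear: "ennreal (c j ^ DIM('a)) * (\<integral>\<^sup>+x. gauss_mass (box a b) (c j) x * g x \<partial>lborel) =
   (\<integral>\<^sup>+p. indicator (box a b) p * (\<integral>\<^sup>+x. ennreal (?e (1 / (c j)\<^sup>2) p x) * g x \<partial>lborel) \<partial>lborel)"
  if [measurable]: "g \<in> borel_measurable borel" for g and a b :: 'a and j
 proof -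
  have "ennreal (c j ^ DIM('a)) * (\<integral>\<^sup>+x. gauss_mass (box a b) (c j) x * g x \<partial>lborel) =
   (\<integral>\<^sup>+x. (ennreal (c j ^ DIM('a)) * gauss_mass (box a b) (c j) x) * g x \<partial>lborel)"
   by (subst nn_integral_cmult[symmetric]) (auto simp: mult.assoc)
  also have "\<dots> = (\<integral>\<^sup>+x. \<integral>\<^sup>+p. indicator (box a b) p * ennreal (?e (1 / (c j)\<^sup>2) p x) * g x \<partial>lborel \<partial>lborel)"
   using c(1) by (intro nn_integral_cong) (simp add: gauss_mass_eq nn_integral_multc)
  also have "\<dots> = (\<integral>\<^sup>+p. \<integral>\<^sup>+x. indicator (box a b) p * ennreal (?e (1 / (c j)\<^sup>2) p x) * g x \<partial>lborel \<partial>lborel)"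
   by (rule lborel_pair.Fubini'[symmetric]) measurable
  finally show ?thesis by (simp add: nn_integral_cmult mult.assoc)
 qed
 have lim: "(\<lambda>j. \<integral>\<^sup>+x. gauss_mass (box a b) (c j) x * g x \<partial>lborel) \<longlonglongrightarrow> (\<integral>\<^sup>+x. indicator (box a b) x * g x \<partial>lborel)"
  and finb: "(\<integral>\<^sup>+x. indicator (box a b) x * g x \<partial>lborel) < \<infinity>"
  if [measurable]: "g \<in> borel_measurable borel" and gt: "\<And>x. g x < top" and fg: "(\<integral>\<^sup>+x. ennreal (?e (1/4) 0 x) * g x \<partial>lborel) < \<infinity>" for g and a b :: 'a
 proof -
  obtain R where "\<forall>x\<in>box a b. norm x \<le> R" using bounded_box[of a b] unfolding bounded_iff by blast
  then have R: "box a b \<subseteq> cball 0 R" by auto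
  let ?K = "ennreal ((1 / sqrt (1/2)) ^ DIM('a) * exp (pi * R\<^sup>2 / 2))"
  let ?w = "\<lambda>x. ?K * (ennreal (?e (1/4) 0 x) * g x)"
  have w: "(\<integral>\<^sup>+x. ?w x \<partial>lborel) < \<infinity>" using fg by (subst nn_integral_cmult) (auto simp: ennreal_mult_less_top)
  have gw: "gauss_mass (box a b) (c j) x * g x \<le> ?w x" for j x
   using mult_right_mono[OF gauss_mass_le[OF c(1)[of j] c(2)[of j] R borel_open[OF open_box], of x], of "g x"] by (simp add: mult.assoc)
  have ae: "AE x in lborel. (\<lambda>j. gauss_mass (box a b) (c j) x * g x) \<longlonglongrightarrow> indicator (box a b) x * g x"
   using AE_not_box_boundary[of a b]
  proof eventually_elim
   case (elim x)
   show ?case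
    using gauss_mass_tendsto[OF elim c0] gt[of x]
    by (intro tendsto_mult_ennreal tendsto_const) (auto simp: indicator_def)
  qed
  show "(\<lambda>j. \<integral>\<^sup>+x. gauss_mass (box a b) (c j) x * g x \<partial>lborel) \<longlonglongrightarrow> (\<integral>\<^sup>+x. indicator (box a b) x * g x \<partial>lborel)"
  proof (rule nn_integral_dominated_convergence[OF _ _ _ _ w ae])
   show "AE x in lborel. gauss_mass (box a b) (c j) x * g x \<le> ?w x" for j by (rule AE_I2) (rule gw)
  qed measurable
  have "AE x in lborel. indicator (box a b) x * g x \<le> ?w x"
   using ae
  proof eventually_elim
   case (elim x)
   show ?case by (rule LIMSEQ_le_const2[OF elim]) (intro exI[of _ 0] allI impI gw)
  qed
  then show "(\<integral>\<^sup>+x. indicator (box a b) x * g x \<partial>lborel) < \<infinity>"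
   by (intro order.strict_trans1[OF nn_integral_mono_AE w])
 qed
 have q: "(1/4::real) > 0" by simp
 have eqg: "(\<integral>\<^sup>+x. gauss_mass (box a b) (c j) x * h1 x \<partial>lborel) = (\<integral>\<^sup>+x. gauss_mass (box a b) (c j) x * h2 x \<partial>lborel)" for a b :: 'a and j
 proof -
  have "ennreal (c j ^ DIM('a)) * (\<integral>\<^sup>+x. gauss_mass (box a b) (c j) x * h1 x \<partial>lborel) = ennreal (c j ^ DIM('a)) * (\<integral>\<^sup>+x. gauss_mass (box a b) (c j) x * h2 x \<partial>lborel)"
  proof -
   have "1 / (c j)\<^sup>2 > 0" using c(1)[of j] by simp
   note e = eq[OF this]
   show ?thesis unfolding smear[OF hm(1)] smear[OF hm(2)] e ..
  qed
  then show ?thesis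
   using c(1)[of j] by (subst (asm) ennreal_mult_cancel_left) auto
 qed
 have boxes: "(\<integral>\<^sup>+x. indicator (box a b) x * h1 x \<partial>lborel) = (\<integral>\<^sup>+x. indicator (box a b) x * h2 x \<partial>lborel)" for a b :: 'a
  using LIMSEQ_unique[OF lim[of h1, OF _ ht(1) fin(1)[OF q], of a b, unfolded eqg] lim[of h2, OF _ ht(2) fin(2)[OF q], of a b]] by simp
 have "density lborel h1 = density lborel h2"
 proof (rule measure_eqI_generator_eq[where \<Omega>=UNIV and E="range (\<lambda>(a, b). box a b :: 'a set)" and A="\<lambda>i. box (- (real i *\<^sub>R One)) (real i *\<^sub>R One)"])
  show "Int_stable (range (\<lambda>(a, b). box a b :: 'a set))" by (auto simp: Int_stable_def box_Int_box)
  show "sets (density lborel h1) = sigma_sets UNIV (range (\<lambda>(a, b). box a b :: 'a set))"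
   "sets (density lborel h2) = sigma_sets UNIV (range (\<lambda>(a, b). box a b :: 'a set))"
   by (simp_all add: borel_eq_box)
  show "(\<Union>i. box (- (real i *\<^sub>R One)) (real i *\<^sub>R One)) = (UNIV :: 'a set)" by (rule UN_box_eq_UNIV)
  show "emeasure (density lborel h1) (box (- (real i *\<^sub>R One)) (real i *\<^sub>R One)) \<noteq> \<infinity>" for i
   using finb[of h1, OF _ ht(1) fin(1)[OF q]] by (simp add: emeasure_density mult.commute less_top)
  fix X assume "X \<in> range (\<lambda>(a, b). box a b :: 'a set)"
  then obtain a b where "X = box a b" by auto
  then show "emeasure (density lborel h1) X = emeasure (density lborel h2) X"
   using boxes[of a b] by (simp add: emeasure_density mult.commute)
 qed auto
 then have "AE x in lborel. h1 x = h2 x" by (subst (asm) sigma_finite_measure.density_unique_iff[OF sigma_finite_lborel]) auto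
 then show ?thesis
 proof eventually_elim
  case (elim x)
  then show ?case unfolding h1_def h2_def by (cases "h x \<ge> 0") (simp_all add: ennreal_neg ennreal_eq_0_iff)
 qed
qed

lemma gaussian_determines_complex:
 fixes h :: "'a::euclidean_space \<Rightarrow> complex"
 assumes [measurable]: "h \<in> borel_measurable borel"
  and int: "\<And>s p. s > 0 \<Longrightarrow> integrable lborel (\<lambda>x. bump s p x * h x)"
  and zero: "\<And>s p. s > 0 \<Longrightarrow> (\<integral>x. bump s p x * h x \<partial>lborel) = 0"
 shows "AE x in lborel. h x = 0"
proof -
 have "AE x in lborel. Re (h x) = 0"
 proof (rule gaussian_determines)
  fix s :: real and p :: 'a assume s: "s > 0"
  show "integrable lborel (\<lambda>x. exp (- (pi * s * (norm (x - p))\<^sup>2)) * Re (h x))"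
   using integrable_Re[OF int[OF s, of p]] by (simp add: bump_def)
  show "(\<integral>x. exp (- (pi * s * (norm (x - p))\<^sup>2)) * Re (h x) \<partial>lborel) = 0"
   using integral_Re[OF int[OF s, of p]] zero[OF s, of p] by (simp add: bump_def)
 qed measurable
 moreover have "AE x in lborel. Im (h x) = 0"
 proof (rule gaussian_determines)
  fix s :: real and p :: 'a assume s: "s > 0"
  show "integrable lborel (\<lambda>x. exp (- (pi * s * (norm (x - p))\<^sup>2)) * Im (h x))"
   using integrable_Im[OF int[OF s, of p]] by (simp add: bump_def)
  show "(\<integral>x. exp (- (pi * s * (norm (x - p))\<^sup>2)) * Im (h x) \<partial>lborel) = 0"
   using integral_Im[OF int[OF s, of p]] zero[OF s, of p] by (simp add: bump_def)
 qed measurable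
 ultimately show ?thesis by eventually_elim (simp add: complex_eq_iff)
qed

section \<open>Completeness of square-integrable functions\<close>

lemma normsq_diff_triangle: "(norm (x - z))\<^sup>2 \<le> 2 * (norm (x - y))\<^sup>2 + 2 * (norm (y - z :: 'a::real_normed_vector))\<^sup>2"
proof -
 have "(norm (x - z))\<^sup>2 \<le> (norm (x - y) + norm (y - z))\<^sup>2"
  using norm_triangle_ineq[of "x - y" "y - z"] by (intro power_mono) auto
 then show ?thesis using sum_squares_bound[of "norm (x - y)" "norm (y - z)"] by (simp add: power2_sum)
qed

lemma L2_complete:
 fixes f :: "nat \<Rightarrow> 'a \<Rightarrow> 'b::euclidean_space"
 assumes L2: "\<And>j. f j \<in> L2 N"
  and cauchy: "\<And>e. e > 0 \<Longrightarrow> \<exists>K. \<forall>i\<ge>K. \<forall>j\<ge>K. L2_normsq N (\<lambda>x. f i x - f j x) < e"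
 shows "\<exists>g\<in>L2 N. L2_tendsto N f g"
proof -
 have [measurable]: "f j \<in> borel_measurable N" for j using L2[of j] by (simp add: L2_def)
 have "\<forall>k. \<exists>K. \<forall>i\<ge>K. \<forall>j\<ge>K. L2_normsq N (\<lambda>x. f i x - f j x) < ennreal ((1/4) ^ k)"
  using cauchy by auto
 then obtain K where K: "\<And>k i j. i \<ge> K k \<Longrightarrow> j \<ge> K k \<Longrightarrow> L2_normsq N (\<lambda>x. f i x - f j x) < ennreal ((1/4) ^ k)"
  by metis
 define r where "r k = (\<Sum>l\<le>k. K l)" for k
 have rK: "K k \<le> r k" "K k \<le> r (Suc k)" for k by (auto simp: r_def intro: trans_le_add1 member_le_sum[of k "{..k}" K])
 let ?u = "\<lambda>k x. f (r (Suc k)) x - f (r k) x"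
 have "(\<integral>\<^sup>+x. (\<Sum>k. ennreal (2 ^ k * (norm (?u k x))\<^sup>2)) \<partial>N) = (\<Sum>k. \<integral>\<^sup>+x. ennreal (2 ^ k * (norm (?u k x))\<^sup>2) \<partial>N)"
  by (rule nn_integral_suminf) measurable
 also have "\<dots> \<le> (\<Sum>k. ennreal ((1/2) ^ k))"
 proof (intro suminf_le allI)
  fix k
  have "(\<integral>\<^sup>+x. ennreal (2 ^ k * (norm (?u k x))\<^sup>2) \<partial>N) = ennreal (2 ^ k) * L2_normsq N (?u k)"
   by (simp add: ennreal_mult nn_integral_cmult L2_normsq_def)
  also have "\<dots> \<le> ennreal (2 ^ k) * ennreal ((1/4) ^ k)"
   using K[of k "r (Suc k)" "r k"] rK by (intro mult_left_mono) (auto intro: less_imp_le)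
  also have "\<dots> = ennreal ((1/2) ^ k)" by (simp add: ennreal_mult[symmetric] power_mult_distrib[symmetric])
  finally show "(\<integral>\<^sup>+x. ennreal (2 ^ k * (norm (?u k x))\<^sup>2) \<partial>N) \<le> ennreal ((1/2) ^ k)" .
 qed auto
 also have "\<dots> = ennreal (\<Sum>k. (1/2) ^ k)"
  by (rule suminf_ennreal2) (auto intro: summable_geometric)
 also have "\<dots> < \<infinity>" by simp
 finally have "AE x in N. (\<Sum>k. ennreal (2 ^ k * (norm (?u k x))\<^sup>2)) \<noteq> \<infinity>"
  by (intro nn_integral_PInf_AE) auto
 then have conv: "AE x in N. convergent (\<lambda>k. f (r k) x)"
 proof eventually_elim
  case (elim x)
  then have s: "summable (\<lambda>k. 2 ^ k * (norm (?u k x))\<^sup>2)"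
   by (intro summable_suminf_not_top) auto
  have "summable (\<lambda>k. norm (?u k x))"
  proof (rule summable_comparison_test')
   show "summable (\<lambda>k. (1/2) ^ k + 2 ^ k * (norm (?u k x))\<^sup>2)"
    using s by (intro summable_add summable_geometric) auto
   fix k
   let ?a = "norm (?u k x)"
   have "0 \<le> ((1/2) ^ k - ?a)\<^sup>2" by simp
   then have "2 * (1/2) ^ k * ?a \<le> ((1/2) ^ k)\<^sup>2 + ?a\<^sup>2" by (simp add: power2_diff)
   then have "2 ^ k * (2 * (1/2) ^ k * ?a) \<le> 2 ^ k * (((1/2) ^ k)\<^sup>2 + ?a\<^sup>2)" by (intro mult_left_mono) auto
   moreover have "2 ^ k * (1/2::real) ^ k = 1" by (simp add: power_mult_distrib[symmetric])
   moreover have "2 ^ k * (2 * (1/2) ^ k * ?a) = 2 * ?a * (2 ^ k * (1/2) ^ k)"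
    "2 ^ k * (((1/2) ^ k)\<^sup>2 + ?a\<^sup>2) = (2 ^ k * (1/2) ^ k) * (1/2) ^ k + 2 ^ k * ?a\<^sup>2"
    by (simp_all only: power2_eq_square algebra_simps)
   ultimately have "2 * ?a \<le> (1/2) ^ k + 2 ^ k * ?a\<^sup>2"
    by (simp only: mult_1_left mult_1_right)
   then show "norm (norm (?u k x)) \<le> (1/2) ^ k + 2 ^ k * (norm (?u k x))\<^sup>2"
    using norm_ge_zero[of "?u k x"] unfolding real_norm_def abs_norm_cancel by linarith
  qed
  then have "summable (\<lambda>k. ?u k x)" by (rule summable_norm_cancel)
  then have "convergent (\<lambda>n. f (r n) x - f (r 0) x)"
   unfolding summable_iff_convergent by (simp only: sum_lessThan_telescope[of "\<lambda>k. f (r k) x"])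
  from convergent_add[OF this convergent_const[of "f (r 0) x"]] show ?case by simp
 qed
 define g where "g x = lim (\<lambda>k. f (r k) x)" for x
 have gm[measurable]: "g \<in> borel_measurable N" unfolding g_def[abs_def] by (rule borel_measurable_lim_metric) measurable
 have fg: "L2_normsq N (\<lambda>x. f i x - g x) \<le> ennreal ((1/4) ^ k)" if i: "i \<ge> K k" for i k
 proof -
  have "L2_normsq N (\<lambda>x. f i x - g x) = (\<integral>\<^sup>+x. liminf (\<lambda>l. ennreal ((norm (f i x - f (r l) x))\<^sup>2)) \<partial>N)"
   unfolding L2_normsq_def
  proof (rule nn_integral_cong_AE, use conv in eventually_elim)
   case (elim x)
   then have "(\<lambda>l. f (r l) x) \<longlonglongrightarrow> g x" unfolding g_def by (simp add: convergent_LIMSEQ_iff)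
   then have "(\<lambda>l. ennreal ((norm (f i x - f (r l) x))\<^sup>2)) \<longlonglongrightarrow> ennreal ((norm (f i x - g x))\<^sup>2)"
    by (intro tendsto_intros)
   from lim_imp_Liminf[OF trivial_limit_sequentially this] show ?case by simp
  qed
  also have "\<dots> \<le> liminf (\<lambda>l. L2_normsq N (\<lambda>x. f i x - f (r l) x))"
   unfolding L2_normsq_def by (rule nn_integral_liminf) measurable
  also have "\<dots> \<le> liminf (\<lambda>l. ennreal ((1/4) ^ k))"
  proof (rule Liminf_mono)
   have "r l \<ge> K k" if "l \<ge> k" for l
    using that unfolding r_def by (intro member_le_sum) auto
   then show "\<forall>\<^sub>F l in sequentially. L2_normsq N (\<lambda>x. f i x - f (r l) x) \<le> ennreal ((1/4) ^ k)"
    using K[OF i] by (auto simp: eventually_sequentially intro!: exI[of _ k] less_imp_le)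
  qed
  finally show ?thesis by (simp add: Liminf_const)
 qed
 have "L2_normsq N g \<le> (\<integral>\<^sup>+x. ennreal (2 * (norm (f (K 0) x - g x))\<^sup>2) + ennreal (2 * (norm (f (K 0) x))\<^sup>2) \<partial>N)"
  unfolding L2_normsq_def
 proof (rule nn_integral_mono)
  fix x
  have "(norm (g x))\<^sup>2 \<le> 2 * (norm (f (K 0) x - g x))\<^sup>2 + 2 * (norm (f (K 0) x))\<^sup>2"
   using normsq_diff_triangle[of "g x" 0 "f (K 0) x"] by (simp add: norm_minus_commute)
  then show "ennreal ((norm (g x))\<^sup>2) \<le> ennreal (2 * (norm (f (K 0) x - g x))\<^sup>2) + ennreal (2 * (norm (f (K 0) x))\<^sup>2)"
   by (simp add: ennreal_plus[symmetric] ennreal_leI del: ennreal_plus)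
 qed
 also have "\<dots> = 2 * L2_normsq N (\<lambda>x. f (K 0) x - g x) + 2 * L2_normsq N (f (K 0))"
  by (simp add: nn_integral_add nn_integral_cmult L2_normsq_def ennreal_mult)
 also have "\<dots> < \<infinity>"
  using fg[of 0 "K 0"] L2[of "K 0"] by (auto simp: L2_def ennreal_mult_less_top intro: order.strict_trans1)
 finally have "g \<in> L2 N" by (simp add: L2_def)
 moreover have "L2_tendsto N f g"
  unfolding L2_tendsto_def
 proof (rule order_tendstoI)
  fix e :: ennreal assume e: "0 < e"
  have "(\<lambda>k. ennreal ((1/4) ^ k)) \<longlonglongrightarrow> ennreal 0"
   by (intro tendsto_ennrealI LIMSEQ_power_zero) simp
  then have "\<forall>\<^sub>F k in sequentially. ennreal ((1/4) ^ k) < e"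
   using e by (intro order_tendstoD) auto
  then obtain k where "ennreal ((1/4) ^ k) < e" by (auto simp: eventually_sequentially)
  then show "\<forall>\<^sub>F i in sequentially. L2_normsq N (\<lambda>x. f i x - g x) < e"
   unfolding eventually_sequentially using fg order.strict_trans1 by blast
 qed simp
 ultimately show ?thesis by blast
qed

section \<open>Schwartz forms and their plane transforms\<close>

lemma schwartzD:
 assumes "schwartz f" "vs \<in> lists Basis"
 shows "iter_deriv vs f differentiable (at x)"
  and "\<exists>C. \<forall>x. norm (iter_deriv vs f x) \<le> C * (1 + (norm x)\<^sup>2) powr (- real N / 2)"
 using bspec[OF assms(1)[unfolded schwartz_def] assms(2)] by auto

lemma iter_deriv_bounded_linear:
 assumes T: "bounded_linear T" and f: "schwartz f" and vs: "vs \<in> lists Basis"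
 shows "iter_deriv vs (\<lambda>x. T (f x)) = (\<lambda>x. T (iter_deriv vs f x))"
 using vs
proof (induction vs rule: list.induct)
 case (Cons v vs)
 have vs: "vs \<in> lists Basis" using Cons.prems by simp
 show ?case
 proof
  fix x
  have "(iter_deriv vs f has_derivative frechet_derivative (iter_deriv vs f) (at x)) (at x)"
   using schwartzD(1)[OF f vs] frechet_derivative_works by blast
  from bounded_linear.has_derivative[OF T this]
  have "frechet_derivative (\<lambda>x. T (iter_deriv vs f x)) (at x) = (\<lambda>v. T (frechet_derivative (iter_deriv vs f) (at x) v))"
   by (rule frechet_derivative_at[symmetric])
  then show "iter_deriv (v # vs) (\<lambda>x. T (f x)) x = T (iter_deriv (v # vs) f x)"
   by (simp add: Cons.IH[OF vs])
 qed
qed simp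

lemma schwartz_bounded_linear:
 fixes f :: "'a::euclidean_space \<Rightarrow> 'b::real_normed_vector" and T :: "'b \<Rightarrow> 'c::real_normed_vector"
 assumes T: "bounded_linear T" and f: "schwartz f"
 shows "schwartz (\<lambda>x. T (f x))"
 unfolding schwartz_def
proof (intro ballI conjI allI)
 fix vs :: "'a list" and N :: nat assume vs: "vs \<in> lists Basis"
 note e = iter_deriv_bounded_linear[OF T f vs]
 show "iter_deriv vs (\<lambda>x. T (f x)) differentiable (at x)" for x
  unfolding e using schwartzD(1)[OF f vs] bounded_linear.has_derivative[OF T] unfolding differentiable_def by blast
 obtain K where K: "K > 0" "\<And>y. norm (T y) \<le> norm y * K" using bounded_linear.pos_bounded[OF T] by blast
 obtain C where C: "\<And>x. norm (iter_deriv vs f x) \<le> C * (1 + (norm x)\<^sup>2) powr (- real N / 2)"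
  using schwartzD(2)[OF f vs] by blast
 have "norm (T (iter_deriv vs f x)) \<le> (C * K) * (1 + (norm x)\<^sup>2) powr (- real N / 2)" for x
 proof -
  have "norm (T (iter_deriv vs f x)) \<le> norm (iter_deriv vs f x) * K" by (rule K)
  also have "\<dots> \<le> (C * (1 + (norm x)\<^sup>2) powr (- real N / 2)) * K" using K(1) C by (intro mult_right_mono) auto
  finally show ?thesis by (simp only: mult_ac)
 qed
 then show "\<exists>C. \<forall>x. norm (iter_deriv vs (\<lambda>x. T (f x)) x) \<le> C * (1 + (norm x)\<^sup>2) powr (- real N / 2)"
  unfolding e by blast
qed

lemma iter_deriv_diff:
 assumes f: "schwartz f" and g: "schwartz g" and vs: "vs \<in> lists Basis"
 shows "iter_deriv vs (\<lambda>x. f x - g x) = (\<lambda>x. iter_deriv vs f x - iter_deriv vs g x)"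
 using vs
proof (induction vs rule: list.induct)
 case (Cons v vs)
 have vs: "vs \<in> lists Basis" using Cons.prems by simp
 show ?case
 proof
  fix x
  have "(iter_deriv vs f has_derivative frechet_derivative (iter_deriv vs f) (at x)) (at x)"
   "(iter_deriv vs g has_derivative frechet_derivative (iter_deriv vs g) (at x)) (at x)"
   using schwartzD(1)[OF f vs] schwartzD(1)[OF g vs] frechet_derivative_works by blast+
  from has_derivative_diff[OF this]
  have "frechet_derivative (\<lambda>x. iter_deriv vs f x - iter_deriv vs g x) (at x) =
    (\<lambda>v. frechet_derivative (iter_deriv vs f) (at x) v - frechet_derivative (iter_deriv vs g) (at x) v)"
   by (rule frechet_derivative_at[symmetric])
  then show "iter_deriv (v # vs) (\<lambda>x. f x - g x) x = iter_deriv (v # vs) f x - iter_deriv (v # vs) g x"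
   by (simp add: Cons.IH[OF vs])
 qed
qed simp

lemma schwartz_diff:
 fixes f g :: "'a::euclidean_space \<Rightarrow> 'b::real_normed_vector"
 assumes f: "schwartz f" and g: "schwartz g"
 shows "schwartz (\<lambda>x. f x - g x)"
 unfolding schwartz_def
proof (intro ballI conjI allI)
 fix vs :: "'a list" and N :: nat assume vs: "vs \<in> lists Basis"
 note e = iter_deriv_diff[OF f g vs]
 show "iter_deriv vs (\<lambda>x. f x - g x) differentiable (at x)" for x
  unfolding e using schwartzD(1)[OF f vs] schwartzD(1)[OF g vs] by (rule differentiable_diff)
 obtain C D where C: "\<And>x. norm (iter_deriv vs f x) \<le> C * (1 + (norm x)\<^sup>2) powr (- real N / 2)"
  and D: "\<And>x. norm (iter_deriv vs g x) \<le> D * (1 + (norm x)\<^sup>2) powr (- real N / 2)"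
  using schwartzD(2)[OF f vs] schwartzD(2)[OF g vs] by metis
 have "norm (iter_deriv vs f x - iter_deriv vs g x) \<le> (C + D) * (1 + (norm x)\<^sup>2) powr (- real N / 2)" for x
  using norm_triangle_ineq4[of "iter_deriv vs f x" "iter_deriv vs g x"] C[of x] D[of x] unfolding distrib_right by linarith
 then show "\<exists>C. \<forall>x. norm (iter_deriv vs (\<lambda>x. f x - g x) x) \<le> C * (1 + (norm x)\<^sup>2) powr (- real N / 2)"
  unfolding e by blast
qed

text \<open>The bound is uniform in \<open>V\<close> because the weight at \<open>x + y\<close> splits for orthogonal \<open>x\<close> and \<open>y\<close>.\<close>

lemma coset_integrals:
 fixes f :: "'a::euclidean_space \<Rightarrow> 'b::{banach, second_countable_topology}"
 assumes f: "rapid_decay f" and [measurable]: "f \<in> borel_measurable borel"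
 shows "\<exists>C\<ge>0. \<forall>V. subspace V \<longrightarrow> (\<forall>x\<in>V. integrable (subspace_lborel (orthogonal_comp V)) (\<lambda>y. f (x + y)) \<and>
  (\<integral>y. norm (f (x + y)) \<partial>subspace_lborel (orthogonal_comp V)) \<le> C * weight x ^ N)"
proof -
 let ?M = "max N DIM('a)"
 obtain C where C: "C \<ge> 0" "\<And>x. norm (f x) \<le> C * weight x ^ (2 * ?M)" using rapid_decayD[OF f] by blast
 have "integrable (subspace_lborel (orthogonal_comp V)) (\<lambda>y. f (x + y)) \<and>
  (\<integral>y. norm (f (x + y)) \<partial>subspace_lborel (orthogonal_comp V)) \<le> (C * pi ^ DIM('a)) * weight x ^ N"
  if V: "subspace V" and x: "x \<in> V" for V x
 proof
  let ?N = "subspace_lborel (orthogonal_comp V)"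
  have W: "subspace (orthogonal_comp V)" by (rule subspace_orthogonal_comp)
  have dM: "dim (orthogonal_comp V) \<le> ?M" using dim_subset_UNIV[of "orthogonal_comp V"] by simp
  have iw: "integrable ?N (\<lambda>y. weight y ^ ?M)" by (rule integrable_weight_subspace[OF W dM])
  have b: "AE y in ?N. norm (f (x + y)) \<le> C * weight x ^ N * weight y ^ ?M"
   using AE_orthogonal_comp[OF x]
  proof eventually_elim
   case (elim y)
   have "norm (f (x + y)) \<le> C * weight (x + y) ^ (2 * ?M)" by (rule C)
   also have "\<dots> \<le> C * (weight x ^ ?M * weight y ^ ?M)"
    using weight_add_le[OF elim] C(1) by (intro mult_left_mono)
   also have "\<dots> \<le> C * (weight x ^ N * weight y ^ ?M)"
    using C(1) by (intro mult_left_mono mult_right_mono power_decreasing) (simp_all add: weight_bounds)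
   finally show ?case by (simp only: mult.assoc)
  qed
  have iw': "integrable ?N (\<lambda>y. C * weight x ^ N * weight y ^ ?M)" using iw by (rule integrable_mult_right)
  show i: "integrable ?N (\<lambda>y. f (x + y))"
   by (rule Bochner_Integration.integrable_bound[OF iw'], measurable) (use b in \<open>auto elim!: eventually_mono\<close>)
  have "ennreal (\<integral>y. weight y ^ ?M \<partial>?N) \<le> ennreal (pi ^ dim (orthogonal_comp V))"
   using nn_integral_weight_subspace[OF W dM] nn_integral_eq_integral[OF iw] by (simp add: weight_bounds)
  then have "(\<integral>y. weight y ^ ?M \<partial>?N) \<le> pi ^ dim (orthogonal_comp V)" by (subst (asm) ennreal_le_iff) auto
  also have "\<dots> \<le> pi ^ DIM('a)" using pi_ge_two dim_subset_UNIV[of "orthogonal_comp V"] by (intro power_increasing) auto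
  finally have w: "(\<integral>y. weight y ^ ?M \<partial>?N) \<le> pi ^ DIM('a)" .
  have "(\<integral>y. norm (f (x + y)) \<partial>?N) \<le> (\<integral>y. C * weight x ^ N * weight y ^ ?M \<partial>?N)"
   using i iw' b by (intro integral_mono_AE) auto
  also have "\<dots> = C * weight x ^ N * (\<integral>y. weight y ^ ?M \<partial>?N)" by (rule integral_mult_right_zero)
  also have "\<dots> \<le> C * weight x ^ N * pi ^ DIM('a)"
   using w C(1) by (intro mult_left_mono mult_nonneg_nonneg) (simp_all add: weight_bounds)
  finally show "(\<integral>y. norm (f (x + y)) \<partial>?N) \<le> (C * pi ^ DIM('a)) * weight x ^ N" by (simp only: mult_ac)
 qed
 moreover have "C * pi ^ DIM('a) \<ge> 0" using C(1) by simp
 ultimately show ?thesis by blast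
qed

definition form_fourier :: "('a::euclidean_space \<Rightarrow> real ^ 'i) \<Rightarrow> 'a \<Rightarrow> complex ^ 'i" where
 "form_fourier w \<xi> = (\<chi> S. fourier (\<lambda>x. complex_of_real (w x $ S)) \<xi>)"

lemma schwartz_formD:
 fixes w :: "'n::{finite,linorder} rvec \<Rightarrow> 'n rform"
 assumes "w \<in> schwartz_forms m"
 shows "schwartz w" "rapid_decay w" "w \<in> borel_measurable borel" "schwartz (\<lambda>x. complex_of_real (w x $ S))"
  "card S \<noteq> m \<Longrightarrow> w x $ S = 0"
proof -
 show s: "schwartz w" using assms by (simp add: schwartz_forms_def)
 show "rapid_decay w" "w \<in> borel_measurable borel" using schwartz_rapid_decay[OF s] schwartz_borel[OF s] by auto
 have "bounded_linear (\<lambda>v::'n rform. complex_of_real (v $ S))"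
  by (rule bounded_linear_compose[OF bounded_linear_of_real bounded_linear_vec_nth])
 from schwartz_bounded_linear[OF this s] show "schwartz (\<lambda>x. complex_of_real (w x $ S))" .
 show "card S \<noteq> m \<Longrightarrow> w x $ S = 0" using assms ext_power_degree[of "w x" m UNIV S] by (auto simp: schwartz_forms_def forms_def)
qed

lemma schwartz_forms_diff:
 assumes "a \<in> schwartz_forms m" "b \<in> schwartz_forms m"
 shows "(\<lambda>x. a x - b x) \<in> schwartz_forms m"
 using assms schwartz_diff by (auto simp: schwartz_forms_def forms_def ext_power_def intro!: span_diff)

lemma form_fourier_diff:
 fixes a b :: "'n::{finite,linorder} rvec \<Rightarrow> 'n rform"
 assumes "a \<in> schwartz_forms m" "b \<in> schwartz_forms m"
 shows "form_fourier (\<lambda>x. a x - b x) \<xi> = form_fourier a \<xi> - form_fourier b \<xi>"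
proof -
 have i: "integrable lborel (\<lambda>x. echar x \<xi> * complex_of_real (a x $ S))" if "a \<in> schwartz_forms m" for a :: "'n rvec \<Rightarrow> 'n rform" and S
 proof -
  note s = schwartz_formD(4)[OF that, of S]
  note [measurable] = schwartz_borel[OF s]
  show ?thesis
   by (rule Bochner_Integration.integrable_bound[OF rapid_decay_integrable[OF schwartz_rapid_decay[OF s]]])
    (auto simp: norm_mult)
 qed
 show ?thesis
  unfolding form_fourier_def fourier_echar
  by (simp add: vec_eq_iff right_diff_distrib Bochner_Integration.integral_diff[OF i[OF assms(1)] i[OF assms(2)]])
qed

lemma form_fourier_rapid_decay:
 fixes w :: "'n::{finite,linorder} rvec \<Rightarrow> 'n rform"
 assumes w: "w \<in> schwartz_forms m"
 shows "rapid_decay (\<lambda>\<xi>. form_fourier w \<xi> $ S)" "(\<lambda>\<xi>. form_fourier w \<xi> $ S) \<in> borel_measurable borel"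
  "card S \<noteq> m \<Longrightarrow> form_fourier w \<xi> $ S = 0"
proof -
 note s = schwartz_formD(4)[OF w, of S]
 show "rapid_decay (\<lambda>\<xi>. form_fourier w \<xi> $ S)" using fourier_rapid_decay[OF s] by (simp add: form_fourier_def)
 show "(\<lambda>\<xi>. form_fourier w \<xi> $ S) \<in> borel_measurable borel"
  using borel_measurable_fourier_on[OF subspace_UNIV schwartz_borel[OF s]] by (simp add: form_fourier_def fourier_on_UNIV)
 show "card S \<noteq> m \<Longrightarrow> form_fourier w \<xi> $ S = 0"
  using schwartz_formD(5)[OF w, of S] by (simp add: form_fourier_def fourier_def)
qed

lemma bounded_linear_ext_map: "bounded_linear (ext_map m g)"
 using ext_map_linear linear_conv_bounded_linear by blast

lemma plane_transform_eq:
 fixes w :: "'n::{finite,linorder} rvec \<Rightarrow> 'n rform"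
 assumes w: "w \<in> schwartz_forms m" and P: "subspace P" and x: "x \<in> P"
 shows "plane_transform m w (P, x) = ext_map m (orth_proj P) (\<integral>y. w (x + y) \<partial>subspace_lborel (orthogonal_comp P))"
  and "integrable (subspace_lborel (orthogonal_comp P)) (\<lambda>y. w (x + y))"
proof -
 show i: "integrable (subspace_lborel (orthogonal_comp P)) (\<lambda>y. w (x + y))"
  using coset_integrals[OF schwartz_formD(2,3)[OF w]] P x by blast
 show "plane_transform m w (P, x) = ext_map m (orth_proj P) (\<integral>y. w (x + y) \<partial>subspace_lborel (orthogonal_comp P))"
  unfolding plane_transform_def by (simp add: form_restrict_eq[OF P] integral_bounded_linear[OF bounded_linear_ext_map i])
qed

lemma plane_transform_diff:
 fixes a b :: "'n::{finite,linorder} rvec \<Rightarrow> 'n rform"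
 assumes a: "a \<in> schwartz_forms m" and b: "b \<in> schwartz_forms m" and P: "subspace P" and x: "x \<in> P"
 shows "plane_transform m (\<lambda>x. a x - b x) (P, x) = plane_transform m a (P, x) - plane_transform m b (P, x)"
 unfolding plane_transform_eq(1)[OF a P x] plane_transform_eq(1)[OF b P x] plane_transform_eq(1)[OF schwartz_forms_diff[OF a b] P x]
 by (simp add: Bochner_Integration.integral_diff[OF plane_transform_eq(2)[OF a P x] plane_transform_eq(2)[OF b P x]] linear_diff[OF ext_map_linear])

lemma plane_transform_bound:
 fixes w :: "'n::{finite,linorder} rvec \<Rightarrow> 'n rform"
 assumes w: "w \<in> schwartz_forms m"
 shows "\<exists>C\<ge>0. \<forall>P. subspace P \<longrightarrow> (\<forall>x\<in>P. norm (plane_transform m w (P, x)) \<le> C * weight x ^ N)"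
proof -
 obtain C where C: "C \<ge> 0" "\<And>P x. subspace P \<Longrightarrow> x \<in> P \<Longrightarrow> (\<integral>y. norm (w (x + y)) \<partial>subspace_lborel (orthogonal_comp P)) \<le> C * weight x ^ N"
  using coset_integrals[OF schwartz_formD(2,3)[OF w]] by blast
 have "norm (plane_transform m w (P, x)) \<le> C * weight x ^ N" if P: "subspace P" and x: "x \<in> P" for P x
 proof -
  have "norm (plane_transform m w (P, x)) \<le> norm (\<integral>y. w (x + y) \<partial>subspace_lborel (orthogonal_comp P))"
   unfolding plane_transform_eq(1)[OF w P x] by (rule norm_ext_map_orth_proj_le[OF P])
  also have "\<dots> \<le> (\<integral>y. norm (w (x + y)) \<partial>subspace_lborel (orthogonal_comp P))" by (rule integral_norm_bound)
  finally show ?thesis using C(2)[OF P x] by simp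
 qed
 then show ?thesis using C(1) by blast
qed

text \<open>
 The Fourier slice theorem: Fubini along \<open>P\<close> and its complement, as the character of \<open>\<xi> \<in> P\<close> is
 constant on the cosets of the complement.
\<close>

lemma fourier_on_plane_transform:
 fixes w :: "'n::{finite,linorder} rvec \<Rightarrow> 'n rform"
 assumes w: "w \<in> schwartz_forms m" and P: "subspace P" and \<xi>: "\<xi> \<in> P"
 shows "fourier_on P (\<lambda>x. complex_of_real (plane_transform m w (P, x) $ S)) \<xi> =
  (\<Sum>S'\<in>UNIV. complex_of_real (ext_map m (orth_proj P) (axis S' 1) $ S) * form_fourier w \<xi> $ S')"
proof -
 let ?N = "subspace_lborel (orthogonal_comp P)"
 let ?c = "\<lambda>S' x. complex_of_real (w x $ S')" and ?L = "\<lambda>S'. ext_map m (orth_proj P) (axis S' 1) $ S"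
 define A where "A S' x = (\<integral>y. ?c S' (x + y) \<partial>?N)" for S' x
 interpret sigma_finite_measure ?N by (rule sigma_finite_subspace_lborel[OF subspace_orthogonal_comp])
 note s = schwartz_formD(4)[OF w]
 have cm[measurable]: "?c S' \<in> borel_measurable borel" for S' by (rule schwartz_borel[OF s])
 have [measurable]: "A S' \<in> borel_measurable borel" for S' unfolding A_def[abs_def] by measurable
 have e: "complex_of_real (plane_transform m w (P, x) $ S) = (\<Sum>S'\<in>UNIV. complex_of_real (?L S') * A S' x)" if x: "x \<in> P" for x
 proof -
  note i = plane_transform_eq(2)[OF w P x]
  have nthA: "complex_of_real ((\<integral>y. w (x + y) \<partial>?N) $ S') = A S' x" for S'
   unfolding A_def integral_complex_of_real integral_bounded_linear[OF bounded_linear_vec_nth i] ..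
  have "plane_transform m w (P, x) $ S = (\<Sum>S'\<in>UNIV. (\<integral>y. w (x + y) \<partial>?N) $ S' * ?L S')"
   unfolding plane_transform_eq(1)[OF w P x] by (rule linear_axis_expansion[OF ext_map_linear])
  then have "complex_of_real (plane_transform m w (P, x) $ S) = (\<Sum>S'\<in>UNIV. complex_of_real ((\<integral>y. w (x + y) \<partial>?N) $ S') * complex_of_real (?L S'))"
   by (simp only: of_real_sum of_real_mult)
  also have "\<dots> = (\<Sum>S'\<in>UNIV. complex_of_real (?L S') * A S' x)"
   unfolding nthA by (intro sum.cong refl mult.commute)
  finally show ?thesis .
 qed
 have iA: "integrable (subspace_lborel P) (\<lambda>x. echar x \<xi> * A S' x)" for S'
 proof -
  from coset_integrals[OF schwartz_rapid_decay[OF s[of S']] cm[of S'], of "dim P"]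
  obtain C where C0: "C \<ge> 0" and C1: "\<And>V x. subspace V \<Longrightarrow> x \<in> V \<Longrightarrow>
    (\<integral>y. norm (?c S' (x + y)) \<partial>subspace_lborel (orthogonal_comp V)) \<le> C * weight x ^ dim P" by auto
  note C = C0 C1[OF P]
  show ?thesis
  proof (rule Bochner_Integration.integrable_bound)
   show "integrable (subspace_lborel P) (\<lambda>x. C * weight x ^ dim P)"
    using integrable_weight_subspace[OF P order_refl] by simp
   show "AE x in subspace_lborel P. norm (echar x \<xi> * A S' x) \<le> norm (C * weight x ^ dim P)"
    using AE_subspace_lborel[OF P]
   proof eventually_elim
    case (elim x)
    have "norm (A S' x) \<le> C * weight x ^ dim P"
     unfolding A_def using integral_norm_bound C(2)[OF elim] by (rule order_trans)
    then show ?case using C(1) by (simp add: norm_mult weight_bounds abs_of_nonneg)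
   qed
  qed measurable
 qed
 have FA: "(\<integral>x. echar x \<xi> * A S' x \<partial>subspace_lborel P) = form_fourier w \<xi> $ S'" for S'
 proof -
  have ic: "integrable lborel (\<lambda>z. echar z \<xi> * ?c S' z)"
   by (rule Bochner_Integration.integrable_bound[OF rapid_decay_integrable[OF schwartz_rapid_decay[OF s[of S']] cm]])
    (auto simp: norm_mult)
  have "form_fourier w \<xi> $ S' = (\<integral>x. \<integral>y. echar (x + y) \<xi> * ?c S' (x + y) \<partial>?N \<partial>subspace_lborel P)"
   unfolding form_fourier_def vec_lambda_beta fourier_echar by (rule integral_subspace_product[OF P _ ic]) measurable
  also have "\<dots> = (\<integral>x. echar x \<xi> * A S' x \<partial>subspace_lborel P)"
  proof (rule Bochner_Integration.integral_cong[OF refl])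
   fix x
   have "(\<integral>y. echar (x + y) \<xi> * ?c S' (x + y) \<partial>?N) = (\<integral>y. echar x \<xi> * ?c S' (x + y) \<partial>?N)"
   proof (rule integral_cong_AE)
    show "AE y in ?N. echar (x + y) \<xi> * ?c S' (x + y) = echar x \<xi> * ?c S' (x + y)"
     using AE_orthogonal_comp[OF \<xi>]
    proof eventually_elim
     case (elim y)
     then have "y \<bullet> \<xi> = 0" by (simp add: inner_commute)
     then show ?case by (simp add: echar_def inner_add_left)
    qed
   qed measurable
   then show "(\<integral>y. echar (x + y) \<xi> * ?c S' (x + y) \<partial>?N) = echar x \<xi> * A S' x" by (simp add: A_def)
  qed
  finally show ?thesis by simp
 qed
 have "fourier_on P (\<lambda>x. complex_of_real (plane_transform m w (P, x) $ S)) \<xi> =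
  (\<integral>x. echar x \<xi> * complex_of_real (plane_transform m w (P, x) $ S) \<partial>subspace_lborel P)" by (simp add: fourier_on_def)
 also have "\<dots> = (\<integral>x. (\<Sum>S'\<in>UNIV. complex_of_real (?L S') * (echar x \<xi> * A S' x)) \<partial>subspace_lborel P)"
 proof (rule integral_cong_AE)
  show "AE x in subspace_lborel P. echar x \<xi> * complex_of_real (plane_transform m w (P, x) $ S) = (\<Sum>S'\<in>UNIV. complex_of_real (?L S') * (echar x \<xi> * A S' x))"
   using AE_subspace_lborel[OF P] by eventually_elim (simp add: e sum_distrib_left mult_ac)
  have [measurable]: "w \<in> borel_measurable borel" by (rule schwartz_formD(3)[OF w])
  have [measurable]: "ext_map m (orth_proj P) \<in> borel_measurable borel"
   by (intro borel_measurable_continuous_onI linear_continuous_on bounded_linear_ext_map)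
  show "(\<lambda>x. echar x \<xi> * complex_of_real (plane_transform m w (P, x) $ S)) \<in> borel_measurable (subspace_lborel P)"
   unfolding plane_transform_def by (simp add: form_restrict_eq[OF P])
 qed measurable
 also have "\<dots> = (\<Sum>S'\<in>UNIV. complex_of_real (?L S') * (\<integral>x. echar x \<xi> * A S' x \<partial>subspace_lborel P))"
  using iA by (subst Bochner_Integration.integral_sum) (auto intro: integrable_mult_right)
 finally show ?thesis by (simp add: FA)
qed

section \<open>Square-integrable functions\<close>

lemma L2D:
 assumes "f \<in> L2 N"
 shows "f \<in> borel_measurable N" "(\<integral>\<^sup>+x. ennreal ((norm (f x))\<^sup>2) \<partial>N) < \<infinity>"
 using assms by (auto simp: L2_def L2_normsq_def)

lemma L2I: "f \<in> borel_measurable N \<Longrightarrow> (\<integral>\<^sup>+x. ennreal ((norm (f x))\<^sup>2) \<partial>N) < \<infinity> \<Longrightarrow> f \<in> L2 N"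
 by (auto simp: L2_def L2_normsq_def)

lemma nn_integral_normsq_bound:
 assumes f: "f \<in> borel_measurable N" and le: "AE x in N. norm (g x) \<le> C * norm (f x)"
 shows "(\<integral>\<^sup>+x. ennreal ((norm (g x))\<^sup>2) \<partial>N) \<le> ennreal (C\<^sup>2) * (\<integral>\<^sup>+x. ennreal ((norm (f x))\<^sup>2) \<partial>N)"
proof -
 have "(\<integral>\<^sup>+x. ennreal ((norm (g x))\<^sup>2) \<partial>N) \<le> (\<integral>\<^sup>+x. ennreal (C\<^sup>2) * ennreal ((norm (f x))\<^sup>2) \<partial>N)"
 proof (rule nn_integral_mono_AE, use le in eventually_elim)
  case (elim x)
  then have "(norm (g x))\<^sup>2 \<le> (C * norm (f x))\<^sup>2" by (intro power_mono) auto
  then show ?case by (simp add: ennreal_mult[symmetric] power_mult_distrib ennreal_leI)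
 qed
 also have "\<dots> = ennreal (C\<^sup>2) * (\<integral>\<^sup>+x. ennreal ((norm (f x))\<^sup>2) \<partial>N)"
  by (rule nn_integral_cmult) (use f in measurable)
 finally show ?thesis .
qed

lemma L2_bound:
 assumes f: "f \<in> L2 N" and g: "g \<in> borel_measurable N" and le: "AE x in N. norm (g x) \<le> C * norm (f x)"
 shows "g \<in> L2 N"
 using nn_integral_normsq_bound[OF L2D(1)[OF f] le] L2D(2)[OF f] g
 by (intro L2I) (auto simp: ennreal_mult_less_top intro: le_less_trans)

lemma L2_tendsto_bound:
 assumes f: "L2_tendsto N f g" and [measurable]: "\<And>j. f j \<in> borel_measurable N" "g \<in> borel_measurable N"
  and le: "\<And>j. AE x in N. norm (f' j x - g' x) \<le> C * norm (f j x - g x)"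
 shows "L2_tendsto N f' g'"
 unfolding L2_tendsto_def
proof (rule tendsto_sandwich[of "\<lambda>_. 0" _ _ "\<lambda>j. ennreal (C\<^sup>2) * L2_normsq N (\<lambda>x. f j x - g x)"])
 show "\<forall>\<^sub>F j in sequentially. L2_normsq N (\<lambda>x. f' j x - g' x) \<le> ennreal (C\<^sup>2) * L2_normsq N (\<lambda>x. f j x - g x)"
  unfolding L2_normsq_def by (intro always_eventually allI nn_integral_normsq_bound le) measurable
 show "(\<lambda>j. ennreal (C\<^sup>2) * L2_normsq N (\<lambda>x. f j x - g x)) \<longlonglongrightarrow> 0"
  using ennreal_tendsto_cmult[OF _ f[unfolded L2_tendsto_def], of "ennreal (C\<^sup>2)"] by simp
qed auto

lemma L2_mult_integrable:
 fixes f g :: "'a \<Rightarrow> complex"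
 assumes f: "f \<in> L2 N" and g: "g \<in> L2 N"
 shows "integrable N (\<lambda>x. f x * g x)"
proof (rule integrableI_bounded)
 note [measurable] = L2D(1)[OF f] L2D(1)[OF g]
 show "(\<lambda>x. f x * g x) \<in> borel_measurable N" by measurable
 have "(\<integral>\<^sup>+x. ennreal (norm (f x * g x)) \<partial>N) \<le> (\<integral>\<^sup>+x. ennreal ((norm (f x))\<^sup>2) + ennreal ((norm (g x))\<^sup>2) \<partial>N)"
 proof (rule nn_integral_mono)
  fix x
  have "norm (f x) * norm (g x) \<ge> 0" by simp
  then have "norm (f x) * norm (g x) \<le> (norm (f x))\<^sup>2 + (norm (g x))\<^sup>2"
   using sum_squares_bound[of "norm (f x)" "norm (g x)"] by linarith
  then show "ennreal (norm (f x * g x)) \<le> ennreal ((norm (f x))\<^sup>2) + ennreal ((norm (g x))\<^sup>2)"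
   by (simp add: norm_mult ennreal_plus[symmetric] ennreal_leI del: ennreal_plus)
 qed
 also have "\<dots> = (\<integral>\<^sup>+x. ennreal ((norm (f x))\<^sup>2) \<partial>N) + (\<integral>\<^sup>+x. ennreal ((norm (g x))\<^sup>2) \<partial>N)"
  by (rule nn_integral_add) measurable
 also have "\<dots> < \<infinity>" using L2D(2)[OF f] L2D(2)[OF g] by (simp add: ennreal_add_less_top)
 finally show "(\<integral>\<^sup>+x. ennreal (norm (f x * g x)) \<partial>N) < \<infinity>" .
qed

lemma L2_pairing_tendsto:
 fixes w :: "'a \<Rightarrow> complex"
 assumes w: "w \<in> L2 N" and F: "\<And>j. F j \<in> L2 N" and G: "G \<in> L2 N" and FG: "L2_tendsto N F G"
 shows "(\<lambda>j. \<integral>x. w x * F j x \<partial>N) \<longlonglongrightarrow> (\<integral>x. w x * G x \<partial>N)"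
proof -
 note [measurable] = L2D(1)[OF w] L2D(1)[OF F] L2D(1)[OF G]
 let ?d = "\<lambda>j. (\<integral>x. w x * F j x \<partial>N) - (\<integral>x. w x * G x \<partial>N)"
 let ?W = "\<integral>\<^sup>+x. ennreal ((norm (w x))\<^sup>2) \<partial>N"
 have b: "ennreal ((norm (?d j))\<^sup>2) \<le> ?W * L2_normsq N (\<lambda>x. F j x - G x)" for j
 proof -
  have "?d j = (\<integral>x. w x * (F j x - G x) \<partial>N)"
   using L2_mult_integrable[OF w F[of j]] L2_mult_integrable[OF w G] by (simp add: right_diff_distrib)
  then have "ennreal (norm (?d j)) \<le> (\<integral>\<^sup>+x. ennreal (norm (w x)) * ennreal (norm (F j x - G x)) \<partial>N)"
   using norm_integral_le_nn_integral[of N "\<lambda>x. w x * (F j x - G x)"] by (simp add: norm_mult ennreal_mult)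
  then have "(ennreal (norm (?d j)))\<^sup>2 \<le> (\<integral>\<^sup>+x. ennreal (norm (w x)) * ennreal (norm (F j x - G x)) \<partial>N)\<^sup>2"
   by (intro power_mono) auto
  also have "\<dots> \<le> (\<integral>\<^sup>+x. (ennreal (norm (w x)))\<^sup>2 \<partial>N) * (\<integral>\<^sup>+x. (ennreal (norm (F j x - G x)))\<^sup>2 \<partial>N)"
   by (rule Cauchy_Schwarz_nn_integral) measurable
  finally show ?thesis by (simp add: ennreal_power L2_normsq_def)
 qed
 have "(\<lambda>j. ennreal ((norm (?d j))\<^sup>2)) \<longlonglongrightarrow> 0"
 proof (rule tendsto_sandwich[of "\<lambda>_. 0" _ _ "\<lambda>j. ?W * L2_normsq N (\<lambda>x. F j x - G x)"])
  show "(\<lambda>j. ?W * L2_normsq N (\<lambda>x. F j x - G x)) \<longlonglongrightarrow> 0"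
   using ennreal_tendsto_cmult[OF _ FG[unfolded L2_tendsto_def], of ?W] L2D(2)[OF w] by simp
 qed (use b in auto)
 then have "(\<lambda>j. (norm (?d j))\<^sup>2) \<longlonglongrightarrow> 0"
  by (subst (asm) ennreal_0[symmetric], subst (asm) tendsto_ennreal_iff) auto
 from tendsto_real_sqrt[OF this] have "(\<lambda>j. norm (?d j)) \<longlonglongrightarrow> 0" by simp
 then show ?thesis by (simp add: tendsto_norm_zero_iff LIM_zero_iff)
qed

lemma L2_nth:
 fixes f :: "'a \<Rightarrow> complex ^ 'i"
 assumes "f \<in> L2 N"
 shows "(\<lambda>x. f x $ i) \<in> L2 N"
 by (rule L2_bound[OF assms, of _ 1]) (auto intro!: borel_measurable_vec_nth L2D(1)[OF assms] always_eventually simp: Finite_Cartesian_Product.norm_nth_le)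

section \<open>Complexified linear maps\<close>

definition re_vec :: "complex ^ 'i \<Rightarrow> real ^ 'i" where "re_vec v = (\<chi> i. Re (v $ i))"

definition im_vec :: "complex ^ 'i \<Rightarrow> real ^ 'i" where "im_vec v = (\<chi> i. Im (v $ i))"

lemma complexify_eq: "complexify T v = cvec (T (re_vec v)) + \<i> *s cvec (T (im_vec v))"
 by (simp add: complexify_def re_vec_def im_vec_def)

lemma re_im_complexify [simp]:
 "re_vec (complexify T v) = T (re_vec v)" "im_vec (complexify T v) = T (im_vec v)"
 unfolding complexify_eq by (simp_all add: vec_eq_iff cvec_def re_vec_def[of "_ + _"] im_vec_def[of "_ + _"])

lemma normsq_complex_vec: "(norm v)\<^sup>2 = (norm (re_vec v))\<^sup>2 + (norm (im_vec v))\<^sup>2"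
 by (simp add: norm_vec_def L2_set_def sum_nonneg re_vec_def im_vec_def cmod_power2 sum.distrib)

lemma re_im_vec_nth [simp]: "re_vec v $ i = Re (v $ i)" "im_vec v $ i = Im (v $ i)"
 by (simp_all add: re_vec_def im_vec_def)

lemma complexify_nth:
 assumes "linear T"
 shows "complexify T v $ i = (\<Sum>j\<in>UNIV. complex_of_real (T (axis j 1) $ i) * v $ j)"
 by (simp add: complexify_eq cvec_def complex_eq_iff linear_axis_expansion[OF assms, of "re_vec v"]
   linear_axis_expansion[OF assms, of "im_vec v"] mult.commute)

lemma norm_complexify_le:
 assumes T: "\<And>u. norm (T u) \<le> C * norm u" and C: "C \<ge> 0"
 shows "norm (complexify T v) \<le> C * norm v"
proof (rule power2_le_imp_le)
 have "(norm (T u))\<^sup>2 \<le> C\<^sup>2 * (norm u)\<^sup>2" for u using power_mono[OF T, of u 2] by (simp add: power_mult_distrib)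
 then have "(norm (complexify T v))\<^sup>2 \<le> C\<^sup>2 * (norm (re_vec v))\<^sup>2 + C\<^sup>2 * (norm (im_vec v))\<^sup>2"
  unfolding normsq_complex_vec[of "complexify T v"] re_im_complexify by (intro add_mono)
 then show "(norm (complexify T v))\<^sup>2 \<le> (C * norm v)\<^sup>2"
  by (simp add: power_mult_distrib normsq_complex_vec[of v] distrib_left)
qed (use C in simp)

lemma quadratic_form:
 assumes "linear T"
 shows "Re (\<Sum>i\<in>UNIV. \<Sum>j\<in>UNIV. (v $ j * cnj (v $ i)) * complex_of_real (T (axis j 1) $ i)) =
  re_vec v \<bullet> T (re_vec v) + im_vec v \<bullet> T (im_vec v)"
proof -
 have "re_vec v \<bullet> T (re_vec v) + im_vec v \<bullet> T (im_vec v) =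
  (\<Sum>i\<in>UNIV. \<Sum>j\<in>UNIV. Re (v $ i) * (Re (v $ j) * T (axis j 1) $ i) + Im (v $ i) * (Im (v $ j) * T (axis j 1) $ i))"
  by (simp add: inner_vec_def linear_axis_expansion[OF assms, of "re_vec v"] linear_axis_expansion[OF assms, of "im_vec v"]
    sum_distrib_left sum.distrib)
 also have "\<dots> = Re (\<Sum>i\<in>UNIV. \<Sum>j\<in>UNIV. (v $ j * cnj (v $ i)) * complex_of_real (T (axis j 1) $ i))"
  unfolding Re_sum by (intro sum.cong refl) (simp add: algebra_simps)
 finally show ?thesis by simp
qed

section \<open>Uniqueness of distributional Fourier transforms\<close>

definition scalar_fourier :: "('a::euclidean_space \<Rightarrow> complex) \<Rightarrow> ('a \<Rightarrow> complex) \<Rightarrow> bool" where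
 "scalar_fourier u v \<longleftrightarrow> (\<forall>\<phi>. schwartz \<phi> \<longrightarrow>
  integrable lborel (\<lambda>x. fourier \<phi> x * u x) \<and> integrable lborel (\<lambda>\<xi>. \<phi> \<xi> * v \<xi>) \<and>
  (\<integral>x. fourier \<phi> x * u x \<partial>lborel) = (\<integral>\<xi>. \<phi> \<xi> * v \<xi> \<partial>lborel))"

lemma scalar_fourierD:
 assumes "scalar_fourier u v" "schwartz \<phi>"
 shows "integrable lborel (\<lambda>x. fourier \<phi> x * u x)" "integrable lborel (\<lambda>\<xi>. \<phi> \<xi> * v \<xi>)"
  "(\<integral>x. fourier \<phi> x * u x \<partial>lborel) = (\<integral>\<xi>. \<phi> \<xi> * v \<xi> \<partial>lborel)"
 using assms by (auto simp: scalar_fourier_def)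

lemma integrable_vec_iff:
 fixes f :: "'a \<Rightarrow> 'c::euclidean_space ^ 'i"
 shows "integrable N f \<longleftrightarrow> (\<forall>i. integrable N (\<lambda>x. f x $ i))"
proof
 assume "integrable N f"
 then show "\<forall>i. integrable N (\<lambda>x. f x $ i)" using integrable_bounded_linear[OF bounded_linear_vec_nth] by blast
next
 assume i: "\<forall>i. integrable N (\<lambda>x. f x $ i)"
 show "integrable N f"
 proof (rule Bochner_Integration.integrable_bound)
  show "integrable N (\<lambda>x. \<Sum>i\<in>UNIV. norm (f x $ i))" using i by (intro Bochner_Integration.integrable_sum integrable_norm) auto
  show "f \<in> borel_measurable N" unfolding borel_measurable_vec_nth_iff using i by (auto intro: borel_measurable_integrable)
  have "norm (f x) \<le> (\<Sum>i\<in>UNIV. norm (f x $ i))" for x by (simp add: norm_vec_def L2_set_le_sum)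
  then show "AE x in N. norm (f x) \<le> norm (\<Sum>i\<in>UNIV. norm (f x $ i))"
   by (auto intro: order_trans[OF _ abs_ge_self])
 qed
qed

lemma integral_vec_nth:
 fixes f :: "'a \<Rightarrow> 'c::euclidean_space ^ 'i"
 assumes "integrable N f"
 shows "(\<integral>x. f x \<partial>N) $ i = (\<integral>x. f x $ i \<partial>N)"
 using integral_bounded_linear[OF bounded_linear_vec_nth assms] by simp

lemma has_fourier_iff:
 fixes f g :: "'a::euclidean_space \<Rightarrow> complex ^ 'i"
 shows "has_fourier f g \<longleftrightarrow> (\<forall>i. scalar_fourier (\<lambda>x. f x $ i) (\<lambda>x. g x $ i))"
proof -
 have "(integrable lborel (\<lambda>x. fourier \<phi> x *s f x) \<and> integrable lborel (\<lambda>\<xi>. \<phi> \<xi> *s g \<xi>) \<and>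
  (\<integral>x. fourier \<phi> x *s f x \<partial>lborel) = (\<integral>\<xi>. \<phi> \<xi> *s g \<xi> \<partial>lborel)) \<longleftrightarrow>
  (\<forall>i. integrable lborel (\<lambda>x. fourier \<phi> x * f x $ i) \<and> integrable lborel (\<lambda>\<xi>. \<phi> \<xi> * g \<xi> $ i) \<and>
  (\<integral>x. fourier \<phi> x * f x $ i \<partial>lborel) = (\<integral>\<xi>. \<phi> \<xi> * g \<xi> $ i \<partial>lborel))" (is "?a \<and> ?b \<and> ?c \<longleftrightarrow> ?r") for \<phi>
 proof (cases "?a \<and> ?b")
  case True
  then have ab: ?a ?b by auto
  have "?c \<longleftrightarrow> (\<forall>i. (\<integral>x. fourier \<phi> x * f x $ i \<partial>lborel) = (\<integral>\<xi>. \<phi> \<xi> * g \<xi> $ i \<partial>lborel))"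
   unfolding vec_eq_iff integral_vec_nth[OF ab(1)] integral_vec_nth[OF ab(2)] vector_smult_component ..
  with ab show ?thesis unfolding integrable_vec_iff vector_smult_component by blast
 next
  case False
  then show ?thesis unfolding integrable_vec_iff vector_smult_component by blast
 qed
 then show ?thesis unfolding has_fourier_def scalar_fourier_def by blast
qed

lemma bump_nonzero: "bump s p x \<noteq> 0"
 by (simp add: bump_def)

lemma borel_measurable_bump [measurable]: "bump s (p::'a::euclidean_space) \<in> borel_measurable borel"
 unfolding bump_def by measurable

lemma scalar_fourier_test:
 assumes "scalar_fourier u v" "s > 0"
 shows "integrable lborel (\<lambda>x. bump s p x * u x)" "integrable lborel (\<lambda>x. bump s p x * v x)"
proof -
 obtain \<psi> where "schwartz \<psi>" "fourier \<psi> = bump s p" using bump_fourier[OF assms(2)] by blast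
 then show "integrable lborel (\<lambda>x. bump s p x * u x)" using scalar_fourierD(1)[OF assms(1), of \<psi>] by simp
 show "integrable lborel (\<lambda>x. bump s p x * v x)" by (rule scalar_fourierD(2)[OF assms(1) bump_schwartz[OF assms(2)]])
qed

lemma borel_measurable_bump_cancel:
 assumes "integrable lborel (\<lambda>x. bump 1 (0::'a::euclidean_space) x * u x)"
 shows "u \<in> borel_measurable borel"
proof -
 have [measurable]: "(\<lambda>x. bump 1 (0::'a) x * u x) \<in> borel_measurable borel" using assms by simp
 have "(\<lambda>x. bump 1 0 x * u x / bump 1 0 x) \<in> borel_measurable borel" by measurable
 then show ?thesis by (simp add: bump_nonzero)
qed

lemma scalar_fourier_measurable:
 assumes "scalar_fourier u v"
 shows "u \<in> borel_measurable borel" "v \<in> borel_measurable borel"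
 using scalar_fourier_test[OF assms, of 1 0] borel_measurable_bump_cancel by auto

text \<open>Gaussians are Schwartz functions.\<close>

lemma scalar_fourier_unique:
 assumes v: "scalar_fourier u v" and v': "scalar_fourier u v'"
 shows "AE x in lborel. v x = v' x"
proof -
 have "AE x in lborel. v x - v' x = 0"
 proof (rule gaussian_determines_complex)
  show "(\<lambda>x. v x - v' x) \<in> borel_measurable borel"
   using scalar_fourier_measurable[OF v] scalar_fourier_measurable[OF v'] by measurable
  fix s :: real and p :: 'a assume s: "s > 0"
  note i = scalar_fourier_test(2)[OF v s, of p] scalar_fourier_test(2)[OF v' s, of p]
  then show "integrable lborel (\<lambda>x. bump s p x * (v x - v' x))" by (simp add: right_diff_distrib)
  show "(\<integral>x. bump s p x * (v x - v' x) \<partial>lborel) = 0"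
   using i scalar_fourierD(3)[OF v bump_schwartz[OF s], of p] scalar_fourierD(3)[OF v' bump_schwartz[OF s], of p]
   by (simp add: right_diff_distrib)
 qed
 then show ?thesis by simp
qed

text \<open>Gaussians are Fourier transforms of Schwartz functions.\<close>

lemma scalar_fourier_inject:
 assumes u: "scalar_fourier u v" and u': "scalar_fourier u' v"
 shows "AE x in lborel. u x = u' x"
proof -
 have "AE x in lborel. u x - u' x = 0"
 proof (rule gaussian_determines_complex)
  show "(\<lambda>x. u x - u' x) \<in> borel_measurable borel"
   using scalar_fourier_measurable[OF u] scalar_fourier_measurable[OF u'] by measurable
  fix s :: real and p :: 'a assume s: "s > 0"
  obtain \<psi> where \<psi>: "schwartz \<psi>" "fourier \<psi> = bump s p" using bump_fourier[OF s] by blast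
  note i = scalar_fourier_test(1)[OF u s, of p] scalar_fourier_test(1)[OF u' s, of p]
  then show "integrable lborel (\<lambda>x. bump s p x * (u x - u' x))" by (simp add: right_diff_distrib)
  show "(\<integral>x. bump s p x * (u x - u' x) \<partial>lborel) = 0"
   using i scalar_fourierD(3)[OF u \<psi>(1)] scalar_fourierD(3)[OF u' \<psi>(1)]
   by (simp add: right_diff_distrib \<psi>(2))
 qed
 then show ?thesis by simp
qed

lemma scalar_fourier_cong:
 assumes v: "scalar_fourier u v" and ae: "AE x in lborel. v x = v' x" and [measurable]: "v' \<in> borel_measurable borel"
 shows "scalar_fourier u v'"
proof -
 note [measurable] = scalar_fourier_measurable(2)[OF v]
 have "integrable lborel (\<lambda>\<xi>. \<phi> \<xi> * v' \<xi>) \<and> (\<integral>\<xi>. \<phi> \<xi> * v \<xi> \<partial>lborel) = (\<integral>\<xi>. \<phi> \<xi> * v' \<xi> \<partial>lborel)" if \<phi>: "schwartz \<phi>" for \<phi>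
 proof -
  note [measurable] = schwartz_borel[OF \<phi>]
  have ae': "AE \<xi> in lborel. \<phi> \<xi> * v \<xi> = \<phi> \<xi> * v' \<xi>" using ae by eventually_elim simp
  have "integrable lborel (\<lambda>\<xi>. \<phi> \<xi> * v' \<xi>)"
   by (rule integrable_cong_AE_imp[OF scalar_fourierD(2)[OF v \<phi>]]) (use ae' in \<open>auto elim!: eventually_mono\<close>)
  moreover have "(\<integral>\<xi>. \<phi> \<xi> * v \<xi> \<partial>lborel) = (\<integral>\<xi>. \<phi> \<xi> * v' \<xi> \<partial>lborel)"
   by (rule integral_cong_AE) (use ae' in auto)
  ultimately show ?thesis ..
 qed
 then show ?thesis using scalar_fourierD[OF v] unfolding scalar_fourier_def by metis
qed

lemma AE_vec_eq:
 fixes f g :: "'a \<Rightarrow> 'b ^ 'i"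
 assumes "\<And>i. AE x in N. f x $ i = g x $ i"
 shows "AE x in N. f x = g x"
proof -
 have "AE x in N. \<forall>i\<in>UNIV. f x $ i = g x $ i" using assms by (subst AE_finite_all) auto
 then show ?thesis by eventually_elim (simp add: vec_eq_iff)
qed

lemma has_fourier_measurable:
 assumes "has_fourier f g"
 shows "f \<in> borel_measurable borel" "g \<in> borel_measurable borel"
 using assms scalar_fourier_measurable unfolding has_fourier_iff borel_measurable_vec_nth_iff by blast+

lemma has_fourier_nth: "has_fourier f g \<Longrightarrow> scalar_fourier (\<lambda>x. f x $ i) (\<lambda>x. g x $ i)"
 by (simp add: has_fourier_iff)

lemma has_fourier_unique:
 assumes "has_fourier f g" "has_fourier f g'"
 shows "AE x in lborel. g x = g' x"
 by (rule AE_vec_eq, rule scalar_fourier_unique[OF has_fourier_nth[OF assms(1)] has_fourier_nth[OF assms(2)]])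

lemma has_fourier_inject:
 assumes "has_fourier f g" "has_fourier f' g"
 shows "AE x in lborel. f x = f' x"
 by (rule AE_vec_eq, rule scalar_fourier_inject[OF has_fourier_nth[OF assms(1)] has_fourier_nth[OF assms(2)]])

lemma has_fourier_cong:
 assumes "has_fourier f g" "AE x in lborel. g x = g' x" "g' \<in> borel_measurable borel"
 shows "has_fourier f g'"
 unfolding has_fourier_iff
proof
 fix i
 show "scalar_fourier (\<lambda>x. f x $ i) (\<lambda>x. g' x $ i)"
 proof (rule scalar_fourier_cong)
  show "scalar_fourier (\<lambda>x. f x $ i) (\<lambda>x. g x $ i)" using assms(1) by (simp add: has_fourier_iff)
  show "AE x in lborel. g x $ i = g' x $ i" using assms(2) by eventually_elim simp
  show "(\<lambda>x. g' x $ i) \<in> borel_measurable borel" using assms(3) by (simp add: borel_measurable_vec_nth_iff)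
 qed
qed

section \<open>The multiplier inverts the mean restriction\<close>

lemma linear_Pi_proj: "linear (Pi_proj m \<xi>)"
 unfolding Pi_proj_def by (rule orth_proj_linear) (simp add: ext_power_def)

lemma Pi_proj_idem: "Pi_proj m \<xi> (Pi_proj m \<xi> v) = Pi_proj m \<xi> v"
proof -
 have s: "subspace (ext_power m {x. orthogonal \<xi> x})" by (simp add: ext_power_def)
 show ?thesis unfolding Pi_proj_def by (rule orth_proj_id[OF s orth_proj_in[OF s]])
qed

lemma linear_mean_restrict: "linear (mean_restrict k m \<xi>)"
 by (rule linearI)
  (simp_all add: mean_restrict_def Psi_proj_def linear_add[OF linear_Pi_proj] linear_scale[OF linear_Pi_proj] algebra_simps)

lemma mean_coeff_pos:
 assumes "m < k" "k \<le> n"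
 shows "mean_coeff n k m > 0"
 using assms by (simp add: mean_coeff_def)

text \<open>
 Both operators are combinations of the same two complementary projections, with inverse
 coefficients; the binomial coefficients cancel.
\<close>

lemma h_mult_mean_restrict:
 fixes \<xi> :: "'n::{finite,linorder} rvec"
 assumes mk: "m < k" "k < CARD('n)"
 shows "h_mult k m \<xi> (mean_restrict k m \<xi> v) = (sphere_vol CARD('n) / sphere_vol k) *\<^sub>R v"
proof -
 let ?c = "mean_coeff CARD('n) k m" and ?p = "Pi_proj m \<xi> v"
 let ?a = "real k - real m" and ?b = "real CARD('n) - real m"
 let ?H = "real k * sphere_vol CARD('n) * real ((CARD('n) - 1) choose m) / (sphere_vol k * real (k choose m))"
 have ab: "?a \<noteq> 0" "?b \<noteq> 0" using mk by auto
 have P: "Pi_proj m \<xi> (mean_restrict k m \<xi> v) = (?c * ?a) *\<^sub>R ?p"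
  by (simp add: mean_restrict_def Psi_proj_def linear_add[OF linear_Pi_proj] linear_diff[OF linear_Pi_proj]
    linear_scale[OF linear_Pi_proj] Pi_proj_idem)
 have Q: "Psi_proj m \<xi> (mean_restrict k m \<xi> v) = (?c * ?b) *\<^sub>R (v - ?p)"
  unfolding Psi_proj_def P by (simp add: mean_restrict_def Psi_proj_def scaleR_add_right)
 have "h_mult k m \<xi> (mean_restrict k m \<xi> v) = (?H * ?c) *\<^sub>R v"
  unfolding h_mult_def P Q using ab by (simp add: scaleR_add_right[symmetric] del: of_nat_mult)
 moreover have "?H * ?c = sphere_vol CARD('n) / sphere_vol k"
  using mk by (simp add: mean_coeff_def field_simps)
 ultimately show ?thesis by simp
qed

lemma orth_proj_inner_self:
 assumes "subspace (V::'a::euclidean_space set)"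
 shows "u \<bullet> orth_proj V u = (norm (orth_proj V u))\<^sup>2"
 using orth_proj_residual[OF assms orth_proj_in[OF assms, of u], of u]
 by (simp add: inner_diff_left power2_norm_eq_inner)

lemma mean_restrict_inner_ge:
 fixes u :: "'n::{finite,linorder} rform"
 assumes mk: "m < k" "k \<le> CARD('n)"
 shows "mean_coeff CARD('n) k m * (real k - real m) * (norm u)\<^sup>2 \<le> u \<bullet> mean_restrict k m \<xi> u"
proof -
 have s: "subspace (ext_power m {x. orthogonal \<xi> x})" by (simp add: ext_power_def)
 let ?p = "Pi_proj m \<xi> u"
 have 1: "u \<bullet> ?p = (norm ?p)\<^sup>2" unfolding Pi_proj_def by (rule orth_proj_inner_self[OF s])
 have "norm ?p \<le> norm u" unfolding Pi_proj_def by (rule norm_orth_proj_le[OF s])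
 then have le: "(norm ?p)\<^sup>2 \<le> (norm u)\<^sup>2" by (intro power_mono) auto
 have "(real k - real m) * ((norm u)\<^sup>2 - (norm ?p)\<^sup>2) \<le> (real CARD('n) - real m) * ((norm u)\<^sup>2 - (norm ?p)\<^sup>2)"
  using le mk by (intro mult_right_mono) auto
 then have "(real k - real m) * (norm u)\<^sup>2 \<le> (real k - real m) * (norm ?p)\<^sup>2 + (real CARD('n) - real m) * ((norm u)\<^sup>2 - (norm ?p)\<^sup>2)"
  by (simp add: right_diff_distrib)
 from mult_left_mono[OF this less_imp_le[OF mean_coeff_pos[OF mk]]] show ?thesis
  by (simp add: mean_restrict_def Psi_proj_def inner_add_right inner_diff_right 1 power2_norm_eq_inner[symmetric] mult.assoc)
qed

lemma ext_map_orth_proj_inner_self: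
 assumes "subspace P"
 shows "u \<bullet> ext_map m (orth_proj P) u = (norm (ext_map m (orth_proj P) u))\<^sup>2"
 unfolding orth_proj_ext_power[OF assms, symmetric] by (rule orth_proj_inner_self) (simp add: ext_power_def)

lemma borel_measurable_complexify:
 fixes T :: "'b \<Rightarrow> real ^ 'i \<Rightarrow> real ^ 'i"
 assumes T: "\<And>z. linear (T z)" and [measurable]: "\<And>j. (\<lambda>z. T z (axis j 1)) \<in> borel_measurable N" "v \<in> borel_measurable N"
 shows "(\<lambda>z. complexify (T z) (v z)) \<in> borel_measurable N"
 unfolding borel_measurable_vec_nth_iff complexify_nth[OF T] by measurable

section \<open>Square-integrability on the tautological bundle\<close>

lemma rapid_decay_mult:
 fixes f g :: "'a::euclidean_space \<Rightarrow> complex"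
 assumes f: "rapid_decay f" and g: "rapid_decay g"
 shows "rapid_decay (\<lambda>x. f x * g x)"
 unfolding rapid_decay_def
proof
 fix N
 obtain C where C: "C \<ge> 0" "\<And>x. norm (f x) \<le> C * weight x ^ N" using rapid_decayD[OF f] by blast
 obtain D where D: "D \<ge> 0" "\<And>x. norm (g x) \<le> D * weight x ^ 0" using rapid_decayD[OF g, of 0] by blast
 have "norm (f x * g x) \<le> (C * D) * weight x ^ N" for x
  using mult_mono[OF C(2)[of x] D(2)[of x]] C(1) by (simp add: norm_mult weight_bounds mult_ac)
 then show "\<exists>C. \<forall>x. norm (f x * g x) \<le> C * weight x ^ N" by blast
qed

lemma L2_weight_bound:
 fixes f :: "'a::euclidean_space \<Rightarrow> 'b::euclidean_space"
 assumes f: "rapid_decay f" and [measurable]: "f \<in> borel_measurable borel"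
 shows "f \<in> L2 lborel"
proof -
 obtain C where C: "C \<ge> 0" "\<And>x. norm (f x) \<le> C * weight x ^ DIM('a)" using rapid_decayD[OF f] by blast
 have "(\<lambda>x::'a. weight x ^ DIM('a)) \<in> L2 lborel"
 proof (rule L2I)
  have "(\<integral>\<^sup>+x. ennreal ((norm (weight (x::'a) ^ DIM('a)))\<^sup>2) \<partial>lborel) \<le> (\<integral>\<^sup>+x. ennreal (weight (x::'a) ^ DIM('a)) \<partial>lborel)"
  proof (intro nn_integral_mono ennreal_leI)
   fix x :: 'a
   have "0 \<le> weight x ^ DIM('a)" "weight x ^ DIM('a) \<le> 1" by (simp_all add: weight_bounds power_le_one)
   then show "(norm (weight x ^ DIM('a)))\<^sup>2 \<le> weight x ^ DIM('a)"
    by (simp only: power2_eq_square real_norm_def abs_of_nonneg mult_left_le)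
  qed
  also have "\<dots> < \<infinity>" using nn_integral_weight_subspace[OF subspace_UNIV[where 'a='a], of "DIM('a)"]
   by (simp add: subspace_lborel_UNIV dim_UNIV le_less_trans)
  finally show "(\<integral>\<^sup>+x. ennreal ((norm (weight (x::'a) ^ DIM('a)))\<^sup>2) \<partial>lborel) < \<infinity>" .
 qed measurable
 then show ?thesis by (rule L2_bound[where C=C]) (use C in \<open>auto simp: weight_bounds\<close>)
qed

lemma orth_proj_complement:
 assumes P: "subspace (P::'a::euclidean_space set)"
 shows "orth_proj (orthogonal_comp P) z = z - orth_proj P z"
proof (rule orth_proj_eqI[OF subspace_orthogonal_comp])
 show "z - orth_proj P z \<in> orthogonal_comp P"
  using orth_proj_residual[OF P, of _ z] by (auto simp: orthogonal_comp_def orthogonal_def inner_commute)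
 show "orthogonal (z - (z - orth_proj P z)) w" if "w \<in> orthogonal_comp P" for w
  using that orth_proj_in[OF P, of z] by (auto simp: orthogonal_comp_def orthogonal_def)
qed

lemma nn_integral_normsq_vec:
 fixes f :: "'b \<Rightarrow> 'c::euclidean_space ^ 'i"
 assumes [measurable]: "f \<in> borel_measurable N"
 shows "(\<integral>\<^sup>+x. ennreal ((norm (f x))\<^sup>2) \<partial>N) = (\<Sum>i\<in>UNIV. \<integral>\<^sup>+x. ennreal ((norm (f x $ i))\<^sup>2) \<partial>N)"
proof -
 have "(\<integral>\<^sup>+x. ennreal ((norm (f x))\<^sup>2) \<partial>N) = (\<integral>\<^sup>+x. (\<Sum>i\<in>UNIV. ennreal ((norm (f x $ i))\<^sup>2)) \<partial>N)"
  by (simp add: norm_vec_def L2_set_def sum_nonneg)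
 also have "\<dots> = (\<Sum>i\<in>UNIV. \<integral>\<^sup>+x. ennreal ((norm (f x $ i))\<^sup>2) \<partial>N)" by (rule nn_integral_sum) measurable
 finally show ?thesis .
qed

lemma borel_measurable_form_fourier:
 fixes w :: "'n::{finite,linorder} rvec \<Rightarrow> 'n rform"
 assumes "w \<in> schwartz_forms m"
 shows "form_fourier w \<in> borel_measurable borel"
 unfolding borel_measurable_vec_nth_iff using form_fourier_rapid_decay(2)[OF assms] by blast

lemma plane_transform_slice:
 fixes w :: "'n::{finite,linorder} rvec \<Rightarrow> 'n rform"
 assumes w: "w \<in> schwartz_forms m" and P: "subspace P"
 shows "(\<lambda>x. plane_transform m w (P, x)) \<in> borel_measurable borel"
  and "integrable (subspace_lborel P) (\<lambda>x. complex_of_real (plane_transform m w (P, x) $ S))"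
proof -
 let ?N = "subspace_lborel (orthogonal_comp P)"
 interpret sigma_finite_measure ?N by (rule sigma_finite_subspace_lborel[OF subspace_orthogonal_comp])
 have [measurable]: "w \<in> borel_measurable borel" by (rule schwartz_formD(3)[OF w])
 have [measurable]: "ext_map m (orth_proj P) \<in> borel_measurable borel"
  by (intro borel_measurable_continuous_onI linear_continuous_on bounded_linear_ext_map)
 show m[measurable]: "(\<lambda>x. plane_transform m w (P, x)) \<in> borel_measurable borel"
  unfolding plane_transform_def by (simp add: form_restrict_eq[OF P])
 obtain C where C: "C \<ge> 0" "\<And>P x. subspace P \<Longrightarrow> x \<in> P \<Longrightarrow> norm (plane_transform m w (P, x)) \<le> C * weight x ^ CARD('n)"
  using plane_transform_bound[OF w] by blast
 have d: "dim P \<le> CARD('n)" using dim_subset_UNIV[of P] by simp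
 show "integrable (subspace_lborel P) (\<lambda>x. complex_of_real (plane_transform m w (P, x) $ S))"
 proof (rule Bochner_Integration.integrable_bound)
  show "integrable (subspace_lborel P) (\<lambda>x. C * weight x ^ CARD('n))"
   using integrable_weight_subspace[OF P d] by simp
  show "AE x in subspace_lborel P. norm (complex_of_real (plane_transform m w (P, x) $ S)) \<le> norm (C * weight x ^ CARD('n))"
   using AE_subspace_lborel[OF P]
  proof eventually_elim
   case (elim x)
   have "norm (plane_transform m w (P, x) $ S) \<le> C * weight x ^ CARD('n)"
    using Finite_Cartesian_Product.norm_nth_le C(2)[OF P elim] by (rule order_trans)
   then show ?case using C(1) by (simp add: weight_bounds abs_mult)
  qed
 qed measurable
qed

text \<open>Componentwise Bessel inequality combined with the slice theorem.\<close>

lemma slice_energy_le: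
 fixes w :: "'n::{finite,linorder} rvec \<Rightarrow> 'n rform"
 assumes w: "w \<in> schwartz_forms m" and P: "subspace P"
 shows "(\<integral>\<^sup>+\<xi>. ennreal ((norm (complexify (ext_map m (orth_proj P)) (form_fourier w \<xi>)))\<^sup>2) \<partial>subspace_lborel P)
  \<le> (\<integral>\<^sup>+x. ennreal ((norm (plane_transform m w (P, x)))\<^sup>2) \<partial>subspace_lborel P)"
proof -
 note [measurable] = plane_transform_slice(1)[OF w P] borel_measurable_form_fourier[OF w]
 have [measurable]: "(\<lambda>\<xi>. complexify (ext_map m (orth_proj P)) (form_fourier w \<xi>)) \<in> borel_measurable borel"
  by (rule borel_measurable_complexify[OF ext_map_linear]) measurable
 let ?b = "\<lambda>S x. complex_of_real (plane_transform m w (P, x) $ S)"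
 have "(\<integral>\<^sup>+\<xi>. ennreal ((norm (complexify (ext_map m (orth_proj P)) (form_fourier w \<xi>)))\<^sup>2) \<partial>subspace_lborel P) =
  (\<Sum>S\<in>UNIV. \<integral>\<^sup>+\<xi>. ennreal ((norm (complexify (ext_map m (orth_proj P)) (form_fourier w \<xi>) $ S))\<^sup>2) \<partial>subspace_lborel P)"
  by (rule nn_integral_normsq_vec) measurable
 also have "\<dots> = (\<Sum>S\<in>UNIV. \<integral>\<^sup>+\<xi>. ennreal ((norm (fourier_on P (?b S) \<xi>))\<^sup>2) \<partial>subspace_lborel P)"
 proof (intro sum.cong refl nn_integral_cong_AE)
  fix S
  show "AE \<xi> in subspace_lborel P. ennreal ((norm (complexify (ext_map m (orth_proj P)) (form_fourier w \<xi>) $ S))\<^sup>2) =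
    ennreal ((norm (fourier_on P (?b S) \<xi>))\<^sup>2)"
   using AE_subspace_lborel[OF P]
   by eventually_elim (simp only: complexify_nth[OF ext_map_linear] fourier_on_plane_transform[OF w P])
 qed
 also have "\<dots> \<le> (\<Sum>S\<in>UNIV. \<integral>\<^sup>+x. ennreal ((norm (?b S x))\<^sup>2) \<partial>subspace_lborel P)"
  by (intro sum_mono bessel_inequality[OF P] plane_transform_slice[OF w P]) measurable
 also have "\<dots> = (\<integral>\<^sup>+x. ennreal ((norm (plane_transform m w (P, x)))\<^sup>2) \<partial>subspace_lborel P)"
  by (subst nn_integral_normsq_vec) auto
 finally show ?thesis .
qed

lemma form_fourier_normsq_le:
 fixes w :: "'n::{finite,linorder} rvec \<Rightarrow> 'n rform"
 assumes w: "w \<in> schwartz_forms m"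
 shows "L2_normsq lborel (form_fourier w) \<le> L2_normsq lborel w"
proof -
 note [measurable] = borel_measurable_form_fourier[OF w] schwartz_formD(3)[OF w]
 let ?b = "\<lambda>S x. complex_of_real (w x $ S)"
 have "L2_normsq lborel (form_fourier w) = (\<Sum>S\<in>UNIV. \<integral>\<^sup>+\<xi>. ennreal ((norm (form_fourier w \<xi> $ S))\<^sup>2) \<partial>lborel)"
  unfolding L2_normsq_def by (rule nn_integral_normsq_vec) measurable
 also have "\<dots> \<le> (\<Sum>S\<in>UNIV. \<integral>\<^sup>+x. ennreal ((norm (?b S x))\<^sup>2) \<partial>lborel)"
 proof (rule sum_mono)
  fix S
  note s = schwartz_formD(4)[OF w, of S]
  have "integrable lborel (?b S)" by (rule rapid_decay_integrable[OF schwartz_rapid_decay[OF s] schwartz_borel[OF s]])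
  from bessel_inequality[OF subspace_UNIV schwartz_borel[OF s]] this
  show "(\<integral>\<^sup>+\<xi>. ennreal ((norm (form_fourier w \<xi> $ S))\<^sup>2) \<partial>lborel) \<le> (\<integral>\<^sup>+x. ennreal ((norm (?b S x))\<^sup>2) \<partial>lborel)"
   by (simp add: form_fourier_def fourier_on_UNIV subspace_lborel_UNIV)
 qed
 also have "\<dots> = L2_normsq lborel w" unfolding L2_normsq_def by (subst nn_integral_normsq_vec) auto
 finally show ?thesis .
qed

context invariant_grassmannian
begin

text \<open>As a Gaussian integral over \<open>R\<^sup>n\<close>, the integrand depends measurably on the plane.\<close>

lemma measurable_coset_integral:
 fixes f :: "'n::{finite,linorder} rvec \<Rightarrow> 'b::{banach, second_countable_topology}"
 assumes f[measurable]: "f \<in> borel_measurable borel"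
 shows "(\<lambda>p. \<integral>y. f (snd p + y) \<partial>subspace_lborel (orthogonal_comp (fst p))) \<in> borel_measurable taut"
proof -
 let ?F = "\<lambda>p. \<integral>z. exp (- (pi * (norm (orth_proj (fst p) z))\<^sup>2)) *\<^sub>R f (snd p + (z - orth_proj (fst p) z)) \<partial>lborel"
 have "?F \<in> borel_measurable (M \<Otimes>\<^sub>M borel)" by measurable
 then have "?F \<in> borel_measurable taut" by (rule measurable_tautI)
 moreover have "(\<integral>y. f (snd p + y) \<partial>subspace_lborel (orthogonal_comp (fst p))) = ?F p" if "p \<in> space taut" for p
 proof -
  have P[measurable]: "subspace (fst p)" using taut_memD[OF that] by blast
  have m: "(\<lambda>x. f (snd p + (x - orth_proj (fst p) x))) \<in> borel_measurable borel" by measurable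
  have W[measurable]: "subspace (orthogonal_comp (fst p))" by (rule subspace_orthogonal_comp)
  show ?thesis
   unfolding subspace_lborel_eq_distr[OF W]
   by (subst integral_distr, measurable, subst integral_density)
    (auto simp: gauss_comp_bounds gauss_comp_def[of "orthogonal_comp (fst p)"] orth_proj_complement[OF P] m)
 qed
 ultimately show ?thesis by (simp cong: measurable_cong)
qed

lemma taut_proj: "p \<in> space taut \<Longrightarrow> (fst p, orth_proj (fst p) (snd p)) = p"
 using taut_memD[of p] by (cases p) (auto simp: orth_proj_id)

lemma nn_integral_taut_meas:
 assumes F: "F \<in> borel_measurable taut"
 shows "(\<integral>\<^sup>+p. F p \<partial>taut) = (\<integral>\<^sup>+P. \<integral>\<^sup>+x. F (P, x) \<partial>subspace_lborel P \<partial>M)"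
proof -
 let ?G = "\<lambda>p. F (fst p, orth_proj (fst p) (snd p))"
 have "(\<integral>\<^sup>+p. F p \<partial>taut) = (\<integral>\<^sup>+p. ?G p \<partial>taut)" by (rule nn_integral_cong) (simp only: taut_proj)
 also have "\<dots> = (\<integral>\<^sup>+P. \<integral>\<^sup>+x. ?G (P, x) \<partial>subspace_lborel P \<partial>M)"
  by (rule nn_integral_taut[OF measurable_taut_proj[OF F]])
 also have "\<dots> = (\<integral>\<^sup>+P. \<integral>\<^sup>+x. F (P, x) \<partial>subspace_lborel P \<partial>M)"
 proof (rule nn_integral_cong)
  fix P assume "P \<in> space M"
  then have P: "subspace P" by (rule subspace_M)
  show "(\<integral>\<^sup>+x. ?G (P, x) \<partial>subspace_lborel P) = (\<integral>\<^sup>+x. F (P, x) \<partial>subspace_lborel P)"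
   by (rule nn_integral_cong_AE, use AE_subspace_lborel[OF P] in eventually_elim) (simp add: orth_proj_id[OF P])
 qed
 finally show ?thesis .
qed

lemma integral_taut_proj:
 fixes F :: "_ \<Rightarrow> 'b::{banach, second_countable_topology}"
 assumes F: "integrable taut F"
 shows "(\<integral>p. F p \<partial>taut) = (\<integral>P. \<integral>x. F (P, orth_proj P x) \<partial>subspace_lborel P \<partial>M)"
proof -
 let ?G = "\<lambda>p. F (fst p, orth_proj (fst p) (snd p))"
 have "integrable taut ?G"
  using F Bochner_Integration.integrable_cong[of taut taut ?G F] by (simp only: taut_proj simp_thms)
 then have "(\<integral>p. ?G p \<partial>taut) = (\<integral>P. \<integral>x. ?G (P, x) \<partial>subspace_lborel P \<partial>M)"
  using integral_taut[OF measurable_taut_proj[OF borel_measurable_integrable[OF F]]] by simp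
 moreover have "(\<integral>p. F p \<partial>taut) = (\<integral>p. ?G p \<partial>taut)" by (rule Bochner_Integration.integral_cong) (simp_all only: taut_proj)
 ultimately show ?thesis by simp
qed

lemma taut_weight_finite: "(\<integral>\<^sup>+p. ennreal (weight (snd p) ^ k) \<partial>taut) < \<infinity>"
proof -
 have m: "(\<lambda>p. ennreal (weight (snd p) ^ k)) \<in> borel_measurable taut" by measurable
 have "(\<integral>\<^sup>+p. ennreal (weight (snd p) ^ k) \<partial>taut) = (\<integral>\<^sup>+P. \<integral>\<^sup>+x. ennreal (weight x ^ k) \<partial>subspace_lborel P \<partial>M)"
  by (subst nn_integral_taut_meas[OF m]) simp
 also have "\<dots> \<le> (\<integral>\<^sup>+P. ennreal (pi ^ k) \<partial>M)"
 proof (rule nn_integral_mono)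
  fix P assume "P \<in> space M"
  note P = subspace_M[OF this]
  show "(\<integral>\<^sup>+x. ennreal (weight x ^ k) \<partial>subspace_lborel P) \<le> ennreal (pi ^ k)"
   using nn_integral_weight_subspace[OF P(1), of k] P(2) by simp
 qed
 also have "\<dots> < \<infinity>" by (simp add: prob_space.emeasure_space_1[OF prob_M])
 finally show ?thesis .
qed

lemma taut_weight_bound:
 fixes W :: "_ \<Rightarrow> 'b::euclidean_space"
 assumes [measurable]: "W \<in> borel_measurable taut" and C: "C \<ge> 0"
  and le: "\<And>p. p \<in> space taut \<Longrightarrow> norm (W p) \<le> C * weight (snd p) ^ k"
 shows "(\<integral>\<^sup>+p. ennreal (norm (W p)) \<partial>taut) < \<infinity>" "W \<in> L2 taut"
proof -
 have fin: "(\<integral>\<^sup>+p. ennreal (g p) \<partial>taut) < \<infinity>" if "\<And>p. p \<in> space taut \<Longrightarrow> g p \<le> D * weight (snd p) ^ k" "D \<ge> 0" for g D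
 proof -
  have "(\<integral>\<^sup>+p. ennreal (g p) \<partial>taut) \<le> (\<integral>\<^sup>+p. ennreal D * ennreal (weight (snd p) ^ k) \<partial>taut)"
   using that by (intro nn_integral_mono) (simp add: ennreal_mult[symmetric] weight_bounds ennreal_leI)
  also have "\<dots> = ennreal D * (\<integral>\<^sup>+p. ennreal (weight (snd p) ^ k) \<partial>taut)" by (rule nn_integral_cmult) measurable
  also have "\<dots> < \<infinity>" using taut_weight_finite by (simp add: ennreal_mult_less_top)
  finally show ?thesis .
 qed
 show "(\<integral>\<^sup>+p. ennreal (norm (W p)) \<partial>taut) < \<infinity>" using le C by (rule fin)
 have "(\<integral>\<^sup>+p. ennreal ((norm (W p))\<^sup>2) \<partial>taut) < \<infinity>"
 proof (rule fin)
  fix p assume p: "p \<in> space taut"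
  let ?u = "weight (snd p) ^ k"
  have u: "0 \<le> ?u" "?u \<le> 1" by (simp_all add: weight_bounds power_le_one)
  have "(norm (W p))\<^sup>2 \<le> (C * ?u)\<^sup>2" using le[OF p] by (intro power_mono) auto
  also have "\<dots> = C\<^sup>2 * (?u * ?u)" by (simp add: power2_eq_square mult_ac)
  also have "\<dots> \<le> C\<^sup>2 * ?u" using u by (intro mult_left_mono mult_left_le) auto
  finally show "(norm (W p))\<^sup>2 \<le> C\<^sup>2 * ?u" .
 qed simp
 then show "W \<in> L2 taut" by (intro L2I) auto
qed

lemma taut_rapid_decay:
 fixes f :: "'n::{finite,linorder} rvec \<Rightarrow> 'b::euclidean_space"
 assumes f: "rapid_decay f" and [measurable]: "f \<in> borel_measurable borel"
 shows "(\<integral>\<^sup>+p. ennreal (norm (f (snd p))) \<partial>taut) < \<infinity>" "(\<lambda>p. f (snd p)) \<in> L2 taut"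
proof -
 obtain C where "C \<ge> 0" "\<And>x. norm (f x) \<le> C * weight x ^ k" using rapid_decayD[OF f] by blast
 then show "(\<integral>\<^sup>+p. ennreal (norm (f (snd p))) \<partial>taut) < \<infinity>" "(\<lambda>p. f (snd p)) \<in> L2 taut"
  by (intro taut_weight_bound[of _ C]; auto)+
qed

lemma plane_transform_L2:
 assumes w: "w \<in> schwartz_forms m"
 shows "plane_transform m w \<in> L2 taut"
proof -
 obtain C where C: "C \<ge> 0" "\<And>P x. subspace P \<Longrightarrow> x \<in> P \<Longrightarrow> norm (plane_transform m w (P, x)) \<le> C * weight x ^ k"
  using plane_transform_bound[OF w] by blast
 let ?F = "\<lambda>p. ext_map m (orth_proj (fst p)) (\<integral>y. w (snd p + y) \<partial>subspace_lborel (orthogonal_comp (fst p)))"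
 note [measurable] = measurable_coset_integral[OF schwartz_formD(3)[OF w]]
 have "?F \<in> borel_measurable taut" by measurable
 moreover have "?F p = plane_transform m w p" if "p \<in> space taut" for p
  using plane_transform_eq(1)[OF w, of "fst p" "snd p"] taut_memD[OF that] by simp
 ultimately have "plane_transform m w \<in> borel_measurable taut" by (simp cong: measurable_cong)
 then show ?thesis
 proof (rule taut_weight_bound(2)[OF _ C(1)])
  fix p assume "p \<in> space taut"
  from taut_memD[OF this] C(2)[of "fst p" "snd p"] show "norm (plane_transform m w p) \<le> C * weight (snd p) ^ k" by simp
 qed
qed

text \<open>
 The energy of \<open>R w\<close> controls the energy of the Fourier transform of \<open>w\<close> with the singular weight
 \<open>|\<xi>|\<^bsup>k-n\<^esup>\<close>: on every plane Bessel's inequality applies, and averaging over the planes through \<open>\<xi>\<close>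
 replaces the restriction by \<open>mean_restrict\<close>, which is bounded below.
\<close>

lemma form_energy_le:
 fixes w :: "'n::{finite,linorder} rvec \<Rightarrow> 'n rform"
 assumes mk: "m < k" "k \<le> CARD('n)" and w: "w \<in> schwartz_forms m"
 shows "ennreal (mean_coeff CARD('n) k m * (real k - real m)) * (\<integral>\<^sup>+p. ennreal ((norm (form_fourier w (snd p)))\<^sup>2) \<partial>taut)
  \<le> L2_normsq taut (plane_transform m w)"
proof -
 let ?a = "mean_coeff CARD('n) k m * (real k - real m)"
 let ?v = "form_fourier w"
 define f where "f T T' \<xi> = ?v \<xi> $ T' * cnj (?v \<xi> $ T)" for T T' \<xi>
 have a: "?a \<ge> 0" using mean_coeff_pos[OF mk] mk by simp
 note [measurable] = borel_measurable_form_fourier[OF w]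
 have fm[measurable]: "f T T' \<in> borel_measurable borel" for T T' unfolding f_def[abs_def] by measurable
 have fr: "rapid_decay (f T T')" for T T'
  unfolding f_def[abs_def]
  by (intro rapid_decay_mult form_fourier_rapid_decay(1)[OF w] rapid_decay_bound[OF form_fourier_rapid_decay(1)[OF w, of T]]) simp
 have key: "(\<integral>p. f T T' (snd p) * of_real (ext_map m (orth_proj (fst p)) (axis T' 1) $ T) \<partial>taut) =
   (\<integral>p. f T T' (snd p) * of_real (mean_restrict k m (snd p) (axis T' 1) $ T) \<partial>taut) \<and>
  integrable taut (\<lambda>p. f T T' (snd p) * of_real (ext_map m (orth_proj (fst p)) (axis T' 1) $ T)) \<and>
  integrable taut (\<lambda>p. f T T' (snd p) * of_real (mean_restrict k m (snd p) (axis T' 1) $ T))" for T T'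
 proof (cases "card T' = m")
  case True
  obtain B where B: "\<And>x. norm (f T T' x) \<le> B * weight x ^ 0" using rapid_decayD[OF fr, of T T' 0] by blast
  then have "norm (f T T' x) \<le> B" for x by simp
  from integral_restrict_eq_mean[OF mk fm this taut_rapid_decay(1)[OF fr fm] True] show ?thesis by blast
 next
  case False
  then show ?thesis using form_fourier_rapid_decay(3)[OF w, of T'] by (simp add: f_def)
 qed
 define QL where "QL p = (\<Sum>T\<in>UNIV. \<Sum>T'\<in>UNIV. f T T' (snd p) * of_real (ext_map m (orth_proj (fst p)) (axis T' 1) $ T))" for p
 define QA where "QA p = (\<Sum>T\<in>UNIV. \<Sum>T'\<in>UNIV. f T T' (snd p) * of_real (mean_restrict k m (snd p) (axis T' 1) $ T))" for p :: "('n rvec) set \<times> ('n rvec)"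
 have iL: "integrable taut QL" and iA: "integrable taut QA"
  unfolding QL_def[abs_def] QA_def[abs_def] using key by (intro Bochner_Integration.integrable_sum; blast)+
 have int: "(\<integral>p. QL p \<partial>taut) = (\<integral>p. QA p \<partial>taut)"
  unfolding QL_def QA_def using key by (simp add: Bochner_Integration.integral_sum)
 have L: "Re (QL p) = (norm (complexify (ext_map m (orth_proj (fst p))) (?v (snd p))))\<^sup>2" if "p \<in> space taut" for p
 proof -
  have P: "subspace (fst p)" using taut_memD[OF that] by blast
  show ?thesis unfolding QL_def f_def quadratic_form[OF ext_map_linear] ext_map_orth_proj_inner_self[OF P]
    normsq_complex_vec re_im_complexify ..
 qed
 have A: "?a * (norm (?v (snd p)))\<^sup>2 \<le> Re (QA p)" for p
  unfolding QA_def f_def quadratic_form[OF linear_mean_restrict] normsq_complex_vec[of "?v (snd p)"] distrib_left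
  by (intro add_mono mean_restrict_inner_ge[OF mk])
 have A0: "0 \<le> Re (QA p)" for p using A[of p] a by (meson mult_nonneg_nonneg order_trans zero_le_power2)
 have [measurable]: "(\<lambda>p. complexify (ext_map m (orth_proj (fst p))) (?v (snd p))) \<in> borel_measurable taut"
  by (rule borel_measurable_complexify[OF ext_map_linear]) measurable
 note [measurable] = L2D(1)[OF plane_transform_L2[OF w]]
 have m': "(\<lambda>p. ennreal ((norm (plane_transform m w p))\<^sup>2)) \<in> borel_measurable taut" by measurable
 have m: "(\<lambda>p. ennreal ((norm (complexify (ext_map m (orth_proj (fst p))) (?v (snd p))))\<^sup>2)) \<in> borel_measurable taut"
  by measurable
 have "ennreal ?a * (\<integral>\<^sup>+p. ennreal ((norm (?v (snd p)))\<^sup>2) \<partial>taut) = (\<integral>\<^sup>+p. ennreal (?a * (norm (?v (snd p)))\<^sup>2) \<partial>taut)"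
  using a by (subst nn_integral_cmult[symmetric]) (auto simp: ennreal_mult)
 also have "\<dots> \<le> (\<integral>\<^sup>+p. ennreal (Re (QA p)) \<partial>taut)" by (intro nn_integral_mono ennreal_leI A)
 also have "\<dots> = ennreal (Re (\<integral>p. QA p \<partial>taut))" using iA A0 by (subst nn_integral_eq_integral) auto
 also have "\<dots> = ennreal (\<integral>p. Re (QL p) \<partial>taut)" using iL by (simp add: int)
 also have "\<dots> = (\<integral>\<^sup>+p. ennreal (Re (QL p)) \<partial>taut)"
  using iL by (intro nn_integral_eq_integral[symmetric] AE_I2) (auto simp: L)
 also have "\<dots> = (\<integral>\<^sup>+p. ennreal ((norm (complexify (ext_map m (orth_proj (fst p))) (?v (snd p))))\<^sup>2) \<partial>taut)"
  by (rule nn_integral_cong) (simp add: L)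
 also have "\<dots> = (\<integral>\<^sup>+P. \<integral>\<^sup>+\<xi>. ennreal ((norm (complexify (ext_map m (orth_proj P)) (?v \<xi>)))\<^sup>2) \<partial>subspace_lborel P \<partial>M)"
  by (subst nn_integral_taut_meas[OF m]) simp
 also have "\<dots> \<le> (\<integral>\<^sup>+P. \<integral>\<^sup>+x. ennreal ((norm (plane_transform m w (P, x)))\<^sup>2) \<partial>subspace_lborel P \<partial>M)"
  by (intro nn_integral_mono slice_energy_le[OF w] subspace_M(1))
 also have "\<dots> = L2_normsq taut (plane_transform m w)"
  unfolding L2_normsq_def by (rule nn_integral_taut_meas[OF m', symmetric])
 finally show ?thesis .
qed

lemma X_normsq_finite:
 fixes w :: "'n::{finite,linorder} rvec \<Rightarrow> 'n rform"
 assumes w: "w \<in> schwartz_forms m"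
 shows "X_normsq k M m w < \<infinity>"
 using L2D(2)[OF plane_transform_L2[OF w]] L2D(2)[OF L2_weight_bound[OF schwartz_formD(2,3)[OF w]]]
 by (simp add: X_normsq_def L2_normsq_def ennreal_add_less_top)

text \<open>Convergence for this measure is convergence for \<open>d\<xi>\<close> and for the singular weight at once.\<close>

definition spectral_measure :: "('n::{finite,linorder} rvec) measure" where
 "spectral_measure = density lborel (\<lambda>x. ennreal (1 + base_density x))"

lemma sets_spectral_measure [measurable_cong, simp]: "sets spectral_measure = sets borel"
 by (simp add: spectral_measure_def)

lemma spectral_normsq:
 fixes f :: "'n::{finite,linorder} rvec \<Rightarrow> 'b::euclidean_space"
 assumes k: "0 < k" and [measurable]: "f \<in> borel_measurable borel"
 shows "L2_normsq spectral_measure f = L2_normsq lborel f + L2_normsq taut (\<lambda>p. f (snd p))"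
proof -
 have "L2_normsq spectral_measure f = (\<integral>\<^sup>+x. ennreal ((norm (f x))\<^sup>2) + ennreal ((norm (f x))\<^sup>2) * ennreal (base_density x) \<partial>lborel)"
  unfolding L2_normsq_def spectral_measure_def
  by (subst nn_integral_density) (auto simp: base_density_nonneg distrib_right mult.commute)
 also have "\<dots> = L2_normsq lborel f + (\<integral>\<^sup>+x. ennreal ((norm (f x))\<^sup>2) * ennreal (base_density x) \<partial>lborel)"
  unfolding L2_normsq_def by (rule nn_integral_add) measurable
 also have "(\<integral>\<^sup>+x. ennreal ((norm (f x))\<^sup>2) * ennreal (base_density x) \<partial>lborel) = L2_normsq taut (\<lambda>p. f (snd p))"
  unfolding L2_normsq_def by (rule nn_integral_taut_snd[OF k, symmetric]) measurable
 finally show ?thesis .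
qed

lemma spectral_normsq_le:
 fixes w :: "'n::{finite,linorder} rvec \<Rightarrow> 'n rform"
 assumes mk: "m < k" "k \<le> CARD('n)"
 shows "\<exists>K>0. \<forall>w\<in>schwartz_forms m. L2_normsq spectral_measure (form_fourier w) \<le> ennreal K * X_normsq k M m (w :: 'n rvec \<Rightarrow> 'n rform)"
proof -
 define a where "a = mean_coeff CARD('n) k m * (real k - real m)"
 have a: "a > 0" using mean_coeff_pos[OF mk] mk by (simp add: a_def)
 have "L2_normsq spectral_measure (form_fourier w) \<le> ennreal (1 + 1 / a) * X_normsq k M m w" if w: "w \<in> schwartz_forms m" for w :: "'n rvec \<Rightarrow> 'n rform"
 proof -
  let ?B = "L2_normsq taut (\<lambda>p. form_fourier w (snd p))" and ?R = "L2_normsq taut (plane_transform m w)"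
  have "?B = ennreal (1 / a) * (ennreal a * ?B)" using a by (simp add: mult.assoc[symmetric] ennreal_mult[symmetric])
  also have "\<dots> \<le> ennreal (1 / a) * ?R"
   using form_energy_le[OF mk w, folded a_def] by (intro mult_left_mono) (auto simp: L2_normsq_def)
  also have "\<dots> \<le> ennreal (1 / a) * X_normsq k M m w" by (intro mult_left_mono) (auto simp: X_normsq_def)
  finally have B: "?B \<le> ennreal (1 / a) * X_normsq k M m w" .
  have "L2_normsq lborel (form_fourier w) \<le> 1 * X_normsq k M m w"
   using form_fourier_normsq_le[OF w] by (simp add: X_normsq_def add_increasing2)
  from add_mono[OF this B] show ?thesis
   using mk a by (simp add: spectral_normsq[OF _ borel_measurable_form_fourier[OF w]] distrib_right)
 qed
 then show ?thesis using a by (intro exI[of _ "1 + 1 / a"]) (auto intro: add_pos_pos)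
qed

lemma fourier_X_limit:
 fixes a :: "nat \<Rightarrow> 'n::{finite,linorder} rvec \<Rightarrow> 'n rform"
 assumes mk: "m < k" "k \<le> CARD('n)" and X: "X_represents k M m a \<alpha>"
 shows "\<exists>g. g \<in> L2 lborel \<and> L2_tendsto lborel (\<lambda>j. form_fourier (a j)) g \<and>
  (\<lambda>p. g (snd p)) \<in> L2 taut \<and> L2_tendsto taut (\<lambda>j p. form_fourier (a j) (snd p)) (\<lambda>p. g (snd p))"
proof -
 have k: "0 < k" using mk by simp
 have a: "a j \<in> schwartz_forms m" for j using X by (simp add: X_represents_def)
 note [measurable] = borel_measurable_form_fourier[OF a]
 obtain K where K: "K > 0" "\<And>w::'n rvec \<Rightarrow> 'n rform. w \<in> schwartz_forms m \<Longrightarrow>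
   L2_normsq spectral_measure (form_fourier w) \<le> ennreal K * X_normsq k M m w"
  using spectral_normsq_le[OF mk] by blast
 have "\<exists>g\<in>L2 spectral_measure. L2_tendsto spectral_measure (\<lambda>j. form_fourier (a j)) g"
 proof (rule L2_complete)
  show "form_fourier (a j) \<in> L2 spectral_measure" for j
   unfolding L2_def using K(2)[OF a[of j]] X_normsq_finite[OF a[of j]]
   by (auto simp: ennreal_mult_less_top intro: le_less_trans)
  fix e :: ennreal assume e: "e > 0"
  then have "0 < e / ennreal K" by (simp add: ennreal_zero_less_divide)
  then obtain N where N: "\<And>i j. i \<ge> N \<Longrightarrow> j \<ge> N \<Longrightarrow> X_normsq k M m (\<lambda>x. a i x - a j x) < e / ennreal K"
   using X by (fastforce simp: X_represents_def)
  have "L2_normsq spectral_measure (\<lambda>x. form_fourier (a i) x - form_fourier (a j) x) < e" if "i \<ge> N" "j \<ge> N" for i j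
  proof -
   have "L2_normsq spectral_measure (\<lambda>x. form_fourier (a i) x - form_fourier (a j) x) =
     L2_normsq spectral_measure (form_fourier (\<lambda>x. a i x - a j x))"
    by (simp add: L2_normsq_def form_fourier_diff[OF a a])
   also have "\<dots> \<le> ennreal K * X_normsq k M m (\<lambda>x. a i x - a j x)" by (rule K(2)[OF schwartz_forms_diff[OF a a]])
   also have "\<dots> < ennreal K * (e / ennreal K)"
    using N[OF that] K(1) by (intro ennreal_mult_strict_left_mono) auto
   also have "\<dots> = e" using K(1) by (simp add: ennreal_times_divide ennreal_mult_divide_eq mult.commute)
   finally show ?thesis .
  qed
  then show "\<exists>K. \<forall>i\<ge>K. \<forall>j\<ge>K. L2_normsq spectral_measure (\<lambda>x. form_fourier (a i) x - form_fourier (a j) x) < e" by blast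
 qed
 then obtain g where g: "g \<in> L2 spectral_measure" "L2_tendsto spectral_measure (\<lambda>j. form_fourier (a j)) g" by blast
 have gm[measurable]: "g \<in> borel_measurable borel" using L2D(1)[OF g(1)] by (simp cong: measurable_cong_sets)
 have fin: "L2_normsq lborel g + L2_normsq taut (\<lambda>p. g (snd p)) < \<infinity>"
  using g(1) unfolding spectral_normsq[OF k gm, symmetric] by (simp add: L2_def)
 have lim: "(\<lambda>j. L2_normsq lborel (\<lambda>x. form_fourier (a j) x - g x) + L2_normsq taut (\<lambda>p. form_fourier (a j) (snd p) - g (snd p))) \<longlonglongrightarrow> 0"
  using g(2) unfolding L2_tendsto_def by (subst (asm) spectral_normsq[OF k]) auto
 have "L2_tendsto lborel (\<lambda>j. form_fourier (a j)) g"
  unfolding L2_tendsto_def by (rule tendsto_sandwich[OF _ _ tendsto_const lim]) auto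
 moreover have "L2_tendsto taut (\<lambda>j p. form_fourier (a j) (snd p)) (\<lambda>p. g (snd p))"
  unfolding L2_tendsto_def by (rule tendsto_sandwich[OF _ _ tendsto_const lim]) auto
 ultimately show ?thesis using fin by (intro exI[of _ g]) (auto simp: L2_def)
qed

lemma plane_transform_X_limit:
 fixes \<alpha> :: "'n::{finite,linorder} rvec \<Rightarrow> 'n rform"
 assumes \<alpha>: "\<alpha> \<in> X_space k M m"
 shows "\<exists>a. X_represents k M m a \<alpha> \<and> plane_transform_X k M m \<alpha> \<in> L2 taut \<and>
  L2_tendsto taut (\<lambda>j. plane_transform m (a j)) (plane_transform_X k M m \<alpha>)"
proof -
 obtain a where X: "X_represents k M m a \<alpha>" using \<alpha> by (auto simp: X_space_def)
 have a: "a j \<in> schwartz_forms m" for j using X by (simp add: X_represents_def)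
 have "\<exists>\<beta>\<in>L2 taut. L2_tendsto taut (\<lambda>j. plane_transform m (a j)) \<beta>"
 proof (rule L2_complete[OF plane_transform_L2[OF a]])
  fix e :: ennreal assume "e > 0"
  then obtain N where N: "\<And>i j. i \<ge> N \<Longrightarrow> j \<ge> N \<Longrightarrow> X_normsq k M m (\<lambda>x. a i x - a j x) < e"
   using X by (fastforce simp: X_represents_def)
  have "L2_normsq taut (\<lambda>p. plane_transform m (a i) p - plane_transform m (a j) p) < e" if "i \<ge> N" "j \<ge> N" for i j
  proof -
   have "L2_normsq taut (\<lambda>p. plane_transform m (a i) p - plane_transform m (a j) p) = L2_normsq taut (plane_transform m (\<lambda>x. a i x - a j x))"
    unfolding L2_normsq_def
   proof (rule nn_integral_cong)
    fix p assume "p \<in> space taut"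
    from taut_memD[OF this] plane_transform_diff[OF a a, of "fst p" "snd p" i j]
    show "ennreal ((norm (plane_transform m (a i) p - plane_transform m (a j) p))\<^sup>2) =
     ennreal ((norm (plane_transform m (\<lambda>x. a i x - a j x) p))\<^sup>2)" by simp
   qed
   also have "\<dots> \<le> X_normsq k M m (\<lambda>x. a i x - a j x)" by (simp add: X_normsq_def)
   also have "\<dots> < e" by (rule N[OF that])
   finally show ?thesis .
  qed
  then show "\<exists>K. \<forall>i\<ge>K. \<forall>j\<ge>K. L2_normsq taut (\<lambda>p. plane_transform m (a i) p - plane_transform m (a j) p) < e" by blast
 qed
 then have "\<exists>\<beta>. \<beta> \<in> L2 taut \<and> (\<exists>a. X_represents k M m a \<alpha> \<and> L2_tendsto taut (\<lambda>j. plane_transform m (a j)) \<beta>)"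
  using X by blast
 from someI_ex[OF this] show ?thesis unfolding plane_transform_X_def by blast
qed

end

section \<open>The Fourier transform of the back-projection\<close>

lemma borel_measurable_fourier: "schwartz \<phi> \<Longrightarrow> fourier \<phi> \<in> borel_measurable borel"
 using borel_measurable_fourier_on[OF subspace_UNIV schwartz_borel] by (simp add: fourier_on_UNIV)

lemma ext_map_orth_proj_idem:
 assumes "subspace P"
 shows "ext_map m (orth_proj P) (ext_map m (orth_proj P) v) = ext_map m (orth_proj P) v"
proof -
 have s: "subspace (ext_power m P)" by (simp add: ext_power_def)
 show ?thesis unfolding orth_proj_ext_power[OF assms, symmetric] by (rule orth_proj_id[OF s orth_proj_in[OF s]])
qed

lemma fourier_pairing:
 fixes f g :: "'a::euclidean_space \<Rightarrow> complex"
 assumes V: "subspace V" and f: "integrable (subspace_lborel V) f" and g: "integrable (subspace_lborel V) g"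
 shows "(\<integral>x. f x * fourier_on V g x \<partial>subspace_lborel V) = (\<integral>\<xi>. g \<xi> * fourier_on V f \<xi> \<partial>subspace_lborel V)"
 using echar_mult_formula[OF sigma_finite_subspace_lborel[OF V] sigma_finite_subspace_lborel[OF V] _ _ f g]
 by (simp add: fourier_on_def echar_commute[of _ "_ :: 'a"])

lemma L2_of_real_nth:
 fixes f :: "'a \<Rightarrow> real ^ 'i"
 assumes "f \<in> L2 N"
 shows "(\<lambda>x. complex_of_real (f x $ i)) \<in> L2 N"
proof (rule L2_bound[OF assms, of _ 1])
 note [measurable] = L2D(1)[OF assms]
 show "(\<lambda>x. complex_of_real (f x $ i)) \<in> borel_measurable N" by measurable
 show "AE x in N. norm (complex_of_real (f x $ i)) \<le> 1 * norm (f x)"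
  using component_le_norm_cart by (auto simp: norm_of_real)
qed

text \<open>Both sides of \<open>\<integral> F \<phi> a = \<integral> \<phi> F a\<close> are continuous for \<open>L\<^sup>2\<close> convergence.\<close>

lemma has_fourier_X_limit:
 fixes a :: "nat \<Rightarrow> 'n::{finite,linorder} rvec \<Rightarrow> 'n rform"
 assumes a: "\<And>j. a j \<in> schwartz_forms m" and \<alpha>: "\<alpha> \<in> L2 lborel" and lim: "L2_tendsto lborel a \<alpha>"
  and g: "g \<in> L2 lborel" and limg: "L2_tendsto lborel (\<lambda>j. form_fourier (a j)) g"
 shows "has_fourier (\<lambda>x. cvec (\<alpha> x)) g"
 unfolding has_fourier_iff scalar_fourier_def
proof (intro allI impI)
 fix S :: "'n set" and \<phi> :: "'n rvec \<Rightarrow> complex" assume \<phi>: "schwartz \<phi>"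
 note [measurable] = schwartz_formD(3)[OF a] borel_measurable_form_fourier[OF a] L2D(1)[OF \<alpha>] L2D(1)[OF g]
 let ?a = "\<lambda>j x. complex_of_real (a j x $ S)" and ?\<alpha> = "\<lambda>x. complex_of_real (\<alpha> x $ S)"
 have F: "fourier \<phi> \<in> L2 lborel" by (rule L2_weight_bound[OF fourier_rapid_decay[OF \<phi>] borel_measurable_fourier[OF \<phi>]])
 have \<phi>2: "\<phi> \<in> L2 lborel" by (rule L2_weight_bound[OF schwartz_rapid_decay[OF \<phi>] schwartz_borel[OF \<phi>]])
 have aL2: "a j \<in> L2 lborel" for j by (rule L2_weight_bound[OF schwartz_formD(2,3)[OF a]])
 have fL2: "form_fourier (a j) \<in> L2 lborel" for j
  using le_less_trans[OF form_fourier_normsq_le[OF a]] aL2[of j] by (auto simp: L2_def)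
 have ta: "L2_tendsto lborel ?a ?\<alpha>"
 proof (rule L2_tendsto_bound[OF lim, of _ _ 1])
  have "norm (?a j x - ?\<alpha> x) \<le> 1 * norm (a j x - \<alpha> x)" for j x
   using component_le_norm_cart[of "a j x - \<alpha> x" S] by (simp add: of_real_diff[symmetric] norm_of_real del: of_real_diff)
  then show "AE x in lborel. norm (?a j x - ?\<alpha> x) \<le> 1 * norm (a j x - \<alpha> x)" for j by blast
 qed measurable
 have tg: "L2_tendsto lborel (\<lambda>j \<xi>. form_fourier (a j) \<xi> $ S) (\<lambda>\<xi>. g \<xi> $ S)"
 proof (rule L2_tendsto_bound[OF limg, of _ _ 1])
  have "norm (form_fourier (a j) x $ S - g x $ S) \<le> 1 * norm (form_fourier (a j) x - g x)" for j x
   using Finite_Cartesian_Product.norm_nth_le[of "form_fourier (a j) x - g x" S] by simp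
  then show "AE x in lborel. norm (form_fourier (a j) x $ S - g x $ S) \<le> 1 * norm (form_fourier (a j) x - g x)" for j by blast
 qed measurable
 have l1: "(\<lambda>j. \<integral>x. fourier \<phi> x * ?a j x \<partial>lborel) \<longlonglongrightarrow> (\<integral>x. fourier \<phi> x * ?\<alpha> x \<partial>lborel)"
  by (rule L2_pairing_tendsto[OF F L2_of_real_nth[OF aL2] L2_of_real_nth[OF \<alpha>] ta])
 have l2: "(\<lambda>j. \<integral>\<xi>. \<phi> \<xi> * form_fourier (a j) \<xi> $ S \<partial>lborel) \<longlonglongrightarrow> (\<integral>\<xi>. \<phi> \<xi> * g \<xi> $ S \<partial>lborel)"
  by (rule L2_pairing_tendsto[OF \<phi>2 L2_nth[OF fL2] L2_nth[OF g] tg])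
 have e: "(\<integral>x. fourier \<phi> x * ?a j x \<partial>lborel) = (\<integral>\<xi>. \<phi> \<xi> * form_fourier (a j) \<xi> $ S \<partial>lborel)" for j
 proof -
  have 1: "integrable lborel (?a j)"
   by (rule rapid_decay_integrable[OF schwartz_rapid_decay schwartz_borel]; rule schwartz_formD(4)[OF a])
  have 2: "integrable lborel \<phi>" by (rule rapid_decay_integrable[OF schwartz_rapid_decay[OF \<phi>] schwartz_borel[OF \<phi>]])
  from fourier_pairing[OF subspace_UNIV, of "?a j" \<phi>] 1 2 show ?thesis
   by (simp add: subspace_lborel_UNIV fourier_on_UNIV form_fourier_def mult.commute)
 qed
 have "(\<integral>x. fourier \<phi> x * ?\<alpha> x \<partial>lborel) = (\<integral>\<xi>. \<phi> \<xi> * g \<xi> $ S \<partial>lborel)"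
  using LIMSEQ_unique[OF l1] l2 by (simp only: e)
 then show "integrable lborel (\<lambda>x. fourier \<phi> x * cvec (\<alpha> x) $ S) \<and> integrable lborel (\<lambda>\<xi>. \<phi> \<xi> * g \<xi> $ S) \<and>
   (\<integral>x. fourier \<phi> x * cvec (\<alpha> x) $ S \<partial>lborel) = (\<integral>\<xi>. \<phi> \<xi> * g \<xi> $ S \<partial>lborel)"
  using L2_mult_integrable[OF F L2_of_real_nth[OF \<alpha>, of S]] L2_mult_integrable[OF \<phi>2 L2_nth[OF g, of S]] by (simp add: cvec_def)
qed

context invariant_grassmannian
begin

lemma measurable_integral_subspace:
 fixes G :: "_ \<Rightarrow> 'b::{banach, second_countable_topology}"
 assumes [measurable]: "G \<in> borel_measurable (M \<Otimes>\<^sub>M borel)"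
 shows "(\<lambda>P. \<integral>x. G (P, x) \<partial>subspace_lborel P) \<in> borel_measurable M"
proof -
 let ?F = "\<lambda>P. \<integral>z. gauss_comp P z *\<^sub>R G (P, orth_proj P z) \<partial>lborel"
 have "?F \<in> borel_measurable M" by measurable
 moreover have "(\<integral>x. G (P, x) \<partial>subspace_lborel P) = ?F P" if P: "P \<in> space M" for P
 proof -
  have S[measurable]: "subspace P" by (rule subspace_M[OF P])
  have [measurable]: "(\<lambda>x. G (P, x)) \<in> borel_measurable borel"
   by (rule measurable_compose[OF measurable_Pair1'[OF P] assms])
  have m: "(\<lambda>x. G (P, orth_proj P x)) \<in> borel_measurable borel" by measurable
  show ?thesis
   unfolding subspace_lborel_eq_distr[OF S]
   by (subst integral_distr, measurable, subst integral_density) (auto simp: gauss_comp_bounds m)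
 qed
 ultimately show ?thesis by (simp cong: measurable_cong)
qed

text \<open>
 Fubini on \<open>G \<times> R\<^sup>n\<close>: pairing a back-projection with a rapidly decreasing function amounts to pairing,
 on the tautological bundle, with the integrals of that function over the orthogonal cosets.
\<close>

lemma back_projection_pairing:
 fixes b :: "_ \<Rightarrow> complex" and \<psi> :: "'n::{finite,linorder} rvec \<Rightarrow> complex"
 assumes b: "b \<in> L2 taut" and \<psi>: "rapid_decay \<psi>" and m[measurable]: "\<psi> \<in> borel_measurable borel"
 shows "integrable lborel (\<lambda>x. \<psi> x * (\<integral>P. b (P, orth_proj P x) \<partial>M))"
  and "(\<integral>x. \<psi> x * (\<integral>P. b (P, orth_proj P x) \<partial>M) \<partial>lborel) =
   (\<integral>p. b p * (\<integral>y. \<psi> (snd p + y) \<partial>subspace_lborel (orthogonal_comp (fst p))) \<partial>taut)"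
  and "AE x in lborel. integrable M (\<lambda>P. \<psi> x * b (P, orth_proj P x))"
  and "(\<lambda>p. \<integral>y. \<psi> (snd p + y) \<partial>subspace_lborel (orthogonal_comp (fst p))) \<in> L2 taut"
proof -
 have pf: "pair_sigma_finite M (lborel :: ('n rvec) measure)"
  by (simp add: pair_sigma_finite_def sigma_finite_lborel prob_space_imp_sigma_finite[OF prob_M])
 note [measurable] = L2D(1)[OF b]
 let ?W = "\<lambda>p. \<integral>y. \<psi> (snd p + y) \<partial>subspace_lborel (orthogonal_comp (fst p))"
 let ?A = "\<lambda>p. complex_of_real (\<integral>y. norm (\<psi> (snd p + y)) \<partial>subspace_lborel (orthogonal_comp (fst p)))"
 note Wm[measurable] = measurable_coset_integral[OF m]
 have "(\<lambda>x. norm (\<psi> x)) \<in> borel_measurable borel" by measurable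
 note [measurable] = measurable_coset_integral[OF this]
 obtain C where C0: "C \<ge> 0" and C: "\<And>P x. subspace P \<Longrightarrow> x \<in> P \<Longrightarrow> integrable (subspace_lborel (orthogonal_comp P)) (\<lambda>y. \<psi> (x + y)) \<and>
   (\<integral>y. norm (\<psi> (x + y)) \<partial>subspace_lborel (orthogonal_comp P)) \<le> C * weight x ^ k"
  using coset_integrals[OF \<psi> m, of k] by auto
 have "norm (?A p) \<le> C * weight (snd p) ^ k" if "p \<in> space taut" for p
  using C[of "fst p" "snd p"] taut_memD[OF that] by simp
 note A2 = taut_weight_bound(2)[OF _ C0 this]
 have "norm (?W p) \<le> C * weight (snd p) ^ k" if "p \<in> space taut" for p
  using order_trans[OF integral_norm_bound, of "subspace_lborel (orthogonal_comp (fst p))" "\<lambda>y. \<psi> (snd p + y)"]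
   C[of "fst p" "snd p"] taut_memD[OF that] by simp
 from taut_weight_bound(2)[OF Wm C0 this] show W2: "?W \<in> L2 taut" by simp
 have A2': "?A \<in> L2 taut" by (rule A2) measurable
 let ?f = "\<lambda>P x. \<psi> x * b (P, orth_proj P x)"
 have Bm: "(\<lambda>q. b (fst q, orth_proj (fst q) (snd q))) \<in> borel_measurable (M \<Otimes>\<^sub>M borel)"
  by (rule measurable_taut_proj) measurable
 have fm': "(\<lambda>q. ?f (fst q) (snd q)) \<in> borel_measurable (M \<Otimes>\<^sub>M borel)" using Bm by measurable
 then have fm: "case_prod ?f \<in> borel_measurable (M \<Otimes>\<^sub>M lborel)"
  by (simp add: case_prod_unfold cong: measurable_cong_sets)
 have slice[measurable]: "(\<lambda>x. b (P, orth_proj P x)) \<in> borel_measurable borel" if "P \<in> space M" for P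
  using measurable_compose[OF measurable_Pair1'[OF that] Bm] by simp
 have bA: "(\<lambda>p. ennreal (norm (b p * ?A p))) \<in> borel_measurable taut" by measurable
 have "(\<integral>\<^sup>+q. ennreal (norm (case_prod ?f q)) \<partial>(M \<Otimes>\<^sub>M lborel)) = (\<integral>\<^sup>+P. \<integral>\<^sup>+x. ennreal (norm (?f P x)) \<partial>lborel \<partial>M)"
  using fm by (subst lborel.nn_integral_fst[symmetric]) auto
 also have "\<dots> = (\<integral>\<^sup>+P. \<integral>\<^sup>+x. ennreal (norm (b (P, x) * ?A (P, x))) \<partial>subspace_lborel P \<partial>M)"
 proof (rule nn_integral_cong)
  fix P assume PM: "P \<in> space M"
  have P: "subspace P" by (rule subspace_M[OF PM])
  note [measurable] = slice[OF PM]
  have "(\<integral>\<^sup>+x. ennreal (norm (?f P x)) \<partial>lborel) =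
   (\<integral>\<^sup>+x. \<integral>\<^sup>+y. ennreal (norm (?f P (x + y))) \<partial>subspace_lborel (orthogonal_comp P) \<partial>subspace_lborel P)"
   by (rule nn_integral_subspace_product[OF P]) measurable
  also have "\<dots> = (\<integral>\<^sup>+x. ennreal (norm (b (P, x) * ?A (P, x))) \<partial>subspace_lborel P)"
  proof (rule nn_integral_cong_AE, use AE_subspace_lborel[OF P] in eventually_elim)
   case (elim x)
   have "(\<integral>\<^sup>+y. ennreal (norm (?f P (x + y))) \<partial>subspace_lborel (orthogonal_comp P)) =
     (\<integral>\<^sup>+y. ennreal (norm (b (P, x))) * ennreal (norm (\<psi> (x + y))) \<partial>subspace_lborel (orthogonal_comp P))"
    by (rule nn_integral_cong_AE, use AE_subspace_lborel[OF subspace_orthogonal_comp[of P]] in eventually_elim)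
     (simp add: orth_proj_add[OF P elim] norm_mult ennreal_mult mult.commute)
   also have "\<dots> = ennreal (norm (b (P, x))) * (\<integral>\<^sup>+y. ennreal (norm (\<psi> (x + y))) \<partial>subspace_lborel (orthogonal_comp P))"
    by (rule nn_integral_cmult) measurable
   also have "(\<integral>\<^sup>+y. ennreal (norm (\<psi> (x + y))) \<partial>subspace_lborel (orthogonal_comp P)) =
     ennreal (\<integral>y. norm (\<psi> (x + y)) \<partial>subspace_lborel (orthogonal_comp P))"
    using C[OF P elim] by (intro nn_integral_eq_integral) auto
   finally show ?case by (simp add: norm_mult ennreal_mult)
  qed
  finally show "(\<integral>\<^sup>+x. ennreal (norm (?f P x)) \<partial>lborel) = (\<integral>\<^sup>+x. ennreal (norm (b (P, x) * ?A (P, x))) \<partial>subspace_lborel P)" .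
 qed
 also have "\<dots> = (\<integral>\<^sup>+p. ennreal (norm (b p * ?A p)) \<partial>taut)"
  by (subst nn_integral_taut_meas[OF bA]) simp
 also have "\<dots> < \<infinity>" using L2_mult_integrable[OF b A2'] by (simp add: integrable_iff_bounded)
 finally have int: "integrable (M \<Otimes>\<^sub>M lborel) (case_prod ?f)" using fm by (intro integrableI_bounded) auto
 show "integrable lborel (\<lambda>x. \<psi> x * (\<integral>P. b (P, orth_proj P x) \<partial>M))" using pair_sigma_finite.integrable_snd[OF pf int] by simp
 show "AE x in lborel. integrable M (\<lambda>P. ?f P x)" by (rule pair_sigma_finite.AE_integrable_snd[OF pf int])
 have GB: "(\<lambda>q. b (fst q, orth_proj (fst q) (snd q)) * ?W (fst q, orth_proj (fst q) (snd q))) \<in> borel_measurable (M \<Otimes>\<^sub>M borel)" (is "?G \<in> _")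
  by (rule measurable_taut_proj[of "\<lambda>p. b p * ?W p"]) measurable
 have "(\<integral>x. \<psi> x * (\<integral>P. b (P, orth_proj P x) \<partial>M) \<partial>lborel) = (\<integral>x. (\<integral>P. ?f P x \<partial>M) \<partial>lborel)" by simp
 also have "\<dots> = (\<integral>P. (\<integral>x. ?f P x \<partial>lborel) \<partial>M)" by (simp only: pair_sigma_finite.integral_snd[OF pf int] pair_sigma_finite.integral_fst[OF pf int])
 also have "\<dots> = (\<integral>P. \<integral>x. ?G (P, x) \<partial>subspace_lborel P \<partial>M)"
 proof (rule integral_cong_AE)
  show "(\<lambda>P. \<integral>x. ?f P x \<partial>lborel) \<in> borel_measurable M" using pair_sigma_finite.integrable_fst[OF pf int] by (rule borel_measurable_integrable)
  show "(\<lambda>P. \<integral>x. ?G (P, x) \<partial>subspace_lborel P) \<in> borel_measurable M" by (rule measurable_integral_subspace[OF GB])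
  show "AE P in M. (\<integral>x. ?f P x \<partial>lborel) = (\<integral>x. ?G (P, x) \<partial>subspace_lborel P)"
   using pair_sigma_finite.AE_integrable_fst[OF pf int] AE_space
  proof eventually_elim
   case (elim P)
   have P[measurable]: "subspace P" by (rule subspace_M[OF elim(2)])
   note [measurable] = slice[OF elim(2)]
   interpret W: sigma_finite_measure "subspace_lborel (orthogonal_comp P)"
    by (rule sigma_finite_subspace_lborel[OF subspace_orthogonal_comp])
   have "(\<integral>x. ?f P x \<partial>lborel) = (\<integral>x. \<integral>y. ?f P (x + y) \<partial>subspace_lborel (orthogonal_comp P) \<partial>subspace_lborel P)"
    by (rule integral_subspace_product[OF P _ elim(1)]) measurable
   also have "\<dots> = (\<integral>x. ?G (P, x) \<partial>subspace_lborel P)"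
   proof (rule integral_cong_AE)
    show "(\<lambda>x. \<integral>y. ?f P (x + y) \<partial>subspace_lborel (orthogonal_comp P)) \<in> borel_measurable (subspace_lborel P)" by measurable
    show "(\<lambda>x. ?G (P, x)) \<in> borel_measurable (subspace_lborel P)"
     using measurable_compose[OF measurable_Pair1'[OF elim(2)] GB] by (simp cong: measurable_cong_sets)
    show "AE x in subspace_lborel P. (\<integral>y. ?f P (x + y) \<partial>subspace_lborel (orthogonal_comp P)) = ?G (P, x)"
     using AE_subspace_lborel[OF P]
    proof eventually_elim
     case (elim x)
     have "(\<integral>y. ?f P (x + y) \<partial>subspace_lborel (orthogonal_comp P)) =
      (\<integral>y. \<psi> (x + y) * b (P, x) \<partial>subspace_lborel (orthogonal_comp P))"
     proof (rule integral_cong_AE)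
      show "AE y in subspace_lborel (orthogonal_comp P). ?f P (x + y) = \<psi> (x + y) * b (P, x)"
       using AE_subspace_lborel[OF subspace_orthogonal_comp[of P]]
       by eventually_elim (simp add: orth_proj_add[OF P elim])
     qed measurable
     then show ?case by (simp add: orth_proj_id[OF P elim] mult.commute)
    qed
   qed
   finally show ?case .
  qed
 qed
 also have "\<dots> = (\<integral>p. b p * ?W p \<partial>taut)"
  by (subst integral_taut_proj[OF L2_mult_integrable[OF b W2]]) simp
 finally show "(\<integral>x. \<psi> x * (\<integral>P. b (P, orth_proj P x) \<partial>M) \<partial>lborel) = (\<integral>p. b p * ?W p \<partial>taut)" .
qed

text \<open>
 For a Schwartz form the pairing is computed on each plane: coset integrals of \<open>F \<phi>\<close> are Fourier
 transforms on the plane, which move over to the plane transform, where the slice theorem turns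
 them into the restriction of the full Fourier transform. Averaging yields \<open>mean_restrict\<close>.
\<close>

lemma slice_pairing:
 fixes w :: "'n::{finite,linorder} rvec \<Rightarrow> 'n rform" and \<phi> :: "'n rvec \<Rightarrow> complex"
 assumes mk: "m < k" "k \<le> CARD('n)" and w: "w \<in> schwartz_forms m" and \<phi>: "schwartz \<phi>"
 shows "(\<integral>p. complex_of_real (plane_transform m w p $ T) * (\<integral>y. fourier \<phi> (snd p + y) \<partial>subspace_lborel (orthogonal_comp (fst p))) \<partial>taut) =
  (\<Sum>S\<in>UNIV. \<integral>p. (\<phi> (snd p) * of_real (mean_restrict k m (snd p) (axis S 1) $ T)) * form_fourier w (snd p) $ S \<partial>taut)"
proof -
 let ?b = "\<lambda>p. complex_of_real (plane_transform m w p $ T)"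
 let ?W = "\<lambda>p. \<integral>y. fourier \<phi> (snd p + y) \<partial>subspace_lborel (orthogonal_comp (fst p))"
 let ?L = "\<lambda>S p. complex_of_real (ext_map m (orth_proj (fst p)) (axis S 1) $ T)"
 define f where "f S \<xi> = \<phi> \<xi> * form_fourier w \<xi> $ S" for S \<xi>
 define H where "H p = (\<Sum>S\<in>UNIV. f S (snd p) * ?L S p)" for p
 note [measurable] = schwartz_borel[OF \<phi>] borel_measurable_form_fourier[OF w] borel_measurable_fourier[OF \<phi>]
 have b: "?b \<in> L2 taut" by (rule L2_of_real_nth[OF plane_transform_L2[OF w]])
 have W: "?W \<in> L2 taut" by (rule back_projection_pairing(4)[OF b fourier_rapid_decay[OF \<phi>] borel_measurable_fourier[OF \<phi>]])
 have fm[measurable]: "f S \<in> borel_measurable borel" for S unfolding f_def[abs_def] by measurable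
 have fr: "rapid_decay (f S)" for S unfolding f_def[abs_def]
  by (intro rapid_decay_mult form_fourier_rapid_decay(1)[OF w] schwartz_rapid_decay[OF \<phi>])
 have key: "(\<integral>p. f S (snd p) * ?L S p \<partial>taut) = (\<integral>p. f S (snd p) * of_real (mean_restrict k m (snd p) (axis S 1) $ T) \<partial>taut) \<and>
  integrable taut (\<lambda>p. f S (snd p) * ?L S p)" for S
 proof (cases "card S = m")
  case True
  obtain B where B: "\<And>x. norm (f S x) \<le> B * weight x ^ 0" using rapid_decayD[OF fr, of S 0] by blast
  then have "norm (f S x) \<le> B" for x by simp
  from integral_restrict_eq_mean[OF mk fm this taut_rapid_decay(1)[OF fr fm] True] show ?thesis by blast
 next
  case False
  then show ?thesis using form_fourier_rapid_decay(3)[OF w, of S] by (simp add: f_def)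
 qed
 have Hm: "H \<in> borel_measurable (M \<Otimes>\<^sub>M borel)" unfolding H_def[abs_def] by measurable
 have Hi: "integrable taut H" unfolding H_def[abs_def] using key by (intro Bochner_Integration.integrable_sum) blast
 have "(\<integral>p. ?b p * ?W p \<partial>taut) = (\<integral>P. \<integral>x. ?b (P, orth_proj P x) * ?W (P, orth_proj P x) \<partial>subspace_lborel P \<partial>M)"
  by (rule integral_taut_proj[OF L2_mult_integrable[OF b W]])
 also have "\<dots> = (\<integral>P. \<integral>\<xi>. H (P, \<xi>) \<partial>subspace_lborel P \<partial>M)"
 proof (rule Bochner_Integration.integral_cong[OF refl])
  fix P assume PM: "P \<in> space M"
  have P[measurable]: "subspace P" by (rule subspace_M[OF PM])
  interpret N: sigma_finite_measure "subspace_lborel (orthogonal_comp P)"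
   by (rule sigma_finite_subspace_lborel[OF subspace_orthogonal_comp])
  have pm[measurable]: "(\<lambda>x. plane_transform m w (P, x)) \<in> borel_measurable borel" by (rule plane_transform_slice(1)[OF w P])
  have pm'[measurable]: "(\<lambda>x. plane_transform m w (P, orth_proj P x)) \<in> borel_measurable borel"
   by (rule measurable_compose[OF _ pm]) measurable
  have bm[measurable]: "(\<lambda>x. ?b (P, x)) \<in> borel_measurable borel" by measurable
  note [measurable] = borel_measurable_fourier_on[OF P schwartz_borel[OF \<phi>]] borel_measurable_fourier_on[OF P bm]
  have "(\<integral>x. ?b (P, orth_proj P x) * ?W (P, orth_proj P x) \<partial>subspace_lborel P) = (\<integral>x. ?b (P, x) * fourier_on P \<phi> x \<partial>subspace_lborel P)"
  proof (rule integral_cong_AE)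
   show "AE x in subspace_lborel P. ?b (P, orth_proj P x) * ?W (P, orth_proj P x) = ?b (P, x) * fourier_on P \<phi> x"
    using AE_subspace_lborel[OF P]
   proof eventually_elim
    case (elim x)
    then show ?case by (simp add: orth_proj_id[OF P elim] integral_fourier_complement[OF P \<phi> elim])
   qed
   show "(\<lambda>x. ?b (P, orth_proj P x) * ?W (P, orth_proj P x)) \<in> borel_measurable (subspace_lborel P)" unfolding fst_conv snd_conv by measurable
  qed measurable
  also have "\<dots> = (\<integral>\<xi>. \<phi> \<xi> * fourier_on P (\<lambda>x. ?b (P, x)) \<xi> \<partial>subspace_lborel P)"
   by (rule fourier_pairing[OF P plane_transform_slice(2)[OF w P]
      rapid_decay_integrable_subspace[OF schwartz_rapid_decay[OF \<phi>] P schwartz_borel[OF \<phi>]]])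
  also have "\<dots> = (\<integral>\<xi>. H (P, \<xi>) \<partial>subspace_lborel P)"
  proof (rule integral_cong_AE)
   show "AE \<xi> in subspace_lborel P. \<phi> \<xi> * fourier_on P (\<lambda>x. ?b (P, x)) \<xi> = H (P, \<xi>)"
    using AE_subspace_lborel[OF P]
   proof eventually_elim
    case (elim \<xi>)
    show ?case unfolding fourier_on_plane_transform[OF w P elim] H_def f_def sum_distrib_left fst_conv snd_conv
     by (intro sum.cong refl) (simp add: mult_ac)
   qed
   show "(\<lambda>\<xi>. H (P, \<xi>)) \<in> borel_measurable (subspace_lborel P)"
    using measurable_compose[OF measurable_Pair1'[OF PM] Hm] by (simp cong: measurable_cong_sets)
  qed measurable
  finally show "(\<integral>x. ?b (P, orth_proj P x) * ?W (P, orth_proj P x) \<partial>subspace_lborel P) = (\<integral>\<xi>. H (P, \<xi>) \<partial>subspace_lborel P)" .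
 qed
 also have "\<dots> = (\<integral>p. H p \<partial>taut)" by (rule integral_taut[OF Hm Hi, symmetric])
 also have "\<dots> = (\<Sum>S\<in>UNIV. \<integral>p. f S (snd p) * ?L S p \<partial>taut)"
  unfolding H_def using key by (intro Bochner_Integration.integral_sum) blast
 also have "\<dots> = (\<Sum>S\<in>UNIV. \<integral>p. (\<phi> (snd p) * of_real (mean_restrict k m (snd p) (axis S 1) $ T)) * form_fourier w (snd p) $ S \<partial>taut)"
  by (simp only: key) (simp add: f_def mult_ac)
 finally show ?thesis .
qed

end

section \<open>Reconstruction\<close>

lemma complexify_compose: "complexify S (complexify T v) = complexify (\<lambda>u. S (T u)) v"
 by (simp add: complexify_eq[of S] complexify_eq[of "\<lambda>u. S (T u)"])

lemma complexify_scaleR: "complexify ((*\<^sub>R) r) v = r *\<^sub>R v"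
 by (simp add: complexify_eq cvec_def vec_eq_iff complex_eq_iff)

lemma norm_cvec [simp]: "norm (cvec v) = norm v"
 by (simp add: cvec_def norm_vec_def)

lemma linear_h_mult: "linear (h_mult k m \<xi>)"
proof (rule linearI)
 note l = linear_add[OF linear_Pi_proj] linear_scale[OF linear_Pi_proj]
 show "h_mult k m \<xi> (u + v) = h_mult k m \<xi> u + h_mult k m \<xi> v" for u v
  unfolding h_mult_def Psi_proj_def l scaleR_add_right[symmetric] by (simp add: algebra_simps)
 show "h_mult k m \<xi> (r *\<^sub>R v) = r *\<^sub>R h_mult k m \<xi> v" for r v
  unfolding h_mult_def Psi_proj_def l by (simp add: algebra_simps)
qed

lemma borel_measurable_h_mult:
 assumes [measurable]: "\<xi> \<in> borel_measurable N" "v \<in> borel_measurable N"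
 shows "(\<lambda>z. h_mult k m (\<xi> z) (v z)) \<in> borel_measurable N"
proof -
 have [measurable]: "(\<lambda>z. Pi_proj m (\<xi> z) (v z)) \<in> borel_measurable N"
  unfolding Pi_proj_eq by (rule borel_measurable_ext_map) (auto simp: orth_proj_hyperplane)
 show ?thesis unfolding h_mult_def Psi_proj_def by measurable
qed

context invariant_grassmannian
begin

text \<open>
 Plane transforms take values in \<open>\<Lambda>\<^sup>m(P)\<close>, so they also converge to the projection of \<open>\<beta>\<close>, and both
 sides of \<open>slice_pairing\<close> pass to the limit in \<open>L\<^sup>2\<close> of the bundle. Testing against a Gaussian, which
 has no zeros, shows that the fibre integrals exist for almost every \<open>x\<close>.
\<close>

lemma back_projection_fourier:
 fixes a :: "nat \<Rightarrow> 'n::{finite,linorder} rvec \<Rightarrow> 'n rform"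
 assumes mk: "m < k" "k \<le> CARD('n)" and a: "\<And>j. a j \<in> schwartz_forms m"
  and \<beta>: "\<beta> \<in> L2 taut" and lim: "L2_tendsto taut (\<lambda>j. plane_transform m (a j)) \<beta>"
  and g: "g \<in> L2 lborel" and gt: "(\<lambda>p. g (snd p)) \<in> L2 taut"
  and limg: "L2_tendsto taut (\<lambda>j p. form_fourier (a j) (snd p)) (\<lambda>p. g (snd p))"
 shows "has_fourier (\<lambda>x. cvec (plane_adjoint M m \<beta> x)) (\<lambda>\<xi>. base_density \<xi> *\<^sub>R complexify (mean_restrict k m \<xi>) (g \<xi>))"
proof -
 have k: "0 < k" using mk by simp
 note [measurable] = L2D(1)[OF \<beta>] borel_measurable_form_fourier[OF a] L2D(1)[OF plane_transform_L2[OF a]]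
 have gm[measurable]: "g \<in> borel_measurable borel" using L2D(1)[OF g] by simp
 let ?L = "\<lambda>p. ext_map m (orth_proj (fst p))"
 define \<beta>' where "\<beta>' p = ?L p (\<beta> p)" for p
 have \<beta>m[measurable]: "\<beta>' \<in> borel_measurable taut" unfolding \<beta>'_def[abs_def] by measurable
 have L1: "norm (?L p v) \<le> norm v" if "p \<in> space taut" for p v
  using taut_memD[OF that] by (intro norm_ext_map_orth_proj_le) simp
 have \<beta>'2: "\<beta>' \<in> L2 taut"
  by (rule L2_bound[OF \<beta> \<beta>m, of 1]) (auto simp: \<beta>'_def L1)
 define b where "b T p = complex_of_real (\<beta>' p $ T)" for T p
 have b2: "b T \<in> L2 taut" for T unfolding b_def[abs_def] by (rule L2_of_real_nth[OF \<beta>'2])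
 have bj2: "(\<lambda>p. complex_of_real (plane_transform m (a j) p $ T)) \<in> L2 taut" for j T
  by (rule L2_of_real_nth[OF plane_transform_L2[OF a]])
 have limb: "L2_tendsto taut (\<lambda>j p. complex_of_real (plane_transform m (a j) p $ T)) (b T)" for T
 proof (rule L2_tendsto_bound[OF lim, of _ _ 1])
  have "norm (complex_of_real (plane_transform m (a j) p $ T) - b T p) \<le> 1 * norm (plane_transform m (a j) p - \<beta> p)"
   if p: "p \<in> space taut" for j p
  proof -
   have P: "subspace (fst p)" "snd p \<in> fst p" using taut_memD[OF p] by auto
   have "plane_transform m (a j) p = ?L p (plane_transform m (a j) p)"
    using plane_transform_eq(1)[OF a P] by (simp add: ext_map_orth_proj_idem[OF P(1)])
   then have "plane_transform m (a j) p - \<beta>' p = ?L p (plane_transform m (a j) p - \<beta> p)"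
    by (simp add: \<beta>'_def linear_diff[OF ext_map_linear])
   then have "norm (plane_transform m (a j) p - \<beta>' p) \<le> norm (plane_transform m (a j) p - \<beta> p)"
    using L1[OF p] by simp
   moreover have "norm (complex_of_real (plane_transform m (a j) p $ T) - b T p) \<le> norm (plane_transform m (a j) p - \<beta>' p)"
    using component_le_norm_cart[of "plane_transform m (a j) p - \<beta>' p" T]
    by (simp add: b_def of_real_diff[symmetric] norm_of_real del: of_real_diff)
   ultimately show ?thesis by simp
  qed
  then show "AE p in taut. norm (complex_of_real (plane_transform m (a j) p $ T) - b T p) \<le> 1 * norm (plane_transform m (a j) p - \<beta> p)" for j
   by (rule AE_I2)
 qed measurable
 let ?\<gamma> = "plane_adjoint M m \<beta>"
 have \<beta>m2: "(\<lambda>z. \<beta>' (snd z, orth_proj (snd z) (fst z))) \<in> borel_measurable (borel \<Otimes>\<^sub>M M)"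
  using measurable_compose[OF measurable_Pair[OF measurable_snd measurable_fst] measurable_taut_proj[OF \<beta>m]] by simp
 have \<gamma>eq: "?\<gamma> x = (\<integral>P. \<beta>' (P, orth_proj P x) \<partial>M)" for x
  unfolding plane_adjoint_def
  by (rule Bochner_Integration.integral_cong[OF refl]) (simp add: \<beta>'_def form_restrict_eq subspace_M)
 have \<gamma>m[measurable]: "?\<gamma> \<in> borel_measurable borel"
  unfolding \<gamma>eq using \<beta>m2 by (intro sigma_finite_measure.borel_measurable_lebesgue_integral[OF prob_space_imp_sigma_finite[OF prob_M]]) (simp add: case_prod_unfold)
 have "AE x in lborel. \<forall>T\<in>UNIV. integrable M (\<lambda>P. b T (P, orth_proj P x))"
 proof (subst AE_finite_all[OF finite], intro ballI)
  fix T :: "'n set"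
  note s = bump_schwartz[of 1 "0 :: 'n rvec", OF zero_less_one]
  show "AE x in lborel. integrable M (\<lambda>P. b T (P, orth_proj P x))"
   using back_projection_pairing(3)[OF b2 schwartz_rapid_decay[OF s] schwartz_borel[OF s], of T]
  proof eventually_elim
   case (elim x)
   from integrable_mult_right[OF this, of "inverse (bump 1 0 x)"] show ?case
    by (simp add: mult.assoc[symmetric] bump_nonzero)
  qed
 qed
 then have \<gamma>T: "AE x in lborel. \<forall>T. (\<integral>P. b T (P, orth_proj P x) \<partial>M) = cvec (?\<gamma> x) $ T"
 proof eventually_elim
  case (elim x)
  have "integrable M (\<lambda>P. \<beta>' (P, orth_proj P x) $ T)" for T
   using integrable_Re[OF elim[THEN bspec, OF UNIV_I, of T]] by (simp add: b_def)
  then have "integrable M (\<lambda>P. \<beta>' (P, orth_proj P x))" by (simp add: integrable_vec_iff)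
  from integral_vec_nth[OF this] show ?case by (simp add: b_def cvec_def \<gamma>eq integral_complex_of_real)
 qed
 show ?thesis
  unfolding has_fourier_iff scalar_fourier_def
 proof (intro allI impI)
  fix T :: "'n set" and \<phi> :: "'n rvec \<Rightarrow> complex" assume \<phi>: "schwartz \<phi>"
  note [measurable] = schwartz_borel[OF \<phi>] borel_measurable_fourier[OF \<phi>]
  let ?F = "fourier \<phi>"
  let ?W = "\<lambda>p. \<integral>y. ?F (snd p + y) \<partial>subspace_lborel (orthogonal_comp (fst p))"
  note bp = back_projection_pairing[OF b2[of T] fourier_rapid_decay[OF \<phi>] borel_measurable_fourier[OF \<phi>]]
  have ae: "AE x in lborel. ?F x * (\<integral>P. b T (P, orth_proj P x) \<partial>M) = ?F x * cvec (?\<gamma> x) $ T"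
   using \<gamma>T by eventually_elim simp
  have cm: "(\<lambda>x. ?F x * cvec (?\<gamma> x) $ T) \<in> borel_measurable lborel" unfolding cvec_def by simp
  have i1: "integrable lborel (\<lambda>x. ?F x * cvec (?\<gamma> x) $ T)"
   by (rule integrable_cong_AE_imp[OF bp(1) cm]) (use ae in \<open>auto elim!: eventually_mono\<close>)
  have e1: "(\<integral>x. ?F x * cvec (?\<gamma> x) $ T \<partial>lborel) = (\<integral>p. b T p * ?W p \<partial>taut)"
   using integral_cong_AE[OF borel_measurable_integrable[OF bp(1)] cm ae] bp(2) by simp
  define V where "V S \<xi> = \<phi> \<xi> * of_real (mean_restrict k m \<xi> (axis S 1) $ T)" for S \<xi>
  have Vm[measurable]: "V S \<in> borel_measurable borel" for S unfolding V_def[abs_def] by measurable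
  define D where "D = \<bar>mean_coeff CARD('n) k m\<bar> * (\<bar>real k - real m\<bar> + \<bar>real CARD('n) - real m\<bar> * 2)"
  have V2: "(\<lambda>p. V S (snd p)) \<in> L2 taut" for S
  proof (rule L2_bound[OF taut_rapid_decay(2)[OF schwartz_rapid_decay[OF \<phi>] schwartz_borel[OF \<phi>]], of _ D])
   have "norm (V S \<xi>) \<le> D * norm (\<phi> \<xi>)" for \<xi>
   proof -
    have "\<bar>mean_restrict k m \<xi> (axis S 1) $ T\<bar> \<le> norm (mean_restrict k m \<xi> (axis S 1))" by (rule component_le_norm_cart)
    also have "\<dots> \<le> D * norm (axis S (1::real))" unfolding D_def by (rule norm_mean_restrict_le)
    finally have "\<bar>mean_restrict k m \<xi> (axis S 1) $ T\<bar> \<le> D" by simp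
    from mult_left_mono[OF this, of "norm (\<phi> \<xi>)"] show ?thesis by (simp add: V_def norm_mult mult.commute)
   qed
   then show "AE p in taut. norm (V S (snd p)) \<le> D * norm (\<phi> (snd p))" by blast
  qed measurable
  have f2: "(\<lambda>p. form_fourier (a j) (snd p) $ S) \<in> L2 taut" for j S
   by (rule taut_rapid_decay(2)[OF form_fourier_rapid_decay(1,2)[OF a]])
  have g2: "(\<lambda>p. g (snd p) $ S) \<in> L2 taut" for S by (rule L2_nth[OF gt])
  have limgS: "L2_tendsto taut (\<lambda>j p. form_fourier (a j) (snd p) $ S) (\<lambda>p. g (snd p) $ S)" for S
  proof (rule L2_tendsto_bound[OF limg, of _ _ 1])
   have "norm (form_fourier (a j) x $ S - g x $ S) \<le> 1 * norm (form_fourier (a j) x - g x)" for j x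
    using Finite_Cartesian_Product.norm_nth_le[of "form_fourier (a j) x - g x" S] by simp
   then show "AE p in taut. norm (form_fourier (a j) (snd p) $ S - g (snd p) $ S) \<le> 1 * norm (form_fourier (a j) (snd p) - g (snd p))" for j
    by blast
  qed measurable
  have l1: "(\<lambda>j. \<integral>p. ?W p * complex_of_real (plane_transform m (a j) p $ T) \<partial>taut) \<longlonglongrightarrow> (\<integral>p. ?W p * b T p \<partial>taut)"
   by (rule L2_pairing_tendsto[OF bp(4) bj2 b2 limb])
  have l2: "(\<lambda>j. \<Sum>S\<in>UNIV. \<integral>p. V S (snd p) * form_fourier (a j) (snd p) $ S \<partial>taut) \<longlonglongrightarrow>
    (\<Sum>S\<in>UNIV. \<integral>p. V S (snd p) * g (snd p) $ S \<partial>taut)"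
   by (intro tendsto_sum L2_pairing_tendsto[OF V2 f2 g2 limgS])
  have "(\<integral>p. ?W p * complex_of_real (plane_transform m (a j) p $ T) \<partial>taut) =
    (\<Sum>S\<in>UNIV. \<integral>p. V S (snd p) * form_fourier (a j) (snd p) $ S \<partial>taut)" for j
   using slice_pairing[OF mk a \<phi>, of j T] by (simp add: V_def mult.commute[of "?W _"])
  with LIMSEQ_unique[OF l1] l2 have "(\<integral>p. ?W p * b T p \<partial>taut) = (\<Sum>S\<in>UNIV. \<integral>p. V S (snd p) * g (snd p) $ S \<partial>taut)"
   by simp
  also have "\<dots> = (\<integral>p. (\<Sum>S\<in>UNIV. V S (snd p) * g (snd p) $ S) \<partial>taut)"
   by (intro Bochner_Integration.integral_sum[symmetric] L2_mult_integrable[OF V2 g2])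
  finally have e2: "(\<integral>p. b T p * ?W p \<partial>taut) = (\<integral>p. (\<Sum>S\<in>UNIV. V S (snd p) * g (snd p) $ S) \<partial>taut)"
   by (simp add: mult.commute)
  have i2: "integrable taut (\<lambda>p. \<Sum>S\<in>UNIV. V S (snd p) * g (snd p) $ S)"
   by (intro Bochner_Integration.integrable_sum L2_mult_integrable[OF V2 g2])
  have Sm: "(\<lambda>\<xi>. \<Sum>S\<in>UNIV. V S \<xi> * g \<xi> $ S) \<in> borel_measurable borel" by measurable
  have e3: "base_density \<xi> *\<^sub>R (\<Sum>S\<in>UNIV. V S \<xi> * g \<xi> $ S) =
    \<phi> \<xi> * (base_density \<xi> *\<^sub>R complexify (mean_restrict k m \<xi>) (g \<xi>)) $ T" for \<xi>
   unfolding vector_scaleR_component complexify_nth[OF linear_mean_restrict] V_def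
   by (simp add: sum_distrib_left scaleR_conv_of_real mult_ac)
  have i3: "integrable lborel (\<lambda>\<xi>. \<phi> \<xi> * (base_density \<xi> *\<^sub>R complexify (mean_restrict k m \<xi>) (g \<xi>)) $ T)"
   using i2 integral_taut_snd(2)[OF k Sm] unfolding e3 by simp
  have "(\<integral>x. ?F x * cvec (?\<gamma> x) $ T \<partial>lborel) = (\<integral>\<xi>. \<phi> \<xi> * (base_density \<xi> *\<^sub>R complexify (mean_restrict k m \<xi>) (g \<xi>)) $ T \<partial>lborel)"
   unfolding e1 e2 using integral_taut_snd(1)[OF k Sm] unfolding e3 .
  with i1 i3 show "integrable lborel (\<lambda>x. ?F x * cvec (?\<gamma> x) $ T) \<and>
   integrable lborel (\<lambda>\<xi>. \<phi> \<xi> * (base_density \<xi> *\<^sub>R complexify (mean_restrict k m \<xi>) (g \<xi>)) $ T) \<and>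
   (\<integral>x. ?F x * cvec (?\<gamma> x) $ T \<partial>lborel) = (\<integral>\<xi>. \<phi> \<xi> * (base_density \<xi> *\<^sub>R complexify (mean_restrict k m \<xi>) (g \<xi>)) $ T \<partial>lborel)"
   by blast
 qed
qed

theorem reconstruction:
 fixes \<alpha> :: "'n::{finite,linorder} rvec \<Rightarrow> 'n rform"
 assumes mk: "m < k" "k < CARD('n)" and \<alpha>: "\<alpha> \<in> X_space k M m"
 defines "\<gamma> \<equiv> \<lambda>x. cvec (plane_adjoint M m (plane_transform_X k M m \<alpha>) x)"
 shows "\<gamma> \<in> Q_domain k" "AE x in lborel. cvec (\<alpha> x) = Q_mult k m \<gamma> x"
proof -
 have mk': "m < k" "k \<le> CARD('n)" using mk by auto
 obtain a where X: "X_represents k M m a \<alpha>" and \<beta>: "plane_transform_X k M m \<alpha> \<in> L2 taut"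
  and lim: "L2_tendsto taut (\<lambda>j. plane_transform m (a j)) (plane_transform_X k M m \<alpha>)"
  using plane_transform_X_limit[OF \<alpha>] by blast
 have a: "a j \<in> schwartz_forms m" for j using X by (simp add: X_represents_def)
 have lima: "L2_tendsto lborel a \<alpha>" using X by (simp add: X_represents_def)
 have \<alpha>2: "\<alpha> \<in> L2 lborel" using \<alpha> by (simp add: X_space_def)
 obtain g where g: "g \<in> L2 lborel" "L2_tendsto lborel (\<lambda>j. form_fourier (a j)) g" "(\<lambda>p. g (snd p)) \<in> L2 taut"
  "L2_tendsto taut (\<lambda>j p. form_fourier (a j) (snd p)) (\<lambda>p. g (snd p))"
  using fourier_X_limit[OF mk' X] by blast
 have gm[measurable]: "g \<in> borel_measurable borel" using L2D(1)[OF g(1)] by simp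
 have F\<alpha>: "has_fourier (\<lambda>x. cvec (\<alpha> x)) g" by (rule has_fourier_X_limit[OF a \<alpha>2 lima g(1,2)])
 have F\<gamma>: "has_fourier \<gamma> (\<lambda>\<xi>. base_density \<xi> *\<^sub>R complexify (mean_restrict k m \<xi>) (g \<xi>))"
  unfolding \<gamma>_def by (rule back_projection_fourier[OF mk' a \<beta> lim g(1,3,4)])
 let ?t = "tempered_fourier \<gamma>"
 have ex: "\<exists>g. has_fourier \<gamma> g" using F\<gamma> by blast
 have Ft: "has_fourier \<gamma> ?t" unfolding tempered_fourier_def by (rule someI_ex[OF ex])
 have tm[measurable]: "?t \<in> borel_measurable borel" by (rule has_fourier_measurable(2)[OF Ft])
 let ?r = "CARD('n) - k"
 define c where "c = sphere_vol k / sphere_vol CARD('n)"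
 have s: "sphere_vol k > 0" "sphere_vol CARD('n) > 0" using mk by (auto intro!: sphere_vol_pos)
 then have c: "c > 0" by (simp add: c_def)
 have cd: "norm \<xi> ^ ?r * base_density \<xi> = c" if "\<xi> \<noteq> 0" for \<xi> :: "'n rvec"
  using that by (simp add: base_density_def c_def)
 have ae: "AE \<xi> in lborel. \<xi> \<noteq> 0 \<and> ?t \<xi> = base_density \<xi> *\<^sub>R complexify (mean_restrict k m \<xi>) (g \<xi>)"
  using has_fourier_unique[OF Ft F\<gamma>] AE_lborel_singleton[of 0] by eventually_elim simp
 define D where "D = \<bar>mean_coeff CARD('n) k m\<bar> * (\<bar>real k - real m\<bar> + \<bar>real CARD('n) - real m\<bar> * 2)"
 have D: "norm (complexify (mean_restrict k m \<xi>) v) \<le> D * norm v" for \<xi> :: "'n rvec" and v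
  by (rule norm_complexify_le) (auto simp: D_def intro: norm_mean_restrict_le)
 have "(\<lambda>\<xi>. norm \<xi> ^ ?r *\<^sub>R ?t \<xi>) \<in> L2 lborel"
 proof (rule L2_bound[OF g(1), of _ "c * D"])
  show "AE \<xi> in lborel. norm (norm \<xi> ^ ?r *\<^sub>R ?t \<xi>) \<le> c * D * norm (g \<xi>)"
   using ae
  proof eventually_elim
   case (elim \<xi>)
   then have "norm \<xi> ^ ?r *\<^sub>R ?t \<xi> = c *\<^sub>R complexify (mean_restrict k m \<xi>) (g \<xi>)" by (simp add: cd)
   then show ?case using mult_left_mono[OF D, of c \<xi> "g \<xi>"] c by (simp add: mult.assoc)
  qed
 qed measurable
 with ex show "\<gamma> \<in> Q_domain k" by (simp add: Q_domain_def)
 define G where "G \<xi> = norm \<xi> ^ ?r *\<^sub>R complexify (h_mult k m \<xi>) (?t \<xi>)" for \<xi> :: "'n rvec"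
 have [measurable]: "(\<lambda>\<xi>. complexify (h_mult k m \<xi>) (?t \<xi>)) \<in> borel_measurable borel"
  by (rule borel_measurable_complexify[OF linear_h_mult]) (auto intro: borel_measurable_h_mult)
 have Gm: "G \<in> borel_measurable borel" unfolding G_def[abs_def] by measurable
 have "AE \<xi> in lborel. g \<xi> = G \<xi>"
  using ae
 proof eventually_elim
  case (elim \<xi>)
  have "h_mult k m \<xi> (base_density \<xi> *\<^sub>R mean_restrict k m \<xi> u) = (base_density \<xi> / c) *\<^sub>R u" for u
   using s by (simp add: linear_scale[OF linear_h_mult] h_mult_mean_restrict[OF mk] c_def)
  then have "complexify (h_mult k m \<xi>) (?t \<xi>) = (base_density \<xi> / c) *\<^sub>R g \<xi>"
   using elim by (simp add: complexify_scaleR[symmetric] complexify_compose)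
  then have "G \<xi> = (norm \<xi> ^ ?r * base_density \<xi> / c) *\<^sub>R g \<xi>" by (simp add: G_def)
  then show ?case using elim c by (simp add: cd)
 qed
 then have FG: "has_fourier (\<lambda>x. cvec (\<alpha> x)) G" by (rule has_fourier_cong[OF F\<alpha> _ Gm])
 have "(\<lambda>x. cvec (\<alpha> x)) \<in> L2 lborel"
  by (rule L2_bound[OF \<alpha>2, of _ 1]) (use has_fourier_measurable(1)[OF F\<alpha>] in auto)
 with FG have "\<exists>f. f \<in> L2 lborel \<and> has_fourier f G" by blast
 from someI_ex[OF this] have "has_fourier (Q_mult k m \<gamma>) G"
  by (simp add: Q_mult_def L2_inverse_fourier_def G_def[abs_def])
 from has_fourier_inject[OF FG this] show "AE x in lborel. cvec (\<alpha> x) = Q_mult k m \<gamma> x" .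
qed

end

theorem theorem4:
  fixes M :: "(real ^ 'n::{finite,linorder}) set measure"
    and \<alpha> :: "real ^ 'n::{finite,linorder} \<Rightarrow> real ^ ('n set)"
    and k m :: nat
  assumes "m < k" and "k < CARD('n)"
    and "invariant_grassmann_measure k M"
    and "\<alpha> \<in> X_space k M m"
  shows "let \<gamma> = \<lambda>x. cvec (plane_adjoint M m (plane_transform_X k M m \<alpha>) x) in
           \<gamma> \<in> Q_domain k \<and> (AE x in lborel. cvec (\<alpha> x) = Q_mult k m \<gamma> x)"
proof -
  interpret invariant_grassmannian k M using assms(3) by unfold_locales
  show ?thesis unfolding Let_def using reconstruction[OF assms(1,2,4)] by blast
qed

end
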